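(* Let $U\subset\mathbb{R}^d$ be open, let $r\ge1$ be an integer and let $\phi,(\psi^{(i)})_{1\le i<2^d}\in C^r_c(\mathbb{R}^d)$ be a compactly supported wavelet family with supports in $B(0,R)$. Let $(f(\eta),\ \eta\in C^r_c(U))$ be a family of random variables such that, for every $\eta,\eta'\in C^r_c(U)$ and every $\mu\in\mathbb{R}$, there exists a measurable set $A=A(\mu,\eta,\eta')$ with $\mathbb{P}(A)=1$ such that $$f(\mu\eta+\eta')(\omega)=\mu f(\eta)(\omega)+f(\eta')(\omega)\qquad\forall\omega\in A.$$ Assume also the following weak continuity property: for each compact $K'\subset U$ and each sequence $\eta_n,\eta\in C^r_c(U)$ with $\mathrm{Supp}\,\eta_n\subset K'$, if $\eta_n\to\eta$ in $C^{r-1}_c$ as $n\to\infty$, then $f(\eta_n)\to f(\eta)$ in probability as $n\to\infty$. Let $p\in[1,\infty)$, $q\in[1,\infty]$, and let $\alpha,\beta\in\mathbb{R}$ be such that $|\alpha|,|\beta|<r$ and $\alpha<\beta$. Let $\mathcal{K}$ be a spanning sequence, and assume finally that for every $(K,k)\in\mathcal{K}$ there exists $C>0$ such that for every $n\ge k$ and every $1\le i<2^d$, $$\sup_{x\in\Lambda_k\cap K}\mathbb{E}\left[\left|f\left(\phi(2^k(\cdot-x))\right)\right|^p\right]^{\frac1p}\le C$$ and $$\sup_{x\in\Lambda_n\cap K}2^{dn}\,\mathbb{E}\left[\left|f\left(\psi^{(i)}(2^n(\cdot-x))\right)\right|^p\right]^{\frac1p}\le C\,2^{-n\beta}.$$ Then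 there exists a random distribution $\tilde f$ taking values in $\mathcal{B}^{\alpha,\mathrm{loc}}_{p,q}(U)$ such that for every $\eta\in C^r_c(U)$, $$(\tilde f,\eta)=f(\eta)\quad\text{a.s.}$$ Moreover, if $\alpha<\beta-\frac dp$, then $\tilde f$ takes values in $\mathcal{C}^\alpha_{\mathrm{loc}}(U)$ with probability one.
   Context: $\mathbb{N}=\{0,1,\dots\}$; $B(x,R)$ is the open Euclidean ball; $\Lambda_n=2^{-n}\mathbb{Z}^d$. $C^r_c(U)$ is the set of compactly supported $C^r$ functions on $U$; convergence in $C^{r-1}_c$ of functions supported in a fixed compact is convergence for $\|\eta\|_{C^{r-1}}=\sum_{|k|\le r-1}\|\partial^k\eta\|_{L^\infty}$. All random variables $f(\eta)$ are defined on a common probability space. Wavelets: $\phi,(\psi^{(i)})_{1\le i<2^d}\in C^r_c(\mathbb{R}^d)$ are such that $\phi$ is the scaling function of a multiresolution analysis $(V_n)_{n\in\mathbb{Z}}$ of $L^2(\mathbb{R}^d)$ (increasing subspaces, $\bigcup V_n$ dense, $\bigcap V_n=\{0\}$, $f\in V_n\Leftrightarrow f(2^{-n}\cdot)\in V_0$, $(\phi(\cdot-k))_{k\in\mathbb{Z}^d}$ an orthonormal basis of $V_0$), and $(\psi^{(i)}(\cdot-k))_{i<2^d,k\in\mathbb{Z}^d}$ is an orthonormal basis of $W_0$, where $W_n$ is the orthogonal complement of $V_n$ in $V_{n+1}$. $R>0$ is fixed such that the supports of $\phi$ and all $\psi^{(i)}$ are contained in $B(0,R)$. Spaces: with $\mathcal{V}_n,\mathcal{W}_n$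 the orthogonal projections of $L^2(\mathbb{R}^d)$ onto $V_n,W_n$, set for $f\in C^\infty_c(\mathbb{R}^d)$, $p,q\in[1,\infty]$ and $|\alpha|<r$ $$\|f\|_{\mathcal{B}^\alpha_{p,q}}=\|\mathcal{V}_0f\|_{L^p}+\left\|\left(2^{\alpha n}\|\mathcal{W}_nf\|_{L^p}\right)_{n\ge0}\right\|_{\ell^q}.$$ $\mathcal{B}^{\alpha,\mathrm{loc}}_{p,q}(U)$ is the completion of $C^\infty(U)$ with respect to the seminorms $f\mapsto\|\chi f\|_{\mathcal{B}^\alpha_{p,q}}$, $\chi\in C^\infty_c(U)$; it is a Fréchet space whose elements are viewed as linear forms on $C^r_c(U)$, with duality pairing $(\cdot,\cdot)$ extending the $L^2$ scalar product. $\mathcal{C}^\alpha_{\mathrm{loc}}(U)=\mathcal{B}^{\alpha,\mathrm{loc}}_{\infty,\infty}(U)$. Spanning sequence: a pair $(K,k)$ with $K\subset U$ compact and $k\in\mathbb{N}$ is adapted if $2^{-k}R<\mathrm{dist}(K,U^c)$. A spanning sequence is a set that can be written as $\mathcal{K}=\{(K_n,k_n):n\in\mathbb{N}\}$, where $(K_n)$ is an increasing sequence of compact subsets of $U$ such that $\bigcup_nK_n=U$ and for every $n$ the pair $(K_n,k_n)$ is adapted.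
   Formalization: A spanning sequence is also required to exhaust U: every compact subset of U is contained in some K_n. With only K_n increasing and union U the claim is false, e.g. U = R, K_n = [-n,-1/n] ∪ {0} ∪ [1/n,n], with wavelets supported in [0,L]. *)

theory Defs
  imports "HOL-Probability.Probability"
begin

section \<open>Functions of class C^r\<close>

definition partial :: "'d \<Rightarrow> (real^'d::finite \<Rightarrow> real) \<Rightarrow> real^'d \<Rightarrow> real" where
  "partial i f x = deriv (\<lambda>t. f (x + t *\<^sub>R axis i 1)) 0"

primrec partials :: "'d list \<Rightarrow> (real^'d::finite \<Rightarrow> real) \<Rightarrow> real^'d \<Rightarrow> real" where
  "partials [] f = f"
| "partials (i # js) f = partial i (partials js f)"

text \<open>The derivative of multi-index \<open>k\<close>. The order in which the partial derivatives are taken is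
  arbitrary; it is irrelevant for functions of class C^m, where m is the order of \<open>k\<close>.\<close>

definition mpartial :: "('d \<Rightarrow> nat) \<Rightarrow> (real^'d::finite \<Rightarrow> real) \<Rightarrow> real^'d \<Rightarrow> real" where
  "mpartial k f = partials (SOME js. \<forall>i. count_list js i = k i) f"

text \<open>Only used for open \<open>U\<close>.\<close>

primrec C_on :: "nat \<Rightarrow> (real^'d::finite) set \<Rightarrow> (real^'d \<Rightarrow> real) \<Rightarrow> bool" where
  "C_on 0 U f \<longleftrightarrow> continuous_on U f"
| "C_on (Suc r) U f \<longleftrightarrow> (\<forall>x\<in>U. f differentiable (at x)) \<and> (\<forall>i. C_on r U (partial i f))"

definition smooth_on :: "(real^'d::finite) set \<Rightarrow> (real^'d \<Rightarrow> real) \<Rightarrow> bool" where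
  "smooth_on U f \<longleftrightarrow> (\<forall>r. C_on r U f)"

definition supp :: "(real^'d::finite \<Rightarrow> real) \<Rightarrow> (real^'d) set" where
  "supp f = closure {x. f x \<noteq> 0}"

text \<open>A compactly supported function on \<open>U\<close> is identified with its extension by zero to the whole
  space.\<close>

definition Cc :: "nat \<Rightarrow> (real^'d::finite) set \<Rightarrow> (real^'d \<Rightarrow> real) set" where
  "Cc r U = {\<eta>. C_on r UNIV \<eta> \<and> compact (supp \<eta>) \<and> supp \<eta> \<subseteq> U}"

definition Cc_smooth :: "(real^'d::finite) set \<Rightarrow> (real^'d \<Rightarrow> real) set" where
  "Cc_smooth U = {\<rho>. smooth_on UNIV \<rho> \<and> compact (supp \<rho>) \<and> supp \<rho> \<subseteq> U}"

section \<open>Lebesgue norms\<close>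

text \<open>Power with a positive exponent on \<open>[0, \<infinity>]\<close>.\<close>

definition enn_powr :: "ennreal \<Rightarrow> real \<Rightarrow> ennreal" where
  "enn_powr x a = (if x = \<infinity> then \<infinity> else ennreal (enn2real x powr a))"

text \<open>The norm of order \<open>p \<in> [1, \<infinity>]\<close> of a function with values in \<open>[0, \<infinity>]\<close>. With the counting
  measure on \<open>nat\<close> it is the norm of the sequence space of exponent \<open>p\<close>.\<close>

definition eLp_norm :: "'a measure \<Rightarrow> ennreal \<Rightarrow> ('a \<Rightarrow> ennreal) \<Rightarrow> ennreal" where
  "eLp_norm M p g =
     (if p = \<infinity> then esssup M g
      else enn_powr (\<integral>\<^sup>+x. enn_powr (g x) (enn2real p) \<partial>M) (1 / enn2real p))"

definition Lp_norm :: "'a measure \<Rightarrow> ennreal \<Rightarrow> ('a \<Rightarrow> real) \<Rightarrow> ennreal" where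
  "Lp_norm M p f = eLp_norm M p (\<lambda>x. ennreal \<bar>f x\<bar>)"

definition C_norm :: "nat \<Rightarrow> (real^'d::finite \<Rightarrow> real) \<Rightarrow> ennreal" where
  "C_norm m \<eta> = (\<Sum>k | (\<Sum>i\<in>UNIV. k i) \<le> m. Lp_norm lborel \<infinity> (mpartial k \<eta>))"

section \<open>Multiresolution analyses and wavelets\<close>

definition L2 :: "(real^'d::finite \<Rightarrow> real) set" where
  "L2 = {f \<in> borel_measurable lborel. integrable lborel (\<lambda>x. (f x)\<^sup>2)}"

definition L2_inner :: "(real^'d::finite \<Rightarrow> real) \<Rightarrow> (real^'d \<Rightarrow> real) \<Rightarrow> real" where
  "L2_inner f g = (\<integral>x. f x * g x \<partial>lborel)"

text \<open>Subspaces of the Lebesgue space are represented by the set of all functions whose class lies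
  in the subspace; closedness makes these sets invariant under almost everywhere equality.\<close>

definition L2_closed_subspace :: "(real^'d::finite \<Rightarrow> real) set \<Rightarrow> bool" where
  "L2_closed_subspace V \<longleftrightarrow>
     V \<subseteq> L2 \<and> (\<lambda>x. 0) \<in> V \<and>
     (\<forall>f\<in>V. \<forall>g\<in>V. \<forall>a. (\<lambda>x. a * f x + g x) \<in> V) \<and>
     (\<forall>f\<in>L2. (\<forall>\<epsilon>>0. \<exists>g\<in>V. Lp_norm lborel 2 (\<lambda>x. f x - g x) < \<epsilon>) \<longrightarrow> f \<in> V)"

definition L2_orthonormal_basis ::
  "(real^'d::finite \<Rightarrow> real) set \<Rightarrow> 'i set \<Rightarrow> ('i \<Rightarrow> real^'d \<Rightarrow> real) \<Rightarrow> bool" where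
  "L2_orthonormal_basis V I e \<longleftrightarrow>
     (\<forall>i\<in>I. e i \<in> V) \<and>
     (\<forall>i\<in>I. \<forall>j\<in>I. L2_inner (e i) (e j) = (if i = j then 1 else 0)) \<and>
     (\<forall>f\<in>V. \<forall>\<epsilon>>0. \<exists>F c. finite F \<and> F \<subseteq> I \<and>
        Lp_norm lborel 2 (\<lambda>x. f x - (\<Sum>i\<in>F. c i * e i x)) < \<epsilon>)"

definition L2_proj ::
  "(real^'d::finite \<Rightarrow> real) set \<Rightarrow> (real^'d \<Rightarrow> real) \<Rightarrow> real^'d \<Rightarrow> real" where
  "L2_proj V f = (SOME g. g \<in> V \<and> (\<forall>h\<in>V. L2_inner (\<lambda>x. f x - g x) h = 0))"

definition dyadic_lattice :: "nat \<Rightarrow> (real^'d::finite) set" where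
  "dyadic_lattice n = {x. \<forall>i. 2 ^ n * x $ i \<in> \<int>}"

definition multiresolution_analysis ::
  "(int \<Rightarrow> (real^'d::finite \<Rightarrow> real) set) \<Rightarrow> (real^'d \<Rightarrow> real) \<Rightarrow> bool" where
  "multiresolution_analysis V \<phi> \<longleftrightarrow>
     (\<forall>n. L2_closed_subspace (V n)) \<and>
     (\<forall>n. V n \<subseteq> V (n + 1)) \<and>
     (\<forall>f\<in>L2. \<forall>\<epsilon>>0. \<exists>n. \<exists>g\<in>V n. Lp_norm lborel 2 (\<lambda>x. f x - g x) < \<epsilon>) \<and>
     (\<forall>f\<in>(\<Inter>n. V n). AE x in lborel. f x = 0) \<and>
     (\<forall>n f. f \<in> V n \<longleftrightarrow> (\<lambda>x. f ((2 powi (- n)) *\<^sub>R x)) \<in> V 0) \<and>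
     L2_orthonormal_basis (V 0) (dyadic_lattice 0) (\<lambda>k x. \<phi> (x - k))"

definition wavelet_space ::
  "(int \<Rightarrow> (real^'d::finite \<Rightarrow> real) set) \<Rightarrow> int \<Rightarrow> (real^'d \<Rightarrow> real) set" where
  "wavelet_space V n = {f \<in> V (n + 1). \<forall>g\<in>V n. L2_inner f g = 0}"

definition wavelet_family ::
  "nat \<Rightarrow> real \<Rightarrow> (int \<Rightarrow> (real^'d::finite \<Rightarrow> real) set) \<Rightarrow> (real^'d \<Rightarrow> real) \<Rightarrow>
   (nat \<Rightarrow> real^'d \<Rightarrow> real) \<Rightarrow> bool" where
  "wavelet_family r R V \<phi> \<psi> \<longleftrightarrow>
     \<phi> \<in> Cc r UNIV \<and> supp \<phi> \<subseteq> ball 0 R \<and>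
     (\<forall>i\<in>{1..<2 ^ CARD('d)}. \<psi> i \<in> Cc r UNIV \<and> supp (\<psi> i) \<subseteq> ball 0 R) \<and>
     multiresolution_analysis V \<phi> \<and>
     L2_orthonormal_basis (wavelet_space V 0) ({1..<2 ^ CARD('d)} \<times> dyadic_lattice 0)
       (\<lambda>(i, k) x. \<psi> i (x - k))"

section \<open>Besov spaces\<close>

definition besov_norm ::
  "(int \<Rightarrow> (real^'d::finite \<Rightarrow> real) set) \<Rightarrow> real \<Rightarrow> ennreal \<Rightarrow> ennreal \<Rightarrow>
   (real^'d \<Rightarrow> real) \<Rightarrow> ennreal" where
  "besov_norm V \<alpha> p q f =
     Lp_norm lborel p (L2_proj (V 0) f) +
     eLp_norm (count_space UNIV) q
       (\<lambda>n. ennreal (2 powr (\<alpha> * real n)) *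
            Lp_norm lborel p (L2_proj (wavelet_space V (int n)) f))"

text \<open>The completion of the smooth functions on \<open>U\<close> for the seminorms \<open>f \<mapsto> besov_norm (\<rho> f)\<close>,
  realised as Cauchy sequences modulo null sequences. Sequences suffice since the seminorms given
  by cut-offs equal to 1 on larger and larger compact sets already generate the topology. Functions
  on \<open>U\<close> are represented by total functions; their values outside \<open>U\<close> do not affect any of the
  notions below.\<close>

definition besov_cauchy ::
  "(int \<Rightarrow> (real^'d::finite \<Rightarrow> real) set) \<Rightarrow> (real^'d) set \<Rightarrow> real \<Rightarrow> ennreal \<Rightarrow> ennreal \<Rightarrow>
   (nat \<Rightarrow> real^'d \<Rightarrow> real) set" where
  "besov_cauchy V U \<alpha> p q =
     {f. (\<forall>n. smooth_on U (f n)) \<and>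
         (\<forall>\<rho>\<in>Cc_smooth U. \<forall>\<epsilon>>0. \<exists>N. \<forall>m\<ge>N. \<forall>n\<ge>N.
            besov_norm V \<alpha> p q (\<lambda>x. \<rho> x * (f m x - f n x)) < \<epsilon>)}"

definition besov_null_rel ::
  "(int \<Rightarrow> (real^'d::finite \<Rightarrow> real) set) \<Rightarrow> (real^'d) set \<Rightarrow> real \<Rightarrow> ennreal \<Rightarrow> ennreal \<Rightarrow>
   (nat \<Rightarrow> real^'d \<Rightarrow> real) rel" where
  "besov_null_rel V U \<alpha> p q =
     {(f, g). f \<in> besov_cauchy V U \<alpha> p q \<and> g \<in> besov_cauchy V U \<alpha> p q \<and>
       (\<forall>\<rho>\<in>Cc_smooth U.
          (\<lambda>n. besov_norm V \<alpha> p q (\<lambda>x. \<rho> x * (f n x - g n x))) \<longlonglongrightarrow> 0)}"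

definition besov_loc ::
  "(int \<Rightarrow> (real^'d::finite \<Rightarrow> real) set) \<Rightarrow> (real^'d) set \<Rightarrow> real \<Rightarrow> ennreal \<Rightarrow> ennreal \<Rightarrow>
   (nat \<Rightarrow> real^'d \<Rightarrow> real) set set" where
  "besov_loc V U \<alpha> p q = besov_cauchy V U \<alpha> p q // besov_null_rel V U \<alpha> p q"

text \<open>The seminorm of index \<open>\<rho>\<close>, extended to the completion, of the difference of two elements.\<close>

definition besov_loc_dist ::
  "(int \<Rightarrow> (real^'d::finite \<Rightarrow> real) set) \<Rightarrow> real \<Rightarrow> ennreal \<Rightarrow> ennreal \<Rightarrow> (real^'d \<Rightarrow> real) \<Rightarrow>
   (nat \<Rightarrow> real^'d \<Rightarrow> real) set \<Rightarrow> (nat \<Rightarrow> real^'d \<Rightarrow> real) set \<Rightarrow> ennreal" where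
  "besov_loc_dist V \<alpha> p q \<rho> X Y =
     lim (\<lambda>n. besov_norm V \<alpha> p q (\<lambda>x. \<rho> x * ((SOME f. f \<in> X) n x - (SOME g. g \<in> Y) n x)))"

definition besov_loc_open ::
  "(int \<Rightarrow> (real^'d::finite \<Rightarrow> real) set) \<Rightarrow> (real^'d) set \<Rightarrow> real \<Rightarrow> ennreal \<Rightarrow> ennreal \<Rightarrow>
   (nat \<Rightarrow> real^'d \<Rightarrow> real) set set \<Rightarrow> bool" where
  "besov_loc_open V U \<alpha> p q G \<longleftrightarrow>
     G \<subseteq> besov_loc V U \<alpha> p q \<and>
     (\<forall>X\<in>G. \<exists>F \<epsilon>. finite F \<and> F \<subseteq> Cc_smooth U \<and> \<epsilon> > 0 \<and>
        (\<forall>Y\<in>besov_loc V U \<alpha> p q. (\<forall>\<rho>\<in>F. besov_loc_dist V \<alpha> p q \<rho> X Y < \<epsilon>) \<longrightarrow> Y \<in> G))"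

definition besov_loc_borel ::
  "(int \<Rightarrow> (real^'d::finite \<Rightarrow> real) set) \<Rightarrow> (real^'d) set \<Rightarrow> real \<Rightarrow> ennreal \<Rightarrow> ennreal \<Rightarrow>
   (nat \<Rightarrow> real^'d \<Rightarrow> real) set measure" where
  "besov_loc_borel V U \<alpha> p q = sigma (besov_loc V U \<alpha> p q) {G. besov_loc_open V U \<alpha> p q G}"

text \<open>The duality pairing is the extension by continuity of the \<open>L2\<close> scalar product.\<close>

definition besov_pairing ::
  "(nat \<Rightarrow> real^'d::finite \<Rightarrow> real) set \<Rightarrow> (real^'d \<Rightarrow> real) \<Rightarrow> real" where
  "besov_pairing X \<eta> = lim (\<lambda>n. L2_inner ((SOME f. f \<in> X) n) \<eta>)"

text \<open>Elements of different completions are compared as linear forms on the space \<open>Cc r U\<close>.\<close>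

definition in_holder_loc ::
  "nat \<Rightarrow> (int \<Rightarrow> (real^'d::finite \<Rightarrow> real) set) \<Rightarrow> (real^'d) set \<Rightarrow> real \<Rightarrow>
   (nat \<Rightarrow> real^'d \<Rightarrow> real) set \<Rightarrow> bool" where
  "in_holder_loc r V U \<alpha> X \<longleftrightarrow>
     (\<exists>Y\<in>besov_loc V U \<alpha> \<infinity> \<infinity>. \<forall>\<eta>\<in>Cc r U. besov_pairing Y \<eta> = besov_pairing X \<eta>)"

section \<open>Spanning sequences\<close>

text \<open>The infimum of an empty family is \<open>\<infinity>\<close>, so that every pair is adapted if \<open>U\<close> is the whole
  space (\<open>setdist\<close> would give 0 instead).\<close>

definition adapted :: "(real^'d::finite) set \<Rightarrow> real \<Rightarrow> (real^'d) set \<Rightarrow> nat \<Rightarrow> bool" where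
  "adapted U R K k \<longleftrightarrow>
     compact K \<and> K \<subseteq> U \<and> ennreal (R / 2 ^ k) < (INF x\<in>K. INF y\<in>- U. ennreal (dist x y))"

text \<open>"Increasing to \<open>U\<close>" is understood in the sense of an exhaustion: every compact subset of \<open>U\<close>
  is contained in some \<open>K n\<close>. This does not follow from the union being \<open>U\<close>: take
  the union of \<open>[-n, -1/n]\<close>, \<open>{0}\<close> and \<open>[1/n, n]\<close> on the real line. Along such a sequence, bounds
  on the wavelet coefficients at the points of \<open>K n\<close> with constants depending on \<open>n\<close> say nothing
  about the regularity at 0.\<close>

definition spanning_sequence ::
  "(real^'d::finite) set \<Rightarrow> real \<Rightarrow> ((real^'d) set \<times> nat) set \<Rightarrow> bool" where
  "spanning_sequence U R \<K> \<longleftrightarrow>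
     (\<exists>K k. incseq K \<and> (\<Union>n. K n) = U \<and>
        (\<forall>L. compact L \<and> L \<subseteq> U \<longrightarrow> (\<exists>n. L \<subseteq> K n)) \<and>
        (\<forall>n. adapted U R (K n) (k n)) \<and>
        \<K> = range (\<lambda>n. (K n, k n)))"

end

theory Submission
  imports Defs
begin

text \<open>Put \<open>F n = \<Sum>x. 2 ^ (d * n) * f (\<phi> (2 ^ n * (\<cdot> - x))) * \<phi> (2 ^ n * (\<cdot> - x))\<close>, the sum being over the lattice
  points whose wavelet is supported in \<open>U\<close>. Almost surely, \<open>F (n + 1) - F n\<close> is locally the layer of
  wavelets of level \<open>n\<close> with the coefficients prescribed by \<open>f\<close>, by almost sure linearity applied to the
  reproducing kernels. For \<open>\<alpha> < \<alpha>' < \<beta>\<close> the moment bounds and summability in \<open>n\<close> make the normalised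
  sums of p-th powers of these coefficients at most \<open>\<kappa> * 2 powr (- \<alpha>' * p * n)\<close> for a random constant
  \<open>\<kappa>\<close>. Vanishing moments and the regularity of the wavelets bound the Besov norm of
  such a layer times a cut-off, so \<open>F n\<close> is Cauchy in the local Besov space; in the supremum norm
  the layer costs an additional \<open>d / p\<close>, which gives the Hoelder case. Since \<open>F n\<close> is only of class C^r,
  it is replaced by a smooth approximation with a deterministic precision that beats
  the almost sure growth of the coefficients. Pairing \<open>F n\<close> with \<open>\<eta>\<close> gives \<open>f\<close> of the projection of \<open>\<eta>\<close>
  onto \<open>V n\<close>, which tends to \<open>f \<eta>\<close> in probability by the weak continuity.\<close>

section \<open>Calculus of functions of class C^r\<close>

text \<open>Almost sure linearity has an exceptional set that depends on the functions involved, so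
  \<open>f\<close> can only be used in countably many identities: those between reproducing kernels
  at dyadic points, which continuity in the point then extends. The wavelets are only given as
  orthonormal and of class C^r; their vanishing moments are derived from the orthogonality to the
  dilates of \<open>\<phi>\<close> in \<open>V 0\<close>, through a Taylor expansion at dyadic
  points and the injectivity of the Laplace transform. An element of the local space is a class of
  Cauchy sequences of smooth functions, and distances and pairings pick representatives by
  \<open>SOME\<close>. One explicit sequence \<open>X \<omega>\<close>, the same for all target
  spaces, is therefore used, and the Hoelder statement becomes a comparison of two limits of the
  same pairings. The auxiliary exponent \<open>\<alpha>'\<close> separates two tasks: the gap up to
  \<open>\<beta>\<close> makes the expected series of coefficients converge, the gap down to
  \<open>\<alpha>\<close> (or to \<open>\<alpha> + d / p\<close>) makes the layers decay
  geometrically.\<close>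

lemma partial_eq:
  assumes "(f has_derivative D) (at x)"
  shows "partial i f x = D (axis i 1)"
proof -
  have a: "((\<lambda>t::real. x + t *\<^sub>R axis i 1) has_derivative (\<lambda>t. t *\<^sub>R axis i 1)) (at 0)"
    by (auto intro!: derivative_eq_intros)
  have "((\<lambda>t. f (x + t *\<^sub>R axis i 1)) has_derivative (\<lambda>t. D (t *\<^sub>R axis i 1))) (at 0)"
    using has_derivative_compose[OF a, of f D] assms by simp
  moreover have "(\<lambda>t. D (t *\<^sub>R axis i 1)) = (*) (D (axis i 1))"
    using has_derivative_bounded_linear[OF assms] by (auto simp: linear_simps mult.commute)
  ultimately show ?thesis
    unfolding partial_def by (intro DERIV_imp_deriv) (simp add: has_field_derivative_def)
qed

lemma has_derivative_partial:
  fixes f :: "real^'d::finite \<Rightarrow> real"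
  assumes "f differentiable (at x)"
  shows "(f has_derivative (\<lambda>h. \<Sum>i\<in>UNIV. h $ i * partial i f x)) (at x)"
proof -
  obtain D where D: "(f has_derivative D) (at x)"
    using assms by (auto simp: differentiable_def)
  have bl: "bounded_linear D" using D by (rule has_derivative_bounded_linear)
  have "D h = (\<Sum>i\<in>UNIV. h $ i * partial i f x)" for h
  proof -
    have "h = (\<Sum>i\<in>UNIV. (h $ i) *\<^sub>R axis i 1)"
      by (simp add: vec_eq_iff axis_def if_distrib cong: if_cong)
    then have "D h = D (\<Sum>i\<in>UNIV. (h $ i) *\<^sub>R axis i 1)" by simp
    also have "\<dots> = (\<Sum>i\<in>UNIV. (h $ i) * D (axis i 1))"
      using bl by (simp add: linear_simps linear_sum bounded_linear.linear)
    finally show ?thesis using partial_eq[OF D] by simp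
  qed
  then show ?thesis using D by (metis (no_types, lifting) ext)
qed

lemma partial_DERIV:
  assumes "f differentiable (at (x + t *\<^sub>R axis i 1))"
  shows "((\<lambda>t. f (x + t *\<^sub>R axis i 1)) has_real_derivative partial i f (x + t *\<^sub>R axis i 1)) (at t)"
proof -
  obtain D where D: "(f has_derivative D) (at (x + t *\<^sub>R axis i 1))"
    using assms by (auto simp: differentiable_def)
  have a: "((\<lambda>t::real. x + t *\<^sub>R axis i 1) has_derivative (\<lambda>t. t *\<^sub>R axis i 1)) (at t)"
    by (auto intro!: derivative_eq_intros)
  have "((\<lambda>t. f (x + t *\<^sub>R axis i 1)) has_derivative (\<lambda>t. D (t *\<^sub>R axis i 1))) (at t)"
    using has_derivative_compose[OF a D] .
  moreover have "(\<lambda>t. D (t *\<^sub>R axis i 1)) = (*) (D (axis i 1))"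
    using has_derivative_bounded_linear[OF D] by (auto simp: linear_simps mult.commute)
  ultimately show ?thesis
    using partial_eq[OF D] by (simp add: has_field_derivative_def)
qed

lemma partial_zero_open:
  assumes "open S" "x \<in> S" "\<And>y. y \<in> S \<Longrightarrow> u y = 0"
  shows "partial i u x = 0"
proof -
  have "(u has_derivative (\<lambda>_. 0)) (at x)"
    by (rule has_derivative_transform_within_open[where f="\<lambda>_. 0" and s=S]) (use assms in auto)
  from partial_eq[OF this] show ?thesis by simp
qed

lemma partial_const [simp]: "partial i (\<lambda>x. c) = (\<lambda>x. 0)"
  using partial_eq[of "\<lambda>x. c" "\<lambda>_. 0"] by (auto intro: has_derivative_const)

lemma partial_add:
  assumes "f differentiable (at x)" "g differentiable (at x)"
  shows "partial i (\<lambda>x. f x + g x) x = partial i f x + partial i g x"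
proof -
  obtain D E where D: "(f has_derivative D) (at x)" and E: "(g has_derivative E) (at x)"
    using assms by (auto simp: differentiable_def)
  show ?thesis
    using partial_eq[OF D] partial_eq[OF E] partial_eq[OF has_derivative_add[OF D E]] by simp
qed

lemma partial_mult:
  fixes f g :: "real^'d::finite \<Rightarrow> real"
  assumes "f differentiable (at x)" "g differentiable (at x)"
  shows "partial i (\<lambda>x. f x * g x) x = partial i f x * g x + f x * partial i g x"
proof -
  obtain D E where D: "(f has_derivative D) (at x)" and E: "(g has_derivative E) (at x)"
    using assms by (auto simp: differentiable_def)
  show ?thesis
    using partial_eq[OF D] partial_eq[OF E] partial_eq[OF has_derivative_mult[OF D E]] by simp
qed

lemma partial_cmult:
  fixes f :: "real^'d::finite \<Rightarrow> real"
  assumes "f differentiable (at x)"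
  shows "partial i (\<lambda>x. c * f x) x = c * partial i f x"
  using partial_mult[of "\<lambda>_. c" x f] assms by simp

lemma C_on_continuous: "C_on r UNIV f \<Longrightarrow> continuous_on UNIV f"
  by (cases r) (auto intro!: continuous_at_imp_continuous_on differentiable_imp_continuous_within)

lemma C_on_SucD:
  fixes f :: "real^'d::finite \<Rightarrow> real"
  shows "C_on (Suc r) UNIV f \<Longrightarrow> C_on r UNIV f"
proof (induction r arbitrary: f)
  case 0
  then show ?case
    by (auto intro!: continuous_at_imp_continuous_on differentiable_imp_continuous_within)
next
  case (Suc r)
  then have "C_on r UNIV (partial i f)" for i by (subst (asm) (2) C_on.simps) blast
  with Suc.prems show ?case by (subst (asm) C_on.simps) (simp only: C_on.simps, blast)
qed

lemma C_on_le: "C_on r UNIV f \<Longrightarrow> m \<le> r \<Longrightarrow> C_on m UNIV f"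
proof (induction r)
  case (Suc r)
  then show ?case using C_on_SucD by (cases "m = Suc r") auto
qed auto

lemma C_on_subset: "C_on r S f \<Longrightarrow> T \<subseteq> S \<Longrightarrow> C_on r T f"
  by (induction r arbitrary: f) (auto intro: continuous_on_subset)

lemma C_on_const: "C_on r UNIV (\<lambda>x. c)"
  by (induction r arbitrary: c) (auto intro: continuous_on_const)

lemma C_on_add: "C_on r UNIV f \<Longrightarrow> C_on r UNIV g \<Longrightarrow> C_on r UNIV (\<lambda>x. f x + g x)"
proof (induction r arbitrary: f g)
  case 0 then show ?case by (auto intro: continuous_intros)
next
  case (Suc r)
  have "partial i (\<lambda>x. f x + g x) = (\<lambda>x. partial i f x + partial i g x)" for i
    using Suc.prems by (auto intro!: partial_add)
  then show ?case using Suc by (auto intro!: derivative_intros)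
qed

lemma C_on_mult: "C_on r UNIV f \<Longrightarrow> C_on r UNIV g \<Longrightarrow> C_on r UNIV (\<lambda>x. f x * g x)"
proof (induction r arbitrary: f g)
  case 0 then show ?case by (auto intro: continuous_intros)
next
  case (Suc r)
  have *: "partial i (\<lambda>x. f x * g x) = (\<lambda>x. partial i f x * g x + f x * partial i g x)" for i
    using Suc.prems by (auto intro!: partial_mult)
  show ?case using Suc.prems C_on_SucD[OF Suc.prems(1)] C_on_SucD[OF Suc.prems(2)]
    by (auto intro!: C_on_add derivative_intros Suc.IH simp: *)
qed

lemma C_on_cmult: "C_on r UNIV f \<Longrightarrow> C_on r UNIV (\<lambda>x. c * f x)"
  by (intro C_on_mult C_on_const)

lemma C_on_sum: "(\<And>i. i \<in> I \<Longrightarrow> C_on r UNIV (f i)) \<Longrightarrow> C_on r UNIV (\<lambda>x. \<Sum>i\<in>I. f i x)"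
  by (induction I rule: infinite_finite_induct) (auto intro!: C_on_const C_on_add)

lemma C_on_prod: "(\<And>i. i \<in> I \<Longrightarrow> C_on r UNIV (f i)) \<Longrightarrow> C_on r UNIV (\<lambda>x. \<Prod>i\<in>I. f i x)"
  by (induction I rule: infinite_finite_induct) (auto intro!: C_on_const C_on_mult)

lemma C_on_diff: "C_on r UNIV f \<Longrightarrow> C_on r UNIV g \<Longrightarrow> C_on r UNIV (\<lambda>x. f x - g x)"
  using C_on_add[OF _ C_on_cmult[of r g "-1"], of f] by simp

text \<open>Rescaled without normalisation, so that the supremum norm does not depend on the level.
  The factor \<open>2 ^ (CARD('d) * n)\<close> that makes up for the squared \<open>L2\<close> norm
  is attached to the coefficients throughout.\<close>

definition wav :: "(real^'d::finite \<Rightarrow> real) \<Rightarrow> nat \<Rightarrow> real^'d \<Rightarrow> real^'d \<Rightarrow> real" where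
  "wav g n x = (\<lambda>y. g (2 ^ n *\<^sub>R (y - x)))"

lemma differentiable_wav:
  assumes "\<And>y. g differentiable (at y)" shows "wav g n x differentiable (at y)"
  unfolding wav_def by (rule differentiable_compose[of g]) (auto intro!: derivative_intros assms)

lemma partial_wav:
  assumes "\<And>y. g differentiable (at y)"
  shows "partial i (wav g n x) = (\<lambda>y. 2 ^ n * wav (partial i g) n x y)"
proof
  fix y
  obtain D where D: "(g has_derivative D) (at (2 ^ n *\<^sub>R (y - x)))"
    using assms by (auto simp: differentiable_def)
  have a: "((\<lambda>y. 2 ^ n *\<^sub>R (y - x)) has_derivative (\<lambda>h. 2 ^ n *\<^sub>R h)) (at y)"
    by (auto intro!: derivative_eq_intros)
  have "(wav g n x has_derivative (\<lambda>h. D (2 ^ n *\<^sub>R h))) (at y)"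
    unfolding wav_def using has_derivative_compose[OF a D] .
  from partial_eq[OF this] partial_eq[OF D]
  show "partial i (wav g n x) y = 2 ^ n * wav (partial i g) n x y"
    using has_derivative_bounded_linear[OF D] by (simp add: wav_def linear_simps)
qed

lemma C_on_wav: "C_on r UNIV g \<Longrightarrow> C_on r UNIV (wav g n x)"
proof (induction r arbitrary: g)
  case 0
  then show ?case unfolding wav_def C_on.simps
    by (rule continuous_on_compose2[of UNIV g]) (auto intro!: continuous_intros)
next
  case (Suc r)
  then show ?case by (auto simp: partial_wav intro!: C_on_cmult differentiable_wav)
qed

subsection \<open>Quantitative bounds\<close>

text \<open>Partial derivatives of order m \<le> r are bounded by \<open>A * s ^ m\<close>:
  \<open>A\<close> is an amplitude and \<open>s\<close> a frequency. Keeping both lets a dilation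
  act on \<open>s\<close> alone; sums and products are taken at a common \<open>s\<close>.\<close>

primrec cbnd :: "nat \<Rightarrow> real \<Rightarrow> real \<Rightarrow> (real^'d::finite \<Rightarrow> real) \<Rightarrow> bool" where
  "cbnd 0 A s u \<longleftrightarrow> continuous_on UNIV u \<and> (\<forall>x. \<bar>u x\<bar> \<le> A)"
| "cbnd (Suc r) A s u \<longleftrightarrow> (\<forall>x. u differentiable (at x)) \<and> (\<forall>x. \<bar>u x\<bar> \<le> A) \<and>
     (\<forall>i. cbnd r (A * s) s (partial i u))"

lemma cbnd_C_on: "cbnd r A s u \<Longrightarrow> C_on r UNIV u"
proof (induction r arbitrary: u A)
  case (Suc r)
  then have "C_on r UNIV (partial i u)" for i using Suc.IH[of "A * s" "partial i u"] by simp
  then show ?case using Suc.prems by simp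
qed auto

lemma cbnd_abs: "cbnd r A s u \<Longrightarrow> \<bar>u x\<bar> \<le> A"
  by (cases r) auto

lemma cbnd_nonneg: "cbnd r A s u \<Longrightarrow> 0 \<le> A"
  using cbnd_abs[of r A s u 0] by linarith

lemma cbnd_SucD: "cbnd (Suc r) A s u \<Longrightarrow> cbnd r A s u"
proof (induction r arbitrary: u A)
  case 0
  then show ?case using C_on_continuous[OF cbnd_C_on[OF 0]] cbnd_abs[OF 0] by simp
next
  case (Suc r)
  have "cbnd (Suc r) (A * s) s (partial i u)" for i using Suc.prems by (subst (asm) cbnd.simps) blast
  then have "cbnd r (A * s) s (partial i u)" for i by (rule Suc.IH)
  then show ?case using Suc.prems by (subst (asm) cbnd.simps) (simp only: cbnd.simps, blast)
qed

lemma cbnd_mono: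
  "cbnd r A s u \<Longrightarrow> A \<le> B \<Longrightarrow> 0 \<le> s \<Longrightarrow> s \<le> t \<Longrightarrow> cbnd r B t u"
proof (induction r arbitrary: u A B)
  case 0
  then have "\<bar>u x\<bar> \<le> B" for x using order_trans[of "\<bar>u x\<bar>" A B] by simp
  then show ?case using 0 by simp
next
  case (Suc r)
  have "0 \<le> A" using Suc.prems(1) by (rule cbnd_nonneg)
  then have *: "A * s \<le> B * t" using Suc.prems by (intro mult_mono) auto
  have "\<bar>u x\<bar> \<le> B" for x using Suc.prems order_trans[of "\<bar>u x\<bar>" A B] by simp
  moreover have "cbnd r (B * t) t (partial i u)" for i
    using Suc.IH[OF _ * Suc.prems(3,4)] Suc.prems(1) by simp
  ultimately show ?case using Suc.prems(1) by simp
qed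

lemma cbnd_add: "cbnd r A s u \<Longrightarrow> cbnd r B s v \<Longrightarrow> cbnd r (A + B) s (\<lambda>x. u x + v x)"
proof (induction r arbitrary: u v A B)
  case 0
  have "\<bar>u x + v x\<bar> \<le> A + B" for x
    using cbnd_abs[OF 0(1), of x] cbnd_abs[OF 0(2), of x] by linarith
  then show ?case using 0 by (auto intro!: continuous_intros)
next
  case (Suc r)
  have "partial i (\<lambda>x. u x + v x) = (\<lambda>x. partial i u x + partial i v x)" for i
    using Suc.prems by (auto intro!: partial_add)
  moreover have "\<bar>u x + v x\<bar> \<le> A + B" for x
    using cbnd_abs[OF Suc.prems(1), of x] cbnd_abs[OF Suc.prems(2), of x] by linarith
  ultimately show ?case using Suc by (auto intro!: derivative_intros simp: distrib_right)
qed

lemma cbnd_const0: "0 \<le> A \<Longrightarrow> 0 \<le> s \<Longrightarrow> cbnd r A s (\<lambda>x. 0)"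
  by (induction r arbitrary: A) auto

lemma cbnd_cmult: "cbnd r A s u \<Longrightarrow> cbnd r (\<bar>c\<bar> * A) s (\<lambda>x. c * u x)"
proof (induction r arbitrary: u A)
  case 0
  then show ?case by (auto intro!: continuous_intros mult_left_mono simp: abs_mult)
next
  case (Suc r)
  have "partial i (\<lambda>x. c * u x) = (\<lambda>x. c * partial i u x)" for i
    using Suc.prems by (auto intro!: partial_cmult)
  then show ?case using Suc.prems Suc.IH[of "A * s"]
    by (auto intro!: derivative_intros mult_left_mono simp: abs_mult mult.assoc)
qed

lemma cbnd_sum:
  assumes "\<And>i. i \<in> I \<Longrightarrow> cbnd r (A i) s (u i)" "0 \<le> s"
  shows "cbnd r (\<Sum>i\<in>I. A i) s (\<lambda>x. \<Sum>i\<in>I. u i x)"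
  using assms
  by (induction I rule: infinite_finite_induct) (auto intro!: cbnd_const0 cbnd_add)

text \<open>Leibniz rule: every derivative splits the product into two terms, which doubles the
  constant and leads to \<open>2 ^ r\<close>.\<close>

lemma cbnd_mult:
  "cbnd r A s u \<Longrightarrow> cbnd r B s v \<Longrightarrow> 0 \<le> s \<Longrightarrow> cbnd r (2 ^ r * A * B) s (\<lambda>x. u x * v x)"
proof (induction r arbitrary: u v A B)
  case 0
  have "\<bar>u x * v x\<bar> \<le> A * B" for x
    unfolding abs_mult
    using cbnd_abs[OF 0(1), of x] cbnd_abs[OF 0(2), of x] cbnd_nonneg[OF 0(1)] by (intro mult_mono) auto
  then show ?case using 0 by (auto intro!: continuous_intros)
next
  case (Suc r)
  have *: "partial i (\<lambda>x. u x * v x) = (\<lambda>x. partial i u x * v x + u x * partial i v x)" for i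
    using Suc.prems by (auto intro!: partial_mult)
  have AB: "0 \<le> A" "0 \<le> B" using Suc.prems cbnd_nonneg by blast+
  have "cbnd r (2 ^ r * (A * s) * B + 2 ^ r * A * (B * s)) s (partial i (\<lambda>x. u x * v x))" for i
    unfolding * using Suc.prems by (intro cbnd_add Suc.IH) (auto intro: cbnd_SucD)
  moreover have "\<bar>u x * v x\<bar> \<le> 2 ^ Suc r * A * B" for x
  proof -
    have "\<bar>u x * v x\<bar> \<le> A * B"
      unfolding abs_mult using Suc.prems AB by (intro mult_mono) auto
    also have "\<dots> \<le> 2 ^ Suc r * (A * B)"
      using AB mult_right_mono[of 1 "2 ^ Suc r :: real" "A * B"] one_le_power[of "2::real" "Suc r"] by simp
    finally show ?thesis by (simp add: mult.assoc)
  qed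
  ultimately show ?case using Suc.prems by (auto intro!: derivative_intros simp: algebra_simps)
qed

lemma cbnd_wav: "cbnd r A s g \<Longrightarrow> cbnd r A (2 ^ n * s) (wav g n x)"
proof (induction r arbitrary: g A)
  case 0
  then have "C_on 0 UNIV (wav g n x)" by (intro C_on_wav) auto
  with 0 show ?case by (auto simp: wav_def)
next
  case (Suc r)
  have "cbnd r (\<bar>2 ^ n\<bar> * (A * s)) (2 ^ n * s) (\<lambda>y. 2 ^ n * wav (partial i g) n x y)" for i
    using Suc by (intro cbnd_cmult) auto
  then show ?case using Suc.prems
    by (auto simp: partial_wav mult.left_commute intro!: differentiable_wav) (auto simp: wav_def)
qed

lemma C_on_cbnd:
  fixes u :: "real^'d::finite \<Rightarrow> real"
  assumes "C_on r UNIV u" "\<And>y. y \<notin> S \<Longrightarrow> u y = 0" "bounded S" "0 < s"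
  obtains A where "cbnd r A s u"
proof -
  have cl: "compact (closure S)" using assms(3) by (simp add: compact_closure)
  have "\<exists>A. cbnd r A s u"
    if "C_on r UNIV u" "\<And>y. y \<notin> closure S \<Longrightarrow> u y = 0" for u
    using that
  proof (induction r arbitrary: u)
    case (0 u)
    have "compact (u ` closure S)"
      using 0 cl by (intro compact_continuous_image) (auto intro: continuous_on_subset)
    then obtain A where A: "\<And>y. y \<in> closure S \<Longrightarrow> \<bar>u y\<bar> \<le> A"
      using compact_imp_bounded[of "u ` closure S"] by (auto simp: bounded_iff)
    have "\<bar>u y\<bar> \<le> max A 0" for y
      using A[of y] 0(2)[of y] by (cases "y \<in> closure S") auto
    with 0 show ?case by auto
  next
    case (Suc r)
    have "\<exists>A. cbnd r A s (partial i u)" for i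
      using Suc.prems partial_zero_open[of "- closure S" _ u i] by (intro Suc.IH) auto
    then obtain B where B: "\<And>i. cbnd r (B i) s (partial i u)" by metis
    have "\<exists>A. cbnd 0 A s u"
      using cl Suc.prems C_on_continuous[OF Suc.prems(1)]
    proof -
      have "compact (u ` closure S)"
        using cl C_on_continuous[OF Suc.prems(1)] by (intro compact_continuous_image) (auto intro: continuous_on_subset)
      then obtain A where A: "\<And>y. y \<in> closure S \<Longrightarrow> \<bar>u y\<bar> \<le> A"
        using compact_imp_bounded[of "u ` closure S"] by (auto simp: bounded_iff)
      have "\<bar>u y\<bar> \<le> max A 0" for y
        using A[of y] Suc.prems(2)[of y] by (cases "y \<in> closure S") auto
      with C_on_continuous[OF Suc.prems(1)] show ?thesis by auto
    qed
    then obtain A where A: "cbnd 0 A s u" ..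
    \<comment> \<open>\<open>C\<close> has to dominate \<open>A\<close> itself and, after
      multiplication by \<open>s\<close>, every first-order bound \<open>B i\<close>.\<close>
    define C where "C = A + (\<Sum>i\<in>UNIV. B i / s)"
    have Bn: "0 \<le> B i" for i using B cbnd_nonneg by blast
    have A0: "0 \<le> A" using A cbnd_nonneg by blast
    have le: "B i \<le> C * s" for i
    proof -
      have "B i / s \<le> (\<Sum>i\<in>UNIV. B i / s)"
        using Bn \<open>0 < s\<close> by (intro member_le_sum) auto
      then have "B i / s \<le> C" using A0 by (simp add: C_def)
      then show ?thesis using \<open>0 < s\<close> by (simp add: field_simps)
    qed
    have "A \<le> C" using Bn \<open>0 < s\<close> by (auto simp: C_def intro!: sum_nonneg)
    then have "\<bar>u x\<bar> \<le> C" for x using cbnd_abs[OF A, of x] by linarith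
    moreover have "cbnd r (C * s) s (partial i u)" for i
      using cbnd_mono[OF B le] \<open>0 < s\<close> by simp
    ultimately have "cbnd (Suc r) C s u" using Suc.prems by simp
    then show ?case ..
  qed
  moreover have "\<And>y. y \<notin> closure S \<Longrightarrow> u y = 0"
    using assms(2) closure_subset by blast
  ultimately show ?thesis using assms(1) that by blast
qed

lemma cbnd_partials:
  "cbnd r A s u \<Longrightarrow> length js \<le> r \<Longrightarrow> C_on (r - length js) UNIV (partials js u) \<and>
     (\<forall>x. \<bar>partials js u x\<bar> \<le> A * s ^ length js)"
proof -
  \<comment> \<open>\<open>partials\<close> applies the last entry of the list first, and
    \<open>cbnd\<close> descends through that first derivative; hence the induction from the
    right.\<close>
  have *: "partials (js @ [i]) u = partials js (partial i u)" for js i and u :: "real^'d::finite \<Rightarrow> real"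
    by (induction js) auto
  show "cbnd r A s u \<Longrightarrow> length js \<le> r \<Longrightarrow> C_on (r - length js) UNIV (partials js u) \<and>
     (\<forall>x. \<bar>partials js u x\<bar> \<le> A * s ^ length js)"
  proof (induction js arbitrary: r A u rule: rev_induct)
    case Nil then show ?case by (auto intro: cbnd_C_on cbnd_abs)
  next
    case (snoc i js)
    then obtain r' where r: "r = Suc r'" by (cases r) auto
    have "cbnd r' (A * s) s (partial i u)" using snoc.prems r by auto
    from snoc.IH[OF this] show ?case using snoc.prems r by (auto simp: * mult.assoc)
  qed
qed

section \<open>Supports and membership in the spaces \<open>Cc r U\<close>\<close>

lemma supp_subset:
  assumes "\<And>y. y \<notin> S \<Longrightarrow> u y = 0" "closed S" shows "supp u \<subseteq> S"
proof -
  have "{x. u x \<noteq> 0} \<subseteq> S" using assms(1) by blast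
  then show ?thesis unfolding supp_def using assms(2) by (rule closure_minimal)
qed

lemma supp_zero: "y \<notin> supp u \<Longrightarrow> u y = 0"
  using closure_subset[of "{x. u x \<noteq> 0}"] unfolding supp_def by (metis (mono_tags) mem_Collect_eq subsetD)

lemma CcI:
  assumes "C_on r UNIV u" "\<And>y. y \<notin> S \<Longrightarrow> u y = 0" "compact S" "S \<subseteq> U"
  shows "u \<in> Cc r U"
proof -
  have sub: "supp u \<subseteq> S" using supp_subset[of S u] assms compact_imp_closed by blast
  then have "compact (S \<inter> supp u)"
    using assms(3) by (intro compact_Int_closed) (simp_all add: supp_def)
  then have "compact (supp u)" using sub by (simp add: Int_absorb1)
  then show ?thesis using assms(1,4) sub by (auto simp: Cc_def)
qed

lemma Cc_C_on: "u \<in> Cc r U \<Longrightarrow> C_on r UNIV u"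
  by (simp add: Cc_def)

lemma Cc_cbnd:
  assumes "u \<in> Cc r U" "0 < s" obtains A where "cbnd r A s u"
  using C_on_cbnd[of r u "supp u" s] assms supp_zero
  by (auto simp: Cc_def compact_imp_bounded)

section \<open>Integration of compactly supported functions\<close>

text \<open>The working class of functions: integrability and square integrability are automatic,
  and it is stable under products, dilations, wavelet projections and mollification. A radius
  replaces the support, so that supports of sums and dilates only need the triangle
  inequality.\<close>

definition cs :: "(real^'d::finite \<Rightarrow> real) \<Rightarrow> bool" where
  "cs u \<longleftrightarrow> continuous_on UNIV u \<and> (\<exists>b. \<forall>y. b < norm y \<longrightarrow> u y = 0)"

lemma csI: "continuous_on UNIV u \<Longrightarrow> (\<And>y. b < norm y \<Longrightarrow> u y = 0) \<Longrightarrow> cs u"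
  unfolding cs_def by blast

lemma cs_continuous: "cs u \<Longrightarrow> continuous_on UNIV u"
  by (simp add: cs_def)

lemma cs_measurable: "cs u \<Longrightarrow> u \<in> borel_measurable lborel"
  by (auto dest!: cs_continuous intro: borel_measurable_continuous_onI)

lemma cs_integrable:
  assumes "cs u" shows "integrable lborel u"
proof -
  obtain b where b: "\<And>y. b < norm y \<Longrightarrow> u y = 0" using assms unfolding cs_def by blast
  have "integrable lborel (\<lambda>x. indicator (cball 0 b) x *\<^sub>R u x)"
    using cs_continuous[OF assms] by (intro borel_integrable_compact) (auto intro: continuous_on_subset)
  moreover have "(\<lambda>x. indicator (cball 0 b) x *\<^sub>R u x) = u"
    using b by (auto simp: indicator_def fun_eq_iff not_le)
  ultimately show ?thesis by simp
qed

lemma cs_zero: "cs (\<lambda>x. 0)"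
  by (auto simp: cs_def)

lemma cs_add: "cs u \<Longrightarrow> cs v \<Longrightarrow> cs (\<lambda>x. u x + v x)"
proof -
  assume u: "cs u" and v: "cs v"
  obtain b c where "\<And>y. b < norm y \<Longrightarrow> u y = 0" "\<And>y. c < norm y \<Longrightarrow> v y = 0"
    using u v unfolding cs_def by blast
  then show ?thesis using u v
    by (intro csI[of _ "max b c"]) (auto intro!: continuous_intros dest: cs_continuous)
qed

lemma cs_mult: "cs u \<Longrightarrow> continuous_on UNIV v \<Longrightarrow> cs (\<lambda>x. u x * v x)"
proof -
  assume u: "cs u" and v: "continuous_on UNIV v"
  obtain b where "\<And>y. b < norm y \<Longrightarrow> u y = 0" using u unfolding cs_def by blast
  then show ?thesis using u v
    by (intro csI[of _ b]) (auto intro!: continuous_intros dest: cs_continuous)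
qed

lemma cs_mult_left: "cs u \<Longrightarrow> continuous_on UNIV v \<Longrightarrow> cs (\<lambda>x. v x * u x)"
  using cs_mult[of u v] by (simp add: mult.commute)

lemma cs_cmult: "cs u \<Longrightarrow> cs (\<lambda>x. c * u x)"
  by (rule cs_mult_left) auto

lemma cs_diff: "cs u \<Longrightarrow> cs v \<Longrightarrow> cs (\<lambda>x. u x - v x)"
  using cs_add[OF _ cs_cmult[of v "-1"]] by simp

lemma cs_sum: "(\<And>i. i \<in> I \<Longrightarrow> cs (u i)) \<Longrightarrow> cs (\<lambda>x. \<Sum>i\<in>I. u i x)"
  by (induction I rule: infinite_finite_induct) (auto intro: cs_zero cs_add)

lemma cs_abs: "cs u \<Longrightarrow> cs (\<lambda>x. \<bar>u x\<bar>)"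
  unfolding cs_def by (auto intro!: continuous_intros)

lemma cs_wav: "cs u \<Longrightarrow> cs (wav u n x)"
proof -
  assume u: "cs u"
  obtain b where b: "\<And>y. b < norm y \<Longrightarrow> u y = 0" using u unfolding cs_def by blast
  have "wav u n x y = 0" if y: "\<bar>b\<bar> + norm x < norm y" for y
  proof -
    have "\<bar>b\<bar> < norm (y - x)" using y norm_triangle_ineq2[of y x] by linarith
    also have "\<dots> \<le> 2 ^ n * norm (y - x)" by (simp add: mult_le_cancel_right1)
    finally show ?thesis unfolding wav_def by (intro b) simp
  qed
  moreover have "continuous_on UNIV (wav u n x)"
    using C_on_wav[of 0 u n x] cs_continuous[OF u] by simp
  ultimately show ?thesis by (intro csI)
qed

lemma Cc_cs: "u \<in> Cc r U \<Longrightarrow> cs u"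
proof -
  assume u: "u \<in> Cc r U"
  then obtain b where "\<And>y. y \<in> supp u \<Longrightarrow> norm y \<le> b"
    using compact_imp_bounded[of "supp u"] unfolding Cc_def bounded_iff by blast
  then have "b < norm y \<Longrightarrow> u y = 0" for y
    using supp_zero[of y u] by (meson linorder_not_le)
  then show ?thesis using u by (intro csI) (auto simp: Cc_def intro: C_on_continuous)
qed

lemma cs_partial: "cs u \<Longrightarrow> C_on (Suc r) UNIV u \<Longrightarrow> cs (partial i u)"
proof -
  assume u: "cs u" "C_on (Suc r) UNIV u"
  obtain b where b: "\<And>y. b < norm y \<Longrightarrow> u y = 0" using u unfolding cs_def by blast
  have "partial i u y = 0" if "b < norm y" for y
    by (rule partial_zero_open[of "- cball 0 b"]) (use that b in auto)
  then show ?thesis using u(2) by (intro csI[of _ b]) (auto intro: C_on_continuous)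
qed

section \<open>Changes of variables and differentiation under the integral\<close>

lemma integral_affine:
  fixes u :: "real^'d::finite \<Rightarrow> real"
  assumes [measurable]: "u \<in> borel_measurable borel" and c: "0 < c"
  shows "(\<integral>x. u (t + c *\<^sub>R x) \<partial>lborel) = (\<integral>x. u x \<partial>lborel) / c ^ CARD('d)"
proof -
  have "(\<integral>x. u x \<partial>lborel) = (\<integral>x. u x \<partial>density (distr lborel borel (\<lambda>x. t + c *\<^sub>R x)) (\<lambda>_. ennreal (c ^ CARD('d))))"
    using lborel_affine[of c t] c by simp
  also have "\<dots> = c ^ CARD('d) * (\<integral>x. u (t + c *\<^sub>R x) \<partial>lborel)"
    using c by (subst integral_density) (auto simp: integral_distr)
  finally show ?thesis using c by simp
qed

lemma integrable_affine:
  fixes u :: "real^'d::finite \<Rightarrow> real"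
  assumes "integrable lborel u" and c: "0 < c"
  shows "integrable lborel (\<lambda>x. u (t + c *\<^sub>R x))"
proof -
  have [measurable]: "u \<in> borel_measurable borel" using assms by auto
  have "integrable (density (distr lborel borel (\<lambda>x. t + c *\<^sub>R x)) (\<lambda>_. ennreal (c ^ CARD('d)))) u"
    using lborel_affine[of c t] c assms by simp
  then show ?thesis
    using c by (subst (asm) integrable_density) (auto simp: integrable_distr_eq)
qed

lemma integral_wav:
  fixes u :: "real^'d::finite \<Rightarrow> real"
  assumes "u \<in> borel_measurable borel"
  shows "(\<integral>y. u (2 ^ n *\<^sub>R (y - x)) \<partial>lborel) = (\<integral>y. u y \<partial>lborel) / 2 ^ (CARD('d) * n)"
  using integral_affine[OF assms, of "2 ^ n" "- (2 ^ n *\<^sub>R x)"]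
  by (simp add: algebra_simps power_mult[symmetric] mult.commute)

text \<open>Passage from the Lebesgue integral to the gauge integral over a box, the setting of the
  Leibniz rule and of continuity in a parameter.\<close>

lemma cs_integral_box:
  fixes u :: "real^'d::finite \<Rightarrow> real"
  assumes "cs u" "\<And>y. y \<notin> cbox a c \<Longrightarrow> u y = 0"
  shows "(\<integral>y. u y \<partial>lborel) = integral (cbox a c) u"
proof -
  have "(\<lambda>x. if x \<in> cbox a c then u x else 0) = u" using assms(2) by auto
  then show ?thesis
    using integral_lborel[OF cs_integrable[OF assms(1)]] integral_restrict_UNIV[of "cbox a c" u] by simp
qed

text \<open>The supports are confined to one ball only for \<open>t\<close> within distance 1 of
  \<open>t0\<close>, since under translations they move with \<open>t\<close>; this is enough for a
  derivative at \<open>t0\<close>.\<close>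

lemma DERIV_integral:
  fixes G :: "real \<Rightarrow> real^'d::finite \<Rightarrow> real"
  assumes D: "\<And>t y. \<bar>t - t0\<bar> \<le> 1 \<Longrightarrow> ((\<lambda>t. G t y) has_real_derivative G' t y) (at t)"
    and cG: "\<And>t. continuous_on UNIV (G t)"
    and cG': "continuous_on UNIV (\<lambda>(t, y). G' t y)"
    and z: "\<And>t y. \<bar>t - t0\<bar> \<le> 1 \<Longrightarrow> b < norm y \<Longrightarrow> G t y = 0"
    and z': "\<And>y. b < norm y \<Longrightarrow> G' t0 y = 0"
  shows "((\<lambda>t. \<integral>y. G t y \<partial>lborel) has_real_derivative (\<integral>y. G' t0 y \<partial>lborel)) (at t0)"
proof -
  obtain a :: "real^'d" where a: "cball 0 b \<subseteq> cbox (-a) a"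
    using bounded_subset_cbox_symmetric[OF bounded_cball] by blast
  then have out: "y \<notin> cbox (-a) a \<Longrightarrow> b < norm y" for y by (force simp: not_le[symmetric])
  have cG'0: "continuous_on UNIV (G' t0)"
    using continuous_on_compose2[OF cG' continuous_on_Pair[OF continuous_on_const[of UNIV t0] continuous_on_id]] by simp
  have e: "(\<integral>y. G t y \<partial>lborel) = integral (cbox (-a) a) (G t)" if "\<bar>t - t0\<bar> \<le> 1" for t
    using that cG z out by (intro cs_integral_box csI[of _ b]) auto
  have e': "(\<integral>y. G' t0 y \<partial>lborel) = integral (cbox (-a) a) (G' t0)"
    using cG'0 z' out by (intro cs_integral_box csI[of _ b]) auto
  have "((\<lambda>t. integral (cbox (-a) a) (G t)) has_field_derivative integral (cbox (-a) a) (G' t0)) (at t0 within {t0-1<..<t0+1})"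
    using cG cG'
    by (intro leibniz_rule_field_derivative)
       (auto intro!: D[THEN DERIV_subset] integrable_continuous intro: continuous_on_subset)
  then have "((\<lambda>t. integral (cbox (-a) a) (G t)) has_field_derivative integral (cbox (-a) a) (G' t0)) (at t0)"
    by (subst (asm) at_within_open) auto
  then show ?thesis unfolding e'
    by (rule has_field_derivative_transform_within_open[where S="{t0-1<..<t0+1}"]) (auto simp: e)
qed

text \<open>By translation invariance the integral of \<open>u\<close> shifted by \<open>t\<close>
  in direction \<open>i\<close> does not depend on \<open>t\<close>; differentiation at
  \<open>t = 0\<close> under the integral gives the claim.\<close>

lemma integral_partial_zero:
  fixes u :: "real^'d::finite \<Rightarrow> real"
  assumes u: "cs u" "C_on (Suc 0) UNIV u"
  shows "(\<integral>y. partial i u y \<partial>lborel) = 0"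
proof -
  obtain b where b: "\<And>y. b < norm y \<Longrightarrow> u y = 0" using u unfolding cs_def by blast
  have out: "u (y + t *\<^sub>R axis i 1) = 0" "partial i u (y + t *\<^sub>R axis i 1) = 0"
    if "\<bar>t - 0\<bar> \<le> 1" "\<bar>b\<bar> + 1 < norm y" for t y
  proof -
    have "norm (t *\<^sub>R axis i 1 :: real^'d) \<le> 1" using that by (simp add: norm_axis_1)
    then have n: "b < norm (y + t *\<^sub>R axis i 1)"
      using that norm_triangle_ineq2[of y "- (t *\<^sub>R axis i 1)"] by simp
    then show "u (y + t *\<^sub>R axis i 1) = 0" by (rule b)
    show "partial i u (y + t *\<^sub>R axis i 1) = 0"
      by (rule partial_zero_open[of "- cball 0 b"]) (use n b in auto)
  qed
  have c: "continuous_on UNIV (partial i u)" using u(2) by simp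
  have "((\<lambda>t. \<integral>y. u (y + t *\<^sub>R axis i 1) \<partial>lborel) has_real_derivative
      (\<integral>y. partial i u (y + 0 *\<^sub>R axis i 1) \<partial>lborel)) (at 0)"
  proof (rule DERIV_integral[where b="\<bar>b\<bar> + 1"])
    show "continuous_on UNIV (\<lambda>(t, y). partial i u (y + t *\<^sub>R axis i 1))"
      unfolding case_prod_beta by (rule continuous_on_compose2[OF c]) (auto intro!: continuous_intros)
    show "continuous_on UNIV (\<lambda>y. u (y + t *\<^sub>R axis i 1))" for t
      by (rule continuous_on_compose2[OF cs_continuous[OF u(1)]]) (auto intro!: continuous_intros)
    show "partial i u (y + 0 *\<^sub>R axis i 1) = 0" if "\<bar>b\<bar> + 1 < norm y" for y
      using out(2)[of 0 y] that by simp
  qed (use u(2) out(1) in \<open>auto intro!: partial_DERIV\<close>)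
  moreover have "(\<lambda>t. \<integral>y. u (y + t *\<^sub>R axis i 1) \<partial>lborel) = (\<lambda>t. \<integral>y. u y \<partial>lborel)"
  proof
    fix t
    show "(\<integral>y. u (y + t *\<^sub>R axis i 1) \<partial>lborel) = (\<integral>y. u y \<partial>lborel)"
      using integral_affine[of u 1 "t *\<^sub>R axis i 1"] cs_measurable[OF u(1)]
      by (simp add: add.commute[of _ "t *\<^sub>R axis i 1"])
  qed
  ultimately show ?thesis using DERIV_unique[OF _ DERIV_const] by fastforce
qed

lemma integral_by_parts_partial:
  fixes u v :: "real^'d::finite \<Rightarrow> real"
  assumes u: "cs u" "C_on (Suc 0) UNIV u" and v: "C_on (Suc 0) UNIV v"
  shows "(\<integral>y. partial i u y * v y \<partial>lborel) = - (\<integral>y. u y * partial i v y \<partial>lborel)"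
proof -
  have c: "continuous_on UNIV v" "continuous_on UNIV (partial i v)"
    using C_on_continuous[OF v] v by auto
  have "cs (\<lambda>y. u y * v y)" using u(1) c(1) by (rule cs_mult)
  then have "(\<integral>y. partial i (\<lambda>y. u y * v y) y \<partial>lborel) = 0"
    by (rule integral_partial_zero) (intro C_on_mult u v)
  moreover have "partial i (\<lambda>y. u y * v y) y = partial i u y * v y + u y * partial i v y" for y
    using u v by (intro partial_mult) auto
  ultimately show ?thesis
    using cs_integrable[OF cs_mult[OF cs_partial[OF u] c(1), of i]] cs_integrable[OF cs_mult[OF u(1) c(2)]]
    by (simp add: add_eq_0_iff)
qed

lemma continuous_AE_zero:
  fixes u :: "'a::euclidean_space \<Rightarrow> real"
  assumes c: "continuous_on UNIV u" and z: "AE x in lborel. u x = 0"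
  shows "u x = 0"
proof (rule ccontr)
  assume "u x \<noteq> 0"
  moreover have "open {x. u x \<noteq> 0}"
    using c by (intro open_Collect_neq) auto
  moreover have "{x. u x \<noteq> 0} \<in> null_sets lborel"
    using z c AE_iff_null_sets[of "{x. u x \<noteq> 0}" lborel] calculation(2) by auto
  then have "negligible {x. u x \<noteq> 0}"
    using negligible_iff_null_sets null_sets_completionI by blast
  ultimately show False using open_not_negligible by blast
qed

text \<open>The pattern behind the pointwise identities below: the difference of the two sides is
  continuous with bounded support, and it is shown to be orthogonal to itself.\<close>

lemma cs_square_zero:
  assumes u: "cs u" and z: "(\<integral>y. u y * u y \<partial>lborel) = 0"
  shows "u x = 0"
proof -
  have "integrable lborel (\<lambda>y. u y * u y)"
    by (intro cs_integrable cs_mult u cs_continuous)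
  then have "AE y in lborel. u y * u y = 0"
    using z integral_nonneg_eq_0_iff_AE[of lborel "\<lambda>y. u y * u y"] by simp
  then have "AE y in lborel. u y = 0" by simp
  then show ?thesis using continuous_AE_zero cs_continuous[OF u] by blast
qed

lemma cs_integral_bound:
  fixes u :: "real^'d::finite \<Rightarrow> real"
  assumes "cs u" "\<And>y. \<bar>u y\<bar> \<le> B" "\<And>y. b < norm (y - x) \<Longrightarrow> u y = 0"
  shows "\<bar>\<integral>y. u y \<partial>lborel\<bar> \<le> B * measure lborel (cball x b)"
proof -
  have "\<bar>\<integral>y. u y \<partial>lborel\<bar> \<le> (\<integral>y. \<bar>u y\<bar> \<partial>lborel)" by (rule integral_abs_bound)
  also have "\<dots> \<le> (\<integral>y. B * indicator (cball x b) y \<partial>lborel)"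
  proof (rule integral_mono)
    show "integrable lborel (\<lambda>y. \<bar>u y\<bar>)" by (intro cs_integrable cs_abs assms)
    show "integrable lborel (\<lambda>y. B * indicator (cball x b) y :: real)"
      using emeasure_lborel_cball_finite[of x b] by (intro integrable_mult_right) (auto intro!: integrable_real_indicator)
    show "\<bar>u y\<bar> \<le> B * indicator (cball x b) y" for y
      using assms(2)[of y] assms(3)[of y] by (auto simp: indicator_def dist_norm norm_minus_commute)
  qed
  also have "\<dots> = B * measure lborel (cball x b)"
    by simp
  finally show ?thesis .
qed

section \<open>Square integrable functions and orthogonal projections\<close>

lemma L2_measurable: "f \<in> L2 \<Longrightarrow> f \<in> borel_measurable lborel"
  by (simp add: L2_def)

lemma cs_L2: "cs u \<Longrightarrow> u \<in> L2"
  using cs_integrable[OF cs_mult[of u u]] cs_measurable[of u] cs_continuous[of u]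
  by (simp add: L2_def power2_eq_square)

lemma L2_mult_integrable:
  assumes f: "f \<in> L2" and g: "g \<in> L2" shows "integrable lborel (\<lambda>x. f x * g x)"
proof (rule Bochner_Integration.integrable_bound)
  show "integrable lborel (\<lambda>x. (f x)\<^sup>2 + (g x)\<^sup>2)" using f g by (simp add: L2_def)
  show "(\<lambda>x. f x * g x) \<in> borel_measurable lborel" using f g by (auto simp: L2_def)
  have "\<bar>a * b\<bar> \<le> a\<^sup>2 + b\<^sup>2" for a b :: real
    using sum_squares_bound[of a b] sum_squares_bound[of "-a" b] zero_le_power2[of a] zero_le_power2[of b]
    unfolding power2_minus abs_le_iff by linarith
  then show "AE x in lborel. norm (f x * g x) \<le> norm ((f x)\<^sup>2 + (g x)\<^sup>2)"
    by (auto intro!: AE_I2)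
qed

lemma L2_combine:
  assumes f: "f \<in> L2" and g: "g \<in> L2" shows "(\<lambda>x. a * f x + g x) \<in> L2"
proof -
  have "integrable lborel (\<lambda>x. a\<^sup>2 * (f x)\<^sup>2 + 2 * a * (f x * g x) + (g x)\<^sup>2)"
    using f g L2_mult_integrable[OF f g] by (simp add: L2_def)
  moreover have "(\<lambda>x. a\<^sup>2 * (f x)\<^sup>2 + 2 * a * (f x * g x) + (g x)\<^sup>2) = (\<lambda>x. (a * f x + g x)\<^sup>2)"
    by (auto simp: power2_eq_square algebra_simps)
  ultimately show ?thesis using f g by (auto simp: L2_def)
qed

lemma L2_diff: "f \<in> L2 \<Longrightarrow> g \<in> L2 \<Longrightarrow> (\<lambda>x. f x - g x) \<in> L2"
  using L2_combine[of g f "-1"] by simp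

lemma L2_zero: "(\<lambda>x. 0) \<in> L2"
  by (simp add: L2_def)

lemma L2_sum: "(\<And>i. i \<in> I \<Longrightarrow> f i \<in> L2) \<Longrightarrow> (\<lambda>x. \<Sum>i\<in>I. c i * f i x) \<in> L2"
  by (induction I rule: infinite_finite_induct) (auto intro!: L2_zero L2_combine)

lemma L2_inner_commute: "L2_inner f g = L2_inner g f"
  by (simp add: L2_inner_def mult.commute)

lemma L2_inner_combine:
  assumes "f \<in> L2" "g \<in> L2" "h \<in> L2"
  shows "L2_inner (\<lambda>x. a * f x + g x) h = a * L2_inner f h + L2_inner g h"
proof -
  have "(\<lambda>x. (a * f x + g x) * h x) = (\<lambda>x. a * (f x * h x) + g x * h x)" by (auto simp: algebra_simps)
  then show ?thesis unfolding L2_inner_def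
    using L2_mult_integrable[OF assms(1,3)] L2_mult_integrable[OF assms(2,3)] by simp
qed

lemma L2_inner_diff:
  assumes "f \<in> L2" "g \<in> L2" "h \<in> L2"
  shows "L2_inner (\<lambda>x. f x - g x) h = L2_inner f h - L2_inner g h"
  using L2_inner_combine[OF assms(2,1,3), of "-1"] by simp

lemma L2_inner_add:
  assumes "f \<in> L2" "g \<in> L2" "h \<in> L2"
  shows "L2_inner (\<lambda>x. f x + g x) h = L2_inner f h + L2_inner g h"
  using L2_inner_combine[OF assms, of 1] by simp

lemma L2_inner_zero [simp]: "L2_inner (\<lambda>x. 0) h = 0" "L2_inner h (\<lambda>x. 0) = 0"
  by (auto simp: L2_inner_def)

lemma L2_inner_sum:
  assumes "\<And>i. i \<in> I \<Longrightarrow> f i \<in> L2" "h \<in> L2"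
  shows "L2_inner (\<lambda>x. \<Sum>i\<in>I. c i * f i x) h = (\<Sum>i\<in>I. c i * L2_inner (f i) h)"
  using assms by (induction I rule: infinite_finite_induct) (auto simp: L2_inner_combine L2_sum)

lemma L2_inner_diff_right:
  assumes "f \<in> L2" "g \<in> L2" "h \<in> L2"
  shows "L2_inner h (\<lambda>x. f x - g x) = L2_inner h f - L2_inner h g"
  using L2_inner_diff[OF assms] by (simp add: L2_inner_commute)

lemma L2_inner_nonneg: "0 \<le> L2_inner f f"
  by (simp add: L2_inner_def)

lemma L2_Cauchy_Schwarz:
  assumes f: "f \<in> L2" and g: "g \<in> L2"
  shows "(L2_inner f g)\<^sup>2 \<le> L2_inner f f * L2_inner g g"
proof -
  have q: "0 \<le> t\<^sup>2 * L2_inner f f + 2 * t * L2_inner f g + L2_inner g g" for t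
  proof -
    have tf: "(\<lambda>x. t * f x + g x) \<in> L2" using f g by (rule L2_combine)
    have "0 \<le> L2_inner (\<lambda>x. t * f x + g x) (\<lambda>x. t * f x + g x)" by (rule L2_inner_nonneg)
    also have "\<dots> = t * L2_inner (\<lambda>x. t * f x + g x) f + L2_inner (\<lambda>x. t * f x + g x) g"
      unfolding L2_inner_combine[OF f g tf, of t]
      by (simp only: L2_inner_commute[of f "\<lambda>x. t * f x + g x"] L2_inner_commute[of g "\<lambda>x. t * f x + g x"])
    also have "\<dots> = t\<^sup>2 * L2_inner f f + 2 * t * L2_inner f g + L2_inner g g"
      using L2_inner_combine[OF f g f, of t] L2_inner_combine[OF f g g, of t] L2_inner_commute[of g f]
      by (simp add: power2_eq_square algebra_simps)
    finally show ?thesis .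
  qed
  define A B C where "A = L2_inner f f" and "B = L2_inner f g" and "C = L2_inner g g"
  have A: "0 \<le> A" unfolding A_def by (rule L2_inner_nonneg)
  have q: "0 \<le> t\<^sup>2 * A + 2 * t * B + C" for t using q unfolding A_def B_def C_def by simp
  show ?thesis
  proof (cases "A = 0")
    case True
    \<comment> \<open>With \<open>A = 0\<close> the quadratic is affine in \<open>t\<close>, and a
      nonconstant affine function takes negative values.\<close>
    have "B = 0"
    proof (rule ccontr)
      assume "B \<noteq> 0"
      then show False using q[of "- (C + 1) / (2 * B)"] True by (simp add: field_simps)
    qed
    then show ?thesis using True by (simp add: A_def B_def)
  next
    case False
    with A have "0 < A" by simp
    then have "0 \<le> A * ((- B / A)\<^sup>2 * A + 2 * (- B / A) * B + C)"
      using q[of "- B / A"] by (intro mult_nonneg_nonneg) auto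
    also have "\<dots> = A * C - B\<^sup>2" using \<open>0 < A\<close> by (simp add: power2_eq_square field_simps)
    finally show ?thesis by (simp add: A_def B_def C_def)
  qed
qed

lemma Lp_norm_2:
  assumes "f \<in> L2" shows "Lp_norm lborel 2 f = ennreal (sqrt (L2_inner f f))"
proof -
  have "(\<integral>\<^sup>+x. enn_powr (ennreal \<bar>f x\<bar>) 2 \<partial>lborel) = (\<integral>\<^sup>+x. ennreal (f x * f x) \<partial>lborel)"
    by (intro nn_integral_cong) (auto simp: enn_powr_def power2_eq_square)
  also have "\<dots> = ennreal (L2_inner f f)"
    unfolding L2_inner_def using L2_mult_integrable[OF assms assms] by (intro nn_integral_eq_integral) auto
  finally show ?thesis
    using L2_inner_nonneg[of f] by (simp add: Lp_norm_def eLp_norm_def enn_powr_def powr_half_sqrt)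
qed

text \<open>\<open>g\<close> is orthogonal to every finite combination \<open>s\<close> of the
  system, so its product with \<open>v\<close> equals that with \<open>v - s\<close>, which
  Cauchy-Schwarz makes arbitrarily small.\<close>

lemma L2_dense_orthogonal:
  assumes g: "g \<in> L2" and v: "v \<in> L2" and e: "\<And>i. i \<in> I \<Longrightarrow> e i \<in> L2" "\<And>i. i \<in> I \<Longrightarrow> L2_inner g (e i) = 0"
    and dense: "\<And>\<epsilon>. \<epsilon> > 0 \<Longrightarrow> \<exists>F c. finite F \<and> F \<subseteq> I \<and>
        Lp_norm lborel 2 (\<lambda>x. v x - (\<Sum>i\<in>F. c i * e i x)) < \<epsilon>"
  shows "L2_inner g v = 0"
proof -
  have "(L2_inner g v)\<^sup>2 \<le> L2_inner g g * \<delta>" if "\<delta> > 0" for \<delta>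
  proof -
    have "ennreal (sqrt \<delta>) > 0" using that by simp
    from dense[OF this] obtain F c where F: "finite F" "F \<subseteq> I"
      and l: "Lp_norm lborel 2 (\<lambda>x. v x - (\<Sum>i\<in>F. c i * e i x)) < ennreal (sqrt \<delta>)" by blast
    define s where "s = (\<lambda>x. \<Sum>i\<in>F. c i * e i x)"
    have s: "s \<in> L2" unfolding s_def using F e by (intro L2_sum) auto
    have vs: "(\<lambda>x. v x - s x) \<in> L2" using v s by (rule L2_diff)
    have "L2_inner s g = (\<Sum>i\<in>F. c i * L2_inner (e i) g)"
      unfolding s_def using F e g by (intro L2_inner_sum) auto
    also have "\<dots> = (\<Sum>i\<in>F. 0)"
      using F e(2) L2_inner_commute[of g] by (intro sum.cong refl) auto
    finally have "L2_inner g s = 0" by (simp add: L2_inner_commute[of g])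
    then have "L2_inner g v = L2_inner g (\<lambda>x. v x - s x)" by (simp add: L2_inner_diff_right v s g)
    then have "(L2_inner g v)\<^sup>2 \<le> L2_inner g g * L2_inner (\<lambda>x. v x - s x) (\<lambda>x. v x - s x)"
      using L2_Cauchy_Schwarz[OF g vs] by simp
    also have "\<dots> \<le> L2_inner g g * \<delta>"
    proof (rule mult_left_mono[OF _ L2_inner_nonneg])
      have "ennreal (sqrt (L2_inner (\<lambda>x. v x - s x) (\<lambda>x. v x - s x))) < ennreal (sqrt \<delta>)"
        using l vs unfolding s_def by (simp add: Lp_norm_2)
      then show "L2_inner (\<lambda>x. v x - s x) (\<lambda>x. v x - s x) \<le> \<delta>"
        using that by (subst (asm) ennreal_less_iff) (auto simp: L2_inner_nonneg)
    qed
    finally show ?thesis .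
  qed note b = this
  have "(L2_inner g v)\<^sup>2 \<le> 0"
  proof (rule field_le_epsilon)
    fix \<epsilon> :: real assume "0 < \<epsilon>"
    have n: "0 \<le> L2_inner g g" by (rule L2_inner_nonneg)
    have "(L2_inner g v)\<^sup>2 \<le> L2_inner g g * (\<epsilon> / (L2_inner g g + 1))"
      using n \<open>0 < \<epsilon>\<close> by (intro b) simp
    also have "\<dots> \<le> \<epsilon>" using n \<open>0 < \<epsilon>\<close> by (simp add: field_simps)
    finally show "(L2_inner g v)\<^sup>2 \<le> 0 + \<epsilon>" by simp
  qed
  then show ?thesis by simp
qed

lemma L2_inner_self_AE:
  assumes "f \<in> L2" "L2_inner f f = 0" shows "AE x in lborel. f x = 0"
  using integral_nonneg_eq_0_iff_AE[of lborel "\<lambda>x. f x * f x"] L2_mult_integrable[OF assms(1,1)] assms(2)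
  by (simp add: L2_inner_def)

text \<open>\<open>L2_proj\<close> is a choice among functions that agree almost everywhere: two
  candidates differ by an element of \<open>V\<close> that is orthogonal to all of \<open>V\<close>,
  hence to itself.\<close>

lemma L2_proj_AE:
  assumes V: "V \<subseteq> L2" "\<And>f g a. f \<in> V \<Longrightarrow> g \<in> V \<Longrightarrow> (\<lambda>x. a * f x + g x) \<in> V"
    and f: "f \<in> L2" and P: "P \<in> V" "\<And>v. v \<in> V \<Longrightarrow> L2_inner (\<lambda>x. f x - P x) v = 0"
  shows "AE x in lborel. L2_proj V f x = P x"
proof -
  define Q where "Q = L2_proj V f"
  have "Q \<in> V \<and> (\<forall>h\<in>V. L2_inner (\<lambda>x. f x - Q x) h = 0)"
    unfolding Q_def L2_proj_def by (rule someI[where x=P]) (use P in auto)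
  then have Q: "Q \<in> V" "\<And>v. v \<in> V \<Longrightarrow> L2_inner (\<lambda>x. f x - Q x) v = 0" by auto
  define D where "D = (\<lambda>x. - 1 * P x + Q x)"
  have D: "D \<in> V" unfolding D_def using P Q by (intro V(2))
  have L: "P \<in> L2" "Q \<in> L2" "D \<in> L2" using P(1) Q(1) D V(1) by auto
  have "L2_inner (\<lambda>x. f x - P x) D = L2_inner f D - L2_inner P D"
    "L2_inner (\<lambda>x. f x - Q x) D = L2_inner f D - L2_inner Q D"
    using L f by (auto intro!: L2_inner_diff)
  moreover have "L2_inner D D = L2_inner Q D - L2_inner P D"
    using L2_inner_combine[OF L(1,2,3), of "-1"] unfolding D_def[symmetric] by simp
  ultimately have "L2_inner D D = 0" using P(2)[OF D] Q(2)[OF D] by simp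
  from L2_inner_self_AE[OF L(3) this] show ?thesis by (simp add: D_def Q_def)
qed

section \<open>Dyadic lattices\<close>

lemma dyadic_lattice_mono: "m \<le> n \<Longrightarrow> dyadic_lattice m \<subseteq> dyadic_lattice n"
proof
  fix x :: "real^'d" assume mn: "m \<le> n" and x: "x \<in> dyadic_lattice m"
  have "2 ^ n * x $ i = of_int (2 ^ (n - m)) * (2 ^ m * x $ i)" for i
    using mn by (simp add: power_add[symmetric] mult.assoc[symmetric])
  moreover have "of_int (2 ^ (n - m)) * (2 ^ m * x $ i) \<in> \<int>" for i
    using x unfolding dyadic_lattice_def mem_Collect_eq by (metis Ints_mult Ints_of_int)
  ultimately have "2 ^ n * x $ i \<in> \<int>" for i by (simp only: )
  then show "x \<in> dyadic_lattice n" unfolding dyadic_lattice_def by blast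
qed

lemma dyadic_lattice_scale:
  "2 ^ m *\<^sub>R x \<in> dyadic_lattice n \<longleftrightarrow> x \<in> dyadic_lattice (m + n)"
proof -
  have "2 ^ n * (2 ^ m *\<^sub>R x) $ i = 2 ^ (m + n) * x $ i" for i by (simp add: power_add)
  then show ?thesis unfolding dyadic_lattice_def mem_Collect_eq by (simp only:)
qed

lemma dyadic_lattice_diff: "x \<in> dyadic_lattice n \<Longrightarrow> y \<in> dyadic_lattice n \<Longrightarrow> x - y \<in> dyadic_lattice n"
  by (auto simp: dyadic_lattice_def right_diff_distrib)

text \<open>Multiplication by \<open>2 ^ n\<close> embeds the points into the integer points of a
  cube of side \<open>2 * (2 ^ n * b)\<close>, and an interval of length l contains at most l + 1
  integers.\<close>

lemma card_dyadic_lattice: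
  fixes y :: "real^'d::finite"
  assumes b: "0 \<le> b"
  shows "finite {x \<in> dyadic_lattice n. norm (x - y) \<le> b}"
    and "real (card {x \<in> dyadic_lattice n. norm (x - y) \<le> b}) \<le> (2 * (2 ^ n * b) + 1) ^ CARD('d)"
proof -
  define S where "S = {x \<in> dyadic_lattice n. norm (x - y) \<le> b}"
  define I where "I i = {\<lceil>2 ^ n * (y $ i - b)\<rceil>..\<lfloor>2 ^ n * (y $ i + b)\<rfloor>}" for i
  define F :: "real^'d \<Rightarrow> 'd \<Rightarrow> int" where "F x = (\<lambda>i. \<lfloor>2 ^ n * x $ i\<rfloor>)" for x
  have fl: "of_int (F x i) = 2 ^ n * x $ i" if "x \<in> S" for x i
    using that by (auto simp: S_def dyadic_lattice_def F_def)
  have inj: "inj_on F S"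
  proof (rule inj_onI)
    fix x x' assume "x \<in> S" "x' \<in> S" "F x = F x'"
    then have "2 ^ n * x $ i = 2 ^ n * x' $ i" for i using fl by metis
    then show "x = x'" by (simp add: vec_eq_iff)
  qed
  have sub: "F ` S \<subseteq> (\<Pi>\<^sub>E i\<in>UNIV. I i)"
  proof (auto simp: PiE_def extensional_def)
    fix x i assume x: "x \<in> S"
    have "\<bar>(x - y) $ i\<bar> \<le> b" using x component_le_norm_cart[of "x - y" i] by (auto simp: S_def)
    then have "2 ^ n * (y $ i - b) \<le> 2 ^ n * x $ i" "2 ^ n * x $ i \<le> 2 ^ n * (y $ i + b)"
      by (auto intro!: mult_left_mono)
    then show "F x i \<in> I i"
      unfolding I_def atLeastAtMost_iff ceiling_le_iff le_floor_iff using fl[OF x, of i] by simp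
  qed
  have fin: "finite (\<Pi>\<^sub>E i\<in>UNIV. I i)" by (intro finite_PiE) (auto simp: I_def)
  show "finite S" using finite_imageD[OF finite_subset[OF sub fin] inj] .
  have "real (card (I i)) \<le> 2 * (2 ^ n * b) + 1" for i
  proof -
    have b0: "0 \<le> 2 ^ n * b" using b by simp
    have "of_int (\<lfloor>2 ^ n * (y $ i + b)\<rfloor> - \<lceil>2 ^ n * (y $ i - b)\<rceil> + 1) \<le> 2 ^ n * (y $ i + b) - 2 ^ n * (y $ i - b) + 1"
      using of_int_floor_le[of "2 ^ n * (y $ i + b)"] le_of_int_ceiling[of "2 ^ n * (y $ i - b)"]
      unfolding of_int_add of_int_diff of_int_1 by linarith
    also have "\<dots> = 2 * (2 ^ n * b) + 1" by (simp add: algebra_simps)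
    finally show ?thesis using b0 by (cases "\<lceil>2 ^ n * (y $ i - b)\<rceil> \<le> \<lfloor>2 ^ n * (y $ i + b)\<rfloor>") (auto simp: I_def)
  qed
  then have "(\<Prod>i\<in>(UNIV::'d set). real (card (I i))) \<le> (\<Prod>i\<in>(UNIV::'d set). 2 * (2 ^ n * b) + 1)"
    by (intro prod_mono) auto
  moreover have "card S \<le> card (\<Pi>\<^sub>E i\<in>UNIV. I i)"
    using card_mono[OF fin sub] card_image[OF inj] by simp
  ultimately show "real (card S) \<le> (2 * (2 ^ n * b) + 1) ^ CARD('d)"
    by (simp add: card_PiE prod_constant flip: of_nat_prod)
qed

section \<open>Wavelet projections as locally finite sums\<close>

text \<open>For \<open>b = R\<close> these are the only lattice points whose wavelets of level
  \<open>n\<close> can be nonzero at \<open>y\<close>.\<close>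

definition near :: "real \<Rightarrow> nat \<Rightarrow> real^'d \<Rightarrow> (real^'d::finite) set" where
  "near b n y = {x \<in> dyadic_lattice n. norm (x - y) \<le> b / 2 ^ n}"

lemma finite_near: "0 \<le> b \<Longrightarrow> finite (near b n y)"
  unfolding near_def by (rule card_dyadic_lattice) simp

lemma near_scale: "0 \<le> b \<Longrightarrow> near b 0 (2 ^ n *\<^sub>R y) = (\<lambda>x. 2 ^ n *\<^sub>R x) ` near b n y"
proof (intro set_eqI iffI)
  fix k assume k: "k \<in> near b 0 (2 ^ n *\<^sub>R y)"
  have "norm (k - 2 ^ n *\<^sub>R y) = 2 ^ n * norm ((1 / 2 ^ n) *\<^sub>R k - y)"
  proof -
    have "k - 2 ^ n *\<^sub>R y = 2 ^ n *\<^sub>R ((1 / 2 ^ n) *\<^sub>R k - y)" by (simp add: scaleR_diff_right)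
    then show ?thesis by simp
  qed
  then have "(1 / 2 ^ n) *\<^sub>R k \<in> near b n y"
    using k dyadic_lattice_scale[of n "(1 / 2 ^ n) *\<^sub>R k" 0] by (simp add: near_def field_simps)
  moreover have "k = 2 ^ n *\<^sub>R ((1 / 2 ^ n) *\<^sub>R k)" by simp
  ultimately show "k \<in> (\<lambda>x. 2 ^ n *\<^sub>R x) ` near b n y" by blast
next
  fix k assume "k \<in> (\<lambda>x. 2 ^ n *\<^sub>R x) ` near b n y"
  then obtain x where x: "x \<in> near b n y" "k = 2 ^ n *\<^sub>R x" by blast
  have "norm (k - 2 ^ n *\<^sub>R y) = 2 ^ n * norm (x - y)"
    by (simp add: x(2) flip: scaleR_diff_right)
  then show "k \<in> near b 0 (2 ^ n *\<^sub>R y)"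
    using x dyadic_lattice_scale[of n x 0] by (simp add: near_def field_simps)
qed

text \<open>Instantiated with the spaces \<open>V n\<close> and the scaling function, and with the spaces \<open>W n\<close> and the
  wavelets.\<close>

locale layer =
  fixes R :: real and G :: "'j set" and \<theta> :: "'j \<Rightarrow> real^'d::finite \<Rightarrow> real"
    and S :: "nat \<Rightarrow> (real^'d \<Rightarrow> real) set"
  assumes R: "R > 0" and finG: "finite G"
    and cs: "\<And>j. j \<in> G \<Longrightarrow> cs (\<theta> j)" and supp: "\<And>j y. j \<in> G \<Longrightarrow> R \<le> norm y \<Longrightarrow> \<theta> j y = 0"
    and S_L2: "\<And>n. S n \<subseteq> L2" and S_combine: "\<And>n f g a. f \<in> S n \<Longrightarrow> g \<in> S n \<Longrightarrow> (\<lambda>x. a * f x + g x) \<in> S n"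
    and S_zero: "\<And>n. (\<lambda>x. 0) \<in> S n"
    and S_scale: "\<And>n f. f \<in> S n \<longleftrightarrow> (\<lambda>x. f ((1 / 2 ^ n) *\<^sub>R x)) \<in> S 0"
    and in_S: "\<And>j k. j \<in> G \<Longrightarrow> k \<in> dyadic_lattice 0 \<Longrightarrow> wav (\<theta> j) 0 k \<in> S 0"
    and orthonormal: "\<And>j k j' k'. j \<in> G \<Longrightarrow> k \<in> dyadic_lattice 0 \<Longrightarrow> j' \<in> G \<Longrightarrow> k' \<in> dyadic_lattice 0 \<Longrightarrow>
        L2_inner (wav (\<theta> j) 0 k) (wav (\<theta> j') 0 k') = (if j = j' \<and> k = k' then 1 else 0)"
    and total: "\<And>g v. g \<in> L2 \<Longrightarrow> v \<in> S 0 \<Longrightarrow>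
        (\<And>j k. j \<in> G \<Longrightarrow> k \<in> dyadic_lattice 0 \<Longrightarrow> L2_inner g (wav (\<theta> j) 0 k) = 0) \<Longrightarrow> L2_inner g v = 0"
begin

text \<open>The orthogonal projection onto \<open>S n\<close> in explicit form. The restriction to
  \<open>near R n y\<close> drops only vanishing terms and makes the sum finite, so that the value
  at every point is defined without passing to classes of functions.\<close>

definition P :: "nat \<Rightarrow> (real^'d \<Rightarrow> real) \<Rightarrow> real^'d \<Rightarrow> real" where
  "P n h = (\<lambda>y. \<Sum>j\<in>G. \<Sum>x\<in>near R n y. 2 ^ (CARD('d) * n) * L2_inner h (wav (\<theta> j) n x) * wav (\<theta> j) n x y)"

lemma wav_zero: "j \<in> G \<Longrightarrow> R / 2 ^ n \<le> norm (y - x) \<Longrightarrow> wav (\<theta> j) n x y = 0"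
  using supp[of j "2 ^ n *\<^sub>R (y - x)"] unfolding wav_def by (simp add: divide_le_eq mult.commute)

lemma wav_zero_near: "j \<in> G \<Longrightarrow> x \<in> dyadic_lattice n \<Longrightarrow> x \<notin> near R n y \<Longrightarrow> wav (\<theta> j) n x y = 0"
  by (rule wav_zero) (auto simp: near_def norm_minus_commute)

text \<open>The index set in \<open>P\<close> moves with \<open>y\<close>. A fixed finite set shows
  \<open>P n h\<close> as one linear combination of wavelets, to which linearity in the function
  space applies.\<close>

lemma P_eq_sum:
  assumes "finite X" "X \<subseteq> dyadic_lattice n"
    and "\<And>j x. j \<in> G \<Longrightarrow> x \<in> dyadic_lattice n \<Longrightarrow> x \<notin> X \<Longrightarrow> L2_inner h (wav (\<theta> j) n x) = 0"
  shows "P n h = (\<lambda>y. \<Sum>j\<in>G. \<Sum>x\<in>X. 2 ^ (CARD('d) * n) * L2_inner h (wav (\<theta> j) n x) * wav (\<theta> j) n x y)"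
proof
  fix y :: "real^'d"
  have f: "finite (near R n y)" using R by (intro finite_near) simp
  show "P n h y = (\<Sum>j\<in>G. \<Sum>x\<in>X. 2 ^ (CARD('d) * n) * L2_inner h (wav (\<theta> j) n x) * wav (\<theta> j) n x y)"
    unfolding P_def
  proof (rule sum.cong[OF refl])
    fix j assume j: "j \<in> G"
    let ?t = "\<lambda>x. 2 ^ (CARD('d) * n) * L2_inner h (wav (\<theta> j) n x) * wav (\<theta> j) n x y"
    have "sum ?t (near R n y) = sum ?t (X \<union> near R n y)"
      using assms f j by (intro sum.mono_neutral_left) (auto simp: wav_zero_near)
    also have "\<dots> = sum ?t X"
      using assms f j by (intro sum.mono_neutral_right) (auto simp: near_def)
    finally show "sum ?t (near R n y) = sum ?t X" .
  qed
qed

lemma inner_zero_far: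
  assumes h: "\<And>y. b < norm y \<Longrightarrow> h y = 0" and j: "j \<in> G" and x: "b + R < norm x"
  shows "L2_inner h (wav (\<theta> j) n x) = 0"
proof -
  have "h y * wav (\<theta> j) n x y = 0" for y
  proof (cases "b < norm y")
    case False
    then have "R \<le> norm (y - x)" using x norm_triangle_ineq2[of x y] by (simp add: norm_minus_commute)
    moreover have "R / 2 ^ n \<le> R" using R by (simp add: divide_le_eq)
    ultimately show ?thesis using wav_zero[OF j, of n y x] by simp
  qed (use h in simp)
  then show ?thesis unfolding L2_inner_def by (simp only: integral_zero)
qed

lemma P_finite:
  assumes h: "cs h"
  obtains X where "finite X" "X \<subseteq> dyadic_lattice n"
    "\<And>j x. j \<in> G \<Longrightarrow> x \<in> dyadic_lattice n \<Longrightarrow> x \<notin> X \<Longrightarrow> L2_inner h (wav (\<theta> j) n x) = 0"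
proof -
  obtain b where b: "\<And>y. b < norm y \<Longrightarrow> h y = 0" using h unfolding cs_def by blast
  let ?X = "{x \<in> dyadic_lattice n. norm (x - (0 :: real^'d)) \<le> \<bar>b\<bar> + R}"
  show ?thesis
  proof (rule that)
    show "finite ?X" using R by (intro card_dyadic_lattice) simp
    fix j and x :: "real^'d" assume "j \<in> G" "x \<in> dyadic_lattice n" "x \<notin> ?X"
    then show "L2_inner h (wav (\<theta> j) n x) = 0"
      using inner_zero_far[where b="\<bar>b\<bar>" and h=h] b by auto
  qed auto
qed

lemma cs_P:
  assumes h: "cs h" shows "cs (P n h)"
proof -
  obtain X where X: "finite X" "X \<subseteq> dyadic_lattice n"
    "\<And>j x. j \<in> G \<Longrightarrow> x \<in> dyadic_lattice n \<Longrightarrow> x \<notin> X \<Longrightarrow> L2_inner h (wav (\<theta> j) n x) = 0"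
    using P_finite[OF h] by metis
  show ?thesis by (subst P_eq_sum[OF X]) (assumption | intro cs_sum cs_cmult cs_wav cs | assumption)+
qed

lemma S_sum: "(\<And>i. i \<in> I \<Longrightarrow> f i \<in> S n) \<Longrightarrow> (\<lambda>x. \<Sum>i\<in>I. c i * f i x) \<in> S n"
  by (induction I rule: infinite_finite_induct) (auto intro!: S_zero S_combine)

lemma S_add: "f \<in> S n \<Longrightarrow> g \<in> S n \<Longrightarrow> (\<lambda>x. f x + g x) \<in> S n"
  using S_combine[of f n g 1] by simp

lemma S_diff: "f \<in> S n \<Longrightarrow> g \<in> S n \<Longrightarrow> (\<lambda>x. f x - g x) \<in> S n"
  using S_combine[of g n f "-1"] by simp

lemma wav_in_S:
  assumes j: "j \<in> G" and x: "x \<in> dyadic_lattice n" shows "wav (\<theta> j) n x \<in> S n"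
proof -
  have "(\<lambda>y. wav (\<theta> j) n x ((1 / 2 ^ n) *\<^sub>R y)) = wav (\<theta> j) 0 (2 ^ n *\<^sub>R x)"
    by (auto simp: wav_def fun_eq_iff scaleR_diff_right)
  moreover have "\<dots> \<in> S 0" using j x by (intro in_S) (auto simp: dyadic_lattice_scale)
  ultimately show ?thesis by (subst S_scale) simp
qed

text \<open>At level 0 the residual is orthogonal to every basis function by orthonormality, hence
  to \<open>S 0\<close> by totality.\<close>

lemma P_0:
  assumes h: "cs h"
  shows "P 0 h \<in> S 0" "v \<in> S 0 \<Longrightarrow> L2_inner (\<lambda>x. h x - P 0 h x) v = 0"
proof -
  obtain X where X: "finite X" "X \<subseteq> dyadic_lattice 0"
    "\<And>j x. j \<in> G \<Longrightarrow> x \<in> dyadic_lattice 0 \<Longrightarrow> x \<notin> X \<Longrightarrow> L2_inner h (wav (\<theta> j) 0 x) = 0"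
    using P_finite[OF h] by metis
  have e: "P 0 h = (\<lambda>y. \<Sum>i\<in>G \<times> X. L2_inner h (wav (\<theta> (fst i)) 0 (snd i)) * wav (\<theta> (fst i)) 0 (snd i) y)"
    by (subst P_eq_sum[OF X]) (assumption | simp add: sum.cartesian_product case_prod_beta)+
  show "P 0 h \<in> S 0" unfolding e using X by (intro S_sum in_S) auto
  assume v: "v \<in> S 0"
  have hL: "h \<in> L2" "P 0 h \<in> L2" using h cs_P[OF h] cs_L2 by auto
  show "L2_inner (\<lambda>x. h x - P 0 h x) v = 0"
  proof (rule total[OF L2_diff[OF hL] v])
    fix j and k :: "real^'d" assume jk: "j \<in> G" "k \<in> dyadic_lattice 0"
    have wL: "wav (\<theta> j) 0 k \<in> L2" if "j \<in> G" for j k using that by (intro cs_L2 cs_wav cs)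
    have "L2_inner (P 0 h) (wav (\<theta> j) 0 k) =
       (\<Sum>i\<in>G \<times> X. L2_inner h (wav (\<theta> (fst i)) 0 (snd i)) * L2_inner (wav (\<theta> (fst i)) 0 (snd i)) (wav (\<theta> j) 0 k))"
      unfolding e by (rule L2_inner_sum) (use jk wL in auto)
    also have "\<dots> = (\<Sum>i\<in>G \<times> X. if i = (j, k) then L2_inner h (wav (\<theta> j) 0 k) else 0)"
    proof (intro sum.cong refl)
      fix i assume "i \<in> G \<times> X"
      then have "fst i \<in> G" "snd i \<in> dyadic_lattice 0" using X(2) by auto
      then show "L2_inner h (wav (\<theta> (fst i)) 0 (snd i)) * L2_inner (wav (\<theta> (fst i)) 0 (snd i)) (wav (\<theta> j) 0 k) =
        (if i = (j, k) then L2_inner h (wav (\<theta> j) 0 k) else 0)"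
        using orthonormal[of "fst i" "snd i" j k] jk by (cases i) auto
    qed
    also have "\<dots> = L2_inner h (wav (\<theta> j) 0 k)"
      using X finG jk by (simp add: sum.delta')
    finally show "L2_inner (\<lambda>x. h x - P 0 h x) (wav (\<theta> j) 0 k) = 0"
      using L2_inner_diff[OF hL wL[OF jk(1)]] by simp
  qed
qed

lemma scale_cs: "cs h \<Longrightarrow> cs (\<lambda>x. h ((1 / 2 ^ n) *\<^sub>R x))"
proof -
  assume h: "cs h"
  obtain b where b: "\<And>y. b < norm y \<Longrightarrow> h y = 0" using h unfolding cs_def by blast
  show ?thesis
  proof (rule csI)
    show "continuous_on UNIV (\<lambda>x. h ((1 / 2 ^ n) *\<^sub>R x))"
      by (rule continuous_on_compose2[OF cs_continuous[OF h]]) (auto intro!: continuous_intros)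
    show "h ((1 / 2 ^ n) *\<^sub>R x) = 0" if "2 ^ n * b < norm x" for x
      using that by (intro b) (simp add: field_simps)
  qed
qed

text \<open>Dilation conjugates level \<open>n\<close> to level 0: the weight
  \<open>2 ^ (CARD('d) * n)\<close> is exactly the Jacobian. Membership in \<open>S n\<close> and
  orthogonality of the residual are obtained from level 0 in this way.\<close>

lemma P_scale:
  assumes h: "cs h"
  shows "P n h ((1 / 2 ^ n) *\<^sub>R y) = P 0 (\<lambda>x. h ((1 / 2 ^ n) *\<^sub>R x)) y"
proof -
  let ?h = "\<lambda>x. h ((1 / 2 ^ n) *\<^sub>R x)"
  let ?y = "(1 / 2 ^ n) *\<^sub>R y"
  have c: "2 ^ (CARD('d) * n) * L2_inner h (wav (\<theta> j) n x) = L2_inner ?h (wav (\<theta> j) 0 (2 ^ n *\<^sub>R x))"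
    if "j \<in> G" for j x
  proof -
    let ?u = "\<lambda>z. ?h z * wav (\<theta> j) 0 (2 ^ n *\<^sub>R x) z"
    have "cs ?u" using scale_cs[OF h] cs_continuous[OF cs_wav[OF cs[OF that]]] by (rule cs_mult)
    then have "(\<integral>z. ?u (2 ^ n *\<^sub>R (z - 0)) \<partial>lborel) = (\<integral>z. ?u z \<partial>lborel) / 2 ^ (CARD('d) * n)"
      using cs_measurable by (intro integral_wav) auto
    moreover have "(\<lambda>z. ?u (2 ^ n *\<^sub>R (z - 0))) = (\<lambda>z. h z * wav (\<theta> j) n x z)"
      by (auto simp: wav_def scaleR_diff_right)
    ultimately show ?thesis unfolding L2_inner_def by simp
  qed
  have nr: "near R 0 y = (\<lambda>x. 2 ^ n *\<^sub>R x) ` near R n ?y"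
    using near_scale[of R n ?y] R by simp
  have "P 0 ?h y = (\<Sum>j\<in>G. \<Sum>x\<in>near R n ?y. L2_inner ?h (wav (\<theta> j) 0 (2 ^ n *\<^sub>R x)) * wav (\<theta> j) 0 (2 ^ n *\<^sub>R x) y)"
    unfolding P_def nr by (subst sum.reindex) (auto simp: inj_on_def)
  also have "\<dots> = P n h ?y"
    unfolding P_def by (intro sum.cong refl) (simp add: c[symmetric], simp add: wav_def scaleR_diff_right)
  finally show ?thesis by simp
qed

lemma P_in_S: assumes h: "cs h" shows "P n h \<in> S n"
  using P_0(1)[OF scale_cs[OF h, of n]] by (subst S_scale) (simp add: P_scale[OF h])

lemma L2_scale: "f \<in> L2 \<Longrightarrow> (\<lambda>x. f ((1 / 2 ^ n) *\<^sub>R x)) \<in> L2"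
proof -
  assume f: "f \<in> L2"
  then have [measurable]: "f \<in> borel_measurable borel" by (simp add: L2_def)
  show ?thesis using f integrable_affine[of "\<lambda>x. (f x)\<^sup>2" "1 / 2 ^ n" 0] by (simp add: L2_def)
qed

lemma L2_inner_scale:
  fixes f g :: "real^'d \<Rightarrow> real"
  assumes "f \<in> L2" "g \<in> L2"
  shows "L2_inner (\<lambda>x. f ((1 / 2 ^ n) *\<^sub>R x)) (\<lambda>x. g ((1 / 2 ^ n) *\<^sub>R x)) = 2 ^ (CARD('d) * n) * L2_inner f g"
proof -
  have "(\<lambda>x. f x * g x) \<in> borel_measurable borel" using L2_measurable[OF assms(1)] L2_measurable[OF assms(2)] by simp
  from integral_affine[OF this, of "1 / 2 ^ n" 0] show ?thesis
    by (simp add: L2_inner_def power_divide power_mult[symmetric] mult.commute)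
qed

lemma P_orth:
  assumes h: "cs h" and v: "v \<in> S n" shows "L2_inner (\<lambda>x. h x - P n h x) v = 0"
proof -
  have L: "(\<lambda>x. h x - P n h x) \<in> L2" "v \<in> L2"
    using h v cs_P[OF h] S_L2 by (auto intro!: L2_diff intro: cs_L2)
  have "(\<lambda>x. v ((1 / 2 ^ n) *\<^sub>R x)) \<in> S 0" using v by (subst (asm) S_scale)
  from P_0(2)[OF scale_cs[OF h, of n] this] L2_inner_scale[OF L, of n] show ?thesis
    by (simp add: P_scale[OF h])
qed

lemma total_n:
  assumes g: "g \<in> L2" and v: "v \<in> S n"
    and o: "\<And>j x. j \<in> G \<Longrightarrow> x \<in> dyadic_lattice n \<Longrightarrow> L2_inner g (wav (\<theta> j) n x) = 0"
  shows "L2_inner g v = 0"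
proof -
  have vL: "v \<in> L2" using v S_L2 by auto
  have "(\<lambda>x. v ((1 / 2 ^ n) *\<^sub>R x)) \<in> S 0" using v by (subst (asm) S_scale)
  then have "L2_inner (\<lambda>x. g ((1 / 2 ^ n) *\<^sub>R x)) (\<lambda>x. v ((1 / 2 ^ n) *\<^sub>R x)) = 0"
  proof (rule total[OF L2_scale[OF g]])
    fix j and k :: "real^'d" assume j: "j \<in> G" and k: "k \<in> dyadic_lattice 0"
    have "(\<lambda>x. wav (\<theta> j) n ((1 / 2 ^ n) *\<^sub>R k) ((1 / 2 ^ n) *\<^sub>R x)) = wav (\<theta> j) 0 k"
      by (auto simp: wav_def scaleR_diff_right)
    then show "L2_inner (\<lambda>x. g ((1 / 2 ^ n) *\<^sub>R x)) (wav (\<theta> j) 0 k) = 0"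
      using L2_inner_scale[OF g cs_L2[OF cs_wav[OF cs[OF j]]], of n n "(1 / 2 ^ n) *\<^sub>R k"]
        o[OF j, of "(1 / 2 ^ n) *\<^sub>R k"] k dyadic_lattice_scale[of n "(1 / 2 ^ n) *\<^sub>R k" 0] by simp
  qed
  then show ?thesis using L2_inner_scale[OF g vL, of n] by simp
qed

lemma proj_AE: "cs h \<Longrightarrow> AE x in lborel. L2_proj (S n) h x = P n h x"
  using S_L2 by (intro L2_proj_AE) (auto intro: S_combine P_in_S P_orth cs_L2)

lemma inner_P:
  assumes h: "cs h" and g: "cs g" shows "L2_inner h (P n g) = L2_inner (P n h) (P n g)"
  using P_orth[OF h P_in_S[OF g], of n] L2_inner_diff[of h "P n h" "P n g"] cs_L2 h cs_P[OF h] cs_P[OF g] by auto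

text \<open>The reproducing kernel: \<open>P n h z\<close> is the inner product of \<open>h\<close>
  with it. It is a finite combination of wavelets, so \<open>f\<close> can be applied to it, and
  identities between projections turn into identities between coefficients of
  \<open>f\<close>.\<close>

definition kern :: "nat \<Rightarrow> real^'d \<Rightarrow> real^'d \<Rightarrow> real" where
  "kern n z = (\<lambda>y. \<Sum>j\<in>G. \<Sum>x\<in>near R n z. (2 ^ (CARD('d) * n) * wav (\<theta> j) n x z) * wav (\<theta> j) n x y)"

lemma cs_kern: "cs (kern n z)"
  unfolding kern_def by (intro cs_sum cs_cmult cs_wav cs)

lemma P_kern:
  assumes h: "h \<in> L2" shows "P n h z = L2_inner (kern n z) h"
proof -
  have w: "wav (\<theta> j) n x \<in> L2" if "j \<in> G" for j x using that by (intro cs_L2 cs_wav cs)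
  have e: "kern n z = (\<lambda>y. \<Sum>j\<in>G. 1 * (\<Sum>x\<in>near R n z. (2 ^ (CARD('d) * n) * wav (\<theta> j) n x z) * wav (\<theta> j) n x y))"
    by (simp add: kern_def)
  have "L2_inner (kern n z) h = (\<Sum>j\<in>G. 1 * L2_inner (\<lambda>y. \<Sum>x\<in>near R n z. (2 ^ (CARD('d) * n) * wav (\<theta> j) n x z) * wav (\<theta> j) n x y) h)"
    unfolding e by (intro L2_inner_sum h L2_sum w)
  also have "\<dots> = (\<Sum>j\<in>G. \<Sum>x\<in>near R n z. (2 ^ (CARD('d) * n) * wav (\<theta> j) n x z) * L2_inner (wav (\<theta> j) n x) h)"
    using w h by (intro sum.cong refl) (simp add: L2_inner_sum)
  also have "\<dots> = P n h z"
    unfolding P_def by (intro sum.cong refl) (simp add: L2_inner_commute[of h])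
  finally show ?thesis ..
qed

end

section \<open>The two layers of a wavelet family\<close>

locale wavelets =
  fixes r :: nat and R :: real and V :: "int \<Rightarrow> (real^'d::finite \<Rightarrow> real) set"
    and \<phi> :: "real^'d \<Rightarrow> real" and \<psi> :: "nat \<Rightarrow> real^'d \<Rightarrow> real"
  assumes family: "wavelet_family r R V \<phi> \<psi>" and R_pos: "R > 0" and r_pos: "r \<ge> 1"
begin

text \<open>Index 0 stands for the scaling function and the positive indices for the wavelets, so
  that both layers are indexed by sets of naturals and share their estimates.\<close>

definition \<theta> :: "nat \<Rightarrow> real^'d \<Rightarrow> real" where
  "\<theta> j = (if j = 0 then \<phi> else \<psi> j)"

abbreviation "W n \<equiv> wavelet_space V n"

lemma mra: "multiresolution_analysis V \<phi>"
  using family by (simp add: wavelet_family_def)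

lemma \<theta>_Cc: "j \<in> {0} \<union> {0<..<2 ^ CARD('d)} \<Longrightarrow> \<theta> j \<in> Cc r UNIV"
  using family by (auto simp: wavelet_family_def \<theta>_def)

lemma \<theta>_supp: "j \<in> {0} \<union> {0<..<2 ^ CARD('d)} \<Longrightarrow> R \<le> norm y \<Longrightarrow> \<theta> j y = 0"
proof -
  assume j: "j \<in> {0} \<union> {0<..<2 ^ CARD('d)}" and y: "R \<le> norm y"
  have "supp (\<theta> j) \<subseteq> ball 0 R" using family j by (auto simp: wavelet_family_def \<theta>_def)
  then have "y \<notin> supp (\<theta> j)" using y by auto
  then show "\<theta> j y = 0" by (rule supp_zero)
qed

lemma V_L2: "V n \<subseteq> L2" and V_zero: "(\<lambda>x. 0) \<in> V n"
  and V_combine: "f \<in> V n \<Longrightarrow> g \<in> V n \<Longrightarrow> (\<lambda>x. a * f x + g x) \<in> V n"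
  and V_closed: "f \<in> L2 \<Longrightarrow> (\<And>\<epsilon>. \<epsilon> > 0 \<Longrightarrow> \<exists>g\<in>V n. Lp_norm lborel 2 (\<lambda>x. f x - g x) < \<epsilon>) \<Longrightarrow> f \<in> V n"
  using mra by (auto simp: multiresolution_analysis_def L2_closed_subspace_def)

lemma V_Suc: "V n \<subseteq> V (n + 1)"
  using mra by (auto simp: multiresolution_analysis_def)

lemma V_mono: "m \<le> n \<Longrightarrow> V m \<subseteq> V n"
proof (induction n rule: int_ge_induct)
  case (step n) then show ?case using V_Suc[of n] by blast
qed simp

lemma V_powi: "f \<in> V n \<longleftrightarrow> (\<lambda>x. f ((2 powi (- n)) *\<^sub>R x)) \<in> V 0"
  using mra unfolding multiresolution_analysis_def by blast

lemma V_scale: "f \<in> V (int n) \<longleftrightarrow> (\<lambda>x. f ((1 / 2 ^ n) *\<^sub>R x)) \<in> V 0"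
  using V_powi[of f "int n"] by (simp add: power_int_minus divide_inverse)

lemma V_shift: "f \<in> V (int m + int n) \<longleftrightarrow> (\<lambda>x. f ((1 / 2 ^ n) *\<^sub>R x)) \<in> V (int m)"
  unfolding of_nat_add[symmetric] V_scale by (simp add: power_add mult.commute)

lemma onb_V: "L2_orthonormal_basis (V 0) (dyadic_lattice 0) (\<lambda>k x. \<phi> (x - k))"
  using mra by (simp add: multiresolution_analysis_def)

lemma onb_W: "L2_orthonormal_basis (W 0) ({0<..<2 ^ CARD('d)} \<times> dyadic_lattice 0) (\<lambda>(i, k) x. \<psi> i (x - k))"
proof -
  have "{0<..<2 ^ CARD('d)} = {1..<2 ^ CARD('d) :: nat}" by auto
  then show ?thesis using family by (simp only: wavelet_family_def)
qed

lemma W_L2: "W n \<subseteq> L2"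
  using V_L2 by (auto simp: wavelet_space_def)

lemma W_combine: "f \<in> W n \<Longrightarrow> g \<in> W n \<Longrightarrow> (\<lambda>x. a * f x + g x) \<in> W n"
proof -
  assume f: "f \<in> W n" and g: "g \<in> W n"
  have "L2_inner (\<lambda>x. a * f x + g x) h = 0" if h: "h \<in> V n" for h
    using L2_inner_combine[of f g h a] f g h W_L2 V_L2 by (auto simp: wavelet_space_def subset_iff)
  then show ?thesis using f g by (auto simp: wavelet_space_def intro: V_combine)
qed

lemma W_zero: "(\<lambda>x. 0) \<in> W n"
  by (simp add: wavelet_space_def V_zero)

end

sublocale wavelets \<subseteq> VL: layer R "{0}" \<theta> "\<lambda>n. V (int n)"
proof
  have w: "wav (\<theta> 0) 0 k = (\<lambda>x. \<phi> (x - k))" for k by (simp add: wav_def \<theta>_def)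
  fix j :: nat and n :: nat and k k' :: "real^'d" and f g v :: "real^'d \<Rightarrow> real" and a :: real
  show "0 < R" by (rule R_pos)
  show "finite {0 :: nat}" by simp
  show "j \<in> {0} \<Longrightarrow> cs (\<theta> j)" using \<theta>_Cc Cc_cs by blast
  show "j \<in> {0} \<Longrightarrow> R \<le> norm k \<Longrightarrow> \<theta> j k = 0" using \<theta>_supp by blast
  show "V (int n) \<subseteq> L2" by (rule V_L2)
  show "f \<in> V (int n) \<Longrightarrow> g \<in> V (int n) \<Longrightarrow> (\<lambda>x. a * f x + g x) \<in> V (int n)" by (rule V_combine)
  show "(\<lambda>x. 0) \<in> V (int n)" by (rule V_zero)
  show "f \<in> V (int n) \<longleftrightarrow> (\<lambda>x. f ((1 / 2 ^ n) *\<^sub>R x)) \<in> V (int 0)" using V_scale by simp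
  show "j \<in> {0} \<Longrightarrow> k \<in> dyadic_lattice 0 \<Longrightarrow> wav (\<theta> j) 0 k \<in> V (int 0)"
    using onb_V by (auto simp: L2_orthonormal_basis_def w)
  fix j' :: nat
  show "j \<in> {0} \<Longrightarrow> k \<in> dyadic_lattice 0 \<Longrightarrow> j' \<in> {0} \<Longrightarrow> k' \<in> dyadic_lattice 0 \<Longrightarrow>
    L2_inner (wav (\<theta> j) 0 k) (wav (\<theta> j') 0 k') = (if j = j' \<and> k = k' then 1 else 0)"
    using onb_V by (auto simp: L2_orthonormal_basis_def w)
  assume g: "g \<in> L2" and v: "v \<in> V (int 0)"
    and o: "\<And>j k. j \<in> {0} \<Longrightarrow> k \<in> dyadic_lattice 0 \<Longrightarrow> L2_inner g (wav (\<theta> j) 0 k) = 0"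
  show "L2_inner g v = 0"
  proof (rule L2_dense_orthogonal[where I="dyadic_lattice 0" and e="\<lambda>k x. \<phi> (x - k)"])
    show "v \<in> L2" using v V_L2 by auto
    show "(\<lambda>x. \<phi> (x - i)) \<in> L2" if "i \<in> dyadic_lattice 0" for i
      using onb_V that V_L2 by (auto simp: L2_orthonormal_basis_def)
  qed (use g v o onb_V in \<open>auto simp: L2_orthonormal_basis_def w\<close>)
qed

sublocale wavelets \<subseteq> WL: layer R "{0<..<2 ^ CARD('d)}" \<theta> "\<lambda>n. wavelet_space V (int n)"
proof
  have w: "wav (\<theta> j) 0 k = (\<lambda>(i, k) x. \<psi> i (x - k)) (j, k)" if "j \<in> {0<..<2 ^ CARD('d)}" for j k
    using that by (auto simp: wav_def \<theta>_def)
  fix j :: nat and n :: nat and k k' :: "real^'d" and f g v :: "real^'d \<Rightarrow> real" and a :: real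
  show "0 < R" by (rule R_pos)
  show "finite {0<..<2 ^ CARD('d) :: nat}" by simp
  show "j \<in> {0<..<2 ^ CARD('d)} \<Longrightarrow> cs (\<theta> j)" using \<theta>_Cc Cc_cs by blast
  show "j \<in> {0<..<2 ^ CARD('d)} \<Longrightarrow> R \<le> norm k \<Longrightarrow> \<theta> j k = 0" using \<theta>_supp by blast
  show "W (int n) \<subseteq> L2" by (rule W_L2)
  show "f \<in> W (int n) \<Longrightarrow> g \<in> W (int n) \<Longrightarrow> (\<lambda>x. a * f x + g x) \<in> W (int n)" by (rule W_combine)
  show "(\<lambda>x. 0) \<in> W (int n)" by (rule W_zero)
  show "f \<in> W (int n) \<longleftrightarrow> (\<lambda>x. f ((1 / 2 ^ n) *\<^sub>R x)) \<in> W (int 0)"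
  proof -
    \<comment> \<open>Dilation maps \<open>V n\<close> onto \<open>V 0\<close> and multiplies inner
      products by a constant; hence it maps the orthogonal complement of \<open>V n\<close> in
      \<open>V (n + 1)\<close> onto that of \<open>V 0\<close> in \<open>V 1\<close>.\<close>
    let ?s = "\<lambda>f x. f ((1 / 2 ^ n) *\<^sub>R x :: real^'d)"
    have 1: "f \<in> V (int n + 1) \<longleftrightarrow> ?s f \<in> V 1" using V_shift[of f 1 n] by (simp add: add.commute)
    have 2: "(\<forall>g\<in>V (int n). L2_inner f g = 0) \<longleftrightarrow> (\<forall>g\<in>V 0. L2_inner (?s f) g = 0)" if f: "f \<in> V (int n + 1)"
    proof -
      have fL: "f \<in> L2" using f V_L2 by auto
      have i: "L2_inner (?s f) (?s g) = 2 ^ (CARD('d) * n) * L2_inner f g" if "g \<in> V (int n)" for g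
        using VL.L2_inner_scale[OF fL, of g n] that V_L2 by auto
      have "?s ` V (int n) = V 0"
      proof (intro set_eqI iffI)
        fix g assume g: "g \<in> V 0"
        then have "(\<lambda>x. g (2 ^ n *\<^sub>R x)) \<in> V (int n)" unfolding V_scale by simp
        then have "?s (\<lambda>x. g (2 ^ n *\<^sub>R x)) \<in> ?s ` V (int n)" by (rule imageI)
        then show "g \<in> ?s ` V (int n)" by simp
      qed (use V_scale in auto)
      then have "(\<forall>g\<in>V 0. L2_inner (?s f) g = 0) \<longleftrightarrow> (\<forall>g\<in>V (int n). L2_inner (?s f) (?s g) = 0)"
        by (simp only: Set.ball_simps(9) flip: \<open>?s ` V (int n) = V 0\<close>)
      then show ?thesis using i by auto
    qed
    show ?thesis using 1 2 unfolding wavelet_space_def by auto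
  qed
  show "j \<in> {0<..<2 ^ CARD('d)} \<Longrightarrow> k \<in> dyadic_lattice 0 \<Longrightarrow> wav (\<theta> j) 0 k \<in> W (int 0)"
  proof -
    assume jk: "j \<in> {0<..<2 ^ CARD('d)}" "k \<in> dyadic_lattice 0"
    then have "(\<lambda>(i, k) x. \<psi> i (x - k)) (j, k) \<in> W 0" using onb_W unfolding L2_orthonormal_basis_def by blast
    then show ?thesis using w[OF jk(1)] by simp
  qed
  fix j' :: nat
  show "j \<in> {0<..<2 ^ CARD('d)} \<Longrightarrow> k \<in> dyadic_lattice 0 \<Longrightarrow> j' \<in> {0<..<2 ^ CARD('d)} \<Longrightarrow> k' \<in> dyadic_lattice 0 \<Longrightarrow>
    L2_inner (wav (\<theta> j) 0 k) (wav (\<theta> j') 0 k') = (if j = j' \<and> k = k' then 1 else 0)"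
  proof -
    assume jk: "j \<in> {0<..<2 ^ CARD('d)}" "k \<in> dyadic_lattice 0" and jk': "j' \<in> {0<..<2 ^ CARD('d)}" "k' \<in> dyadic_lattice 0"
    then have "(j, k) \<in> {0<..<2 ^ CARD('d)} \<times> dyadic_lattice 0" "(j', k') \<in> {0<..<2 ^ CARD('d)} \<times> dyadic_lattice 0" by auto
    then have "L2_inner ((\<lambda>(i, k) x. \<psi> i (x - k)) (j, k)) ((\<lambda>(i, k) x. \<psi> i (x - k)) (j', k')) =
       (if (j, k) = (j', k') then 1 else 0)"
      using onb_W unfolding L2_orthonormal_basis_def by blast
    then show ?thesis using w[OF jk(1)] w[OF jk'(1)] by simp
  qed
  assume g: "g \<in> L2" and v: "v \<in> W (int 0)"
    and o: "\<And>j k. j \<in> {0<..<2 ^ CARD('d)} \<Longrightarrow> k \<in> dyadic_lattice 0 \<Longrightarrow> L2_inner g (wav (\<theta> j) 0 k) = 0"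
  show "L2_inner g v = 0"
  proof (rule L2_dense_orthogonal[where I="{0<..<2 ^ CARD('d)} \<times> dyadic_lattice 0" and e="\<lambda>(i, k) x. \<psi> i (x - k)"])
    show "v \<in> L2" using v W_L2 by auto
    fix i :: "nat \<times> (real^'d)" assume i: "i \<in> {0<..<2 ^ CARD('d)} \<times> (dyadic_lattice 0 :: (real^'d) set)"
    then have "(\<lambda>(i, k) x. \<psi> i (x - k)) i \<in> W 0"
      using onb_W unfolding L2_orthonormal_basis_def by blast
    then show "(\<lambda>(i, k) x. \<psi> i (x - k)) i \<in> L2" using W_L2 by blast
    show "L2_inner g ((\<lambda>(i, k) x. \<psi> i (x - k)) i) = 0"
      using i o[of "fst i" "snd i"] w[of "fst i" "snd i"] by (auto simp: case_prod_beta)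
  next
    fix \<epsilon> :: ennreal assume "0 < \<epsilon>"
    then show "\<exists>F c. finite F \<and> F \<subseteq> {0<..<2 ^ CARD('d)} \<times> dyadic_lattice 0 \<and>
        Lp_norm lborel 2 (\<lambda>x. v x - (\<Sum>i\<in>F. c i * (case i of (i, k) \<Rightarrow> \<lambda>x. \<psi> i (x - k)) x)) < \<epsilon>"
      using onb_W v unfolding L2_orthonormal_basis_def by simp
  qed (rule g)
qed

context wavelets
begin

abbreviation "PV \<equiv> VL.P"
abbreviation "PW \<equiv> WL.P"

lemma V_diff: "f \<in> V n \<Longrightarrow> g \<in> V n \<Longrightarrow> (\<lambda>x. f x - g x) \<in> V n"
  using V_combine[of g n f "-1"] by simp

lemma W_sub_V: "W n \<subseteq> V (n + 1)"
  by (auto simp: wavelet_space_def)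

text \<open>The splitting of \<open>V (n + 1)\<close> into \<open>V n\<close> and its complement, as
  an identity at every point. The difference of the two sides is orthogonal to the basis functions
  of level \<open>n + 1\<close>, and hence to itself, since it lies in
  \<open>V (n + 1)\<close>.\<close>

lemma PV_Suc: 
  assumes h: "cs h" shows "PV (Suc n) h y = PV n h y + PW n h y"
proof -
  define A where "A = (\<lambda>x. PV n h x + PW n h x)"
  define D where "D = (\<lambda>x. PV (Suc n) h x - A x)"
  have csA: "cs A" unfolding A_def using h VL.cs_P WL.cs_P by (intro cs_add) auto
  have csD: "cs D" unfolding D_def using h csA VL.cs_P by (intro cs_diff) auto
  have "PV n h \<in> V (int n + 1)" "PW n h \<in> V (int n + 1)"
    using VL.P_in_S[OF h, of n] WL.P_in_S[OF h, of n] V_Suc W_sub_V by auto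
  then have AV: "A \<in> V (int (Suc n))" unfolding A_def using VL.S_add[of _ "Suc n"] by (simp add: add.commute)
  have DV: "D \<in> V (int (Suc n))" unfolding D_def using AV VL.P_in_S[OF h, of "Suc n"] by (rule VL.S_diff[rotated])
  \<comment> \<open>\<open>A\<close> has the same products with the test functions in
    \<open>V (n + 1)\<close> as \<open>h\<close>: such a function is split into its projection
    \<open>v'\<close> on \<open>V n\<close> and the remainder \<open>v''\<close>, which lies in
    \<open>W n\<close>. The bounded support of \<open>v\<close> gives access to the explicit
    projection.\<close>
  have hA: "L2_inner (\<lambda>x. h x - A x) v = 0" if v: "v \<in> V (int (Suc n))" and csv: "cs v" for v
  proof -
    define v' where "v' = PV n v"
    define v'' where "v'' = (\<lambda>x. v x - v' x)"
    have v': "v' \<in> V (int n)" "cs v'" unfolding v'_def using csv VL.P_in_S VL.cs_P by auto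
    have csv'': "cs v''" unfolding v''_def using csv v' by (intro cs_diff)
    have "v'' \<in> V (int (Suc n))" unfolding v''_def using v v' V_Suc[of "int n"] by (intro V_diff) (auto simp: add.commute)
    then have v'': "v'' \<in> W (int n)"
      using VL.P_orth[OF csv, of _ n] unfolding wavelet_space_def v''_def v'_def by (simp add: add.commute)
    have L: "h \<in> L2" "PV n h \<in> L2" "PW n h \<in> L2" "v' \<in> L2" "v'' \<in> L2" "A \<in> L2" "v \<in> L2"
      using cs_L2[OF h] cs_L2[OF VL.cs_P[OF h, of n]] cs_L2[OF WL.cs_P[OF h, of n]] cs_L2[OF v'(2)]
        cs_L2[OF csv''] cs_L2[OF csA] cs_L2[OF csv] by blast+
    have i1: "L2_inner h v' = L2_inner (PV n h) v'" "L2_inner h v'' = L2_inner (PW n h) v''"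
      using VL.P_orth[OF h v'(1)] WL.P_orth[OF h v''] L by (auto simp: L2_inner_diff)
    have i2: "L2_inner (PW n h) v' = 0" "L2_inner (PV n h) v'' = 0"
      using WL.P_in_S[OF h, of n] v' v'' VL.P_in_S[OF h, of n] L2_inner_commute[of "PV n h" v''] by (auto simp: wavelet_space_def)
    have Av: "L2_inner A u = L2_inner (PV n h) u + L2_inner (PW n h) u" if "u \<in> L2" for u
      unfolding A_def using L that by (intro L2_inner_add)
    have "L2_inner (\<lambda>x. h x - A x) v'' = L2_inner (\<lambda>x. h x - A x) v - L2_inner (\<lambda>x. h x - A x) v'"
      unfolding v''_def by (intro L2_inner_diff_right L2_diff L)
    moreover have "L2_inner (\<lambda>x. h x - A x) v'' = 0" "L2_inner (\<lambda>x. h x - A x) v' = 0"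
      using L i1 i2 Av by (auto simp: L2_inner_diff)
    ultimately show ?thesis by simp
  qed
  have "L2_inner D D = 0"
  proof (rule VL.total_n[OF cs_L2[OF csD] DV])
    fix j and x :: "real^'d" assume j: "j \<in> {0::nat}" and x: "x \<in> dyadic_lattice (Suc n)"
    define v where "v = wav (\<theta> j) (Suc n) x"
    have v: "v \<in> V (int (Suc n))" "cs v" unfolding v_def using VL.wav_in_S[OF j x] VL.cs[OF j] cs_wav by auto
    have L: "h \<in> L2" "PV (Suc n) h \<in> L2" "A \<in> L2" "v \<in> L2" using cs_L2 h VL.cs_P csA v by auto
    have "L2_inner h v = L2_inner A v" "L2_inner h v = L2_inner (PV (Suc n) h) v"
      using hA[OF v] VL.P_orth[OF h v(1)] L by (auto simp: L2_inner_diff)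
    then show "L2_inner D (wav (\<theta> j) (Suc n) x) = 0"
      unfolding D_def v_def[symmetric] using L by (simp add: L2_inner_diff)
  qed
  then have "D y = 0" unfolding L2_inner_def by (rule cs_square_zero[OF csD])
  then show ?thesis by (simp add: D_def A_def)
qed

text \<open>The transpose of \<open>PV_Suc\<close>: applied to the difference \<open>K\<close> of
  the kernels and evaluated at \<open>z\<close>, that lemma says that \<open>K\<close> is orthogonal
  to itself.\<close>

lemma kern_Suc: "VL.kern (Suc n) z y = VL.kern n z y + WL.kern n z y"
proof -
  define K where "K = (\<lambda>y. VL.kern (Suc n) z y - (VL.kern n z y + WL.kern n z y))"
  have K: "cs K" unfolding K_def by (intro cs_diff cs_add VL.cs_kern WL.cs_kern)
  have L: "VL.kern m z \<in> L2" "WL.kern m z \<in> L2" "K \<in> L2" "(\<lambda>y. VL.kern m z y + WL.kern m z y) \<in> L2" for m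
    by (intro cs_L2 VL.cs_kern WL.cs_kern K cs_add)+
  have "L2_inner K K = L2_inner (VL.kern (Suc n) z) K - (L2_inner (VL.kern n z) K + L2_inner (WL.kern n z) K)"
  proof -
    have "L2_inner K K = L2_inner (VL.kern (Suc n) z) K - L2_inner (\<lambda>y. VL.kern n z y + WL.kern n z y) K"
      using L2_inner_diff[OF L(1)[of "Suc n"] L(4)[of n] L(3)] by (simp add: K_def)
    then show ?thesis using L2_inner_add[OF L(1,2,3), of n n] by simp
  qed
  also have "\<dots> = 0"
    using PV_Suc[OF K, of n z] by (simp add: VL.P_kern[OF L(3)] WL.P_kern[OF L(3)])
  finally have "K y = 0" unfolding L2_inner_def by (rule cs_square_zero[OF K])
  then show ?thesis by (simp add: K_def)
qed

text \<open>The projection is the best approximation: as \<open>D = h - PV n h\<close> is orthogonal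
  to \<open>V n\<close>, its product with itself equals its product with \<open>h - g\<close> for
  every \<open>g\<close> in \<open>V n\<close>, and Cauchy-Schwarz compares the two errors.\<close>

lemma PV_tendsto:
  assumes h: "cs h" and \<epsilon>: "\<epsilon> > 0"
  obtains n0 where "\<And>n. n \<ge> n0 \<Longrightarrow> L2_inner (\<lambda>x. h x - PV n h x) (\<lambda>x. h x - PV n h x) < \<epsilon>"
proof -
  have hL: "h \<in> L2" using h by (rule cs_L2)
  have "ennreal (sqrt \<epsilon>) > 0" using \<epsilon> by simp
  then obtain m g where g: "g \<in> V m" "Lp_norm lborel 2 (\<lambda>x. h x - g x) < ennreal (sqrt \<epsilon>)"
    using mra hL unfolding multiresolution_analysis_def by blast
  have gL: "g \<in> L2" using g V_L2 by auto
  define E where "E = (\<lambda>x. h x - g x)"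
  have EL: "E \<in> L2" unfolding E_def using hL gL by (rule L2_diff)
  have E: "L2_inner E E < \<epsilon>"
    using g(2) EL \<epsilon> unfolding E_def[symmetric] by (simp add: Lp_norm_2 ennreal_less_iff L2_inner_nonneg)
  \<comment> \<open>Density provides an integer level \<open>m\<close>, possibly negative; every
    later level contains \<open>V m\<close>, so the natural number \<open>nat m\<close> serves as
    threshold.\<close>
  show ?thesis
  proof (rule that[of "nat m"])
    fix n assume "n \<ge> nat m"
    then have gV: "g \<in> V (int n)" using g(1) V_mono[of m "int n"] nat_le_iff[of m n] by blast
    define D where "D = (\<lambda>x. h x - PV n h x)"
    have PL: "PV n h \<in> L2" using VL.cs_P[OF h] by (rule cs_L2)
    have DL: "D \<in> L2" unfolding D_def using hL PL by (rule L2_diff)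
    have "L2_inner D (\<lambda>x. g x - PV n h x) = 0"
      unfolding D_def using gV VL.P_in_S[OF h, of n] by (intro VL.P_orth[OF h] V_diff)
    then have "L2_inner D g = L2_inner D (PV n h)" using gL PL DL by (simp add: L2_inner_diff_right)
    then have "L2_inner D D = L2_inner D E"
      using L2_inner_diff_right[OF hL PL DL] L2_inner_diff_right[OF hL gL DL] by (simp add: D_def E_def)
    then have "(L2_inner D D)\<^sup>2 \<le> L2_inner D D * L2_inner E E" using L2_Cauchy_Schwarz[OF DL EL] by simp
    then have "L2_inner D D \<le> L2_inner E E"
      using L2_inner_nonneg[of D] L2_inner_nonneg[of E] by (cases "L2_inner D D = 0") (auto simp: power2_eq_square)
    then show "L2_inner (\<lambda>x. h x - PV n h x) (\<lambda>x. h x - PV n h x) < \<epsilon>"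
      using E unfolding D_def by simp
  qed
qed

text \<open>Invariance under integer translations follows from the form of the orthonormal basis:
  finite combinations of the functions \<open>\<phi> (x - k)\<close> are mapped to such
  combinations, and \<open>V 0\<close> is closed.\<close>

lemma V0_translate:
  assumes g: "g \<in> V 0" and k: "k \<in> dyadic_lattice 0" shows "(\<lambda>x. g (x + k)) \<in> V 0"
proof (rule V_closed)
  have gL: "g \<in> L2" using g V_L2 by auto
  have [measurable]: "g \<in> borel_measurable borel" using gL by (simp add: L2_def)
  have tr: "(\<lambda>x. u (x + k)) \<in> L2" if "u \<in> L2" for u :: "real^'d \<Rightarrow> real"
  proof -
    have [measurable]: "u \<in> borel_measurable borel" using that by (simp add: L2_def)
    show ?thesis
      using integrable_affine[of "\<lambda>x. (u x)\<^sup>2" 1 k] that by (simp add: L2_def add.commute)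
  qed
  have inn: "L2_inner (\<lambda>x. u (x + k)) (\<lambda>x. u (x + k)) = L2_inner u u" if "u \<in> L2" for u :: "real^'d \<Rightarrow> real"
  proof -
    have "(\<lambda>x. u x * u x) \<in> borel_measurable borel" using that by (auto simp: L2_def)
    from integral_affine[OF this, of 1 k] show ?thesis by (simp add: L2_inner_def add.commute)
  qed
  show "(\<lambda>x. g (x + k)) \<in> L2" by (rule tr[OF gL])
  fix \<epsilon> :: ennreal assume "0 < \<epsilon>"
  then obtain F c where F: "finite F" "F \<subseteq> dyadic_lattice 0"
    and l: "Lp_norm lborel 2 (\<lambda>x. g x - (\<Sum>i\<in>F. c i * \<phi> (x - i))) < \<epsilon>"
    using onb_V g unfolding L2_orthonormal_basis_def by blast
  define s where "s = (\<lambda>x. \<Sum>i\<in>F. c i * \<phi> (x - i))"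
  have "(\<lambda>x. \<phi> (x - i)) \<in> V 0" if "i \<in> dyadic_lattice 0" for i
    using onb_V that by (auto simp: L2_orthonormal_basis_def)
  then have s: "s \<in> V 0" unfolding s_def using VL.S_sum[of F "\<lambda>i x. \<phi> (x - i)" 0] F by auto
  have "(\<lambda>x. \<Sum>i\<in>F. c i * \<phi> (x - (i - k))) \<in> V 0"
    using VL.S_sum[of F "\<lambda>i x. \<phi> (x - (i - k))" 0 c] F onb_V dyadic_lattice_diff[OF _ k]
    by (auto simp: L2_orthonormal_basis_def)
  then have sk: "(\<lambda>x. s (x + k)) \<in> V 0" by (simp add: s_def algebra_simps)
  have L: "(\<lambda>x. g x - s x) \<in> L2" using s gL V_L2 by (intro L2_diff) auto
  have "Lp_norm lborel 2 (\<lambda>x. g (x + k) - s (x + k)) = Lp_norm lborel 2 (\<lambda>x. g x - s x)"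
    using Lp_norm_2[OF tr[OF L]] Lp_norm_2[OF L] inn[OF L] by simp
  then show "\<exists>h\<in>V 0. Lp_norm lborel 2 (\<lambda>x. g (x + k) - h x) < \<epsilon>"
    using l sk unfolding s_def by (intro bexI[OF _ sk[unfolded s_def]]) simp
qed

text \<open>\<open>\<theta> 0\<close> lies in \<open>V 0\<close> and hence in \<open>V j\<close>.
  Its dilate by \<open>2 ^ j\<close>, and the translate of that dilate by the integer vector
  \<open>2 ^ j *\<^sub>R a\<close>, therefore lie in \<open>V 0\<close>, to which the wavelet is
  orthogonal.\<close>

lemma \<phi>_integral_zero:
  assumes i: "i \<in> {0<..<2 ^ CARD('d)}" and a: "a \<in> dyadic_lattice j"
  shows "(\<integral>y. \<theta> i y * \<theta> 0 (a + (1 / 2 ^ j) *\<^sub>R y) \<partial>lborel) = 0"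
proof -
  have z: "(0 :: real^'d) \<in> dyadic_lattice 0" by (simp add: dyadic_lattice_def)
  have w0: "wav (\<theta> l) 0 0 = \<theta> l" for l by (simp add: wav_def)
  have "\<theta> 0 \<in> V 0" using VL.in_S[OF _ z, of 0] by (simp add: w0)
  then have "\<theta> 0 \<in> V (int j)" using V_mono[of 0 "int j"] by auto
  then have "(\<lambda>x. \<theta> 0 ((1 / 2 ^ j) *\<^sub>R x)) \<in> V 0" by (simp only: V_scale)
  moreover have "2 ^ j *\<^sub>R a \<in> dyadic_lattice 0" using a by (simp add: dyadic_lattice_scale)
  ultimately have "(\<lambda>x. \<theta> 0 ((1 / 2 ^ j) *\<^sub>R (x + 2 ^ j *\<^sub>R a))) \<in> V 0" by (rule V0_translate)
  then have "(\<lambda>x. \<theta> 0 (a + (1 / 2 ^ j) *\<^sub>R x)) \<in> V 0" by (simp add: scaleR_add_right add.commute)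
  moreover have "\<theta> i \<in> W 0" using WL.in_S[OF i z] by (simp add: w0)
  ultimately show ?thesis by (auto simp: wavelet_space_def L2_inner_def)
qed

lemma \<phi>_norm: "(\<integral>y. \<theta> 0 y * \<theta> 0 y \<partial>lborel) = 1"
  using VL.orthonormal[of 0 0 0 0] by (simp add: L2_inner_def wav_def dyadic_lattice_def)

end

section \<open>Vanishing moments\<close>

text \<open>All moments of degree less than \<open>m\<close> vanish; a monomial is built up one
  coordinate factor at a time.\<close>

primrec mom :: "nat \<Rightarrow> (real^'d::finite \<Rightarrow> real) \<Rightarrow> bool" where
  "mom 0 g \<longleftrightarrow> True"
| "mom (Suc m) g \<longleftrightarrow> (\<integral>y. g y \<partial>lborel) = 0 \<and> (\<forall>i. mom m (\<lambda>y. y $ i * g y))"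

text \<open>Unfolded, the sum over all index tuples of length \<open>m\<close> of the moment of
  \<open>g\<close> times the corresponding partial derivative of \<open>f\<close>: the
  \<open>m\<close>-th derivative at \<open>h = 0\<close> of \<open>pint g f a h\<close>.\<close>

primrec dual_op :: "nat \<Rightarrow> (real^'d::finite \<Rightarrow> real) \<Rightarrow> (real^'d \<Rightarrow> real) \<Rightarrow> real^'d \<Rightarrow> real" where
  "dual_op 0 g f = (\<lambda>a. (\<integral>y. g y \<partial>lborel) * f a)"
| "dual_op (Suc m) g f = (\<lambda>a. \<Sum>i\<in>UNIV. dual_op m (\<lambda>y. y $ i * g y) (partial i f) a)"

text \<open>For \<open>h = 1 / 2 ^ n\<close> this is the weighted coefficient of \<open>f\<close>
  against the copy of \<open>g\<close> at level \<open>n\<close> centred at \<open>a\<close>, see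
  \<open>L2_inner_wav_pint\<close>.\<close>

definition pint :: "(real^'d::finite \<Rightarrow> real) \<Rightarrow> (real^'d \<Rightarrow> real) \<Rightarrow> real^'d \<Rightarrow> real \<Rightarrow> real" where
  "pint g f a h = (\<integral>y. g y * f (a + h *\<^sub>R y) \<partial>lborel)"

lemma cs_coord: "cs g \<Longrightarrow> cs (\<lambda>y. y $ i * g y)"
  by (rule cs_mult_left) (auto intro!: continuous_intros)

lemma continuous_integral:
  fixes G :: "real^'d::finite \<Rightarrow> real^'d \<Rightarrow> real"
  assumes c: "continuous_on UNIV (\<lambda>(x, y). G x y)" and z: "\<And>x y. b < norm y \<Longrightarrow> G x y = 0"
  shows "continuous_on UNIV (\<lambda>x. \<integral>y. G x y \<partial>lborel)"
proof -
  obtain a :: "real^'d" where a: "cball 0 b \<subseteq> cbox (-a) a"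
    using bounded_subset_cbox_symmetric[OF bounded_cball] by blast
  then have out: "y \<notin> cbox (-a) a \<Longrightarrow> b < norm y" for y by (force simp: not_le[symmetric])
  have "continuous_on UNIV (G x)" for x
    using continuous_on_compose2[OF c continuous_on_Pair[OF continuous_on_const[of UNIV x] continuous_on_id]] by simp
  then have "(\<integral>y. G x y \<partial>lborel) = integral (cbox (-a) a) (G x)" for x
    using z out by (intro cs_integral_box csI[of _ b]) auto
  moreover have "continuous_on UNIV (\<lambda>x. integral (cbox (-a) a) (G x))"
    using c by (intro integral_continuous_on_param) (auto intro: continuous_on_subset)
  ultimately show ?thesis by simp
qed

text \<open>Differentiation in the scale yields quantities of the same kind, with one more
  coordinate factor in \<open>g\<close> and one more derivative on \<open>f\<close>. This is the
  recursion on which \<open>mom\<close> and \<open>dual_op\<close> are modelled.\<close>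

lemma pint_DERIV:
  fixes f :: "real^'d::finite \<Rightarrow> real"
  assumes g: "cs g" and f: "C_on (Suc 0) UNIV f"
  shows "(pint g f a has_real_derivative (\<Sum>i\<in>UNIV. pint (\<lambda>y. y $ i * g y) (partial i f) a h)) (at h)"
proof -
  obtain b where b: "\<And>y. b < norm y \<Longrightarrow> g y = 0" using g unfolding cs_def by blast
  have cg: "continuous_on UNIV g" using g by (rule cs_continuous)
  have cf: "continuous_on UNIV f" using f by (rule C_on_continuous)
  have cp: "continuous_on UNIV (partial i f)" for i using f by simp
  let ?G' = "\<lambda>t y. \<Sum>i\<in>UNIV. y $ i * g y * partial i f (a + t *\<^sub>R y)"
  have "((\<lambda>t. \<integral>y. g y * f (a + t *\<^sub>R y) \<partial>lborel) has_real_derivative (\<integral>y. ?G' h y \<partial>lborel)) (at h)"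
  proof (rule DERIV_integral[where b=b])
    fix t y
    have fd: "(f has_derivative (\<lambda>h. \<Sum>i\<in>UNIV. h $ i * partial i f (a + t *\<^sub>R y))) (at (a + t *\<^sub>R y))"
      using f by (intro has_derivative_partial) auto
    have "((\<lambda>t::real. a + t *\<^sub>R y) has_derivative (\<lambda>t. t *\<^sub>R y)) (at t)"
      by (auto intro!: derivative_eq_intros)
    from has_derivative_compose[OF this fd]
    have "((\<lambda>t. f (a + t *\<^sub>R y)) has_derivative (*) (\<Sum>i\<in>UNIV. y $ i * partial i f (a + t *\<^sub>R y))) (at t)"
      by (simp add: mult.assoc mult_commute_abs flip: sum_distrib_left)
    then have "((\<lambda>t. f (a + t *\<^sub>R y)) has_real_derivative (\<Sum>i\<in>UNIV. y $ i * partial i f (a + t *\<^sub>R y))) (at t)"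
      by (simp only: has_field_derivative_def)
    from DERIV_cmult[OF this, of "g y"]
    show "((\<lambda>t. g y * f (a + t *\<^sub>R y)) has_real_derivative ?G' t y) (at t)"
      by (simp add: sum_distrib_left mult_ac)
  next
    show "continuous_on UNIV (\<lambda>y. g y * f (a + t *\<^sub>R y))" for t
      by (intro continuous_on_mult cg continuous_on_compose2[OF cf]) (auto intro!: continuous_intros)
    show "continuous_on UNIV (\<lambda>(t, y). ?G' t y)"
      unfolding case_prod_beta
      by (intro continuous_on_sum continuous_on_mult continuous_on_compose2[OF cg] continuous_on_compose2[OF cp])
         (auto intro!: continuous_intros)
  qed (use b in auto)
  moreover have "(\<integral>y. ?G' h y \<partial>lborel) = (\<Sum>i\<in>UNIV. pint (\<lambda>y. y $ i * g y) (partial i f) a h)"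
    unfolding pint_def
    by (intro Bochner_Integration.integral_sum cs_integrable cs_mult cs_coord g continuous_on_compose2[OF cp])
       (auto intro!: continuous_intros)
  moreover have "pint g f a = (\<lambda>t. \<integral>y. g y * f (a + t *\<^sub>R y) \<partial>lborel)" by (auto simp: pint_def)
  ultimately show ?thesis by simp
qed

lemma pint_0: "pint g f a 0 = (\<integral>y. g y \<partial>lborel) * f a"
  by (simp add: pint_def)

text \<open>L'Hopital's rule once per order: \<open>mom\<close> makes the numerator vanish at 0, and
  \<open>pint_DERIV\<close> reduces the order by one. The extra derivative, \<open>Suc m\<close>
  instead of \<open>m\<close>, pays for continuity in \<open>h\<close> at the last stage.\<close>

lemma pint_tendsto:
  fixes f :: "real^'d::finite \<Rightarrow> real"
  assumes "cs g" "C_on (Suc m) UNIV f" "mom m g"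
  shows "((\<lambda>h. pint g f a h / h ^ m) \<longlongrightarrow> dual_op m g f a / fact m) (at_right 0)"
  using assms
proof (induction m arbitrary: g f)
  case 0
  have "isCont (pint g f a) 0" using pint_DERIV[OF 0(1,2)] by (rule DERIV_isCont)
  then have "(pint g f a \<longlongrightarrow> pint g f a 0) (at_right 0)"
    by (auto simp: isCont_def intro: tendsto_within_subset)
  then show ?case by (simp add: pint_0)
next
  case (Suc m)
  have f1: "C_on (Suc 0) UNIV f" using Suc.prems(2) by (rule C_on_le) simp
  let ?Q = "\<lambda>h. \<Sum>i\<in>UNIV. pint (\<lambda>y. y $ i * g y) (partial i f) a h"
  have "((\<lambda>h. \<Sum>i\<in>UNIV. pint (\<lambda>y. y $ i * g y) (partial i f) a h / h ^ m) \<longlongrightarrow>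
      (\<Sum>i\<in>UNIV. dual_op m (\<lambda>y. y $ i * g y) (partial i f) a / fact m)) (at_right 0)"
    by (intro tendsto_sum Suc.IH cs_coord Suc.prems(1)) (use Suc.prems in auto)
  from tendsto_divide[OF this tendsto_const[of "real (Suc m)"]]
  have lim: "((\<lambda>h. ?Q h / (real (Suc m) * h ^ m)) \<longlongrightarrow> dual_op (Suc m) g f a / fact (Suc m)) (at_right 0)"
    by (simp add: sum_divide_distrib[symmetric] divide_divide_eq_left mult.commute)
  show ?case
  proof (rule lhopital_right_0[OF _ _ _ _ _ _ lim])
    have "isCont (pint g f a) 0" using pint_DERIV[OF Suc.prems(1) f1] by (rule DERIV_isCont)
    then have "(pint g f a \<longlongrightarrow> pint g f a 0) (at_right 0)"
      by (auto simp: isCont_def intro: tendsto_within_subset)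
    then show "(pint g f a \<longlongrightarrow> 0) (at_right 0)" using Suc.prems(3) by (simp add: pint_0)
    show "((\<lambda>h::real. h ^ Suc m) \<longlongrightarrow> 0) (at_right 0)" by (auto intro!: tendsto_eq_intros)
    have pos: "\<forall>\<^sub>F x::real in at_right 0. x > 0" by (rule eventually_at_right_less)
    show "\<forall>\<^sub>F x::real in at_right 0. x ^ Suc m \<noteq> 0"
      using pos by eventually_elim simp
    show "\<forall>\<^sub>F x in at_right 0. real (Suc m) * x ^ m \<noteq> 0"
      using pos by eventually_elim simp
    show "\<forall>\<^sub>F x in at_right 0. (pint g f a has_real_derivative ?Q x) (at x)"
      using pint_DERIV[OF Suc.prems(1) f1] by (intro always_eventually) auto
    show "\<forall>\<^sub>F x in at_right 0. ((\<lambda>h. h ^ Suc m) has_real_derivative real (Suc m) * x ^ m) (at x)"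
      using DERIV_pow[of "Suc m"] by (intro always_eventually allI) (simp del: of_nat_Suc power_Suc)
  qed
qed

lemma cs_dual_op: "cs f \<Longrightarrow> C_on m UNIV f \<Longrightarrow> cs (dual_op m g f)"
proof (induction m arbitrary: f g)
  case 0 then show ?case by (auto intro: cs_cmult)
next
  case (Suc m)
  have "cs (partial i f)" for i using Suc.prems by (rule cs_partial)
  then show ?case using Suc unfolding dual_op.simps by (intro cs_sum Suc.IH) auto
qed

lemma C_on_exp: "C_on (Suc 0) UNIV (\<lambda>x. exp (- (\<xi> \<bullet> x)))"
  and partial_exp: "partial i (\<lambda>x. exp (- (\<xi> \<bullet> x))) = (\<lambda>x. - (\<xi> $ i) * exp (- (\<xi> \<bullet> x)))"
  for \<xi> :: "real^'d::finite"
proof -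
  have d: "((\<lambda>x. exp (- (\<xi> \<bullet> x))) has_derivative (\<lambda>h. exp (- (\<xi> \<bullet> x)) * (- (\<xi> \<bullet> h)))) (at x)" for x
    by (auto intro!: derivative_eq_intros simp: mult.commute)
  show p: "partial i (\<lambda>x. exp (- (\<xi> \<bullet> x))) = (\<lambda>x. - (\<xi> $ i) * exp (- (\<xi> \<bullet> x)))" for i
    using partial_eq[OF d] by (auto simp: inner_axis)
  show "C_on (Suc 0) UNIV (\<lambda>x. exp (- (\<xi> \<bullet> x)))"
    using d by (auto simp: p differentiable_def intro!: continuous_intros)
qed

text \<open>Integration by parts turns each derivative of \<open>f\<close> into a factor
  \<open>\<xi> $ i\<close>, so the operator becomes multiplication by its symbol, a homogeneous
  polynomial of degree \<open>m\<close> in \<open>\<xi>\<close>. Bounded supports permit real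
  exponentials.\<close>

lemma integral_exp_dual_op:
  fixes f :: "real^'d::finite \<Rightarrow> real"
  assumes "cs g" "cs f" "C_on m UNIV f"
  shows "(\<integral>a. dual_op m g f a * exp (- (\<xi> \<bullet> a)) \<partial>lborel) =
    (\<integral>y. g y * (\<xi> \<bullet> y) ^ m \<partial>lborel) * (\<integral>a. f a * exp (- (\<xi> \<bullet> a)) \<partial>lborel)"
  using assms
proof (induction m arbitrary: g f)
  case 0
  then show ?case by (simp add: mult.assoc)
next
  case (Suc m)
  have ce: "continuous_on UNIV (\<lambda>x. exp (- (\<xi> \<bullet> x)))" by (intro continuous_intros)
  have csp: "cs (partial i f)" for i using Suc.prems(2,3) by (rule cs_partial)
  have Cp: "C_on m UNIV (partial i f)" for i using Suc.prems(3) by simp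
  have f1: "C_on (Suc 0) UNIV f" using Suc.prems(3) by (rule C_on_le) simp
  have ibp: "(\<integral>a. partial i f a * exp (- (\<xi> \<bullet> a)) \<partial>lborel) = \<xi> $ i * (\<integral>a. f a * exp (- (\<xi> \<bullet> a)) \<partial>lborel)" for i
    unfolding integral_by_parts_partial[OF Suc.prems(2) f1 C_on_exp] partial_exp
    by (simp add: mult.left_commute flip: integral_mult_right_zero)
  have "(\<integral>a. dual_op (Suc m) g f a * exp (- (\<xi> \<bullet> a)) \<partial>lborel) =
      (\<integral>a. (\<Sum>i\<in>UNIV. dual_op m (\<lambda>y. y $ i * g y) (partial i f) a * exp (- (\<xi> \<bullet> a))) \<partial>lborel)"
    by (simp add: sum_distrib_right)
  also have "\<dots> = (\<Sum>i\<in>UNIV. \<integral>a. dual_op m (\<lambda>y. y $ i * g y) (partial i f) a * exp (- (\<xi> \<bullet> a)) \<partial>lborel)"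
    by (intro Bochner_Integration.integral_sum cs_integrable cs_mult cs_dual_op csp Cp ce)
  also have "\<dots> = (\<Sum>i\<in>UNIV. (\<integral>y. y $ i * g y * (\<xi> \<bullet> y) ^ m \<partial>lborel) * (\<xi> $ i * (\<integral>a. f a * exp (- (\<xi> \<bullet> a)) \<partial>lborel)))"
    by (intro sum.cong refl) (simp only: Suc.IH[OF cs_coord[OF Suc.prems(1)] csp Cp] ibp)
  also have "\<dots> = (\<Sum>i\<in>UNIV. \<integral>y. \<xi> $ i * (y $ i * g y * (\<xi> \<bullet> y) ^ m) \<partial>lborel) * (\<integral>a. f a * exp (- (\<xi> \<bullet> a)) \<partial>lborel)"
    unfolding integral_mult_right_zero sum_distrib_right by (intro sum.cong refl) simp
  also have "(\<Sum>i\<in>UNIV. \<integral>y. \<xi> $ i * (y $ i * g y * (\<xi> \<bullet> y) ^ m) \<partial>lborel) =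
     (\<integral>y. (\<Sum>i\<in>UNIV. \<xi> $ i * (y $ i * g y * (\<xi> \<bullet> y) ^ m)) \<partial>lborel)"
    by (intro Bochner_Integration.integral_sum[symmetric] cs_integrable cs_cmult cs_mult cs_coord Suc.prems(1))
       (auto intro!: continuous_intros)
  also have "(\<lambda>y. \<Sum>i\<in>UNIV. \<xi> $ i * (y $ i * g y * (\<xi> \<bullet> y) ^ m)) = (\<lambda>y. g y * (\<xi> \<bullet> y) ^ Suc m)"
    by (auto simp: inner_vec_def sum_distrib_left sum_distrib_right mult_ac)
  finally show ?case .
qed

section \<open>Injectivity of the Laplace transform\<close>

inductive exp_span :: "(real^'d::finite) set \<Rightarrow> (real^'d \<Rightarrow> real) \<Rightarrow> bool" for C where
  base: "\<xi> \<in> C \<Longrightarrow> exp_span C (\<lambda>x. c * exp (- (\<xi> \<bullet> x)))"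
| add: "exp_span C u \<Longrightarrow> exp_span C v \<Longrightarrow> exp_span C (\<lambda>x. u x + v x)"

lemma exp_span_continuous: "exp_span C u \<Longrightarrow> continuous_on UNIV u"
  by (induction rule: exp_span.induct) (auto intro!: continuous_intros)

lemma exp_span_mult:
  assumes C: "\<And>\<xi> \<eta>. \<xi> \<in> C \<Longrightarrow> \<eta> \<in> C \<Longrightarrow> \<xi> + \<eta> \<in> C" and u: "exp_span C u" and v: "exp_span C v"
  shows "exp_span C (\<lambda>x. u x * v x)"
  using u
proof (induction rule: exp_span.induct)
  case (base \<xi> c)
  from v show ?case
  proof (induction rule: exp_span.induct)
    case (base \<eta> c')
    from exp_span.base[OF C[OF \<open>\<xi> \<in> C\<close> base], of "c * c'"] show ?case
      by (simp add: inner_add_left exp_add exp_minus exp_diff field_simps)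
  next
    case (add u v)
    from exp_span.add[OF add(3,4)] show ?case by (simp add: distrib_left)
  qed
next
  case (add u v)
  from exp_span.add[OF add(3,4)] show ?case by (simp add: distrib_right)
qed

text \<open>A compactly supported function is determined by the restriction of its Laplace transform to
  an open cone, because the exponentials with exponents in that cone span an algebra.\<close>

lemma Laplace_unique:
  fixes f :: "real^'d::finite \<Rightarrow> real"
  assumes f: "cs f" and \<delta>: "\<delta> > 0"
    and L: "\<And>t \<xi>. t > 0 \<Longrightarrow> \<xi> \<in> ball \<xi>0 \<delta> \<Longrightarrow> (\<integral>a. f a * exp (- ((t *\<^sub>R \<xi>) \<bullet> a)) \<partial>lborel) = 0"
  shows "f x = 0"
proof -
  obtain b where b: "\<And>y. b < norm y \<Longrightarrow> f y = 0" using f unfolding cs_def by blast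
  \<comment> \<open>The cone over the ball is closed under addition by convexity; 0 is added so that
    the span contains the constants.\<close>
  define C where "C = insert 0 {t *\<^sub>R \<xi> | t \<xi>. t > 0 \<and> \<xi> \<in> ball \<xi>0 \<delta>}"
  have Cadd: "\<xi> + \<eta> \<in> C" if "\<xi> \<in> C" "\<eta> \<in> C" for \<xi> \<eta>
  proof (cases "\<xi> = 0 \<or> \<eta> = 0")
    case False
    then obtain s t \<xi>' \<eta>' where e: "\<xi> = s *\<^sub>R \<xi>'" "\<eta> = t *\<^sub>R \<eta>'" "s > 0" "t > 0" "\<xi>' \<in> ball \<xi>0 \<delta>" "\<eta>' \<in> ball \<xi>0 \<delta>"
      using \<open>\<xi> \<in> C\<close> \<open>\<eta> \<in> C\<close> unfolding C_def by auto
    have "(s / (s + t)) *\<^sub>R \<xi>' + (t / (s + t)) *\<^sub>R \<eta>' \<in> ball \<xi>0 \<delta>"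
      using e by (intro convexD[OF convex_ball]) (auto simp: add_divide_distrib[symmetric])
    moreover have "\<xi> + \<eta> = (s + t) *\<^sub>R ((s / (s + t)) *\<^sub>R \<xi>' + (t / (s + t)) *\<^sub>R \<eta>')"
      using e by (simp add: scaleR_add_right)
    ultimately show ?thesis unfolding C_def using e(3,4) by (auto intro!: exI[of _ "s + t"])
  qed (use that in auto)
  define Lf where "Lf \<xi> = (\<integral>a. f a * exp (- (\<xi> \<bullet> a)) \<partial>lborel)" for \<xi>
  have contL: "continuous_on UNIV Lf"
    unfolding Lf_def
  proof (rule continuous_integral[where b=b])
    show "continuous_on UNIV (\<lambda>(\<xi>, a). f a * exp (- (\<xi> \<bullet> a)))"
      unfolding case_prod_beta
      by (intro continuous_on_mult continuous_on_compose2[OF cs_continuous[OF f]]) (auto intro!: continuous_intros)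
  qed (use b in auto)
  \<comment> \<open>The exponent 0 is a limit of points of the cone, so the hypothesis reaches it by
    continuity.\<close>
  have L0: "Lf 0 = 0"
  proof -
    have "continuous_on UNIV (\<lambda>t::real. Lf (t *\<^sub>R \<xi>0))"
      by (rule continuous_on_compose2[OF contL]) (auto intro!: continuous_intros)
    then have "(\<lambda>t. Lf (t *\<^sub>R \<xi>0)) \<midarrow>0\<rightarrow> Lf (0 *\<^sub>R \<xi>0)"
      unfolding continuous_on_def by blast
    then have "((\<lambda>t. Lf (t *\<^sub>R \<xi>0)) \<longlongrightarrow> Lf 0) (at_right 0)"
      by (auto intro: tendsto_within_subset)
    moreover have "\<forall>\<^sub>F t in at_right 0. Lf (t *\<^sub>R \<xi>0) = 0"
      using L \<delta> unfolding Lf_def by (auto simp: eventually_at_right intro!: exI[of _ 1])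
    ultimately have "((\<lambda>t. 0) \<longlongrightarrow> Lf 0) (at_right (0::real))" by (rule Lim_transform_eventually)
    then show ?thesis by (simp add: tendsto_const_iff)
  qed
  have LC: "Lf \<xi> = 0" if "\<xi> \<in> C" for \<xi>
    using that L L0 unfolding C_def Lf_def by auto
  have orth: "(\<integral>a. f a * u a \<partial>lborel) = 0" if "exp_span C u" for u
    using that
  proof (induction rule: exp_span.induct)
    case (base \<xi> c)
    have "(\<lambda>a. f a * (c * exp (- (\<xi> \<bullet> a)))) = (\<lambda>a. c * (f a * exp (- (\<xi> \<bullet> a))))" by auto
    then show ?case using LC[OF base] by (simp add: Lf_def)
  next
    case (add u v)
    then show ?case using f exp_span_continuous[of C]
      by (simp add: distrib_left cs_integrable cs_mult)
  qed
  have sep: "\<exists>u. exp_span C u \<and> u x \<noteq> u y" if "x \<noteq> y" for x y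
  proof -
    have "\<exists>\<xi>\<in>C. \<xi> \<bullet> x \<noteq> \<xi> \<bullet> y"
    proof (cases "\<xi>0 \<bullet> x = \<xi>0 \<bullet> y")
      case True
      \<comment> \<open>If \<open>\<xi>0\<close> does not separate \<open>x\<close> from
        \<open>y\<close>, a shift of length \<open>\<delta> / 2\<close> in the direction
        \<open>x - y\<close> does, and it stays in the ball.\<close>
      define s where "s = \<delta> / (2 * norm (x - y))"
      have s: "s > 0" using \<delta> that by (simp add: s_def)
      let ?\<xi> = "\<xi>0 + s *\<^sub>R (x - y)"
      have "norm (s *\<^sub>R (x - y)) < \<delta>" using \<delta> that s by (simp add: s_def)
      then have "?\<xi> \<in> ball \<xi>0 \<delta>" by (simp add: dist_norm)
      then have "1 *\<^sub>R ?\<xi> \<in> C" unfolding C_def using zero_less_one by blast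
      moreover have "?\<xi> \<bullet> x - ?\<xi> \<bullet> y = s * ((x - y) \<bullet> (x - y))"
        using True by (simp add: inner_add_left inner_diff_left inner_diff_right algebra_simps)
      moreover have "s * ((x - y) \<bullet> (x - y)) \<noteq> 0" using s that by simp
      ultimately show ?thesis by (intro bexI[of _ "1 *\<^sub>R ?\<xi>"]) auto
    next
      case False
      have "1 *\<^sub>R \<xi>0 \<in> C" unfolding C_def using \<delta> zero_less_one centre_in_ball by blast
      with False show ?thesis by (intro bexI[of _ "1 *\<^sub>R \<xi>0"]) auto
    qed
    then obtain \<xi> where "\<xi> \<in> C" "\<xi> \<bullet> x \<noteq> \<xi> \<bullet> y" by blast
    with exp_span.base[of \<xi> C 1] show ?thesis by (intro exI[of _ "\<lambda>x. 1 * exp (- (\<xi> \<bullet> x))"]) auto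
  qed
  have csff: "cs (\<lambda>a. f a * f a)" by (intro cs_mult f cs_continuous)
  \<comment> \<open>\<open>f\<close> is orthogonal to the span and uniformly approximable by it on
    its support, so the integral of its square is at most the approximation error times the integral
    of its modulus.\<close>
  have "(\<integral>a. f a * f a \<partial>lborel) \<le> 0"
  proof (rule field_le_epsilon)
    fix e :: real assume e: "0 < e"
    define I where "I = (\<integral>a. \<bar>f a\<bar> \<partial>lborel)"
    have I: "0 \<le> I" by (simp add: I_def)
    have "\<exists>u. exp_span C u \<and> (\<forall>y\<in>cball 0 b. \<bar>f y - u y\<bar> < e / (I + 1))"
    proof (rule Stone_Weierstrass_HOL)
      show "exp_span C (\<lambda>x. c)" for c using exp_span.base[of 0 C c] by (simp add: C_def)
      show "exp_span C u \<Longrightarrow> continuous_on (cball 0 b) u" for u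
        using exp_span_continuous continuous_on_subset by blast
      show "continuous_on (cball 0 b) f" using cs_continuous[OF f] continuous_on_subset by blast
      show "exp_span C u \<and> exp_span C v \<Longrightarrow> exp_span C (\<lambda>x. u x * v x)" for u v
        using exp_span_mult[of C u v] Cadd by blast
    qed (use sep e I in \<open>auto intro: exp_span.add\<close>)
    then obtain u where u: "exp_span C u" "\<And>y. y \<in> cball 0 b \<Longrightarrow> \<bar>f y - u y\<bar> < e / (I + 1)" by blast
    have cu: "continuous_on UNIV u" using u(1) by (rule exp_span_continuous)
    have csfu: "cs (\<lambda>a. f a * u a)" using f cu by (rule cs_mult)
    have "(\<integral>a. f a * f a \<partial>lborel) = (\<integral>a. f a * f a - f a * u a \<partial>lborel)"
      using orth[OF u(1)] cs_integrable[OF csff] cs_integrable[OF csfu] by simp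
    also have "\<dots> \<le> (\<integral>a. e / (I + 1) * \<bar>f a\<bar> \<partial>lborel)"
    proof (rule integral_mono)
      show "integrable lborel (\<lambda>a. f a * f a - f a * u a)" by (intro cs_integrable cs_diff csff csfu)
      show "integrable lborel (\<lambda>a. e / (I + 1) * \<bar>f a\<bar>)" by (intro cs_integrable cs_cmult cs_abs f)
      show "f a * f a - f a * u a \<le> e / (I + 1) * \<bar>f a\<bar>" for a
      proof (cases "b < norm a")
        case False
        then have "\<bar>f a - u a\<bar> \<le> e / (I + 1)" using u(2)[of a] by auto
        have "f a * f a - f a * u a \<le> \<bar>(f a - u a) * f a\<bar>" by (simp add: algebra_simps)
        also have "\<dots> \<le> e / (I + 1) * \<bar>f a\<bar>" unfolding abs_mult
          by (rule mult_right_mono) (use \<open>\<bar>f a - u a\<bar> \<le> e / (I + 1)\<close> in auto)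
        finally show ?thesis .
      qed (simp add: b)
    qed
    also have "\<dots> = e / (I + 1) * I" by (simp add: I_def)
    also have "\<dots> \<le> e" using e I by (simp add: field_simps)
    finally show "(\<integral>a. f a * f a \<partial>lborel) \<le> 0 + e" by simp
  qed
  moreover have "0 \<le> (\<integral>a. f a * f a \<partial>lborel)" by simp
  ultimately show ?thesis by (intro cs_square_zero[OF f]) linarith
qed

text \<open>Polarisation: differentiating the vanishing polynomial with respect to
  \<open>\<xi> $ i\<close> gives the hypothesis of one degree less for
  \<open>y $ i * g y\<close>.\<close>

lemma mom_polarize:
  fixes g :: "real^'d::finite \<Rightarrow> real"
  assumes "cs g" "mom m g" "\<And>\<xi>. (\<integral>y. g y * (\<xi> \<bullet> y) ^ m \<partial>lborel) = 0"
  shows "mom (Suc m) g"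
  using assms
proof (induction m arbitrary: g)
  case (Suc m)
  obtain b where b: "\<And>y. b < norm y \<Longrightarrow> g y = 0" using Suc.prems(1) unfolding cs_def by blast
  have cg: "continuous_on UNIV g" using Suc.prems(1) by (rule cs_continuous)
  have "(\<integral>y. y $ i * g y * (\<xi> \<bullet> y) ^ m \<partial>lborel) = 0" for i \<xi>
  proof -
    let ?\<xi> = "\<lambda>t. \<xi> + t *\<^sub>R axis i 1"
    let ?G' = "\<lambda>t y. g y * (real (Suc m) * (?\<xi> t \<bullet> y) ^ m * y $ i)"
    have "((\<lambda>t. \<integral>y. g y * (?\<xi> t \<bullet> y) ^ Suc m \<partial>lborel) has_real_derivative (\<integral>y. ?G' 0 y \<partial>lborel)) (at 0)"
    proof (rule DERIV_integral[where b=b])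
      fix t y
      show "((\<lambda>t. g y * (?\<xi> t \<bullet> y) ^ Suc m) has_real_derivative ?G' t y) (at t)"
        unfolding inner_add_left inner_scaleR_left
        by (auto intro!: derivative_eq_intros simp: inner_axis' simp del: of_nat_Suc power_Suc)
    next
      show "continuous_on UNIV (\<lambda>y. g y * (?\<xi> t \<bullet> y) ^ Suc m)" for t
        by (intro continuous_on_mult cg) (auto intro!: continuous_intros)
      show "continuous_on UNIV (\<lambda>(t, y). ?G' t y)"
        unfolding case_prod_beta
        by (intro continuous_on_mult continuous_on_compose2[OF cg]) (auto intro!: continuous_intros)
    qed (use b in auto)
    then have "((\<lambda>t. 0) has_real_derivative (\<integral>y. ?G' 0 y \<partial>lborel)) (at (0::real))"
      by (simp only: Suc.prems(3))
    then have "(\<integral>y. ?G' 0 y \<partial>lborel) = 0" using DERIV_unique[OF _ DERIV_const] by blast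
    moreover have "(\<lambda>y. ?G' 0 y) = (\<lambda>y. real (Suc m) * (y $ i * g y * (\<xi> \<bullet> y) ^ m))" by auto
    ultimately show ?thesis by (simp del: of_nat_Suc)
  qed
  then have "mom (Suc m) (\<lambda>y. y $ i * g y)" for i
    using Suc.prems(2) by (intro Suc.IH cs_coord Suc.prems(1)) auto
  then show ?case using Suc.prems(2) by (subst mom.simps) (simp only: mom.simps, blast)
qed simp

lemma dyadic_dense:
  fixes u :: "real^'d::finite \<Rightarrow> real"
  assumes u: "continuous_on UNIV u" and z: "\<And>n a. a \<in> dyadic_lattice n \<Longrightarrow> u a = 0"
  shows "u a = 0"
proof -
  define s :: "nat \<Rightarrow> real^'d" where "s n = (\<chi> i. of_int \<lfloor>2 ^ n * a $ i\<rfloor> / 2 ^ n)" for n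
  have "s n \<in> dyadic_lattice n" for n by (simp add: s_def dyadic_lattice_def)
  then have us: "u (s n) = 0" for n by (rule z)
  have "(\<lambda>n. of_int \<lfloor>2 ^ n * x\<rfloor> / 2 ^ n) \<longlonglongrightarrow> x" for x :: real
  proof (rule tendsto_sandwich[where f="\<lambda>n. x - 1 / 2 ^ n" and h="\<lambda>n. x"])
    show "\<forall>\<^sub>F n in sequentially. x - 1 / 2 ^ n \<le> of_int \<lfloor>2 ^ n * x\<rfloor> / 2 ^ n"
    proof (intro always_eventually allI)
      fix n :: nat
      have "2 ^ n * x - 1 \<le> of_int \<lfloor>2 ^ n * x\<rfloor>" by linarith
      then have "(2 ^ n * x - 1) / 2 ^ n \<le> of_int \<lfloor>2 ^ n * x\<rfloor> / 2 ^ n" by (intro divide_right_mono) auto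
      then show "x - 1 / 2 ^ n \<le> of_int \<lfloor>2 ^ n * x\<rfloor> / 2 ^ n" by (simp add: diff_divide_distrib)
    qed
    show "\<forall>\<^sub>F n in sequentially. of_int \<lfloor>2 ^ n * x\<rfloor> / 2 ^ n \<le> x"
    proof (intro always_eventually allI)
      fix n :: nat
      have "of_int \<lfloor>2 ^ n * x\<rfloor> / 2 ^ n \<le> (2 ^ n * x) / 2 ^ n" by (intro divide_right_mono) auto
      then show "of_int \<lfloor>2 ^ n * x\<rfloor> / 2 ^ n \<le> x" by simp
    qed
    have "(\<lambda>n. x - (1/2) ^ n) \<longlonglongrightarrow> x - 0" by (intro tendsto_diff tendsto_const LIMSEQ_power_zero) auto
    then show "(\<lambda>n. x - 1 / 2 ^ n) \<longlonglongrightarrow> x" by (simp add: power_one_over)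
  qed auto
  then have "s \<longlonglongrightarrow> (\<chi> i. a $ i)" unfolding s_def by (intro tendsto_vec_lambda) blast
  then have "s \<longlonglongrightarrow> a" by simp
  moreover have "isCont u a" using u by (simp add: continuous_on_eq_continuous_at)
  ultimately have "(\<lambda>n. u (s n)) \<longlonglongrightarrow> u a" using isCont_tendsto_compose by blast
  then have "(\<lambda>n. 0) \<longlonglongrightarrow> u a" by (simp only: us)
  then show ?thesis by (simp only: LIMSEQ_const_iff)
qed

context wavelets
begin

text \<open>By induction on the order. When all moments of degree below \<open>m\<close> vanish,
  \<open>\<phi>_integral_zero\<close> forces the next Taylor term, \<open>dual_op m\<close>, to
  vanish at dyadic points and hence everywhere. Its Laplace transform is \<open>p \<xi>\<close>
  times that of \<open>\<theta> 0\<close>; a nonzero value of \<open>p\<close> would persist on an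
  open cone, by continuity and homogeneity, and force \<open>\<theta> 0\<close>, which has norm 1,
  to be 0. Each order uses one derivative of \<open>\<theta> 0\<close>, so the degrees reached are
  those below \<open>r\<close>.\<close>

lemma vanishing_moments:
  assumes i: "i \<in> {0<..<2 ^ CARD('d)}" shows "mom r (\<theta> i)"
proof -
  have f: "cs (\<theta> 0)" "C_on r UNIV (\<theta> 0)" using \<theta>_Cc[of 0] Cc_cs Cc_C_on by blast+
  have g: "cs (\<theta> i)" using \<theta>_Cc[of i] i Cc_cs by blast
  have "m \<le> r \<Longrightarrow> mom m (\<theta> i)" for m
  proof (induction m)
    case (Suc m)
    then have m: "mom m (\<theta> i)" "Suc m \<le> r" by auto
    define p where "p \<xi> = (\<integral>y. \<theta> i y * (\<xi> \<bullet> y) ^ m \<partial>lborel)" for \<xi>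
    have d0: "dual_op m (\<theta> i) (\<theta> 0) a = 0" if a: "a \<in> dyadic_lattice n" for n a
    proof -
      \<comment> \<open>Along the scales \<open>1 / 2 ^ j\<close> with \<open>j \<ge> n\<close> the
        point \<open>a\<close> belongs to \<open>dyadic_lattice j\<close>, so the quotient is
        eventually 0.\<close>
      have "filterlim (\<lambda>j. 1 / 2 ^ j :: real) (at_right 0) sequentially"
        unfolding filterlim_at using LIMSEQ_power_zero[of "1/2 :: real"] by (auto simp: power_one_over)
      from filterlim_compose[OF pint_tendsto[OF g C_on_le[OF f(2) m(2)] m(1), of a] this]
      have "(\<lambda>j. pint (\<theta> i) (\<theta> 0) a (1 / 2 ^ j) / (1 / 2 ^ j) ^ m) \<longlonglongrightarrow> dual_op m (\<theta> i) (\<theta> 0) a / fact m" .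
      moreover have "\<forall>\<^sub>F j in sequentially. pint (\<theta> i) (\<theta> 0) a (1 / 2 ^ j) / (1 / 2 ^ j) ^ m = 0"
        using eventually_ge_at_top[of n]
      proof eventually_elim
        case (elim j)
        then have "a \<in> dyadic_lattice j" using a dyadic_lattice_mono by blast
        from \<phi>_integral_zero[OF i this] show ?case by (simp add: pint_def)
      qed
      ultimately have "(\<lambda>j. 0) \<longlonglongrightarrow> dual_op m (\<theta> i) (\<theta> 0) a / fact m" by (rule Lim_transform_eventually)
      then show ?thesis by (simp add: tendsto_const_iff)
    qed
    have "cs (dual_op m (\<theta> i) (\<theta> 0))" using f m(2) by (intro cs_dual_op) (auto intro: C_on_le)
    then have d: "dual_op m (\<theta> i) (\<theta> 0) a = 0" for a
      by (rule dyadic_dense[OF cs_continuous]) (rule d0)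
    have pL: "p \<xi> * (\<integral>a. \<theta> 0 a * exp (- (\<xi> \<bullet> a)) \<partial>lborel) = 0" for \<xi>
      using integral_exp_dual_op[OF g f(1), of m \<xi>] C_on_le[OF f(2), of m] m(2) d by (simp add: p_def)
    have "p \<xi>0 = 0" for \<xi>0
    proof (rule ccontr)
      assume nz: "p \<xi>0 \<noteq> 0"
      obtain b where b: "\<And>y. b < norm y \<Longrightarrow> \<theta> i y = 0" using g unfolding cs_def by blast
      have "continuous_on UNIV p"
        unfolding p_def
      proof (rule continuous_integral[where b=b])
        show "continuous_on UNIV (\<lambda>(\<xi>, y). \<theta> i y * (\<xi> \<bullet> y) ^ m)"
          unfolding case_prod_beta
          by (intro continuous_on_mult continuous_on_compose2[OF cs_continuous[OF g]]) (auto intro!: continuous_intros)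
      qed (use b in auto)
      then have "open {\<xi>. p \<xi> \<noteq> 0}" by (intro open_Collect_neq) auto
      then obtain \<delta> where \<delta>: "\<delta> > 0" "ball \<xi>0 \<delta> \<subseteq> {\<xi>. p \<xi> \<noteq> 0}" using nz open_contains_ball by blast
      have "\<theta> 0 x = 0" for x
      proof (rule Laplace_unique[OF f(1) \<delta>(1), where ?\<xi>0.0 = \<xi>0])
        fix t :: real and \<xi> assume t: "t > 0" and \<xi>: "\<xi> \<in> ball \<xi>0 \<delta>"
        have "p (t *\<^sub>R \<xi>) = t ^ m * p \<xi>"
          by (simp add: p_def power_mult_distrib mult.left_commute)
        then have "p (t *\<^sub>R \<xi>) \<noteq> 0" using t \<xi> \<delta>(2) by auto
        then show "(\<integral>a. \<theta> 0 a * exp (- ((t *\<^sub>R \<xi>) \<bullet> a)) \<partial>lborel) = 0"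
          using pL[of "t *\<^sub>R \<xi>"] by simp
      qed
      then show False using \<phi>_norm by simp
    qed
    then show ?case using mom_polarize[OF g m(1)] by (simp add: p_def)
  qed simp
  then show ?thesis by simp
qed

end

section \<open>Decay of wavelet coefficients\<close>

text \<open>A Taylor estimate by repeated use of the mean value theorem in the scale
  \<open>h\<close>: each vanishing order contributes a factor \<open>s * h\<close>. The factor
  \<open>real CARD('d) * b\<close> per order comes from the sum over the coordinates, each at most
  \<open>b\<close> on the support of \<open>g\<close>.\<close>

lemma moment_decay:
  fixes g u :: "real^'d::finite \<Rightarrow> real" and b :: real
  assumes "cs g" "\<And>y. b < norm y \<Longrightarrow> g y = 0" "\<And>y. \<bar>g y\<bar> \<le> B" "mom m g" "cbnd m A s u"
    and s: "0 \<le> s" and b: "0 \<le> b" and h: "0 \<le> h"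
  shows "\<bar>pint g u x h\<bar> \<le> measure lborel (cball (0::real^'d) b) * B * (real CARD('d) * b) ^ m * A * (s * h) ^ m"
  using assms(1-5) h
proof (induction m arbitrary: g u A B h)
  case 0
  have c: "continuous_on UNIV (\<lambda>y. u (x + h *\<^sub>R y))"
    by (rule continuous_on_compose2[of UNIV u]) (use 0 in \<open>auto intro!: continuous_intros\<close>)
  have "\<bar>\<integral>y. g y * u (x + h *\<^sub>R y) \<partial>lborel\<bar> \<le> (B * A) * measure lborel (cball (0::real^'d) b)"
  proof (rule cs_integral_bound)
    show "cs (\<lambda>y. g y * u (x + h *\<^sub>R y))" using 0(1) c by (rule cs_mult)
    show "\<bar>g y * u (x + h *\<^sub>R y)\<bar> \<le> B * A" for y
      unfolding abs_mult using 0(3)[of y] cbnd_abs[OF 0(5), of "x + h *\<^sub>R y"] by (intro mult_mono) auto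
  qed (use 0 in auto)
  then show ?case by (simp add: pint_def mult_ac)
next
  case (Suc m)
  have B0: "0 \<le> B" using Suc.prems(3)[of 0] by linarith
  have A0: "0 \<le> A" using Suc.prems(5) by (rule cbnd_nonneg)
  define K where "K = measure lborel (cball (0::real^'d) b)"
  have K0: "0 \<le> K" by (simp add: K_def)
  have u1: "C_on (Suc 0) UNIV u" using C_on_le[OF cbnd_C_on[OF Suc.prems(5)], of "Suc 0"] by simp
  define Q where "Q t = (\<Sum>i\<in>UNIV. pint (\<lambda>y. y $ i * g y) (partial i u) x t)" for t
  define E where "E = K * B * (real CARD('d) * b) ^ Suc m * A * s ^ Suc m * h ^ m"
  have Qb: "\<bar>Q t\<bar> \<le> E" if t: "0 \<le> t" "t \<le> h" for t
  proof -
    have "\<bar>pint (\<lambda>y. y $ i * g y) (partial i u) x t\<bar> \<le> K * (b * B) * (real CARD('d) * b) ^ m * (A * s) * (s * t) ^ m" for i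
      unfolding K_def
    proof (rule Suc.IH)
      show "cs (\<lambda>y. y $ i * g y)" using Suc.prems(1) by (rule cs_coord)
      show "\<bar>y $ i * g y\<bar> \<le> b * B" for y
      proof (cases "b < norm y")
        case False
        then have "\<bar>y $ i\<bar> \<le> b" using component_le_norm_cart[of y i] by simp
        then show ?thesis unfolding abs_mult using Suc.prems(3)[of y] b by (intro mult_mono) auto
      qed (use Suc.prems(2) b B0 in simp)
    qed (use Suc.prems t in auto)
    then have "\<bar>Q t\<bar> \<le> (\<Sum>i\<in>(UNIV::'d set). K * (b * B) * (real CARD('d) * b) ^ m * (A * s) * (s * t) ^ m)"
      unfolding Q_def by (intro order_trans[OF sum_abs] sum_mono)
    also have "\<dots> = K * B * (real CARD('d) * b) ^ Suc m * A * s ^ Suc m * t ^ m"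
      by (simp add: power_mult_distrib mult_ac)
    also have "\<dots> \<le> E"
      unfolding E_def using K0 B0 A0 b s t by (intro mult_left_mono power_mono mult_nonneg_nonneg zero_le_power) auto
    finally show ?thesis .
  qed
  have p0: "pint g u x 0 = 0" using Suc.prems(4) by (simp add: pint_0)
  have "\<bar>pint g u x h\<bar> \<le> h * E"
  proof (cases "h = 0")
    case False
    then have "0 < h" using Suc.prems(6) by simp
    then obtain z where z: "0 < z" "z < h" "pint g u x h - pint g u x 0 = (h - 0) * Q z"
      using MVT2[of 0 h "pint g u x" Q] pint_DERIV[OF Suc.prems(1) u1] unfolding Q_def by blast
    then have "\<bar>pint g u x h\<bar> = h * \<bar>Q z\<bar>" using p0 \<open>0 < h\<close> by (simp add: abs_mult)
    also have "\<dots> \<le> h * E" using Qb[of z] z \<open>0 < h\<close> by (intro mult_left_mono) auto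
    finally show ?thesis .
  qed (use p0 in simp)
  also have "h * E = K * B * (real CARD('d) * b) ^ Suc m * A * (s * h) ^ Suc m"
    by (simp add: E_def power_mult_distrib mult_ac)
  finally show ?case unfolding K_def .
qed

lemma L2_inner_wav_pint:
  fixes g u :: "real^'d::finite \<Rightarrow> real"
  assumes g: "cs g" and u: "continuous_on UNIV u"
  shows "2 ^ (CARD('d) * n) * L2_inner (wav g n x) u = pint g u x (1 / 2 ^ n)"
proof -
  let ?v = "\<lambda>z. g z * u (x + (1 / 2 ^ n) *\<^sub>R z)"
  have "continuous_on UNIV (\<lambda>z. u (x + (1 / 2 ^ n) *\<^sub>R z))"
    by (rule continuous_on_compose2[OF u]) (auto intro!: continuous_intros)
  then have "cs ?v" using g by (intro cs_mult)
  then have "(\<integral>y. ?v (2 ^ n *\<^sub>R (y - x)) \<partial>lborel) = (\<integral>y. ?v y \<partial>lborel) / 2 ^ (CARD('d) * n)"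
    using cs_measurable by (intro integral_wav) auto
  moreover have "(\<lambda>y. ?v (2 ^ n *\<^sub>R (y - x))) = (\<lambda>y. wav g n x y * u y)" by (auto simp: wav_def)
  ultimately show ?thesis by (simp add: L2_inner_def pint_def)
qed

section \<open>Iterated partial derivatives of sums and dilates\<close>

lemma C_on_partials:
  "C_on r UNIV u \<Longrightarrow> length js \<le> r \<Longrightarrow> C_on (r - length js) UNIV (partials js u)"
proof (induction js)
  case (Cons i js)
  then have "C_on (r - length js) UNIV (partials js u)" "r - length js = Suc (r - length (i # js))" by auto
  then show ?case by simp
qed simp

lemma partials_differentiable:
  "C_on r UNIV u \<Longrightarrow> length js < r \<Longrightarrow> partials js u differentiable (at x)"
  using C_on_partials[of r u js] by (cases "r - length js") auto

lemma partials_sum: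
  assumes "\<And>i. i \<in> I \<Longrightarrow> C_on (length js) UNIV (f i)"
  shows "partials js (\<lambda>x. \<Sum>i\<in>I. c i * f i x) = (\<lambda>x. \<Sum>i\<in>I. c i * partials js (f i) x)"
  using assms
proof (induction js)
  case (Cons k js)
  have d: "partials js (f i) differentiable (at x)" if "i \<in> I" for i x
    using partials_differentiable[OF Cons.prems[OF that]] by simp
  have "C_on (length js) UNIV (f i)" if "i \<in> I" for i using C_on_le[OF Cons.prems[OF that]] by simp
  note IH = Cons.IH[OF this]
  have "partial k (\<lambda>x. \<Sum>i\<in>I. c i * partials js (f i) x) x = (\<Sum>i\<in>I. c i * partial k (partials js (f i)) x)" for x
    using d
  proof (induction I rule: infinite_finite_induct)
    case (insert a I)
    then show ?case
      by (simp add: partial_add partial_cmult differentiable_sum differentiable_mult)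
  qed auto
  then show ?case by (simp add: IH)
qed simp

lemma partials_diff:
  assumes "C_on (length js) UNIV f" "C_on (length js) UNIV g"
  shows "partials js (\<lambda>x. f x - g x) = (\<lambda>x. partials js f x - partials js g x)"
proof -
  have "partials js (\<lambda>x. \<Sum>b\<in>UNIV. (if b then 1 else - 1) * (if b then f else g) x) =
      (\<lambda>x. \<Sum>b\<in>UNIV. (if b then 1 else - 1) * partials js (if b then f else g) x)"
    by (rule partials_sum) (use assms in auto)
  then show ?thesis by (simp add: UNIV_bool)
qed

lemma partials_wav:
  "C_on (length js) UNIV g \<Longrightarrow> partials js (wav g n x) = (\<lambda>y. 2 ^ (n * length js) * wav (partials js g) n x y)"
proof (induction js)
  case (Cons i js)
  have d: "partials js g differentiable (at y)" for y
    using partials_differentiable[OF Cons.prems] by simp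
  have "C_on (length js) UNIV g" using C_on_le[OF Cons.prems] by simp
  then have "partials (i # js) (wav g n x) = partial i (\<lambda>y. 2 ^ (n * length js) * wav (partials js g) n x y)"
    using Cons.IH by simp
  also have "\<dots> = (\<lambda>y. 2 ^ (n * length js) * (2 ^ n * wav (partial i (partials js g)) n x y))"
    using d by (simp add: fun_eq_iff partial_cmult differentiable_wav partial_wav)
  finally show ?case by (simp add: power_add mult_ac)
qed simp

lemma partials_zero_open:
  "open S \<Longrightarrow> x \<in> S \<Longrightarrow> (\<And>y. y \<in> S \<Longrightarrow> u y = 0) \<Longrightarrow> partials js u x = 0"
proof (induction js arbitrary: x)
  case (Cons i js)
  then show ?case by (auto intro!: partial_zero_open[of S])
qed simp

context wavelets
begin

lemma \<theta>_cbnd_ex: "\<exists>A. \<forall>j\<in>{0} \<union> {0<..<2 ^ CARD('d)}. cbnd r A 1 (\<theta> j)"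
proof -
  have "\<exists>A. cbnd r A 1 (\<theta> j)" if "j \<in> {0} \<union> {0<..<2 ^ CARD('d)}" for j
    using Cc_cbnd[OF \<theta>_Cc[OF that], of 1] by auto
  then obtain A where A: "\<And>j. j \<in> {0} \<union> {0<..<2 ^ CARD('d)} \<Longrightarrow> cbnd r (A j) 1 (\<theta> j)" by metis
  have "cbnd r (\<Sum>j\<in>{0} \<union> {0<..<2 ^ CARD('d)}. A j) 1 (\<theta> j)" if "j \<in> {0} \<union> {0<..<2 ^ CARD('d)}" for j
    using cbnd_nonneg[OF A] that by (intro cbnd_mono[OF A[OF that]] member_le_sum) auto
  then show ?thesis by blast
qed

definition "Ath = (SOME A. \<forall>j\<in>{0} \<union> {0<..<2 ^ CARD('d)}. cbnd r A 1 (\<theta> j))"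
definition "K0 = measure lborel (cball (0::real^'d) R)"
text \<open>The bound of \<open>card_dyadic_lattice\<close> for radius \<open>R / 2 ^ n\<close>, in
  which the level cancels.\<close>

definition "M0 = (2 * R + 1) ^ CARD('d)"

lemma \<theta>_cbnd: "j \<in> {0} \<union> {0<..<2 ^ CARD('d)} \<Longrightarrow> cbnd r Ath 1 (\<theta> j)"
  unfolding Ath_def using someI_ex[OF \<theta>_cbnd_ex] by blast

lemma Ath_nonneg: "0 \<le> Ath" using cbnd_nonneg[OF \<theta>_cbnd[of 0]] by simp
lemma K0_nonneg: "0 \<le> K0" by (simp add: K0_def)
lemma M0_ge_1: "1 \<le> M0" using R_pos by (simp add: M0_def)

lemma card_near: "real (card (near R n (y :: real^'d))) \<le> M0"
  using card_dyadic_lattice(2)[of "R / 2 ^ n" n y] R_pos by (simp add: near_def M0_def)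

lemma \<theta>_cs: "j \<in> {0} \<union> {0<..<2 ^ CARD('d)} \<Longrightarrow> cs (\<theta> j)"
  using \<theta>_Cc Cc_cs by blast

text \<open>\<open>moment_decay\<close> of order 0, without any cancellation; it also covers the
  scaling function.\<close>

lemma coef_bound:
  assumes j: "j \<in> {0} \<union> {0<..<2 ^ CARD('d)}" and u: "cbnd m A s u"
  shows "\<bar>2 ^ (CARD('d) * n) * L2_inner (wav (\<theta> j) n x) u\<bar> \<le> K0 * Ath * A"
proof -
  have u0: "cbnd 0 A 0 u" using cbnd_abs[OF u] C_on_continuous[OF cbnd_C_on[OF u]] by simp
  have z: "\<theta> j y = 0" if "R < norm y" for y using \<theta>_supp[OF j, of y] that by simp
  have "\<bar>pint (\<theta> j) u x (1 / 2 ^ n)\<bar> \<le> K0 * Ath * (real CARD('d) * R) ^ 0 * A * (0 * (1 / 2 ^ n)) ^ 0"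
    unfolding K0_def
  proof (rule moment_decay)
    show "cs (\<theta> j)" by (rule \<theta>_cs[OF j])
    show "\<bar>\<theta> j y\<bar> \<le> Ath" for y using cbnd_abs[OF \<theta>_cbnd[OF j]] .
  qed (use R_pos u0 z in auto)
  then show ?thesis
    using L2_inner_wav_pint[OF \<theta>_cs[OF j] C_on_continuous[OF cbnd_C_on[OF u]]] by simp
qed

definition "C0 = K0 * Ath * (real CARD('d) * R) ^ r"

lemma C0_nonneg: "0 \<le> C0" unfolding C0_def using R_pos K0_nonneg Ath_nonneg by simp

text \<open>Cancellation to order \<open>r\<close>: a function of frequency \<open>s\<close> is seen
  by a wavelet of frequency \<open>2 ^ n\<close> with the gain \<open>(s / 2 ^ n) ^ r\<close>. The
  decay between different levels rests on this estimate.\<close>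

lemma coef_decay:
  assumes i: "i \<in> {0<..<2 ^ CARD('d)}" and u: "cbnd r A s u" and s: "0 \<le> s"
  shows "\<bar>2 ^ (CARD('d) * n) * L2_inner (wav (\<theta> i) n x) u\<bar> \<le> C0 * A * (s / 2 ^ n) ^ r"
proof -
  have j: "i \<in> {0} \<union> {0<..<2 ^ CARD('d)}" using i by simp
  have z: "\<theta> i y = 0" if "R < norm y" for y using \<theta>_supp[OF j, of y] that by simp
  have "\<bar>pint (\<theta> i) u x (1 / 2 ^ n)\<bar> \<le> K0 * Ath * (real CARD('d) * R) ^ r * A * (s * (1 / 2 ^ n)) ^ r"
    unfolding K0_def
  proof (rule moment_decay)
    show "cs (\<theta> i)" by (rule \<theta>_cs[OF j])
    show "\<bar>\<theta> i y\<bar> \<le> Ath" for y using cbnd_abs[OF \<theta>_cbnd[OF j]] .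
    show "mom r (\<theta> i)" by (rule vanishing_moments[OF i])
  qed (use R_pos u s z in auto)
  then show ?thesis
    using L2_inner_wav_pint[OF \<theta>_cs[OF j] C_on_continuous[OF cbnd_C_on[OF u]], of n x]
    by (simp add: C0_def mult_ac)
qed

lemma sum_near_bound:
  fixes G :: "nat set" and y :: "real^'d"
  assumes G: "G \<subseteq> {0} \<union> {0<..<2 ^ CARD('d)}" and b: "\<And>j x. j \<in> G \<Longrightarrow> x \<in> dyadic_lattice n \<Longrightarrow> \<bar>c j x\<bar> \<le> b"
    and b0: "0 \<le> b"
  shows "\<bar>\<Sum>j\<in>G. \<Sum>x\<in>near R n y. c j x\<bar> \<le> 2 ^ CARD('d) * M0 * b"
proof -
  have "\<bar>\<Sum>j\<in>G. \<Sum>x\<in>near R n y. c j x\<bar> \<le> (\<Sum>j\<in>G. \<Sum>x\<in>near R n y. b)"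
    by (intro order_trans[OF sum_abs] sum_mono order_trans[OF sum_abs] b) (auto simp: near_def)
  also have "\<dots> = real (card G) * (real (card (near R n y)) * b)" by simp
  also have "\<dots> \<le> 2 ^ CARD('d) * (M0 * b)"
  proof (intro mult_mono card_near order_refl)
    have "G \<subseteq> {..<2 ^ CARD('d)}" using G by auto
    from card_mono[OF _ this] have "card G \<le> 2 ^ CARD('d)" by simp
    then have "real (card G) \<le> real (2 ^ CARD('d))" by (simp only: of_nat_le_iff)
    then show "real (card G) \<le> 2 ^ CARD('d)" by simp
  qed (use b0 M0_ge_1 in auto)
  finally show ?thesis by (simp add: mult.assoc)
qed

text \<open>The coefficients gain \<open>(2 ^ n) ^ r\<close>, and every derivative of the wavelets
  loses a factor \<open>2 ^ n\<close>. Derivatives of order below \<open>r\<close> are thus summable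
  over the levels, which is why the expansion converges in C^(r-1).\<close>

lemma PW_partials:
  assumes h: "cs h" and u: "cbnd r A 1 h" and l: "length js \<le> r"
  shows "\<bar>partials js (PW n h) y\<bar> \<le> 2 ^ CARD('d) * M0 * (C0 * A * Ath) * (2 ^ n) ^ length js / (2 ^ n) ^ r"
proof -
  obtain X where X: "finite X" "X \<subseteq> dyadic_lattice n"
    "\<And>j x. j \<in> {0<..<2 ^ CARD('d)} \<Longrightarrow> x \<in> dyadic_lattice n \<Longrightarrow> x \<notin> X \<Longrightarrow> L2_inner h (wav (\<theta> j) n x) = 0"
    using WL.P_finite[OF h] by metis
  let ?c = "\<lambda>j x. 2 ^ (CARD('d) * n) * L2_inner h (wav (\<theta> j) n x)"
  let ?p = "\<lambda>j x. partials js (wav (\<theta> j) n x) y"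
  have Cw: "C_on (length js) UNIV (wav (\<theta> j) n x)" if "j \<in> {0<..<2 ^ CARD('d)}" for j x
    using C_on_le[OF C_on_wav[OF cbnd_C_on[OF \<theta>_cbnd]]] that l by simp
  have "PW n h = (\<lambda>y. \<Sum>i\<in>{0<..<2 ^ CARD('d)} \<times> X. ?c (fst i) (snd i) * wav (\<theta> (fst i)) n (snd i) y)"
    by (subst WL.P_eq_sum[OF X]) (assumption | simp add: sum.cartesian_product case_prod_beta)+
  then have "partials js (PW n h) y = (\<Sum>i\<in>{0<..<2 ^ CARD('d)} \<times> X. ?c (fst i) (snd i) * ?p (fst i) (snd i))"
    using partials_sum[of "{0<..<2 ^ CARD('d)} \<times> X" js "\<lambda>i. wav (\<theta> (fst i)) n (snd i)"] Cw by auto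
  also have "\<dots> = (\<Sum>j\<in>{0<..<2 ^ CARD('d)}. \<Sum>x\<in>X. ?c j x * ?p j x)"
    by (simp add: sum.cartesian_product case_prod_beta)
  also have "\<dots> = (\<Sum>j\<in>{0<..<2 ^ CARD('d)}. \<Sum>x\<in>near R n y. ?c j x * ?p j x)"
  proof (rule sum.cong[OF refl])
    fix j :: nat assume j: "j \<in> {0<..<2 ^ CARD('d)}"
    have f: "finite (near R n y)" using R_pos by (intro finite_near) simp
    have pz: "?p j x = 0" if "x \<in> X" "x \<notin> near R n y" for x
    proof (rule partials_zero_open)
      show "open (- cball x (R / 2 ^ n))" by auto
      show "y \<in> - cball x (R / 2 ^ n)" using that X(2) by (auto simp: near_def dist_norm)
      show "wav (\<theta> j) n x z = 0" if "z \<in> - cball x (R / 2 ^ n)" for z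
        using that by (intro WL.wav_zero[OF j]) (auto simp: dist_norm norm_minus_commute)
    qed
    have "(\<Sum>x\<in>X. ?c j x * ?p j x) = (\<Sum>x\<in>X \<union> near R n y. ?c j x * ?p j x)"
      using X f j by (intro sum.mono_neutral_left) (auto simp: near_def)
    also have "\<dots> = (\<Sum>x\<in>near R n y. ?c j x * ?p j x)"
      using X f j pz by (intro sum.mono_neutral_right) auto
    finally show "(\<Sum>x\<in>X. ?c j x * ?p j x) = (\<Sum>x\<in>near R n y. ?c j x * ?p j x)" .
  qed
  finally have e: "partials js (PW n h) y = (\<Sum>j\<in>{0<..<2 ^ CARD('d)}. \<Sum>x\<in>near R n y. ?c j x * ?p j x)" .
  have A0: "0 \<le> A" using u by (rule cbnd_nonneg)
  have "\<bar>?c j x * ?p j x\<bar> \<le> (C0 * A * (1 / 2 ^ n) ^ r) * ((2 ^ n) ^ length js * Ath)" if j: "j \<in> {0<..<2 ^ CARD('d)}" for j x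
    unfolding abs_mult[of "?c j x"]
  proof (rule mult_mono)
    show "\<bar>?c j x\<bar> \<le> C0 * A * (1 / 2 ^ n) ^ r"
      using coef_decay[OF j u, of n x] by (simp add: L2_inner_commute)
    have j': "j \<in> {0} \<union> {0<..<2 ^ CARD('d)}" using j by simp
    have "?p j x = 2 ^ (n * length js) * partials js (\<theta> j) (2 ^ n *\<^sub>R (y - x))"
      using partials_wav[OF C_on_le[OF cbnd_C_on[OF \<theta>_cbnd[OF j']] l]] by (simp add: wav_def)
    then show "\<bar>?p j x\<bar> \<le> (2 ^ n) ^ length js * Ath"
      using cbnd_partials[OF \<theta>_cbnd[OF j'] l] by (simp add: abs_mult power_mult mult_left_mono)
  qed (use C0_nonneg A0 in auto)
  then have "\<bar>partials js (PW n h) y\<bar> \<le> 2 ^ CARD('d) * M0 * ((C0 * A * (1 / 2 ^ n) ^ r) * ((2 ^ n) ^ length js * Ath))"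
    unfolding e using A0 C0_nonneg Ath_nonneg by (intro sum_near_bound) auto
  then show ?thesis by (simp add: power_one_over divide_inverse power_inverse mult_ac)
qed

lemma C_on_P:
  assumes h: "cs h" shows "C_on r UNIV (PV n h)" "C_on r UNIV (PW n h)"
proof -
  obtain X where X: "finite X" "X \<subseteq> dyadic_lattice n"
    "\<And>j x. j \<in> {0::nat} \<Longrightarrow> x \<in> dyadic_lattice n \<Longrightarrow> x \<notin> X \<Longrightarrow> L2_inner h (wav (\<theta> j) n x) = 0"
    using VL.P_finite[OF h] by metis
  show "C_on r UNIV (PV n h)"
    by (subst VL.P_eq_sum[OF X]) (assumption | intro C_on_sum C_on_cmult C_on_wav cbnd_C_on[OF \<theta>_cbnd] UnI1)+
  obtain X where X: "finite X" "X \<subseteq> dyadic_lattice n"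
    "\<And>j x. j \<in> {0<..<2 ^ CARD('d)} \<Longrightarrow> x \<in> dyadic_lattice n \<Longrightarrow> x \<notin> X \<Longrightarrow> L2_inner h (wav (\<theta> j) n x) = 0"
    using WL.P_finite[OF h] by metis
  show "C_on r UNIV (PW n h)"
    by (subst WL.P_eq_sum[OF X]) (assumption | intro C_on_sum C_on_cmult C_on_wav cbnd_C_on[OF \<theta>_cbnd] UnI2)+
qed

end

section \<open>Convergence of wavelet expansions of C^r functions\<close>

text \<open>\<open>mpartial\<close> differentiates along an unspecified list with the prescribed
  multiplicities; a bound for all lists of length at most \<open>m\<close> is insensitive to that
  choice.\<close>

lemma C_norm_le:
  fixes u :: "real^'d::finite \<Rightarrow> real"
  assumes "\<And>js. length js \<le> m \<Longrightarrow> partials js u \<in> borel_measurable lborel"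
    and "\<And>js x. length js \<le> m \<Longrightarrow> \<bar>partials js u x\<bar> \<le> b"
  shows "C_norm m u \<le> of_nat (card {k :: 'd \<Rightarrow> nat. (\<Sum>i\<in>UNIV. k i) \<le> m}) * ennreal b"
proof -
  have "Lp_norm lborel \<infinity> (mpartial k u) \<le> ennreal b" if k: "(\<Sum>i\<in>UNIV. k i) \<le> m" for k :: "'d \<Rightarrow> nat"
  proof -
    define js where "js = (SOME js. \<forall>i. count_list js i = k i)"
    have "\<exists>js. \<forall>i. count_list js i = k i"
    proof -
      obtain js where js: "mset js = Abs_multiset k" using ex_mset by blast
      have "count_list js i = k i" for i
        using arg_cong[OF js, of "\<lambda>M. count M i"] by (simp add: count_mset Abs_multiset_inverse)
      then show ?thesis by blast
    qed
    then have "count_list js i = k i" for i unfolding js_def by (rule someI2_ex) blast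
    then have "length js \<le> m" using sum_count_set[of js UNIV] k by simp
    moreover have "mpartial k u = partials js u" by (simp add: mpartial_def js_def)
    ultimately have "esssup lborel (\<lambda>x. ennreal \<bar>mpartial k u x\<bar>) \<le> ennreal b"
      using assms[of js] by (intro esssup_I) (auto intro!: ennreal_leI AE_I2)
    then show ?thesis by (simp add: Lp_norm_def eLp_norm_def)
  qed note b = this
  have "C_norm m u \<le> (\<Sum>k \<in> {k :: 'd \<Rightarrow> nat. (\<Sum>i\<in>UNIV. k i) \<le> m}. ennreal b)"
    unfolding C_norm_def by (rule sum_mono, rule b, simp)
  then show ?thesis by simp
qed

context wavelets
begin

lemma PV_support:
  assumes h: "\<And>y. b < norm y \<Longrightarrow> h y = 0" and y: "b + 2 * R < norm y"
  shows "PV n h y = 0" "PW n h y = 0"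
proof -
  have z: "L2_inner h (wav (\<theta> j) n x) = 0" if x: "x \<in> near R n y" and j: "j \<in> {0} \<union> {0<..<2 ^ CARD('d)}" for j x
  proof -
    have "R / 2 ^ n \<le> R" using R_pos by (simp add: divide_le_eq)
    then have "norm (x - y) \<le> R" using x unfolding near_def mem_Collect_eq by linarith
    then have "b + R < norm x" using y norm_triangle_ineq2[of y x] by (simp add: norm_minus_commute)
    then show ?thesis using j VL.inner_zero_far[where h=h and b=b] WL.inner_zero_far[where h=h and b=b] h by blast
  qed
  show "PV n h y = 0" "PW n h y = 0"
    unfolding VL.P_def WL.P_def using z by (auto intro!: sum.neutral)
qed

text \<open>Consecutive projections differ by a layer, so the derivatives of order below
  \<open>r\<close> form Cauchy sequences with geometric rate. Density identifies the limit with
  \<open>h\<close> only in \<open>L2\<close>; continuity transfers this to the values, and uniform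
  convergence to the derivatives.\<close>

lemma PV_uniform:
  assumes h: "h \<in> Cc r UNIV"
  obtains C where "0 \<le> C" "\<And>n js y. length js < r \<Longrightarrow>
    \<bar>partials js (PV n h) y - partials js h y\<bar> \<le> C * (1 / 2) ^ n"
proof -
  obtain A where A: "cbnd r A 1 h" using Cc_cbnd[OF h, of 1] by auto
  have csh: "cs h" using h by (rule Cc_cs)
  have A0: "0 \<le> A" using A by (rule cbnd_nonneg)
  define C where "C = 2 ^ CARD('d) * M0 * (C0 * A * Ath)"
  have C: "0 \<le> C" unfolding C_def using A0 C0_nonneg Ath_nonneg M0_ge_1 by simp
  have incr: "\<bar>partials js (PV (Suc n) h) y - partials js (PV n h) y\<bar> \<le> C * (1 / 2) ^ n" if js: "length js < r" for n js y
  proof -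
    have e: "PV (Suc n) h = (\<lambda>y. PV n h y - (-1) * PW n h y)" using PV_Suc[OF csh] by auto
    have "PW n h = (\<lambda>y. PV (Suc n) h y - PV n h y)" using PV_Suc[OF csh] by auto
    then have "partials js (PW n h) = (\<lambda>y. partials js (PV (Suc n) h) y - partials js (PV n h) y)"
      using partials_diff[of js "PV (Suc n) h" "PV n h"] C_on_le[OF C_on_P(1)[OF csh]] js by simp
    then have "\<bar>partials js (PV (Suc n) h) y - partials js (PV n h) y\<bar> \<le> C * (2 ^ n) ^ length js / (2 ^ n) ^ r"
      using PW_partials[OF csh A, of js n y] js by (simp add: C_def)
    also have "\<dots> \<le> C * (2 ^ n) ^ (r - 1) / (2 ^ n) ^ r"
      using C js by (intro divide_right_mono mult_left_mono power_increasing) auto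
    also have "\<dots> = C * (1 / 2) ^ n"
      using r_pos by (cases r) (auto simp: power_one_over field_simps)
    finally show ?thesis .
  qed
  have tele: "\<bar>partials js (PV m h) y - partials js (PV n h) y\<bar> \<le> 2 * C * (1 / 2) ^ n" if js: "length js < r" and mn: "n \<le> m" for n m js y
  proof -
    \<comment> \<open>Subtracting \<open>(1 / 2) ^ m\<close> turns the geometric sum into a bound
      that is stable under the induction.\<close>
    have "\<bar>partials js (PV m h) y - partials js (PV n h) y\<bar> \<le> 2 * C * ((1 / 2) ^ n - (1 / 2) ^ m)"
      using mn
    proof (induction m rule: dec_induct)
      case (step m)
      have "\<bar>partials js (PV (Suc m) h) y - partials js (PV n h) y\<bar> \<le>
        2 * C * ((1 / 2) ^ n - (1 / 2) ^ m) + C * (1 / 2) ^ m"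
        using step.IH incr[OF js, of m y] by linarith
      then show ?case by (simp add: algebra_simps)
    qed simp
    also have "\<dots> \<le> 2 * C * (1 / 2) ^ n" using C by (simp add: algebra_simps)
    finally show ?thesis .
  qed
  have half: "(\<lambda>n. K * (1 / 2 :: real) ^ n) \<longlonglongrightarrow> 0" for K
    by (intro tendsto_mult_right_zero LIMSEQ_power_zero) auto
  have lim_bound: "\<bar>l - partials js (PV n h) y\<bar> \<le> 2 * C * (1 / 2) ^ n"
    if "length js < r" "(\<lambda>m. partials js (PV m h) y) \<longlonglongrightarrow> l" for js y l n
  proof (rule Lim_bounded)
    show "(\<lambda>m. \<bar>partials js (PV m h) y - partials js (PV n h) y\<bar>) \<longlonglongrightarrow> \<bar>l - partials js (PV n h) y\<bar>"
      by (intro tendsto_intros that)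
    show "\<forall>m\<ge>n. \<bar>partials js (PV m h) y - partials js (PV n h) y\<bar> \<le> 2 * C * (1 / 2) ^ n"
      using tele that by blast
  qed
  have conv: "convergent (\<lambda>m. partials js (PV m h) y)" if "length js < r" for js y
  proof (rule Cauchy_convergent, rule metric_CauchyI)
    fix e :: real assume "0 < e"
    then obtain N where N: "2 * C * (1 / 2) ^ N < e / 2"
      using order_tendstoD(2)[OF half[of "2 * C"], of "e / 2"] by (auto simp: eventually_sequentially)
    have "dist (partials js (PV m h) y) (partials js (PV n h) y) < e" if "m \<ge> N" "n \<ge> N" for m n
      using tele[OF \<open>length js < r\<close> that(1), of y] tele[OF \<open>length js < r\<close> that(2), of y] N
      unfolding dist_real_def by linarith
    then show "\<exists>M. \<forall>m\<ge>M. \<forall>n\<ge>M. dist (partials js (PV m h) y) (partials js (PV n h) y) < e" by blast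
  qed
  have l0: "length ([] :: 'd list) < r" using r_pos by simp
  define g where "g y = lim (\<lambda>m. PV m h y)" for y
  have g: "(\<lambda>m. PV m h y) \<longlonglongrightarrow> g y" for y
    using conv[OF l0, of y] unfolding g_def by (simp add: convergent_LIMSEQ_iff)
  have gb: "\<bar>g y - PV n h y\<bar> \<le> 2 * C * (1 / 2) ^ n" for y n
    using lim_bound[OF l0, of y "g y" n] g by simp
  have gcont: "continuous_on UNIV g"
  proof (rule uniform_limit_theorem)
    show "uniform_limit UNIV (\<lambda>n. PV n h) g sequentially"
      unfolding uniform_limit_iff
    proof (intro allI impI)
      fix e :: real assume "e > 0"
      show "\<forall>\<^sub>F n in sequentially. \<forall>x\<in>UNIV. dist (PV n h x) (g x) < e"
        using order_tendstoD(2)[OF half[of "2 * C"] \<open>e > 0\<close>]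
      proof eventually_elim
        case (elim n)
        have "dist (PV n h x) (g x) < e" for x
          using gb[of x n] elim unfolding dist_real_def by linarith
        then show ?case by blast
      qed
    qed
    show "\<forall>\<^sub>F n in sequentially. continuous_on UNIV (PV n h)"
      using VL.cs_P[OF csh] cs_continuous by (intro always_eventually) auto
  qed auto
  obtain b where b: "\<And>y. b < norm y \<Longrightarrow> h y = 0" using csh unfolding cs_def by blast
  define b' where "b' = \<bar>b\<bar> + 2 * R"
  have Pz: "PV n h y = 0" if "b' < norm y" for n y
    using PV_support(1)[of "\<bar>b\<bar>" h y n] b that by (auto simp: b'_def)
  have gz: "g y = 0" if "b' < norm y" for y
    using g[of y] Pz[OF that] by (simp add: LIMSEQ_const_iff)
  have csg: "cs g" using gcont gz by (rule csI)
  define D where "D y = h y - g y" for y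
  have csD: "cs D" unfolding D_def using csh csg by (rule cs_diff)
  \<comment> \<open>The error splits into \<open>h - PV n h\<close>, small in \<open>L2\<close> by
    density, and \<open>PV n h - g\<close>, uniformly small and supported in a fixed ball.\<close>
  have "(\<integral>y. D y * D y \<partial>lborel) \<le> e" if e: "e > 0" for e
  proof -
    obtain n0 where n0: "\<And>n. n \<ge> n0 \<Longrightarrow> L2_inner (\<lambda>x. h x - PV n h x) (\<lambda>x. h x - PV n h x) < e / 4"
      using PV_tendsto[OF csh, of "e / 4"] e by auto
    define L where "L = measure lborel (cball (0::real^'d) b')"
    have "(\<lambda>n. (2 * C * (1 / 2) ^ n)\<^sup>2 * L) \<longlonglongrightarrow> 0\<^sup>2 * L" by (intro tendsto_intros half)
    then have "\<forall>\<^sub>F n in sequentially. (2 * C * (1 / 2) ^ n)\<^sup>2 * L < e / 4"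
      using e by (intro order_tendstoD(2)) auto
    then obtain n1 where n1: "\<And>n. n \<ge> n1 \<Longrightarrow> (2 * C * (1 / 2) ^ n)\<^sup>2 * L < e / 4"
      by (auto simp: eventually_sequentially)
    define n where "n = max n0 n1"
    define E1 where "E1 y = h y - PV n h y" for y
    define E2 where "E2 y = PV n h y - g y" for y
    have cE: "cs E1" "cs E2" unfolding E1_def E2_def using csh csg VL.cs_P[OF csh] by (auto intro: cs_diff)
    have i: "integrable lborel (\<lambda>y. E1 y * E1 y)" "integrable lborel (\<lambda>y. E2 y * E2 y)" "integrable lborel (\<lambda>y. D y * D y)"
      using cE csD by (auto intro!: cs_integrable cs_mult dest: cs_continuous)
    have "(\<integral>y. D y * D y \<partial>lborel) \<le> (\<integral>y. 2 * (E1 y * E1 y) + 2 * (E2 y * E2 y) \<partial>lborel)"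
    proof (rule integral_mono)
      fix y
      have "D y = E1 y + E2 y" by (simp add: D_def E1_def E2_def)
      moreover have "(a + b) * (a + b) \<le> 2 * (a * a) + 2 * (b * b)" for a b :: real
        using zero_le_square[of "a - b"] by (simp add: algebra_simps)
      ultimately show "D y * D y \<le> 2 * (E1 y * E1 y) + 2 * (E2 y * E2 y)" by simp
    qed (use i in auto)
    also have "\<dots> = 2 * (\<integral>y. E1 y * E1 y \<partial>lborel) + 2 * (\<integral>y. E2 y * E2 y \<partial>lborel)" using i by simp
    also have "(\<integral>y. E1 y * E1 y \<partial>lborel) \<le> e / 4"
      using n0[of n] by (simp add: L2_inner_def E1_def n_def)
    also have "(\<integral>y. E2 y * E2 y \<partial>lborel) \<le> e / 4"
    proof -
      have "\<bar>\<integral>y. E2 y * E2 y \<partial>lborel\<bar> \<le> (2 * C * (1 / 2) ^ n)\<^sup>2 * measure lborel (cball (0::real^'d) b')"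
      proof (rule cs_integral_bound)
        show "cs (\<lambda>y. E2 y * E2 y)" using cE by (auto intro: cs_mult dest: cs_continuous)
        show "\<bar>E2 y * E2 y\<bar> \<le> (2 * C * (1 / 2) ^ n)\<^sup>2" for y
        proof -
          have "\<bar>E2 y\<bar> \<le> 2 * C * (1 / 2) ^ n" using gb[of y n] by (simp add: E2_def abs_minus_commute)
          then show ?thesis unfolding power2_eq_square abs_mult by (intro mult_mono) (use C in auto)
        qed
        show "E2 y * E2 y = 0" if "b' < norm (y - 0)" for y using that Pz gz by (simp add: E2_def)
      qed
      then show ?thesis using n1[of n] by (simp add: L_def n_def)
    qed
    finally show ?thesis by simp
  qed
  then have "(\<integral>y. D y * D y \<partial>lborel) \<le> 0" by - (rule field_le_epsilon, simp only: add_0)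
  moreover have "0 \<le> (\<integral>y. D y * D y \<partial>lborel)" by simp
  ultimately have "D y = 0" for y by (intro cs_square_zero[OF csD]) linarith
  then have gh: "g = h" by (auto simp: D_def)
  have main: "length js < r \<Longrightarrow> (\<lambda>m. partials js (PV m h) y) \<longlonglongrightarrow> partials js h y" for js y
  proof (induction js arbitrary: y)
    case Nil
    then show ?case using g gh by simp
  next
    case (Cons i js)
    have js: "length js < r" using Cons.prems by simp
    define q where "q y = lim (\<lambda>m. partials (i # js) (PV m h) y)" for y
    have q: "(\<lambda>m. partials (i # js) (PV m h) y) \<longlonglongrightarrow> q y" for y
      using conv[OF Cons.prems, of y] unfolding q_def by (simp add: convergent_LIMSEQ_iff)
    let ?f = "\<lambda>n t. partials js (PV n h) (y + t *\<^sub>R axis i 1)"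
    \<comment> \<open>Along the line through \<open>y\<close> in direction \<open>i\<close>, uniform
      convergence of the derivatives identifies their limit \<open>q\<close> as the derivative of
      the limit.\<close>
    have "\<exists>G. \<forall>t\<in>UNIV. (\<lambda>n. ?f n t) \<longlonglongrightarrow> G t \<and>
        (G has_derivative (\<lambda>h. q (y + t *\<^sub>R axis i 1) * h)) (at t within UNIV)"
    proof (rule has_derivative_sequence)
      show "((\<lambda>t. ?f n t) has_derivative (\<lambda>h'. partials (i # js) (PV n h) (y + t *\<^sub>R axis i 1) * h')) (at t within UNIV)" for n t
        using partial_DERIV[of "partials js (PV n h)" y t i] partials_differentiable[OF C_on_P(1)[OF csh] js]
        by (simp add: has_field_derivative_def)
      show "\<forall>\<^sub>F n in sequentially. \<forall>t\<in>UNIV. \<forall>h'. norm (partials (i # js) (PV n h) (y + t *\<^sub>R axis i 1) * h' - q (y + t *\<^sub>R axis i 1) * h') \<le> e * norm h'"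
        if "e > 0" for e
        using order_tendstoD(2)[OF half[of "2 * C"] that]
      proof eventually_elim
        case (elim n)
        show ?case
        proof (intro ballI allI)
          fix t h' :: real
          have "\<bar>partials (i # js) (PV n h) (y + t *\<^sub>R axis i 1) - q (y + t *\<^sub>R axis i 1)\<bar> \<le> e"
            using lim_bound[OF Cons.prems q, of "y + t *\<^sub>R axis i 1" n] elim by (simp add: abs_minus_commute)
          then show "norm (partials (i # js) (PV n h) (y + t *\<^sub>R axis i 1) * h' - q (y + t *\<^sub>R axis i 1) * h') \<le> e * norm h'"
            unfolding left_diff_distrib[symmetric] real_norm_def abs_mult by (rule mult_right_mono) simp
        qed
      qed
      show "(\<lambda>n. ?f n 0) \<longlonglongrightarrow> partials js h (y + 0 *\<^sub>R axis i 1)" by (rule Cons.IH[OF js])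
    qed auto
    then obtain G where G: "\<And>t. (\<lambda>n. ?f n t) \<longlonglongrightarrow> G t"
      "\<And>t. (G has_derivative (\<lambda>h. q (y + t *\<^sub>R axis i 1) * h)) (at t)" by auto
    have "G = (\<lambda>t. partials js h (y + t *\<^sub>R axis i 1))"
      using G(1) Cons.IH[OF js] LIMSEQ_unique by blast
    moreover have "(G has_real_derivative q (y + 0 *\<^sub>R axis i 1)) (at 0)"
      using G(2)[of 0] unfolding has_field_derivative_def .
    ultimately have "partials (i # js) h y = q y"
      unfolding partials.simps partial_def by (intro DERIV_imp_deriv) simp
    then show ?case using q by simp
  qed
  show ?thesis
  proof (rule that[of "2 * C"])
    show "\<bar>partials js (PV n h) y - partials js h y\<bar> \<le> 2 * C * (1 / 2) ^ n" if "length js < r" for n js y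
      using lim_bound[OF that main[OF that], of y n] by (simp add: abs_minus_commute)
  qed (use C in simp)
qed

text \<open>The mode of convergence that the weak continuity of \<open>f\<close> requires.\<close>

lemma PV_C_norm_tendsto:
  assumes h: "h \<in> Cc r UNIV"
  shows "(\<lambda>n. C_norm (r - 1) (\<lambda>x. PV n h x - h x)) \<longlonglongrightarrow> 0"
proof -
  obtain C where C: "0 \<le> C" "\<And>n js y. length js < r \<Longrightarrow>
    \<bar>partials js (PV n h) y - partials js h y\<bar> \<le> C * (1 / 2) ^ n" using PV_uniform[OF h] by blast
  have csh: "cs h" using h by (rule Cc_cs)
  let ?N = "of_nat (card {k :: 'd \<Rightarrow> nat. (\<Sum>i\<in>UNIV. k i) \<le> r - 1}) :: ennreal"
  have Cr: "C_on r UNIV (\<lambda>x. PV n h x - h x)" for n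
    using C_on_P(1)[OF csh] Cc_C_on[OF h] by (intro C_on_diff) auto
  have b: "C_norm (r - 1) (\<lambda>x. PV n h x - h x) \<le> ?N * ennreal (C * (1 / 2) ^ n)" for n
  proof (rule C_norm_le)
    fix js :: "'d list" assume "length js \<le> r - 1"
    then have js: "length js < r" using r_pos by simp
    have "continuous_on UNIV (partials js (\<lambda>x. PV n h x - h x))"
      using C_on_partials[OF Cr, of js n] js C_on_continuous by auto
    then show "partials js (\<lambda>x. PV n h x - h x) \<in> borel_measurable lborel"
      using borel_measurable_continuous_onI by auto
    show "\<bar>partials js (\<lambda>x. PV n h x - h x) y\<bar> \<le> C * (1 / 2) ^ n" for y
      using C(2)[OF js] js C_on_le[OF C_on_P(1)[OF csh]] C_on_le[OF Cc_C_on[OF h]] by (simp add: partials_diff)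
  qed
  have "(\<lambda>n. C * (1 / 2 :: real) ^ n) \<longlonglongrightarrow> 0"
    by (intro tendsto_mult_right_zero LIMSEQ_power_zero) auto
  then have "(\<lambda>n. ennreal (C * (1 / 2) ^ n)) \<longlonglongrightarrow> ennreal 0" by (rule tendsto_ennrealI)
  then have "(\<lambda>n. ?N * ennreal (C * (1 / 2) ^ n)) \<longlonglongrightarrow> ?N * ennreal 0"
    by (intro ennreal_tendsto_cmult of_nat_less_top)
  then have lim: "(\<lambda>n. ?N * ennreal (C * (1 / 2) ^ n)) \<longlonglongrightarrow> 0" by simp
  show ?thesis
    by (rule tendsto_sandwich[OF _ _ tendsto_const lim]) (use b in auto)
qed

end

section \<open>Lebesgue norms\<close>

lemma enn_powr_ennreal: "0 \<le> t \<Longrightarrow> enn_powr (ennreal t) a = ennreal (t powr a)"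
  by (simp add: enn_powr_def)

lemma enn_powr_top [simp]: "enn_powr \<top> a = \<top>"
  by (simp add: enn_powr_def)

lemma enn_powr_0 [simp]: "enn_powr 0 a = 0"
  by (simp add: enn_powr_def)

lemma enn_powr_mono: "0 \<le> a \<Longrightarrow> x \<le> y \<Longrightarrow> enn_powr x a \<le> enn_powr y a"
  by (cases x rule: ennreal_cases; cases y rule: ennreal_cases)
     (auto simp: enn_powr_ennreal top_unique intro!: ennreal_leI powr_mono2)

lemma enn_powr_powr: "0 < a \<Longrightarrow> 0 < b \<Longrightarrow> enn_powr (enn_powr x a) b = enn_powr x (a * b)"
  by (cases x rule: ennreal_cases) (auto simp: enn_powr_ennreal powr_powr)

lemma enn_powr_1 [simp]: "enn_powr x 1 = x"
  by (cases x rule: ennreal_cases) (auto simp: enn_powr_ennreal)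

lemma enn_powr_le_imp: "0 < a \<Longrightarrow> 0 \<le> c \<Longrightarrow> x \<le> ennreal (c powr a) \<Longrightarrow> enn_powr x (1 / a) \<le> ennreal c"
  using enn_powr_mono[of "1 / a" x "ennreal (c powr a)"] by (simp add: enn_powr_ennreal powr_powr)

lemma enn_powr_measurable [measurable]: "(\<lambda>x. enn_powr x a) \<in> borel_measurable borel"
  unfolding enn_powr_def by measurable

lemma eLp_norm_mono:
  assumes "\<And>x. g x \<le> h x" "g \<in> borel_measurable M"
  shows "eLp_norm M P g \<le> eLp_norm M P h"
  unfolding eLp_norm_def using assms
  by (auto intro!: esssup_mono enn_powr_mono nn_integral_mono)

lemma enn2real_ge_1: "1 \<le> P \<Longrightarrow> P \<noteq> \<top> \<Longrightarrow> 1 \<le> enn2real P"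
  using enn2real_mono[of 1 P] by (simp add: top.not_eq_extremum)

text \<open>Convexity up to the boundary of the half-line: if one argument is 0, the claim reduces
  to \<open>s powr p \<le> s\<close> on the unit interval.\<close>

lemma powr_convex_combination:
  fixes x y t p :: real
  assumes "1 \<le> p" "0 \<le> x" "0 \<le> y" "0 \<le> t" "t \<le> 1"
  shows "((1 - t) * x + t * y) powr p \<le> (1 - t) * x powr p + t * y powr p"
proof -
  have s: "s powr p \<le> s" if "0 \<le> s" "s \<le> 1" for s :: real
    using powr_mono'[of 1 p s] that assms by simp
  consider "x = 0" | "y = 0" | "0 < x" "0 < y" using assms by linarith
  then show ?thesis
  proof cases
    case 1
    then show ?thesis using s[of t] assms by (simp add: powr_mult mult_right_mono)
  next
    case 2
    then show ?thesis using s[of "1 - t"] assms by (simp add: powr_mult mult_right_mono)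
  next
    case 3
    then show ?thesis using convex_onD[OF powr_convex[OF assms(1)], of t x y] assms by simp
  qed
qed

text \<open>For positive bounds \<open>a\<close> and \<open>b\<close> of the two norms, the sum is
  \<open>a + b\<close> times a convex combination of \<open>g / a\<close> and \<open>h / b\<close>.
  Convexity of the power is applied pointwise with the weights \<open>a / (a + b)\<close> and
  \<open>b / (a + b)\<close>, and then integrated.\<close>

lemma Minkowski:
  fixes g h :: "'a \<Rightarrow> ennreal"
  assumes P: "1 \<le> P" and [measurable]: "g \<in> borel_measurable M" "h \<in> borel_measurable M"
  shows "eLp_norm M P (\<lambda>x. g x + h x) \<le> eLp_norm M P g + eLp_norm M P h"
proof (cases "P = \<top>")
  case True
  have "AE x in M. g x + h x \<le> esssup M g + esssup M h"
    using esssup_AE[of g M] esssup_AE[of h M] by eventually_elim (rule add_mono)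
  then show ?thesis using True by (auto simp: eLp_norm_def intro!: esssup_I)
next
  case False
  define p where "p = enn2real P"
  have p: "1 \<le> p" unfolding p_def using P False by (rule enn2real_ge_1)
  let ?N = "\<lambda>g. enn_powr (\<integral>\<^sup>+x. enn_powr (g x) p \<partial>M) (1 / p)"
  have fin: "?N (\<lambda>x. g x + h x) \<le> ennreal (a + b)"
    if ab: "0 < a" "0 < b" "?N g \<le> ennreal a" "?N h \<le> ennreal b" for a b
  proof -
    \<comment> \<open>The coefficients are such that \<open>c1 * a powr p + c2 * b powr p\<close> is
      exactly \<open>(a + b) powr p\<close>.\<close>
    define c1 where "c1 = (a + b) powr p * (a / (a + b)) / a powr p"
    define c2 where "c2 = (a + b) powr p * (b / (a + b)) / b powr p"
    have c: "0 < c1" "0 < c2" using ab by (auto simp: c1_def c2_def)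
    have conv: "(u + v) powr p \<le> c1 * u powr p + c2 * v powr p" if "0 \<le> u" "0 \<le> v" for u v
    proof -
      have t: "1 - b / (a + b) = a / (a + b)" using ab by (simp add: field_simps)
      have "(a / (a + b) * (u / a) + b / (a + b) * (v / b)) powr p
          \<le> a / (a + b) * (u / a) powr p + b / (a + b) * (v / b) powr p"
        using powr_convex_combination[OF p, of "u / a" "v / b" "b / (a + b)"] that ab unfolding t by simp
      also have "a / (a + b) * (u / a) + b / (a + b) * (v / b) = (u + v) / (a + b)"
        using ab by (simp add: add_divide_distrib)
      finally have "(u + v) powr p \<le> (a + b) powr p * (a / (a + b) * (u / a) powr p + b / (a + b) * (v / b) powr p)"
        using that ab by (simp add: powr_divide field_simps)
      also have "\<dots> = c1 * u powr p + c2 * v powr p"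
        using that ab by (simp add: c1_def c2_def powr_divide distrib_left)
      finally show ?thesis .
    qed
    have pw: "enn_powr (g x + h x) p \<le> ennreal c1 * enn_powr (g x) p + ennreal c2 * enn_powr (h x) p" for x
    proof (cases "g x = \<top> \<or> h x = \<top>")
      case True
      then show ?thesis using c by (auto simp: ennreal_mult_top)
    next
      case False
      then obtain u v where uv: "g x = ennreal u" "h x = ennreal v" "0 \<le> u" "0 \<le> v"
        by (metis ennreal_cases)
      then show ?thesis using conv[of u v] c
        by (simp add: enn_powr_ennreal ennreal_leI flip: ennreal_plus ennreal_mult)
    qed
    have I: "(\<integral>\<^sup>+x. enn_powr (k x) p \<partial>M) \<le> ennreal (t powr p)" if "?N k \<le> ennreal t" "0 < t" for k t
      using enn_powr_mono[OF _ that(1), of p] p that(2) by (simp add: enn_powr_powr enn_powr_ennreal)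
    have "(\<integral>\<^sup>+x. enn_powr (g x + h x) p \<partial>M) \<le> (\<integral>\<^sup>+x. ennreal c1 * enn_powr (g x) p + ennreal c2 * enn_powr (h x) p \<partial>M)"
      by (intro nn_integral_mono pw)
    also have "\<dots> = ennreal c1 * (\<integral>\<^sup>+x. enn_powr (g x) p \<partial>M) + ennreal c2 * (\<integral>\<^sup>+x. enn_powr (h x) p \<partial>M)"
      by (subst nn_integral_add) (auto simp: nn_integral_cmult)
    also have "\<dots> \<le> ennreal c1 * ennreal (a powr p) + ennreal c2 * ennreal (b powr p)"
      by (intro add_mono mult_left_mono I ab) auto
    also have "\<dots> = ennreal (c1 * a powr p + c2 * b powr p)"
      using c by (simp flip: ennreal_plus ennreal_mult)
    also have "c1 * a powr p + c2 * b powr p = (a + b) powr p * (a / (a + b) + b / (a + b))"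
      using ab by (simp add: c1_def c2_def distrib_left)
    also have "a / (a + b) + b / (a + b) = 1" using ab by (simp flip: add_divide_distrib)
    finally show ?thesis using p ab by (intro enn_powr_le_imp) auto
  qed
  have "?N (\<lambda>x. g x + h x) \<le> ?N g + ?N h"
  proof (cases "?N g = \<top> \<or> ?N h = \<top>")
    case False
    then obtain a b where ab: "?N g = ennreal a" "?N h = ennreal b" "0 \<le> a" "0 \<le> b"
      by (metis ennreal_cases)
    have "?N (\<lambda>x. g x + h x) \<le> ennreal (a + b)"
    proof (rule ennreal_le_epsilon)
      fix e :: real assume e: "0 < e"
      \<comment> \<open>Half of \<open>e\<close> on each side keeps the bounds positive when a norm
        is 0.\<close>
      have "?N (\<lambda>x. g x + h x) \<le> ennreal ((a + e / 2) + (b + e / 2))"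
        using ab e by (intro fin) (auto intro: ennreal_leI)
      also have "\<dots> = ennreal (a + b) + ennreal e"
        using ab e by (simp flip: ennreal_plus)
      finally show "?N (\<lambda>x. g x + h x) \<le> ennreal (a + b) + ennreal e" .
    qed
    then show ?thesis using ab by simp
  qed auto
  then show ?thesis using False by (simp add: eLp_norm_def p_def)
qed

lemma Lp_norm_add:
  assumes P: "1 \<le> P" and [measurable]: "f \<in> borel_measurable M" "g \<in> borel_measurable M"
  shows "Lp_norm M P (\<lambda>x. f x + g x) \<le> Lp_norm M P f + Lp_norm M P g"
proof -
  have "Lp_norm M P (\<lambda>x. f x + g x) \<le> eLp_norm M P (\<lambda>x. ennreal \<bar>f x\<bar> + ennreal \<bar>g x\<bar>)"
    unfolding Lp_norm_def
    by (rule eLp_norm_mono) (auto simp flip: ennreal_plus intro!: ennreal_leI)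
  also have "\<dots> \<le> Lp_norm M P f + Lp_norm M P g"
    unfolding Lp_norm_def by (rule Minkowski[OF P]) measurable
  finally show ?thesis .
qed

lemma Lp_norm_uminus: "Lp_norm M P (\<lambda>x. - f x) = Lp_norm M P f"
  by (simp add: Lp_norm_def)

lemma Lp_norm_cong_AE:
  assumes [measurable]: "f \<in> borel_measurable M" "g \<in> borel_measurable M" and e: "AE x in M. f x = g x"
  shows "Lp_norm M P f = Lp_norm M P g"
proof -
  have e': "AE x in M. ennreal \<bar>f x\<bar> = ennreal \<bar>g x\<bar>" using e by eventually_elim simp
  have "esssup M (\<lambda>x. ennreal \<bar>f x\<bar>) = esssup M (\<lambda>x. ennreal \<bar>g x\<bar>)"
  proof (rule antisym)
    show "esssup M (\<lambda>x. ennreal \<bar>f x\<bar>) \<le> esssup M (\<lambda>x. ennreal \<bar>g x\<bar>)"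
      using e' by (intro esssup_AE_mono) (auto elim: eventually_mono)
    show "esssup M (\<lambda>x. ennreal \<bar>g x\<bar>) \<le> esssup M (\<lambda>x. ennreal \<bar>f x\<bar>)"
      using e' by (intro esssup_AE_mono) (auto elim: eventually_mono)
  qed
  moreover have "(\<integral>\<^sup>+x. enn_powr (ennreal \<bar>f x\<bar>) a \<partial>M) = (\<integral>\<^sup>+x. enn_powr (ennreal \<bar>g x\<bar>) a \<partial>M)" for a
    using e' by (intro nn_integral_cong_AE) (auto elim: eventually_mono)
  ultimately show ?thesis by (simp add: Lp_norm_def eLp_norm_def)
qed

text \<open>Every norm of exponent \<open>Q\<close> lies between the supremum and the sum. With this
  lemma and \<open>entry_le_lq\<close>, geometric estimates over the levels hold for all
  \<open>Q\<close> at once.\<close>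

lemma lq_le_l1:
  fixes u :: "nat \<Rightarrow> ennreal"
  assumes Q: "1 \<le> Q"
  shows "eLp_norm (count_space UNIV) Q u \<le> (\<Sum>n. u n)"
proof (cases "Q = \<top>")
  case True
  have "u n \<le> (\<Sum>n. u n)" for n using sum_le_suminf[of u "{n}"] by simp
  then show ?thesis using True by (auto simp: eLp_norm_def intro!: esssup_I)
next
  case False
  define q where "q = enn2real Q"
  have q: "1 \<le> q" unfolding q_def using Q False by (rule enn2real_ge_1)
  show ?thesis
  proof (cases "(\<Sum>n. u n) = \<top>")
    case False
    then obtain S where S: "(\<Sum>n. u n) = ennreal S" "0 \<le> S" by (metis ennreal_cases)
    have uS: "u n \<le> ennreal S" for n using sum_le_suminf[of u "{n}"] S by simp
    have "enn_powr (u n) q \<le> ennreal (S powr (q - 1)) * u n" for n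
    proof -
      obtain t where t: "u n = ennreal t" "0 \<le> t" "t \<le> S"
        using uS[of n] S(2) by (cases "u n" rule: ennreal_cases) (auto simp: top_unique)
      have "t powr q = t powr (q - 1) * t" using t(2) by (cases "t = 0") (auto simp: powr_diff)
      also have "\<dots> \<le> S powr (q - 1) * t" using t q by (intro mult_right_mono powr_mono2) auto
      finally show ?thesis using t by (simp add: enn_powr_ennreal ennreal_leI flip: ennreal_mult)
    qed
    then have "(\<Sum>n. enn_powr (u n) q) \<le> (\<Sum>n. ennreal (S powr (q - 1)) * u n)"
      by (intro suminf_le) auto
    also have "\<dots> = ennreal (S powr (q - 1) * S)" using S by (simp add: ennreal_mult)
    also have "S powr (q - 1) * S = S powr q" using S(2) by (cases "S = 0") (auto simp: powr_diff)
    finally have "enn_powr (\<Sum>n. enn_powr (u n) q) (1 / q) \<le> ennreal S"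
      using q S by (intro enn_powr_le_imp) auto
    then show ?thesis using \<open>Q \<noteq> \<top>\<close> S by (simp add: eLp_norm_def q_def nn_integral_count_space_nat)
  qed auto
qed

lemma entry_le_lq:
  fixes u :: "nat \<Rightarrow> ennreal"
  assumes Q: "1 \<le> Q"
  shows "u n \<le> eLp_norm (count_space UNIV) Q u"
proof (cases "Q = \<top>")
  case True
  have "AE n in count_space UNIV. u n \<le> esssup (count_space UNIV) u" by (rule esssup_AE)
  then show ?thesis using True by (simp add: eLp_norm_def AE_count_space)
next
  case False
  define q where "q = enn2real Q"
  have q: "1 \<le> q" unfolding q_def using Q False by (rule enn2real_ge_1)
  have "enn_powr (u n) q \<le> (\<Sum>n. enn_powr (u n) q)" using sum_le_suminf[of "\<lambda>n. enn_powr (u n) q" "{n}"] by simp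
  then have "enn_powr (enn_powr (u n) q) (1 / q) \<le> enn_powr (\<Sum>n. enn_powr (u n) q) (1 / q)"
    using q by (intro enn_powr_mono) auto
  then show ?thesis using False q by (simp add: eLp_norm_def q_def[symmetric] nn_integral_count_space_nat enn_powr_powr)
qed

lemma lq_const_mult_le:
  fixes u :: "nat \<Rightarrow> ennreal"
  assumes Q: "1 \<le> Q" and "\<And>n. u n \<le> ennreal (c * b n)" "0 \<le> c" "\<And>n. 0 \<le> b n" "summable b"
  shows "eLp_norm (count_space UNIV) Q u \<le> ennreal (c * suminf b)"
proof -
  have "eLp_norm (count_space UNIV) Q u \<le> (\<Sum>n. u n)" using Q by (rule lq_le_l1)
  also have "\<dots> \<le> (\<Sum>n. ennreal (c * b n))" using assms(2) by (intro suminf_le) auto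
  also have "\<dots> = ennreal (\<Sum>n. c * b n)"
    using assms by (intro suminf_ennreal2 summable_mult) auto
  also have "(\<Sum>n. c * b n) = c * suminf b" using assms(5) by (rule suminf_mult)
  finally show ?thesis .
qed

text \<open>One plus the volume of the ball dominates the \<open>1 / p\<close>-th power of the
  volume for every exponent, so the constant does not depend on \<open>P\<close>.\<close>

lemma Lp_norm_bounded_support:
  fixes u :: "real^'d::finite \<Rightarrow> real"
  assumes P: "1 \<le> P" and [measurable]: "u \<in> borel_measurable lborel"
    and B: "\<And>y. \<bar>u y\<bar> \<le> B" and z: "\<And>y. b < norm y \<Longrightarrow> u y = 0"
  shows "Lp_norm lborel P u \<le> ennreal (B * (1 + measure lborel (cball (0::real^'d) b)))"
proof -
  let ?L = "measure lborel (cball (0::real^'d) b)"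
  have B0: "0 \<le> B" using B[of 0] by linarith
  have BL: "B \<le> B * (1 + ?L)" using B0 by (simp add: algebra_simps)
  show ?thesis
  proof (cases "P = \<top>")
    case True
    have "esssup lborel (\<lambda>x. ennreal \<bar>u x\<bar>) \<le> ennreal (B * (1 + ?L))"
      using B BL by (intro esssup_I) (auto intro!: AE_I2 ennreal_leI intro: order_trans)
    then show ?thesis using True by (simp add: Lp_norm_def eLp_norm_def)
  next
    case False
    define p where "p = enn2real P"
    have p: "1 \<le> p" unfolding p_def using P False by (rule enn2real_ge_1)
    have "(\<integral>\<^sup>+x. enn_powr (ennreal \<bar>u x\<bar>) p \<partial>lborel) \<le> (\<integral>\<^sup>+x. ennreal (B powr p) * indicator (cball (0::real^'d) b) x \<partial>lborel)"
    proof (rule nn_integral_mono)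
      fix x :: "real^'d"
      show "enn_powr (ennreal \<bar>u x\<bar>) p \<le> ennreal (B powr p) * indicator (cball 0 b) x"
        using z[of x] B[of x] p by (cases "b < norm x") (auto simp: enn_powr_ennreal indicator_def intro!: ennreal_leI powr_mono2)
    qed
    also have "\<dots> = ennreal (B powr p) * emeasure lborel (cball (0::real^'d) b)"
      by (simp add: nn_integral_cmult_indicator)
    also have "emeasure lborel (cball (0::real^'d) b) = ennreal ?L"
      using emeasure_lborel_cball_finite[of "0::real^'d" b] by (intro emeasure_eq_ennreal_measure) auto
    also have "ennreal (B powr p) * ennreal ?L \<le> ennreal ((B * (1 + ?L)) powr p)"
    proof -
      have "?L \<le> 1 + ?L" by simp
      also have "\<dots> = (1 + ?L) powr 1" by simp
      also have "\<dots> \<le> (1 + ?L) powr p" using p by (intro powr_mono) auto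
      finally show ?thesis using B0
        by (simp add: powr_mult ennreal_leI mult_left_mono flip: ennreal_mult)
    qed
    finally have "enn_powr (\<integral>\<^sup>+x. enn_powr (ennreal \<bar>u x\<bar>) p \<partial>lborel) (1 / p) \<le> ennreal (B * (1 + ?L))"
      using p B0 by (intro enn_powr_le_imp) auto
    then show ?thesis using False by (simp add: Lp_norm_def eLp_norm_def p_def)
  qed
qed

text \<open>Hoelder's inequality on a ball, again with a constant independent of the exponent. It
  rests on the pointwise bound of \<open>\<bar>u y\<bar>\<close> by \<open>l\<close> or by
  \<open>l powr (1 - p) * \<bar>u y\<bar> powr p\<close>, where \<open>l\<close> is the norm of
  \<open>u\<close>, slightly enlarged so as to be positive.\<close>

lemma L1_le_Lp:
  fixes u :: "real^'d::finite \<Rightarrow> real"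
  assumes P: "1 \<le> P" and [measurable]: "u \<in> borel_measurable lborel"
    and z: "\<And>y. b < norm y \<Longrightarrow> v y = 0" and [measurable]: "v \<in> borel_measurable lborel"
    and B: "\<And>y. \<bar>v y\<bar> \<le> B"
    and i: "integrable lborel (\<lambda>y. u y * v y)"
  shows "ennreal \<bar>\<integral>y. u y * v y \<partial>lborel\<bar> \<le> ennreal (B * (1 + measure lborel (cball (0::real^'d) b))) * Lp_norm lborel P u"
proof -
  let ?S = "cball (0::real^'d) b"
  let ?L = "measure lborel ?S"
  have B0: "0 \<le> B" using B[of 0] by linarith
  have [measurable]: "?S \<in> sets borel" by simp
  have em: "emeasure lborel ?S = ennreal ?L"
    using emeasure_lborel_cball_finite[of "0::real^'d" b] by (intro emeasure_eq_ennreal_measure) auto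
  define I where "I = (\<integral>\<^sup>+y. ennreal \<bar>u y\<bar> * indicator ?S y \<partial>lborel)"
  have I: "I \<le> ennreal (1 + ?L) * Lp_norm lborel P u"
  proof (cases "P = \<top>")
    case True
    have "AE y in lborel. ennreal \<bar>u y\<bar> \<le> Lp_norm lborel P u"
      using esssup_AE[of "\<lambda>y. ennreal \<bar>u y\<bar>" lborel] True by (simp add: Lp_norm_def eLp_norm_def)
    then have "I \<le> (\<integral>\<^sup>+y. Lp_norm lborel P u * indicator ?S y \<partial>lborel)"
      unfolding I_def by (intro nn_integral_mono_AE) (auto elim!: eventually_mono intro: mult_right_mono)
    also have "\<dots> = Lp_norm lborel P u * ennreal ?L" by (simp add: nn_integral_cmult_indicator em)
    also have "\<dots> \<le> Lp_norm lborel P u * ennreal (1 + ?L)" by (intro mult_left_mono ennreal_leI) auto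
    finally show ?thesis by (simp add: mult.commute)
  next
    case False
    define p where "p = enn2real P"
    have p: "1 \<le> p" unfolding p_def using P False by (rule enn2real_ge_1)
    have N: "Lp_norm lborel P u = enn_powr (\<integral>\<^sup>+x. enn_powr (ennreal \<bar>u x\<bar>) p \<partial>lborel) (1 / p)"
      using False by (simp add: Lp_norm_def eLp_norm_def p_def)
    show ?thesis
    proof (cases "Lp_norm lborel P u = \<top>")
      case True
      moreover have "0 < 1 + ?L" by (simp add: add_pos_nonneg)
      then have "ennreal (1 + ?L) \<noteq> 0" by simp
      ultimately show ?thesis by (simp add: ennreal_mult_top)
    next
      case False
      then obtain a where a: "Lp_norm lborel P u = ennreal a" "0 \<le> a" by (metis ennreal_cases)
      have int: "(\<integral>\<^sup>+x. enn_powr (ennreal \<bar>u x\<bar>) p \<partial>lborel) = ennreal (a powr p)"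
      proof -
        have "enn_powr (Lp_norm lborel P u) p = (\<integral>\<^sup>+x. enn_powr (ennreal \<bar>u x\<bar>) p \<partial>lborel)"
          unfolding N using p by (simp add: enn_powr_powr)
        then show ?thesis using a by (simp add: enn_powr_ennreal)
      qed
      have main: "I \<le> ennreal ((1 + ?L) * l)" if l: "l > 0" "a \<le> l" for l
      proof -
        have "I \<le> (\<integral>\<^sup>+y. ennreal l * indicator ?S y + ennreal (l powr (1 - p)) * enn_powr (ennreal \<bar>u y\<bar>) p \<partial>lborel)"
          unfolding I_def
        proof (rule nn_integral_mono)
          fix y
          have "\<bar>u y\<bar> \<le> l \<or> \<bar>u y\<bar> \<le> l powr (1 - p) * \<bar>u y\<bar> powr p"
          proof (rule disjCI)
            assume "\<not> \<bar>u y\<bar> \<le> l powr (1 - p) * \<bar>u y\<bar> powr p"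
            show "\<bar>u y\<bar> \<le> l"
            proof (rule ccontr)
              assume "\<not> \<bar>u y\<bar> \<le> l"
              then have "1 \<le> \<bar>u y\<bar> / l" using l by simp
              then have "(\<bar>u y\<bar> / l) powr 1 \<le> (\<bar>u y\<bar> / l) powr p" using p by (intro powr_mono) auto
              then have "l * (\<bar>u y\<bar> / l) \<le> l * (\<bar>u y\<bar> powr p / l powr p)"
                using l by (intro mult_left_mono) (auto simp: powr_divide)
              then have "\<bar>u y\<bar> \<le> l powr (1 - p) * \<bar>u y\<bar> powr p"
                using l by (simp add: powr_diff)
              with \<open>\<not> \<bar>u y\<bar> \<le> l powr (1 - p) * \<bar>u y\<bar> powr p\<close> show False ..
            qed
          qed
          then show "ennreal \<bar>u y\<bar> * indicator ?S y \<le> ennreal l * indicator ?S y + ennreal (l powr (1 - p)) * enn_powr (ennreal \<bar>u y\<bar>) p"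
          proof
            assume "\<bar>u y\<bar> \<le> l"
            then show ?thesis by (auto simp: indicator_def intro!: add_increasing2 ennreal_leI)
          next
            assume "\<bar>u y\<bar> \<le> l powr (1 - p) * \<bar>u y\<bar> powr p"
            then have "ennreal \<bar>u y\<bar> \<le> ennreal (l powr (1 - p)) * enn_powr (ennreal \<bar>u y\<bar>) p"
              by (simp add: enn_powr_ennreal ennreal_leI flip: ennreal_mult)
            then show ?thesis by (auto simp: indicator_def intro: add_increasing)
          qed
        qed
        also have "\<dots> = ennreal l * ennreal ?L + ennreal (l powr (1 - p)) * ennreal (a powr p)"
          by (subst nn_integral_add) (auto simp: nn_integral_cmult nn_integral_cmult_indicator em int)
        also have "\<dots> = ennreal (l * ?L + l powr (1 - p) * a powr p)"
          using l by (simp flip: ennreal_mult ennreal_plus)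
        also have "\<dots> \<le> ennreal ((1 + ?L) * l)"
        proof (rule ennreal_leI)
          have "l powr (1 - p) * a powr p \<le> l powr (1 - p) * l powr p"
            using l a(2) p by (intro mult_left_mono powr_mono2) auto
          also have "\<dots> = l" using l by (simp flip: powr_add)
          finally show "l * ?L + l powr (1 - p) * a powr p \<le> (1 + ?L) * l" by (simp add: algebra_simps)
        qed
        finally show ?thesis .
      qed
      have "I \<le> ennreal ((1 + ?L) * a)"
      proof (rule ennreal_le_epsilon)
        fix e :: real assume e: "0 < e"
        have L1: "0 < 1 + ?L" by (simp add: add_pos_nonneg)
        have "I \<le> ennreal ((1 + ?L) * (a + e / (1 + ?L)))" using e a(2) L1 by (intro main) (auto simp: add_nonneg_pos)
        also have "(1 + ?L) * (a + e / (1 + ?L)) = (1 + ?L) * a + e" using L1 by (simp add: distrib_left)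
        also have "ennreal \<dots> = ennreal ((1 + ?L) * a) + ennreal e" using a(2) e L1 by (intro ennreal_plus) auto
        finally show "I \<le> ennreal ((1 + ?L) * a) + ennreal e" .
      qed
      then show ?thesis using a by (simp add: ennreal_mult)
    qed
  qed
  have "ennreal \<bar>\<integral>y. u y * v y \<partial>lborel\<bar> \<le> (\<integral>\<^sup>+y. ennreal \<bar>u y * v y\<bar> \<partial>lborel)"
    using integral_norm_bound_ennreal[OF i] by simp
  also have "\<dots> \<le> (\<integral>\<^sup>+y. ennreal B * (ennreal \<bar>u y\<bar> * indicator ?S y) \<partial>lborel)"
  proof (rule nn_integral_mono)
    fix y
    show "ennreal \<bar>u y * v y\<bar> \<le> ennreal B * (ennreal \<bar>u y\<bar> * indicator ?S y)"
    proof (cases "b < norm y")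
      case False
      have "\<bar>u y * v y\<bar> \<le> B * \<bar>u y\<bar>" using mult_right_mono[OF B[of y], of "\<bar>u y\<bar>"] by (simp add: abs_mult mult.commute)
      then show ?thesis using False B0 by (simp add: indicator_def ennreal_leI flip: ennreal_mult)
    qed (use z in simp)
  qed
  also have "\<dots> = ennreal B * I" unfolding I_def by (rule nn_integral_cmult) measurable
  also have "\<dots> \<le> ennreal B * (ennreal (1 + ?L) * Lp_norm lborel P u)" using I by (rule mult_left_mono) simp
  also have "\<dots> = ennreal (B * (1 + ?L)) * Lp_norm lborel P u" using B0 by (simp add: ennreal_mult mult.assoc)
  finally show ?thesis .
qed

section \<open>Besov norms\<close>

context layer
begin

lemma proj_in: assumes h: "cs h" shows "L2_proj (S n) h \<in> S n"
proof -
  have "L2_proj (S n) h \<in> S n \<and> (\<forall>v\<in>S n. L2_inner (\<lambda>x. h x - L2_proj (S n) h x) v = 0)"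
    unfolding L2_proj_def by (rule someI[where x="P n h"]) (use P_in_S[OF h] P_orth[OF h] in auto)
  then show ?thesis by blast
qed

lemma Lp_norm_proj: assumes h: "cs h" shows "Lp_norm lborel p (L2_proj (S n) h) = Lp_norm lborel p (P n h)"
proof (rule Lp_norm_cong_AE)
  show "L2_proj (S n) h \<in> borel_measurable lborel" using proj_in[OF h] S_L2 L2_measurable by blast
  show "P n h \<in> borel_measurable lborel" using cs_P[OF h] by (rule cs_measurable)
qed (rule proj_AE[OF h])

lemma P_add: "h \<in> L2 \<Longrightarrow> g \<in> L2 \<Longrightarrow> P n (\<lambda>x. h x + g x) y = P n h y + P n g y"
  using P_kern[of h n y] P_kern[of g n y] P_kern[OF L2_combine[of h g 1], of n y]
    L2_inner_add[of h g "kern n y"] cs_L2[OF cs_kern]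
  by (simp add: L2_inner_commute[of "kern n y"])

lemma P_uminus: "P n (\<lambda>x. - h x) y = - P n h y"
  by (simp add: P_def L2_inner_def sum_negf)

end

context wavelets
begin

text \<open>Replaces the chosen \<open>L2\<close> projections, which are determined only almost
  everywhere, by the explicit sums.\<close>

lemma besov_eq:
  assumes h: "cs h"
  shows "besov_norm V \<alpha> P Q h = Lp_norm lborel P (PV 0 h) +
     eLp_norm (count_space UNIV) Q (\<lambda>n. ennreal (2 powr (\<alpha> * real n)) * Lp_norm lborel P (PW n h))"
  using VL.Lp_norm_proj[OF h, of P 0] by (simp add: besov_norm_def WL.Lp_norm_proj[OF h])

lemma besov_add:
  assumes P: "1 \<le> P" and Q: "1 \<le> Q" and h: "cs h" and g: "cs g"
  shows "besov_norm V \<alpha> P Q (\<lambda>x. h x + g x) \<le> besov_norm V \<alpha> P Q h + besov_norm V \<alpha> P Q g"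
proof -
  have hg: "cs (\<lambda>x. h x + g x)" using h g by (rule cs_add)
  have L: "h \<in> L2" "g \<in> L2" using h g cs_L2 by auto
  have a: "PV 0 (\<lambda>x. h x + g x) = (\<lambda>y. PV 0 h y + PV 0 g y)" "PW n (\<lambda>x. h x + g x) = (\<lambda>y. PW n h y + PW n g y)" for n
    using VL.P_add[OF L] WL.P_add[OF L] by auto
  have m: "PV n h \<in> borel_measurable lborel" "PV n g \<in> borel_measurable lborel"
      "PW n h \<in> borel_measurable lborel" "PW n g \<in> borel_measurable lborel" for n
    using h g VL.cs_P WL.cs_P cs_measurable by blast+
  let ?u = "\<lambda>h n. ennreal (2 powr (\<alpha> * real n)) * Lp_norm lborel P (PW n h)"
  have "eLp_norm (count_space UNIV) Q (?u (\<lambda>x. h x + g x)) \<le> eLp_norm (count_space UNIV) Q (\<lambda>n. ?u h n + ?u g n)"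
    unfolding a
    by (rule eLp_norm_mono) (auto simp flip: distrib_left intro!: mult_left_mono Lp_norm_add[OF P] m)
  also have "\<dots> \<le> eLp_norm (count_space UNIV) Q (?u h) + eLp_norm (count_space UNIV) Q (?u g)"
    by (rule Minkowski[OF Q]) auto
  finally have 1: "eLp_norm (count_space UNIV) Q (?u (\<lambda>x. h x + g x)) \<le> \<dots>" .
  have 2: "Lp_norm lborel P (PV 0 (\<lambda>x. h x + g x)) \<le> Lp_norm lborel P (PV 0 h) + Lp_norm lborel P (PV 0 g)"
    unfolding a by (rule Lp_norm_add[OF P m(1,2)])
  show ?thesis unfolding besov_eq[OF h] besov_eq[OF g] besov_eq[OF hg]
    using add_mono[OF 2 1] by (simp add: add_ac)
qed

lemma besov_uminus:
  assumes h: "cs h" shows "besov_norm V \<alpha> P Q (\<lambda>x. - h x) = besov_norm V \<alpha> P Q h"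
proof -
  have h': "cs (\<lambda>x. - h x)" using cs_cmult[OF h, of "-1"] by simp
  have "PV 0 (\<lambda>x. - h x) = (\<lambda>y. - PV 0 h y)" "PW n (\<lambda>x. - h x) = (\<lambda>y. - PW n h y)" for n
    using VL.P_uminus WL.P_uminus by auto
  then show ?thesis unfolding besov_eq[OF h] besov_eq[OF h'] by (simp add: Lp_norm_uminus)
qed

lemma besov_zero: "besov_norm V \<alpha> P Q (\<lambda>x. 0) = 0" if "1 \<le> P" "1 \<le> Q"
proof -
  have z: "PV 0 (\<lambda>x. 0) = (\<lambda>y. 0)" "PW n (\<lambda>x. 0) = (\<lambda>y. 0)" for n
    by (auto simp: VL.P_def WL.P_def)
  have "Lp_norm lborel P (\<lambda>y::real^'d. 0) \<le> ennreal (0 * (1 + measure lborel (cball (0::real^'d) 0)))"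
    using that by (intro Lp_norm_bounded_support) auto
  then have "Lp_norm lborel P (\<lambda>y::real^'d. 0) = 0" by simp
  moreover have "eLp_norm (count_space UNIV) Q (\<lambda>n::nat. 0) \<le> (\<Sum>n::nat. 0)"
    using that by (intro lq_le_l1)
  ultimately show ?thesis unfolding besov_eq[OF cs_zero] z by simp
qed

lemma wav_abs: "j \<in> {0} \<union> {0<..<2 ^ CARD('d)} \<Longrightarrow> \<bar>wav (\<theta> j) n x y\<bar> \<le> Ath"
  using cbnd_abs[OF \<theta>_cbnd] by (simp add: wav_def)

lemma PV0_bound:
  assumes u: "cbnd m A s h"
  shows "\<bar>PV 0 h y\<bar> \<le> 2 ^ CARD('d) * M0 * (K0 * Ath * A * Ath)"
proof -
  have A0: "0 \<le> A" using u by (rule cbnd_nonneg)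
  show ?thesis unfolding VL.P_def
  proof (rule sum_near_bound)
    fix j :: nat and x :: "real^'d" assume j: "j \<in> {0}"
    then have j': "j \<in> {0} \<union> {0<..<2 ^ CARD('d)}" by simp
    show "\<bar>2 ^ (CARD('d) * 0) * L2_inner h (wav (\<theta> j) 0 x) * wav (\<theta> j) 0 x y\<bar> \<le> K0 * Ath * A * Ath"
      unfolding abs_mult[of "2 ^ (CARD('d) * 0) * L2_inner h (wav (\<theta> j) 0 x)"]
      using coef_bound[OF j' u, of 0 x] wav_abs[OF j'] K0_nonneg Ath_nonneg A0
      by (intro mult_mono) (auto simp: L2_inner_commute[of h])
  qed (use K0_nonneg Ath_nonneg A0 in auto)
qed

lemma PW_bound:
  assumes h: "cs h" and u: "cbnd r A 1 h"
  shows "\<bar>PW n h y\<bar> \<le> 2 ^ CARD('d) * M0 * (C0 * A * Ath) * (1 / 2 ^ n) ^ r"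
  using PW_partials[OF h u, of "[]" n y] by (simp add: power_one_over divide_inverse power_inverse)

lemma summable_pow: "\<delta> < 0 \<Longrightarrow> summable (\<lambda>n. 2 powr (\<delta> * real n))"
proof -
  assume d: "\<delta> < 0"
  have "2 powr \<delta> < 2 powr 0" using d by (intro powr_less_mono) auto
  then have "summable (\<lambda>n. (2 powr \<delta>) ^ n)" by (intro summable_geometric) simp
  then show ?thesis by (simp add: powr_powr flip: powr_realpow)
qed

lemma pow_powr: "(1 / 2 ^ n :: real) ^ m = 2 powr (- real m * real n)"
proof -
  have "2 powr (- real m * real n) = 1 / 2 powr real (n * m)" by (simp add: powr_minus divide_inverse mult.commute)
  also have "\<dots> = 1 / 2 ^ (n * m)" by (subst powr_realpow) auto
  finally show ?thesis by (simp add: power_mult power_one_over)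
qed

lemma powr_pow_mult: "2 powr (a * real n) * (1 / 2 ^ n :: real) ^ m = 2 powr ((a - real m) * real n)"
  unfolding pow_powr by (simp add: left_diff_distrib flip: powr_add)

text \<open>The layers of a C^r function decay like \<open>(1 / 2 ^ n) ^ r\<close>, which beats
  \<open>2 powr (\<alpha> * real n)\<close>. The bound is linear in \<open>A\<close>, so it controls
  the error of smooth approximations.\<close>

lemma besov_Cr:
  assumes \<alpha>: "\<alpha> < real r" and P: "1 \<le> P" and Q: "1 \<le> Q"
  obtains C where "0 \<le> C" "\<And>h A. cs h \<Longrightarrow> cbnd r A 1 h \<Longrightarrow> (\<And>y. T < norm y \<Longrightarrow> h y = 0) \<Longrightarrow>
    besov_norm V \<alpha> P Q h \<le> ennreal (C * A)"
proof -
  define L where "L = 1 + measure lborel (cball (0::real^'d) (T + 2 * R))"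
  define c1 where "c1 = 2 ^ CARD('d) * M0 * (K0 * Ath * Ath) * L"
  define c2 where "c2 = 2 ^ CARD('d) * M0 * (C0 * Ath) * L"
  define b where "b n = 2 powr ((\<alpha> - real r) * real n)" for n
  have L: "0 \<le> L" by (simp add: L_def)
  have c: "0 \<le> c1" "0 \<le> c2" using L M0_ge_1 K0_nonneg Ath_nonneg C0_nonneg by (auto simp: c1_def c2_def)
  have sb: "summable b" unfolding b_def using \<alpha> by (intro summable_pow) simp
  have b0: "0 \<le> b n" for n by (simp add: b_def)
  show ?thesis
  proof (rule that[of "c1 + c2 * suminf b"])
    show "0 \<le> c1 + c2 * suminf b" using c suminf_nonneg[OF sb b0] by simp
    fix h :: "real^'d \<Rightarrow> real" and A assume h: "cs h" and u: "cbnd r A 1 h" and z: "\<And>y. T < norm y \<Longrightarrow> h y = 0"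
    have A0: "0 \<le> A" using u by (rule cbnd_nonneg)
    have zz: "PV 0 h y = 0" if "T + 2 * R < norm y" for y
      using PV_support(1)[where h=h and b=T] z that by blast
    have 1: "Lp_norm lborel P (PV 0 h) \<le> ennreal (c1 * A)"
      using Lp_norm_bounded_support[where b="T + 2 * R", OF P cs_measurable[OF VL.cs_P[OF h]] PV0_bound[OF u] zz]
      by (simp add: c1_def L_def mult_ac)
    have 2: "ennreal (2 powr (\<alpha> * real n)) * Lp_norm lborel P (PW n h) \<le> ennreal ((c2 * A) * b n)" for n
    proof -
      have zz: "PW n h y = 0" if "T + 2 * R < norm y" for y
        using PV_support(2)[where h=h and b=T] z that by blast
      have "Lp_norm lborel P (PW n h) \<le> ennreal (c2 * A * (1 / 2 ^ n) ^ r)"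
        using Lp_norm_bounded_support[where b="T + 2 * R", OF P cs_measurable[OF WL.cs_P[OF h]] PW_bound[OF h u] zz]
        by (simp add: c2_def L_def mult_ac)
      then have "ennreal (2 powr (\<alpha> * real n)) * Lp_norm lborel P (PW n h) \<le> ennreal (2 powr (\<alpha> * real n)) * ennreal (c2 * A * (1 / 2 ^ n) ^ r)"
        by (rule mult_left_mono) simp
      also have "\<dots> = ennreal (2 powr (\<alpha> * real n) * (c2 * A * (1 / 2 ^ n) ^ r))"
        using c A0 by (simp add: ennreal_mult)
      also have "2 powr (\<alpha> * real n) * (c2 * A * (1 / 2 ^ n) ^ r) = (c2 * A) * b n"
        using powr_pow_mult[of \<alpha> n r] by (simp add: b_def)
      finally show ?thesis .
    qed
    have "eLp_norm (count_space UNIV) Q (\<lambda>n. ennreal (2 powr (\<alpha> * real n)) * Lp_norm lborel P (PW n h)) \<le> ennreal ((c2 * A) * suminf b)"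
      using lq_const_mult_le[OF Q 2 _ b0 sb] c A0 by simp
    then have "besov_norm V \<alpha> P Q h \<le> ennreal (c1 * A) + ennreal ((c2 * A) * suminf b)"
      unfolding besov_eq[OF h] using 1 by (intro add_mono)
    also have "\<dots> = ennreal ((c1 + c2 * suminf b) * A)"
      using c A0 suminf_nonneg[OF sb b0] by (simp add: algebra_simps flip: ennreal_plus)
    finally show "besov_norm V \<alpha> P Q h \<le> ennreal ((c1 + c2 * suminf b) * A)" .
  qed
qed

text \<open>Level by level, \<open>PW n h\<close> in the norm of exponent \<open>P\<close> is paired
  with \<open>PW n \<eta>\<close> in the supremum norm, whose decay \<open>(1 / 2 ^ n) ^ r\<close>
  beats the weight \<open>2 powr (- \<alpha> * real n)\<close>. This bounds the pairing with
  \<open>PV n \<eta>\<close> uniformly in \<open>n\<close>, and uniform convergence to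
  \<open>\<eta>\<close> concludes.\<close>

lemma besov_dual:
  assumes \<alpha>: "- real r < \<alpha>" and P: "1 \<le> P" and Q: "1 \<le> Q" and \<eta>: "\<eta> \<in> Cc r UNIV"
  obtains C where "0 \<le> C" "\<And>h. cs h \<Longrightarrow> ennreal \<bar>L2_inner h \<eta>\<bar> \<le> ennreal C * besov_norm V \<alpha> P Q h"
proof -
  obtain A where A: "cbnd r A 1 \<eta>" using Cc_cbnd[OF \<eta>, of 1] by auto
  have A0: "0 \<le> A" using A by (rule cbnd_nonneg)
  have cs\<eta>: "cs \<eta>" using \<eta> by (rule Cc_cs)
  obtain T where T: "\<And>y. T < norm y \<Longrightarrow> \<eta> y = 0" using cs\<eta> unfolding cs_def by blast
  define L where "L = 1 + measure lborel (cball (0::real^'d) (T + 2 * R))"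
  define c1 where "c1 = 2 ^ CARD('d) * M0 * (K0 * Ath * A * Ath) * L"
  define c2 where "c2 = 2 ^ CARD('d) * M0 * (C0 * A * Ath) * L"
  define b where "b n = 2 powr ((- \<alpha> - real r) * real n)" for n
  have L: "0 \<le> L" by (simp add: L_def)
  have c: "0 \<le> c1" "0 \<le> c2" using L M0_ge_1 K0_nonneg Ath_nonneg C0_nonneg A0 by (auto simp: c1_def c2_def)
  have sb: "summable b" unfolding b_def using \<alpha> by (intro summable_pow) simp
  have b0: "0 \<le> b n" for n by (simp add: b_def)
  obtain D where D: "0 \<le> D" "\<And>n js y. length js < r \<Longrightarrow> \<bar>partials js (PV n \<eta>) y - partials js \<eta> y\<bar> \<le> D * (1 / 2) ^ n"
    using PV_uniform[OF \<eta>] by blast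
  show ?thesis
  proof (rule that[of "c1 + c2 * suminf b"])
    show "0 \<le> c1 + c2 * suminf b" using c suminf_nonneg[OF sb b0] by simp
    fix h :: "real^'d \<Rightarrow> real" assume h: "cs h"
    define N where "N = besov_norm V \<alpha> P Q h"
    have PL: "PV n \<eta> \<in> L2" "PW n \<eta> \<in> L2" "PV n h \<in> L2" "PW n h \<in> L2" for n
      using cs\<eta> h VL.cs_P WL.cs_P cs_L2 by blast+
    have hL: "h \<in> L2" "\<eta> \<in> L2" using h cs\<eta> cs_L2 by auto
    have N1: "Lp_norm lborel P (PV 0 h) \<le> N" unfolding N_def besov_eq[OF h] by simp
    have N2: "Lp_norm lborel P (PW n h) \<le> ennreal (2 powr (- \<alpha> * real n)) * N" for n
    proof -
      have "ennreal (2 powr (\<alpha> * real n)) * Lp_norm lborel P (PW n h) \<le> N"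
        unfolding N_def besov_eq[OF h]
        using entry_le_lq[OF Q, of "\<lambda>n. ennreal (2 powr (\<alpha> * real n)) * Lp_norm lborel P (PW n h)" n]
        by (simp add: add_increasing)
      then have "ennreal (2 powr (- \<alpha> * real n)) * (ennreal (2 powr (\<alpha> * real n)) * Lp_norm lborel P (PW n h)) \<le> ennreal (2 powr (- \<alpha> * real n)) * N"
        by (rule mult_left_mono) simp
      then show ?thesis
        by (simp add: mult.assoc[symmetric] powr_minus flip: ennreal_mult)
    qed
    have zV: "PV n \<eta> y = 0" and zW: "PW n \<eta> y = 0" if "T + 2 * R < norm y" for n y
      using PV_support[where h=\<eta> and b=T] T that by blast+
    have 0: "ennreal \<bar>L2_inner h (PV 0 \<eta>)\<bar> \<le> ennreal c1 * N"
    proof -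
      have "L2_inner h (PV 0 \<eta>) = (\<integral>y. PV 0 h y * PV 0 \<eta> y \<partial>lborel)"
        using VL.inner_P[OF h cs\<eta>] by (simp add: L2_inner_def)
      also have "ennreal \<bar>\<dots>\<bar> \<le> ennreal c1 * Lp_norm lborel P (PV 0 h)"
        using L1_le_Lp[where b="T + 2 * R", OF P L2_measurable[OF PL(3)] zV L2_measurable[OF PL(1)] PV0_bound[OF A] L2_mult_integrable[OF PL(3,1)]]
        by (simp add: c1_def L_def)
      also have "\<dots> \<le> ennreal c1 * N" using N1 by (rule mult_left_mono) simp
      finally show ?thesis .
    qed
    have m: "ennreal \<bar>L2_inner h (PW n \<eta>)\<bar> \<le> ennreal (c2 * b n) * N" for n
    proof -
      have "L2_inner h (PW n \<eta>) = (\<integral>y. PW n h y * PW n \<eta> y \<partial>lborel)"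
        using WL.inner_P[OF h cs\<eta>] by (simp add: L2_inner_def)
      also have "ennreal \<bar>\<dots>\<bar> \<le> ennreal (c2 * (1 / 2 ^ n) ^ r) * Lp_norm lborel P (PW n h)"
        using L1_le_Lp[where b="T + 2 * R" and u="PW n h" and v="PW n \<eta>", OF P L2_measurable[OF PL(4)] zW L2_measurable[OF PL(2)] PW_bound[OF cs\<eta> A] L2_mult_integrable[OF PL(4,2)]]
        by (simp add: c2_def L_def mult_ac)
      also have "\<dots> \<le> ennreal (c2 * (1 / 2 ^ n) ^ r) * (ennreal (2 powr (- \<alpha> * real n)) * N)"
        using N2 by (rule mult_left_mono) simp
      also have "\<dots> = ennreal (c2 * (1 / 2 ^ n) ^ r * 2 powr (- \<alpha> * real n)) * N"
        using c by (simp add: ennreal_mult mult.assoc)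
      also have "c2 * (1 / 2 ^ n) ^ r * 2 powr (- \<alpha> * real n) = c2 * b n"
        using powr_pow_mult[of "- \<alpha>" n r] by (simp add: b_def mult.commute)
      finally show ?thesis .
    qed
    have part: "ennreal \<bar>L2_inner h (PV n \<eta>)\<bar> \<le> ennreal (c1 + c2 * (\<Sum>m<n. b m)) * N" for n
    proof (induction n)
      case (Suc n)
      have "PV (Suc n) \<eta> = (\<lambda>y. PV n \<eta> y + PW n \<eta> y)" using PV_Suc[OF cs\<eta>] by auto
      then have "L2_inner h (PV (Suc n) \<eta>) = L2_inner h (PV n \<eta>) + L2_inner h (PW n \<eta>)"
        using L2_inner_add[OF PL(1,2) hL(1), of n n] by (simp add: L2_inner_commute[of h])
      then have "ennreal \<bar>L2_inner h (PV (Suc n) \<eta>)\<bar> \<le> ennreal \<bar>L2_inner h (PV n \<eta>)\<bar> + ennreal \<bar>L2_inner h (PW n \<eta>)\<bar>"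
        by (simp flip: ennreal_plus add: ennreal_leI)
      also have "\<dots> \<le> ennreal (c1 + c2 * (\<Sum>m<n. b m)) * N + ennreal (c2 * b n) * N"
        using Suc.IH m by (rule add_mono)
      also have "\<dots> = (ennreal (c1 + c2 * (\<Sum>m<n. b m)) + ennreal (c2 * b n)) * N"
        by (simp add: distrib_right)
      also have "ennreal (c1 + c2 * (\<Sum>m<n. b m)) + ennreal (c2 * b n) = ennreal ((c1 + c2 * (\<Sum>m<n. b m)) + c2 * b n)"
        using c b0 by (intro ennreal_plus[symmetric]) (auto simp: sum_nonneg)
      also have "(c1 + c2 * (\<Sum>m<n. b m)) + c2 * b n = c1 + c2 * (\<Sum>m<Suc n. b m)"
        by (simp add: distrib_left)
      finally show ?case .
    qed (use 0 in simp)
    have lim: "(\<lambda>n. L2_inner h (PV n \<eta>)) \<longlonglongrightarrow> L2_inner h \<eta>"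
    proof -
      define I where "I = (\<integral>y. \<bar>h y\<bar> \<partial>lborel)"
      have "\<bar>L2_inner h (PV n \<eta>) - L2_inner h \<eta>\<bar> \<le> D * (1 / 2) ^ n * I" for n
      proof -
        have dc: "cs (\<lambda>y. h y * (PV n \<eta> y - \<eta> y))"
          using h cs_continuous[OF cs_diff[OF VL.cs_P[OF cs\<eta>] cs\<eta>]] by (rule cs_mult)
        have "L2_inner h (PV n \<eta>) - L2_inner h \<eta> = (\<integral>y. h y * (PV n \<eta> y - \<eta> y) \<partial>lborel)"
          using L2_inner_diff_right[OF PL(1) hL(2,1), of n] by (simp add: L2_inner_def)
        also have "\<bar>\<dots>\<bar> \<le> (\<integral>y. \<bar>h y * (PV n \<eta> y - \<eta> y)\<bar> \<partial>lborel)" by (rule integral_abs_bound)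
        also have "\<dots> \<le> (\<integral>y. D * (1 / 2) ^ n * \<bar>h y\<bar> \<partial>lborel)"
        proof (rule integral_mono)
          show "\<bar>h y * (PV n \<eta> y - \<eta> y)\<bar> \<le> D * (1 / 2) ^ n * \<bar>h y\<bar>" for y
            using D(2)[of "[]" n y] r_pos using mult_right_mono[of "\<bar>PV n \<eta> y - \<eta> y\<bar>" "D * (1 / 2) ^ n" "\<bar>h y\<bar>"]
            by (simp add: abs_mult mult.commute)
        qed (intro cs_integrable cs_abs dc cs_cmult h)+
        finally show ?thesis by (simp add: I_def)
      qed
      then have ev: "\<forall>\<^sub>F n in sequentially. norm (L2_inner h (PV n \<eta>) - L2_inner h \<eta>) \<le> D * (1 / 2) ^ n * I"
        by simp
      have "(\<lambda>n. D * (1 / 2) ^ n * I) \<longlonglongrightarrow> 0"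
        by (intro tendsto_mult_left_zero tendsto_mult_right_zero LIMSEQ_power_zero) auto
      from Lim_null_comparison[OF ev this] show ?thesis by (rule LIM_zero_cancel)
    qed
    have "ennreal \<bar>L2_inner h \<eta>\<bar> \<le> ennreal (c1 + c2 * suminf b) * N"
    proof (rule LIMSEQ_le_const2)
      show "(\<lambda>n. ennreal \<bar>L2_inner h (PV n \<eta>)\<bar>) \<longlonglongrightarrow> ennreal \<bar>L2_inner h \<eta>\<bar>"
        by (intro tendsto_ennrealI tendsto_rabs lim)
      have "ennreal \<bar>L2_inner h (PV n \<eta>)\<bar> \<le> ennreal (c1 + c2 * suminf b) * N" for n
      proof -
        have "(\<Sum>m<n. b m) \<le> suminf b" using sb b0 by (intro sum_le_suminf) auto
        then have "ennreal (c1 + c2 * (\<Sum>m<n. b m)) * N \<le> ennreal (c1 + c2 * suminf b) * N"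
          using c by (intro mult_right_mono ennreal_leI add_left_mono mult_left_mono) auto
        with part[of n] show ?thesis by (rule order_trans)
      qed
      then show "\<exists>N'. \<forall>n\<ge>N'. ennreal \<bar>L2_inner h (PV n \<eta>)\<bar> \<le> ennreal (c1 + c2 * suminf b) * N" by blast
    qed
    then show "ennreal \<bar>L2_inner h \<eta>\<bar> \<le> ennreal (c1 + c2 * suminf b) * besov_norm V \<alpha> P Q h"
      by (simp add: N_def)
  qed
qed

end

section \<open>Products of smooth functions and wavelet layers\<close>

text \<open>Jensen's inequality for the weights \<open>A i / T\<close>; their total may be replaced
  by the upper bound \<open>S\<close> because \<open>p - 1\<close> is nonnegative.\<close>

lemma sum_powr_Jensen:
  fixes A c :: "'i \<Rightarrow> real"
  assumes "finite I" and p: "1 \<le> p" and A: "\<And>i. i \<in> I \<Longrightarrow> 0 \<le> A i" and c: "\<And>i. i \<in> I \<Longrightarrow> 0 \<le> c i"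
    and S: "(\<Sum>i\<in>I. A i) \<le> S"
  shows "(\<Sum>i\<in>I. A i * c i) powr p \<le> S powr (p - 1) * (\<Sum>i\<in>I. A i * c i powr p)"
proof -
  define T where "T = (\<Sum>i\<in>I. A i)"
  have T0: "0 \<le> T" unfolding T_def by (intro sum_nonneg A)
  show ?thesis
  proof (cases "T = 0")
    case True
    then have "\<And>i. i \<in> I \<Longrightarrow> A i = 0" using sum_nonneg_eq_0_iff[OF assms(1), of A] A by (simp add: T_def)
    then show ?thesis by simp
  next
    case False
    then have T: "0 < T" using T0 by simp
    have conv: "convex_on {0..} (\<lambda>x::real. x powr p)"
      by (rule convex_onI) (use powr_convex_combination[OF p] in auto)
    have "(\<Sum>i\<in>I. (A i / T) *\<^sub>R c i) powr p \<le> (\<Sum>i\<in>I. A i / T * c i powr p)"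
      using False T A c by (intro convex_on_sum[OF assms(1) _ conv]) (auto simp: T_def sum_divide_distrib[symmetric])
    also have "(\<Sum>i\<in>I. (A i / T) *\<^sub>R c i) = (\<Sum>i\<in>I. A i * c i) / T" by (simp add: sum_divide_distrib)
    also have "(\<Sum>i\<in>I. A i / T * c i powr p) = (\<Sum>i\<in>I. A i * c i powr p) / T" by (simp add: sum_divide_distrib)
    finally have "(\<Sum>i\<in>I. A i * c i) powr p / T powr p \<le> (\<Sum>i\<in>I. A i * c i powr p) / T"
      using T A c by (simp add: powr_divide sum_nonneg)
    then have "(\<Sum>i\<in>I. A i * c i) powr p \<le> T powr p * ((\<Sum>i\<in>I. A i * c i powr p) / T)"
      using T by (simp add: pos_divide_le_eq mult.commute)
    also have "\<dots> = T powr (p - 1) * (\<Sum>i\<in>I. A i * c i powr p)"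
      using T by (simp add: powr_diff)
    also have "\<dots> \<le> S powr (p - 1) * (\<Sum>i\<in>I. A i * c i powr p)"
      using T S p A c by (intro mult_right_mono powr_mono2 sum_nonneg) (auto simp: T_def)
    finally show ?thesis .
  qed
qed

text \<open>Jensen's inequality in each row with weights \<open>\<bar>A k i\<bar>\<close>, then an
  exchange of the sums: the row sums enter to the power \<open>p - 1\<close>, the column sums to the
  power 1.\<close>

lemma Schur_test:
  fixes A :: "'k \<Rightarrow> 'i \<Rightarrow> real" and c :: "'i \<Rightarrow> real"
  assumes fin: "finite I" "finite K" and p: "1 \<le> p" and S1: "\<And>k. k \<in> K \<Longrightarrow> (\<Sum>i\<in>I. \<bar>A k i\<bar>) \<le> S1"
    and S2: "\<And>i. i \<in> I \<Longrightarrow> (\<Sum>k\<in>K. \<bar>A k i\<bar>) \<le> S2"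
  shows "(\<Sum>k\<in>K. \<bar>\<Sum>i\<in>I. A k i * c i\<bar> powr p) \<le> S1 powr (p - 1) * S2 * (\<Sum>i\<in>I. \<bar>c i\<bar> powr p)"
proof -
  have "(\<Sum>k\<in>K. \<bar>\<Sum>i\<in>I. A k i * c i\<bar> powr p) \<le> (\<Sum>k\<in>K. S1 powr (p - 1) * (\<Sum>i\<in>I. \<bar>A k i\<bar> * \<bar>c i\<bar> powr p))"
  proof (rule sum_mono)
    fix k assume k: "k \<in> K"
    have "\<bar>\<Sum>i\<in>I. A k i * c i\<bar> powr p \<le> (\<Sum>i\<in>I. \<bar>A k i\<bar> * \<bar>c i\<bar>) powr p"
      using p by (intro powr_mono2 order_trans[OF sum_abs]) (auto simp: abs_mult)
    also have "\<dots> \<le> S1 powr (p - 1) * (\<Sum>i\<in>I. \<bar>A k i\<bar> * \<bar>c i\<bar> powr p)"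
      using S1[OF k] by (intro sum_powr_Jensen fin p) auto
    finally show "\<bar>\<Sum>i\<in>I. A k i * c i\<bar> powr p \<le> S1 powr (p - 1) * (\<Sum>i\<in>I. \<bar>A k i\<bar> * \<bar>c i\<bar> powr p)" .
  qed
  also have "\<dots> = S1 powr (p - 1) * (\<Sum>i\<in>I. (\<Sum>k\<in>K. \<bar>A k i\<bar>) * \<bar>c i\<bar> powr p)"
    unfolding sum_distrib_left[symmetric] by (subst sum.swap) (simp add: sum_distrib_right)
  also have "\<dots> \<le> S1 powr (p - 1) * (\<Sum>i\<in>I. S2 * \<bar>c i\<bar> powr p)"
    by (intro mult_left_mono sum_mono mult_right_mono S2) auto
  also have "\<dots> = S1 powr (p - 1) * S2 * (\<Sum>i\<in>I. \<bar>c i\<bar> powr p)"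
    by (simp add: sum_distrib_left mult.assoc)
  finally show ?thesis .
qed

definition dist2 :: "nat \<Rightarrow> nat \<Rightarrow> nat" where "dist2 n m = (if n \<le> m then m - n else n - m)"

context wavelets
begin

text \<open>The analogue of \<open>M0\<close> for radius \<open>2 * R\<close>: two functions whose
  supports have radius at most \<open>R\<close> in units of the coarser level interact only if their
  centres are within twice that distance.\<close>

definition "M1 = (4 * R + 1) ^ CARD('d)"

lemma M1_ge_1: "1 \<le> M1" using R_pos by (simp add: M1_def)

lemma card_near_2R:
  assumes "l \<le> n"
  shows "real (card {x \<in> dyadic_lattice n. norm (x - (y::real^'d)) \<le> 2 * R / 2 ^ l}) \<le> M1 * 2 ^ (CARD('d) * (n - l))"
proof -
  have "real (card {x \<in> dyadic_lattice n. norm (x - y) \<le> 2 * R / 2 ^ l}) \<le> (2 * (2 ^ n * (2 * R / 2 ^ l)) + 1) ^ CARD('d)"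
    using R_pos by (intro card_dyadic_lattice) simp
  also have "2 ^ n * (2 * R / 2 ^ l) = 2 * R * 2 ^ (n - l)" using assms by (simp add: power_diff)
  also have "(2 * (2 * R * 2 ^ (n - l)) + 1) ^ CARD('d) \<le> ((4 * R + 1) * 2 ^ (n - l)) ^ CARD('d)"
    using R_pos by (intro power_mono) (auto simp: algebra_simps)
  also have "\<dots> = M1 * 2 ^ (CARD('d) * (n - l))"
    by (simp add: M1_def power_mult_distrib power_mult[symmetric] mult.commute)
  finally show ?thesis .
qed

text \<open>The number of lattice points of level \<open>n\<close> within reach at the coarser level
  \<open>l\<close>, times a bound on the entries: this yields both the row and the column sums of
  \<open>wmat\<close>.\<close>

lemma sum_pairs_bound:
  fixes A :: "nat \<times> (real^'d) \<Rightarrow> real"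
  assumes G: "G \<subseteq> {0} \<union> {0<..<2 ^ CARD('d)}" and X: "finite X" "X \<subseteq> dyadic_lattice n" and l: "l \<le> n"
    and b: "\<And>i x. i \<in> G \<Longrightarrow> x \<in> X \<Longrightarrow> \<bar>A (i, x)\<bar> \<le> b" and b0: "0 \<le> b"
    and z: "\<And>i x. i \<in> G \<Longrightarrow> x \<in> X \<Longrightarrow> 2 * R / 2 ^ l < norm (x - y) \<Longrightarrow> A (i, x) = 0"
  shows "(\<Sum>k\<in>G \<times> X. \<bar>A k\<bar>) \<le> 2 ^ CARD('d) * M1 * 2 ^ (CARD('d) * (n - l)) * b"
proof -
  let ?N = "{x \<in> dyadic_lattice n. norm (x - y) \<le> 2 * R / 2 ^ l}"
  have fG: "finite G" "card G \<le> 2 ^ CARD('d)"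
  proof -
    have s: "G \<subseteq> {..<2 ^ CARD('d)}" using G by auto
    from finite_subset[OF s] show "finite G" by simp
    from card_mono[OF _ s] show "card G \<le> 2 ^ CARD('d)" by simp
  qed
  have "(\<Sum>k\<in>G \<times> X. \<bar>A k\<bar>) = (\<Sum>i\<in>G. \<Sum>x\<in>X. \<bar>A (i, x)\<bar>)" by (simp add: sum.cartesian_product)
  also have "\<dots> \<le> (\<Sum>i\<in>G. real (card ?N) * b)"
  proof (rule sum_mono)
    fix i assume i: "i \<in> G"
    have "(\<Sum>x\<in>X. \<bar>A (i, x)\<bar>) = (\<Sum>x\<in>X \<inter> ?N. \<bar>A (i, x)\<bar>)"
    proof (rule sum.mono_neutral_right)
      show "\<forall>x\<in>X - X \<inter> ?N. \<bar>A (i, x)\<bar> = 0"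
      proof
        fix x assume x: "x \<in> X - X \<inter> ?N"
        then have "2 * R / 2 ^ l < norm (x - y)" using X(2) by auto
        with z[OF i] x show "\<bar>A (i, x)\<bar> = 0" by simp
      qed
    qed (use X in auto)
    also have "\<dots> \<le> real (card (X \<inter> ?N)) * b"
      using b[OF i] by (intro order_trans[OF sum_bounded_above]) auto
    also have "\<dots> \<le> real (card ?N) * b"
    proof -
      have "finite ?N" using R_pos by (intro card_dyadic_lattice) simp
      then have "card (X \<inter> ?N) \<le> card ?N" by (intro card_mono) auto
      then show ?thesis using b0 by (intro mult_right_mono) auto
    qed
    finally show "(\<Sum>x\<in>X. \<bar>A (i, x)\<bar>) \<le> real (card ?N) * b" .
  qed
  also have "\<dots> = real (card G) * (real (card ?N) * b)" by simp
  also have "\<dots> \<le> 2 ^ CARD('d) * (M1 * 2 ^ (CARD('d) * (n - l)) * b)"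
  proof (intro mult_mono mult_right_mono card_near_2R l)
    have "real (card G) \<le> real (2 ^ CARD('d))" using fG(2) by (simp only: of_nat_le_iff)
    then show "real (card G) \<le> 2 ^ CARD('d)" by simp
  qed (use b0 M1_ge_1 in auto)
  finally show ?thesis by (simp add: mult.assoc)
qed

text \<open>The matrix of multiplication by \<open>\<rho>\<close> in wavelet coordinates: it maps
  the coefficients of a layer at level \<open>m\<close> to the coefficients of the product at level
  \<open>n\<close>, see \<open>coef_layer\<close>.\<close>

definition wmat :: "(real^'d \<Rightarrow> real) \<Rightarrow> nat \<Rightarrow> nat \<Rightarrow> nat \<times> (real^'d) \<Rightarrow> nat \<times> (real^'d) \<Rightarrow> real" where
  "wmat \<rho> n m k i = 2 ^ (CARD('d) * n) *
     L2_inner (\<lambda>z. \<rho> z * wav (\<theta> (fst i)) m (snd i) z) (wav (\<theta> (fst k)) n (snd k))"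

lemma wmat_zero:
  assumes "fst i \<in> {0<..<2 ^ CARD('d)}" "fst k \<in> {0} \<union> {0<..<2 ^ CARD('d)}"
    "2 * R / 2 ^ min n m < norm (snd i - snd k)"
  shows "wmat \<rho> n m k i = 0"
proof -
  have z0: "wav (\<theta> (fst i)) m (snd i) z * wav (\<theta> (fst k)) n (snd k) z = 0" for z
  proof (rule ccontr)
    assume "\<not> ?thesis"
    then have "wav (\<theta> (fst i)) m (snd i) z \<noteq> 0" "wav (\<theta> (fst k)) n (snd k) z \<noteq> 0" by auto
    then have "norm (z - snd i) < R / 2 ^ m" "norm (z - snd k) < R / 2 ^ n"
      using WL.wav_zero[OF assms(1), of m z "snd i"] assms(2)
        VL.wav_zero[of "fst k" n z "snd k"] WL.wav_zero[of "fst k" n z "snd k"] by force+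
    moreover have "R / 2 ^ m \<le> R / 2 ^ min n m" "R / 2 ^ n \<le> R / 2 ^ min n m"
      using R_pos by (auto intro!: divide_left_mono power_increasing)
    ultimately have "norm (z - snd k) + norm (z - snd i) < R / 2 ^ min n m + R / 2 ^ min n m" by linarith
    moreover have "snd i - snd k = (z - snd k) - (z - snd i)" by simp
    then have "norm (snd i - snd k) \<le> norm (z - snd k) + norm (z - snd i)" using norm_triangle_ineq4 by metis
    ultimately show False using assms(3) by simp
  qed
  have "(\<lambda>z. \<rho> z * wav (\<theta> (fst i)) m (snd i) z * wav (\<theta> (fst k)) n (snd k) z) = (\<lambda>z. 0)"
    using z0 by (auto simp: fun_eq_iff mult.assoc)
  then show ?thesis unfolding wmat_def L2_inner_def by simp
qed

text \<open>The finer of the two functions supplies the cancellation and is tested against the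
  product of \<open>\<rho>\<close> with the coarser one. For \<open>n \<le> m\<close> the weight
  belongs to the coarser level \<open>n\<close>, hence the additional factor
  \<open>1 / 2 ^ (CARD('d) * (m - n))\<close>; for \<open>m \<le> n\<close> the finer function is
  the one with index \<open>k\<close>, which must then be a wavelet.\<close>

lemma wmat_bound:
  assumes i: "fst i \<in> {0<..<2 ^ CARD('d)}" and k: "fst k \<in> {0} \<union> {0<..<2 ^ CARD('d)}" and \<rho>: "cbnd r A 1 \<rho>"
  shows "n \<le> m \<Longrightarrow> \<bar>wmat \<rho> n m k i\<bar> \<le> C0 * (2 ^ r * A * Ath) * (1 / 2 ^ (m - n)) ^ r * (1 / 2 ^ (CARD('d) * (m - n)))"
    and "m \<le> n \<Longrightarrow> fst k \<noteq> 0 \<Longrightarrow> \<bar>wmat \<rho> n m k i\<bar> \<le> C0 * (2 ^ r * A * Ath) * (1 / 2 ^ (n - m)) ^ r"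
proof -
  have i': "fst i \<in> {0} \<union> {0<..<2 ^ CARD('d)}" using i by simp
  have pr: "cbnd r (2 ^ r * A * Ath) (2 ^ l) (\<lambda>z. \<rho> z * wav (\<theta> j) l x z)" if "j \<in> {0} \<union> {0<..<2 ^ CARD('d)}" for j l x
    using cbnd_mult[of r A "2 ^ l" \<rho> Ath "wav (\<theta> j) l x"] cbnd_wav[OF \<theta>_cbnd[OF that], of l x]
      cbnd_mono[OF \<rho>, of A "2 ^ l"] by simp
  {
    assume nm: "n \<le> m"
    have "wmat \<rho> n m k i = 2 ^ (CARD('d) * n) * L2_inner (wav (\<theta> (fst i)) m (snd i)) (\<lambda>z. \<rho> z * wav (\<theta> (fst k)) n (snd k) z)"
      by (simp add: wmat_def L2_inner_def mult_ac)
    also have "\<dots> = 1 / 2 ^ (CARD('d) * (m - n)) * (2 ^ (CARD('d) * m) * L2_inner (wav (\<theta> (fst i)) m (snd i)) (\<lambda>z. \<rho> z * wav (\<theta> (fst k)) n (snd k) z))"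
      using nm by (simp add: power_diff right_diff_distrib' field_simps)
    finally have "\<bar>wmat \<rho> n m k i\<bar> = 1 / 2 ^ (CARD('d) * (m - n)) * \<bar>2 ^ (CARD('d) * m) * L2_inner (wav (\<theta> (fst i)) m (snd i)) (\<lambda>z. \<rho> z * wav (\<theta> (fst k)) n (snd k) z)\<bar>"
      by (simp add: abs_mult)
    also have "\<dots> \<le> 1 / 2 ^ (CARD('d) * (m - n)) * (C0 * (2 ^ r * A * Ath) * (2 ^ n / 2 ^ m) ^ r)"
      by (intro mult_left_mono coef_decay i pr k) auto
    also have "2 ^ n / 2 ^ m = (1 / 2 ^ (m - n) :: real)" using nm by (simp add: power_diff)
    finally show "\<bar>wmat \<rho> n m k i\<bar> \<le> C0 * (2 ^ r * A * Ath) * (1 / 2 ^ (m - n)) ^ r * (1 / 2 ^ (CARD('d) * (m - n)))"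
      by (simp add: mult.commute)
  next
    assume nm: "m \<le> n" and "fst k \<noteq> 0"
    then have k': "fst k \<in> {0<..<2 ^ CARD('d)}" using k by simp
    have "\<bar>wmat \<rho> n m k i\<bar> \<le> C0 * (2 ^ r * A * Ath) * (2 ^ m / 2 ^ n) ^ r"
      unfolding wmat_def by (subst L2_inner_commute) (intro coef_decay k' pr i', simp)
    also have "2 ^ m / 2 ^ n = (1 / 2 ^ (n - m) :: real)" using nm by (simp add: power_diff)
    finally show "\<bar>wmat \<rho> n m k i\<bar> \<le> C0 * (2 ^ r * A * Ath) * (1 / 2 ^ (n - m)) ^ r" .
  }
qed

text \<open>A row or column that runs over the finer level has at most of the order of
  \<open>2 ^ (CARD('d) * dist2 n m)\<close> nonzero entries, the others boundedly many. In both
  cases the row sums are therefore bounded by \<open>S1\<close> and the column sums by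
  \<open>S1 * F\<close>, where \<open>F\<close> is the ratio of the densities of the two lattices.
  The scaling function occurs only for \<open>n \<le> m\<close>, where the cancellation comes from
  the layer.\<close>

lemma wmat_Schur:
  fixes c :: "nat \<times> (real^'d) \<Rightarrow> real"
  assumes \<rho>: "cbnd r A 1 \<rho>" and p: "1 \<le> p" and X: "finite X" "X \<subseteq> dyadic_lattice m" and Y: "finite Y" "Y \<subseteq> dyadic_lattice n"
    and G: "G \<subseteq> {0<..<2 ^ CARD('d)} \<or> (G = {0} \<and> n \<le> m)"
  shows "(\<Sum>k\<in>G \<times> Y. \<bar>\<Sum>i\<in>{0<..<2 ^ CARD('d)} \<times> X. wmat \<rho> n m k i * c i\<bar> powr p) \<le>
    (2 ^ CARD('d) * M1 * (C0 * (2 ^ r * A * Ath)) * (1 / 2 ^ dist2 n m) ^ r) powr p * (2 ^ (CARD('d) * n) / 2 ^ (CARD('d) * m)) *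
    (\<Sum>i\<in>{0<..<2 ^ CARD('d)} \<times> X. \<bar>c i\<bar> powr p)"
proof -
  define B where "B = C0 * (2 ^ r * A * Ath) * (1 / 2 ^ dist2 n m) ^ r"
  define S1 where "S1 = 2 ^ CARD('d) * M1 * B"
  define F where "F = (2 ^ (CARD('d) * n) / 2 ^ (CARD('d) * m) :: real)"
  have A0: "0 \<le> A" using \<rho> by (rule cbnd_nonneg)
  have B0: "0 \<le> B" unfolding B_def using C0_nonneg A0 Ath_nonneg by simp
  have S10: "0 \<le> S1" unfolding S1_def using B0 M1_ge_1 by simp
  have G': "G \<subseteq> {0} \<union> {0<..<2 ^ CARD('d)}" using G by auto
  have fG: "finite G" using finite_subset[OF G'] by simp
  have zr: "wmat \<rho> n m (j, y) (i, x) = 0" if "i \<in> {0<..<2 ^ CARD('d)}" "j \<in> G" "2 * R / 2 ^ min n m < norm (x - y)" for i j x y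
    by (rule wmat_zero) (use that G' in auto)
  have "(\<Sum>k\<in>G \<times> Y. \<bar>\<Sum>i\<in>{0<..<2 ^ CARD('d)} \<times> X. wmat \<rho> n m k i * c i\<bar> powr p) \<le>
     S1 powr (p - 1) * (S1 * F) * (\<Sum>i\<in>{0<..<2 ^ CARD('d)} \<times> X. \<bar>c i\<bar> powr p)"
  proof (cases "n \<le> m")
    case True
    then have d: "dist2 n m = m - n" "min n m = n" by (auto simp: dist2_def)
    have F: "F = 1 / 2 ^ (CARD('d) * (m - n))" using True by (simp add: F_def power_diff right_diff_distrib')
    have b: "\<bar>wmat \<rho> n m (j, y) (i, x)\<bar> \<le> B * F" if "i \<in> {0<..<2 ^ CARD('d)}" "j \<in> G" for i j x y
      using wmat_bound(1)[of "(i, x)" "(j, y)" A \<rho> n m] that G' \<rho> True by (auto simp: B_def F d)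
    have F0: "0 \<le> F" by (simp add: F)
    show ?thesis
    proof (rule Schur_test[OF _ _ p])
      fix k :: "nat \<times> (real^'d)" assume k: "k \<in> G \<times> Y"
      have "(\<Sum>i\<in>{0<..<2 ^ CARD('d)} \<times> X. \<bar>wmat \<rho> n m k i\<bar>) \<le> 2 ^ CARD('d) * M1 * 2 ^ (CARD('d) * (m - n)) * (B * F)"
      proof (rule sum_pairs_bound[where y="snd k", OF _ X True])
        show "\<bar>wmat \<rho> n m k (i, x)\<bar> \<le> B * F" if "i \<in> {0<..<2 ^ CARD('d)}" for i x using b[of i "fst k" "snd k" x] k that by (cases k) auto
        show "wmat \<rho> n m k (i, x) = 0" if "i \<in> {0<..<2 ^ CARD('d)}" "2 * R / 2 ^ n < norm (x - snd k)" for i x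
          using zr[of i "fst k" x "snd k"] k that d by (cases k) auto
      qed (use B0 F0 in auto)
      then show "(\<Sum>i\<in>{0<..<2 ^ CARD('d)} \<times> X. \<bar>wmat \<rho> n m k i\<bar>) \<le> S1" by (simp add: S1_def F)
    next
      fix i :: "nat \<times> (real^'d)" assume i: "i \<in> {0<..<2 ^ CARD('d)} \<times> X"
      have "(\<Sum>k\<in>G \<times> Y. \<bar>wmat \<rho> n m k i\<bar>) \<le> 2 ^ CARD('d) * M1 * 2 ^ (CARD('d) * (n - n)) * (B * F)"
      proof (rule sum_pairs_bound[where y="snd i", OF G' Y order_refl])
        show "\<bar>wmat \<rho> n m (j, y) i\<bar> \<le> B * F" if "j \<in> G" for j y using b[of "fst i" j y "snd i"] i that by (cases i) auto
        show "wmat \<rho> n m (j, y) i = 0" if "j \<in> G" "2 * R / 2 ^ n < norm (y - snd i)" for j y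
          using zr[of "fst i" j "snd i" y] i that d by (cases i) (auto simp: norm_minus_commute)
      qed (use B0 F0 in auto)
      then show "(\<Sum>k\<in>G \<times> Y. \<bar>wmat \<rho> n m k i\<bar>) \<le> S1 * F" by (simp add: S1_def mult.assoc)
    qed (use X Y fG in auto)
  next
    case False
    then have d: "dist2 n m = n - m" "min n m = m" and mn: "m \<le> n" by (auto simp: dist2_def)
    have GJ: "G \<subseteq> {0<..<2 ^ CARD('d)}" using G False by auto
    have F: "F = 2 ^ (CARD('d) * (n - m))" using mn by (simp add: F_def power_diff right_diff_distrib')
    have b: "\<bar>wmat \<rho> n m (j, y) (i, x)\<bar> \<le> B" if "i \<in> {0<..<2 ^ CARD('d)}" "j \<in> G" for i j x y
      using wmat_bound(2)[of "(i, x)" "(j, y)" A \<rho> m n] that GJ \<rho> mn by (auto simp: B_def d)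
    show ?thesis
    proof (rule Schur_test[OF _ _ p])
      fix k :: "nat \<times> (real^'d)" assume k: "k \<in> G \<times> Y"
      have "(\<Sum>i\<in>{0<..<2 ^ CARD('d)} \<times> X. \<bar>wmat \<rho> n m k i\<bar>) \<le> 2 ^ CARD('d) * M1 * 2 ^ (CARD('d) * (m - m)) * B"
      proof (rule sum_pairs_bound[where y="snd k", OF _ X order_refl])
        show "\<bar>wmat \<rho> n m k (i, x)\<bar> \<le> B" if "i \<in> {0<..<2 ^ CARD('d)}" for i x using b[of i "fst k" "snd k" x] k that by (cases k) auto
        show "wmat \<rho> n m k (i, x) = 0" if "i \<in> {0<..<2 ^ CARD('d)}" "2 * R / 2 ^ m < norm (x - snd k)" for i x
          using zr[of i "fst k" x "snd k"] k that d by (cases k) auto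
      qed (use B0 in auto)
      then show "(\<Sum>i\<in>{0<..<2 ^ CARD('d)} \<times> X. \<bar>wmat \<rho> n m k i\<bar>) \<le> S1" by (simp add: S1_def)
    next
      fix i :: "nat \<times> (real^'d)" assume i: "i \<in> {0<..<2 ^ CARD('d)} \<times> X"
      have "(\<Sum>k\<in>G \<times> Y. \<bar>wmat \<rho> n m k i\<bar>) \<le> 2 ^ CARD('d) * M1 * 2 ^ (CARD('d) * (n - m)) * B"
      proof (rule sum_pairs_bound[where y="snd i", OF G' Y mn])
        show "\<bar>wmat \<rho> n m (j, y) i\<bar> \<le> B" if "j \<in> G" for j y using b[of "fst i" j y "snd i"] i that by (cases i) auto
        show "wmat \<rho> n m (j, y) i = 0" if "j \<in> G" "2 * R / 2 ^ m < norm (y - snd i)" for j y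
          using zr[of "fst i" j "snd i" y] i that d by (cases i) (auto simp: norm_minus_commute)
      qed (use B0 in auto)
      then show "(\<Sum>k\<in>G \<times> Y. \<bar>wmat \<rho> n m k i\<bar>) \<le> S1 * F" by (simp add: S1_def F mult_ac)
    qed (use X Y fG in auto)
  qed
  also have "S1 powr (p - 1) * (S1 * F) = S1 powr p * F"
    using S10 by (cases "S1 = 0") (auto simp: powr_diff)
  finally show ?thesis by (simp add: S1_def B_def F_def mult.assoc)
qed

end

text \<open>Each distance from \<open>m\<close> is attained at most twice.\<close>

lemma suminf_dist2:
  fixes g :: "nat \<Rightarrow> real"
  assumes g: "summable g" "\<And>k. 0 \<le> g k"
  shows "summable (\<lambda>n. g (dist2 n m))" "(\<Sum>n. g (dist2 n m)) \<le> 2 * suminf g"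
proof -
  let ?h = "\<lambda>n. g (dist2 n m)"
  have sh: "(\<lambda>n. ?h (n + m)) = g" by (auto simp: dist2_def)
  then show s: "summable ?h" using g(1) summable_iff_shift[of ?h m] by simp
  have "(\<Sum>n<m. ?h n) = (\<Sum>n<m. g (m - n))" by (intro sum.cong) (auto simp: dist2_def)
  also have "\<dots> = sum g ((\<lambda>n. m - n) ` {..<m})" by (subst sum.reindex) (auto simp: inj_on_def)
  also have "\<dots> \<le> suminf g" using g by (intro sum_le_suminf) auto
  finally show "(\<Sum>n. ?h n) \<le> 2 * suminf g"
    using suminf_split_initial_segment[OF s, of m] by (simp add: sh)
qed

context wavelets
begin

section \<open>Lebesgue norms of a single layer\<close>

lemma wav_sum_bound:
  assumes G: "G \<subseteq> {0} \<union> {0<..<2 ^ CARD('d)}" and Y: "finite Y" "Y \<subseteq> dyadic_lattice n"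
  shows "(\<Sum>k\<in>G \<times> Y. \<bar>wav (\<theta> (fst k)) n (snd k) z\<bar>) \<le> 2 ^ CARD('d) * M1 * Ath"
proof -
  have "(\<Sum>k\<in>G \<times> Y. \<bar>wav (\<theta> (fst k)) n (snd k) z\<bar>) \<le> 2 ^ CARD('d) * M1 * 2 ^ (CARD('d) * (n - n)) * Ath"
  proof (rule sum_pairs_bound[where y=z, OF G Y order_refl])
    show "\<bar>wav (\<theta> (fst (j, y))) n (snd (j, y)) z\<bar> \<le> Ath" if "j \<in> G" for j y
      using wav_abs[of j n y z] G that by auto
    show "wav (\<theta> (fst (j, y))) n (snd (j, y)) z = 0" if "j \<in> G" "2 * R / 2 ^ n < norm (y - z)" for j y
    proof -
      have "R / 2 ^ n \<le> 2 * R / 2 ^ n" using R_pos by (intro divide_right_mono) auto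
      then have "R / 2 ^ n \<le> norm (z - y)" using that(2) by (simp add: norm_minus_commute)
      then show ?thesis using VL.wav_zero[of j n z y] WL.wav_zero[of j n z y] G that(1) by auto
    qed
  qed (rule Ath_nonneg)
  then show ?thesis by simp
qed

lemma layer_sup:
  assumes G: "G \<subseteq> {0} \<union> {0<..<2 ^ CARD('d)}" and Y: "finite Y" "Y \<subseteq> dyadic_lattice n"
    and a: "\<And>k. k \<in> G \<times> Y \<Longrightarrow> \<bar>a k\<bar> \<le> B" and B: "0 \<le> B"
  shows "\<bar>\<Sum>k\<in>G \<times> Y. a k * wav (\<theta> (fst k)) n (snd k) z\<bar> \<le> 2 ^ CARD('d) * M1 * Ath * B"
proof -
  have "\<bar>\<Sum>k\<in>G \<times> Y. a k * wav (\<theta> (fst k)) n (snd k) z\<bar> \<le> (\<Sum>k\<in>G \<times> Y. B * \<bar>wav (\<theta> (fst k)) n (snd k) z\<bar>)"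
    by (intro order_trans[OF sum_abs] sum_mono) (simp add: abs_mult mult_right_mono a)
  also have "\<dots> = B * (\<Sum>k\<in>G \<times> Y. \<bar>wav (\<theta> (fst k)) n (snd k) z\<bar>)" by (simp add: sum_distrib_left)
  also have "\<dots> \<le> B * (2 ^ CARD('d) * M1 * Ath)" by (rule mult_left_mono[OF wav_sum_bound[OF G Y] B])
  finally show ?thesis by (simp add: mult_ac)
qed

lemma integral_abs_wav:
  assumes "j \<in> {0} \<union> {0<..<2 ^ CARD('d)}"
  shows "(\<integral>z. \<bar>wav (\<theta> j) n x z\<bar> \<partial>lborel) \<le> Ath * K0 / 2 ^ (CARD('d) * n)"
proof -
  have c: "cs (\<lambda>z. \<bar>\<theta> j z\<bar>)" by (intro cs_abs \<theta>_cs assms)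
  have "(\<integral>z. \<bar>\<theta> j z\<bar> \<partial>lborel) \<le> \<bar>\<integral>z. \<bar>\<theta> j z\<bar> \<partial>lborel\<bar>" by simp
  also have "\<dots> \<le> Ath * measure lborel (cball (0::real^'d) R)"
    by (rule cs_integral_bound[OF c]) (use cbnd_abs[OF \<theta>_cbnd[OF assms]] \<theta>_supp[OF assms] in auto)
  finally have "(\<integral>z. \<bar>\<theta> j z\<bar> \<partial>lborel) \<le> Ath * K0" by (simp add: K0_def)
  moreover have "(\<integral>z. \<bar>wav (\<theta> j) n x z\<bar> \<partial>lborel) = (\<integral>z. \<bar>\<theta> j z\<bar> \<partial>lborel) / 2 ^ (CARD('d) * n)"
    unfolding wav_def using cs_measurable[OF c] by (intro integral_wav) simp
  ultimately show ?thesis by (simp add: divide_right_mono)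
qed

text \<open>At each point boundedly many wavelets are active, so Jensen's inequality moves the power
  onto the coefficients; integration then gives each wavelet a mass of order
  \<open>1 / 2 ^ (CARD('d) * n)\<close>.\<close>

lemma layer_Lp:
  assumes G: "G \<subseteq> {0} \<union> {0<..<2 ^ CARD('d)}" and Y: "finite Y" "Y \<subseteq> dyadic_lattice n" and p: "1 \<le> p"
  shows "Lp_norm lborel (ennreal p) (\<lambda>z. \<Sum>k\<in>G \<times> Y. a k * wav (\<theta> (fst k)) n (snd k) z) \<le>
    ennreal (((2 ^ CARD('d) * M1 * Ath) powr (p - 1) * Ath * K0 * ((\<Sum>k\<in>G \<times> Y. \<bar>a k\<bar> powr p) / 2 ^ (CARD('d) * n))) powr (1 / p))"
proof -
  let ?w = "\<lambda>k. wav (\<theta> (fst k)) n (snd k)"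
  let ?S = "(2 ^ CARD('d) * M1 * Ath) powr (p - 1)"
  have fGY: "finite (G \<times> Y)" using finite_subset[OF G] Y by simp
  have csw: "cs (?w k)" if "k \<in> G \<times> Y" for k using that G by (intro cs_wav \<theta>_cs) auto
  have pw: "\<bar>\<Sum>k\<in>G \<times> Y. a k * ?w k z\<bar> powr p \<le> ?S * (\<Sum>k\<in>G \<times> Y. \<bar>?w k z\<bar> * \<bar>a k\<bar> powr p)" for z
  proof -
    have "\<bar>\<Sum>k\<in>G \<times> Y. a k * ?w k z\<bar> powr p \<le> (\<Sum>k\<in>G \<times> Y. \<bar>?w k z\<bar> * \<bar>a k\<bar>) powr p"
      using p by (intro powr_mono2 order_trans[OF sum_abs]) (auto simp: abs_mult mult.commute)
    also have "\<dots> \<le> ?S * (\<Sum>k\<in>G \<times> Y. \<bar>?w k z\<bar> * \<bar>a k\<bar> powr p)"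
      by (intro sum_powr_Jensen fGY p wav_sum_bound[OF G Y]) auto
    finally show ?thesis .
  qed
  let ?b = "\<lambda>z. ?S * (\<Sum>k\<in>G \<times> Y. \<bar>a k\<bar> powr p * \<bar>?w k z\<bar>)"
  have csb: "cs ?b" by (intro cs_cmult cs_sum cs_abs csw)
  have "(\<integral>\<^sup>+z. enn_powr (ennreal \<bar>\<Sum>k\<in>G \<times> Y. a k * ?w k z\<bar>) p \<partial>lborel) \<le> (\<integral>\<^sup>+z. ennreal (?b z) \<partial>lborel)"
    using pw by (intro nn_integral_mono) (simp add: enn_powr_ennreal ennreal_leI mult.commute)
  also have "\<dots> = ennreal (\<integral>z. ?b z \<partial>lborel)"
    by (intro nn_integral_eq_integral cs_integrable csb) (auto intro!: mult_nonneg_nonneg sum_nonneg)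
  also have "(\<integral>z. ?b z \<partial>lborel) = ?S * (\<Sum>k\<in>G \<times> Y. \<bar>a k\<bar> powr p * (\<integral>z. \<bar>?w k z\<bar> \<partial>lborel))"
  proof -
    have "(\<integral>z. (\<Sum>k\<in>G \<times> Y. \<bar>a k\<bar> powr p * \<bar>?w k z\<bar>) \<partial>lborel) = (\<Sum>k\<in>G \<times> Y. \<integral>z. \<bar>a k\<bar> powr p * \<bar>?w k z\<bar> \<partial>lborel)"
      by (intro Bochner_Integration.integral_sum cs_integrable cs_cmult cs_abs csw)
    then show ?thesis by simp
  qed
  also have "\<dots> \<le> ?S * (\<Sum>k\<in>G \<times> Y. \<bar>a k\<bar> powr p * (Ath * K0 / 2 ^ (CARD('d) * n)))"
    using G by (intro mult_left_mono sum_mono integral_abs_wav) auto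
  also have "\<dots> = ?S * Ath * K0 * ((\<Sum>k\<in>G \<times> Y. \<bar>a k\<bar> powr p) / 2 ^ (CARD('d) * n))" (is "_ = ?T")
    by (simp add: sum_distrib_right[symmetric] sum_divide_distrib[symmetric])
  finally have "(\<integral>\<^sup>+z. enn_powr (ennreal \<bar>\<Sum>k\<in>G \<times> Y. a k * ?w k z\<bar>) p \<partial>lborel) \<le> ennreal ?T"
    using ennreal_leI by (metis (no_types, lifting) order_trans)
  also have "?T = (?T powr (1 / p)) powr p"
    using p Ath_nonneg K0_nonneg by (simp add: powr_powr sum_nonneg)
  finally have "enn_powr (\<integral>\<^sup>+z. enn_powr (ennreal \<bar>\<Sum>k\<in>G \<times> Y. a k * ?w k z\<bar>) p \<partial>lborel) (1 / p) \<le> ennreal (?T powr (1 / p))"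
    using p by (intro enn_powr_le_imp) auto
  then show ?thesis using p by (simp add: Lp_norm_def eLp_norm_def)
qed

definition layer_sum :: "nat \<Rightarrow> (real^'d) set \<Rightarrow> (nat \<times> (real^'d) \<Rightarrow> real) \<Rightarrow> real^'d \<Rightarrow> real" where
  "layer_sum m X c z = (\<Sum>i\<in>{0<..<2 ^ CARD('d)} \<times> X. c i * wav (\<theta> (fst i)) m (snd i) z)"

lemma cs_layer_sum: "cs (layer_sum m X c)"
  unfolding layer_sum_def[abs_def] by (intro cs_sum cs_cmult cs_wav \<theta>_cs) auto

text \<open>The discrete norm of exponent \<open>p\<close> in which a lattice point carries the
  volume of its cell; with the normalisation of \<open>wav\<close> it controls the Lebesgue norm of
  the layer.\<close>

definition size_norm :: "real \<Rightarrow> nat \<Rightarrow> (real^'d) set \<Rightarrow> (nat \<times> (real^'d) \<Rightarrow> real) \<Rightarrow> real" where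
  "size_norm p m X c = ((\<Sum>i\<in>{0<..<2 ^ CARD('d)} \<times> X. \<bar>c i\<bar> powr p) / 2 ^ (CARD('d) * m)) powr (1 / p)"

lemma coef_layer:
  assumes \<rho>: "cbnd r A 1 \<rho>" and k: "fst k \<in> {0} \<union> {0<..<2 ^ CARD('d)}"
  shows "2 ^ (CARD('d) * n) * L2_inner (\<lambda>z. \<rho> z * layer_sum m X c z) (wav (\<theta> (fst k)) n (snd k)) =
    (\<Sum>i\<in>{0<..<2 ^ CARD('d)} \<times> X. wmat \<rho> n m k i * c i)"
proof -
  have c\<rho>: "continuous_on UNIV \<rho>" using C_on_continuous[OF cbnd_C_on[OF \<rho>]] .
  have e: "(\<lambda>z. \<rho> z * layer_sum m X c z) = (\<lambda>z. \<Sum>i\<in>{0<..<2 ^ CARD('d)} \<times> X. c i * (\<rho> z * wav (\<theta> (fst i)) m (snd i) z))"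
    by (auto simp: layer_sum_def sum_distrib_left mult_ac)
  have "L2_inner (\<lambda>z. \<rho> z * layer_sum m X c z) (wav (\<theta> (fst k)) n (snd k)) =
    (\<Sum>i\<in>{0<..<2 ^ CARD('d)} \<times> X. c i * L2_inner (\<lambda>z. \<rho> z * wav (\<theta> (fst i)) m (snd i) z) (wav (\<theta> (fst k)) n (snd k)))"
    unfolding e by (intro L2_inner_sum cs_L2 cs_mult_left cs_wav \<theta>_cs c\<rho> k) auto
  then show ?thesis by (simp add: wmat_def sum_distrib_left mult_ac)
qed

text \<open>\<open>e\<close> is the price of the norm in which the result is measured: nothing for
  exponent \<open>p\<close>, and \<open>real CARD('d) / p\<close> for the supremum, because a single
  coefficient is bounded by the p-th root of the sum of p-th powers, in which the cell volume is
  missing.\<close>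

lemma layer_norm_bound:
  assumes A: "0 \<le> A" and p: "1 \<le> p" and P: "(P = ennreal p \<and> e = 0) \<or> (P = \<infinity> \<and> e = real CARD('d) / p)"
  obtains D where "0 \<le> D"
    "\<And>\<rho> n m X c. cbnd r A 1 \<rho> \<Longrightarrow> finite X \<Longrightarrow> X \<subseteq> dyadic_lattice m \<Longrightarrow>
      Lp_norm lborel P (PW n (\<lambda>z. \<rho> z * layer_sum m X c z)) \<le>
        ennreal (D * (1 / 2 ^ dist2 n m) ^ r * 2 powr (e * real n) * size_norm p m X c)"
    "\<And>\<rho> m X c. cbnd r A 1 \<rho> \<Longrightarrow> finite X \<Longrightarrow> X \<subseteq> dyadic_lattice m \<Longrightarrow>
      Lp_norm lborel P (PV 0 (\<lambda>z. \<rho> z * layer_sum m X c z)) \<le>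
        ennreal (D * (1 / 2 ^ dist2 0 m) ^ r * 2 powr (e * real 0) * size_norm p m X c)"
proof -
  define B where "B = 2 ^ CARD('d) * M1 * (C0 * (2 ^ r * A * Ath))"
  define S where "S = 2 ^ CARD('d) * M1 * Ath"
  \<comment> \<open>The first summand serves exponent \<open>p\<close>, the second the supremum
    norm.\<close>
  define D where "D = (S powr (p - 1) * Ath * K0) powr (1 / p) * B + S * B"
  have B0: "0 \<le> B" unfolding B_def using M1_ge_1 C0_nonneg A Ath_nonneg by simp
  have S0: "0 \<le> S" unfolding S_def using M1_ge_1 Ath_nonneg by simp
  have D0: "0 \<le> D" unfolding D_def using B0 S0 by simp
  have main: "Lp_norm lborel P (\<lambda>z. \<Sum>k\<in>G \<times> Y. a k * wav (\<theta> (fst k)) n (snd k) z) \<le>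
        ennreal (D * (1 / 2 ^ dist2 n m) ^ r * 2 powr (e * real n) * size_norm p m X c)"
    if \<rho>: "cbnd r A 1 \<rho>" and X: "finite X" "X \<subseteq> dyadic_lattice m" and Y: "finite Y" "Y \<subseteq> dyadic_lattice n"
      and G: "G \<subseteq> {0<..<2 ^ CARD('d)} \<or> (G = {0} \<and> n \<le> m)"
      and a: "\<And>k. k \<in> G \<times> Y \<Longrightarrow> a k = (\<Sum>i\<in>{0<..<2 ^ CARD('d)} \<times> X. wmat \<rho> n m k i * c i)"
    for \<rho> :: "real^'d \<Rightarrow> real" and n m and X :: "(real^'d) set" and c Y G a
  proof -
    define E where "E = B * (1 / 2 ^ dist2 n m) ^ r"
    define \<zeta> where "\<zeta> = (\<Sum>i\<in>{0<..<2 ^ CARD('d)} \<times> X. \<bar>c i\<bar> powr p) / 2 ^ (CARD('d) * m)"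
    have E0: "0 \<le> E" unfolding E_def using B0 by simp
    have \<zeta>0: "0 \<le> \<zeta>" by (simp add: \<zeta>_def sum_nonneg)
    have sn: "size_norm p m X c = \<zeta> powr (1 / p)" by (simp add: size_norm_def \<zeta>_def)
    have G': "G \<subseteq> {0} \<union> {0<..<2 ^ CARD('d)}" using G by auto
    have "(\<Sum>k\<in>G \<times> Y. \<bar>a k\<bar> powr p) = (\<Sum>k\<in>G \<times> Y. \<bar>\<Sum>i\<in>{0<..<2 ^ CARD('d)} \<times> X. wmat \<rho> n m k i * c i\<bar> powr p)"
      by (intro sum.cong refl) (simp add: a)
    then have sum: "(\<Sum>k\<in>G \<times> Y. \<bar>a k\<bar> powr p) \<le> E powr p * 2 ^ (CARD('d) * n) * \<zeta>"
      using wmat_Schur[OF \<rho> p X Y G, of c] by (simp add: E_def B_def \<zeta>_def)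
    have q: "0 \<le> (1 / 2 ^ dist2 n m :: real) ^ r" by simp
    from P show ?thesis
    proof
      assume P: "P = ennreal p \<and> e = 0"
      have "Lp_norm lborel P (\<lambda>z. \<Sum>k\<in>G \<times> Y. a k * wav (\<theta> (fst k)) n (snd k) z) \<le>
        ennreal ((S powr (p - 1) * Ath * K0 * ((\<Sum>k\<in>G \<times> Y. \<bar>a k\<bar> powr p) / 2 ^ (CARD('d) * n))) powr (1 / p))"
        using layer_Lp[OF G' Y p, of a] P by (simp add: S_def)
      also have "\<dots> \<le> ennreal ((S powr (p - 1) * Ath * K0 * (E powr p * \<zeta>)) powr (1 / p))"
      proof (intro ennreal_leI powr_mono2 mult_left_mono)
        show "(\<Sum>k\<in>G \<times> Y. \<bar>a k\<bar> powr p) / 2 ^ (CARD('d) * n) \<le> E powr p * \<zeta>"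
          using sum by (simp add: divide_le_eq mult_ac)
      qed (use p Ath_nonneg K0_nonneg in \<open>auto intro!: mult_nonneg_nonneg divide_nonneg_nonneg sum_nonneg\<close>)
      also have "(S powr (p - 1) * Ath * K0 * (E powr p * \<zeta>)) powr (1 / p) = (S powr (p - 1) * Ath * K0) powr (1 / p) * (E * \<zeta> powr (1 / p))"
        using p E0 \<zeta>0 Ath_nonneg K0_nonneg by (simp add: powr_mult powr_powr)
      also have "\<dots> \<le> D * (1 / 2 ^ dist2 n m) ^ r * 2 powr (e * real n) * size_norm p m X c"
        unfolding sn E_def D_def using P S0 B0 q \<zeta>0 by (simp add: distrib_right mult.assoc)
      finally show ?thesis using ennreal_leI by (metis (no_types, lifting) order_trans)
    next
      assume P: "P = \<infinity> \<and> e = real CARD('d) / p"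
      define b where "b = E * 2 powr (e * real n) * \<zeta> powr (1 / p)"
      have b0: "0 \<le> b" unfolding b_def using E0 by simp
      have ab: "\<bar>a k\<bar> \<le> b" if k: "k \<in> G \<times> Y" for k
      proof -
        have fGY: "finite (G \<times> Y)" using finite_subset[OF G'] Y by simp
        have "\<bar>a k\<bar> powr p \<le> (\<Sum>k\<in>G \<times> Y. \<bar>a k\<bar> powr p)" using k fGY by (intro member_le_sum) auto
        also note sum
        finally have "(\<bar>a k\<bar> powr p) powr (1 / p) \<le> (E powr p * 2 ^ (CARD('d) * n) * \<zeta>) powr (1 / p)"
          using p by (intro powr_mono2) auto
        also have "(E powr p * 2 ^ (CARD('d) * n) * \<zeta>) powr (1 / p) = E * (2 ^ (CARD('d) * n)) powr (1 / p) * \<zeta> powr (1 / p)"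
          using p E0 \<zeta>0 by (simp add: powr_mult powr_powr)
        also have "(2 ^ (CARD('d) * n)) powr (1 / p) = 2 powr (e * real n)"
          using P by (simp add: powr_powr flip: powr_realpow)
        finally show ?thesis using p by (simp add: powr_powr b_def)
      qed
      have "Lp_norm lborel P (\<lambda>z. \<Sum>k\<in>G \<times> Y. a k * wav (\<theta> (fst k)) n (snd k) z) \<le> ennreal (S * b)"
      proof -
        have m: "(\<lambda>z. \<Sum>k\<in>G \<times> Y. a k * wav (\<theta> (fst k)) n (snd k) z) \<in> borel_measurable lborel"
          by (intro cs_measurable cs_sum cs_cmult cs_wav \<theta>_cs) (use G' in auto)
        have "\<bar>\<Sum>k\<in>G \<times> Y. a k * wav (\<theta> (fst k)) n (snd k) z\<bar> \<le> S * b" for z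
          using layer_sup[OF G' Y ab b0] by (simp add: S_def)
        then have "esssup lborel (\<lambda>z. ennreal \<bar>\<Sum>k\<in>G \<times> Y. a k * wav (\<theta> (fst k)) n (snd k) z\<bar>) \<le> ennreal (S * b)"
          using m by (intro esssup_I AE_I2 ennreal_leI) auto
        then show ?thesis using P by (simp add: Lp_norm_def eLp_norm_def)
      qed
      also have "\<dots> \<le> ennreal (D * (1 / 2 ^ dist2 n m) ^ r * 2 powr (e * real n) * size_norm p m X c)"
        unfolding sn E_def D_def b_def using S0 B0 q \<zeta>0
        by (intro ennreal_leI) (simp add: distrib_right mult.assoc)
      finally show ?thesis .
    qed
  qed
  show ?thesis
  proof (rule that[OF D0])
    fix \<rho> :: "real^'d \<Rightarrow> real" and n m and X :: "(real^'d) set" and c :: "nat \<times> (real^'d) \<Rightarrow> real"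
    assume \<rho>: "cbnd r A 1 \<rho>" and X: "finite X" "X \<subseteq> dyadic_lattice m"
    let ?h = "\<lambda>z. \<rho> z * layer_sum m X c z"
    have h: "cs ?h" using cs_layer_sum C_on_continuous[OF cbnd_C_on[OF \<rho>]] by (rule cs_mult_left)
    obtain Y where Y: "finite Y" "Y \<subseteq> dyadic_lattice n"
      "\<And>j x. j \<in> {0<..<2 ^ CARD('d)} \<Longrightarrow> x \<in> dyadic_lattice n \<Longrightarrow> x \<notin> Y \<Longrightarrow> L2_inner ?h (wav (\<theta> j) n x) = 0"
      using WL.P_finite[OF h] by metis
    have e: "PW n ?h = (\<lambda>z. \<Sum>k\<in>{0<..<2 ^ CARD('d)} \<times> Y. (2 ^ (CARD('d) * n) * L2_inner ?h (wav (\<theta> (fst k)) n (snd k))) * wav (\<theta> (fst k)) n (snd k) z)"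
      by (subst WL.P_eq_sum[OF Y]) (assumption | simp add: sum.cartesian_product case_prod_beta)+
    show "Lp_norm lborel P (PW n ?h) \<le> ennreal (D * (1 / 2 ^ dist2 n m) ^ r * 2 powr (e * real n) * size_norm p m X c)"
      unfolding e
    proof (rule main[OF \<rho> X Y(1,2)])
      fix k :: "nat \<times> (real^'d)" assume "k \<in> {0<..<2 ^ CARD('d)} \<times> Y"
      then show "2 ^ (CARD('d) * n) * L2_inner ?h (wav (\<theta> (fst k)) n (snd k)) = (\<Sum>i\<in>{0<..<2 ^ CARD('d)} \<times> X. wmat \<rho> n m k i * c i)"
        by (intro coef_layer[OF \<rho>]) auto
    qed simp
  next
    fix \<rho> :: "real^'d \<Rightarrow> real" and m and X :: "(real^'d) set" and c :: "nat \<times> (real^'d) \<Rightarrow> real"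
    assume \<rho>: "cbnd r A 1 \<rho>" and X: "finite X" "X \<subseteq> dyadic_lattice m"
    let ?h = "\<lambda>z. \<rho> z * layer_sum m X c z"
    have h: "cs ?h" using cs_layer_sum C_on_continuous[OF cbnd_C_on[OF \<rho>]] by (rule cs_mult_left)
    obtain Y where Y: "finite Y" "Y \<subseteq> dyadic_lattice 0"
      "\<And>j x. j \<in> {0::nat} \<Longrightarrow> x \<in> dyadic_lattice 0 \<Longrightarrow> x \<notin> Y \<Longrightarrow> L2_inner ?h (wav (\<theta> j) 0 x) = 0"
      using VL.P_finite[OF h] by metis
    have e: "PV 0 ?h = (\<lambda>z. \<Sum>k\<in>{0} \<times> Y. (2 ^ (CARD('d) * 0) * L2_inner ?h (wav (\<theta> (fst k)) 0 (snd k))) * wav (\<theta> (fst k)) 0 (snd k) z)"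
      by (subst VL.P_eq_sum[OF Y]) (assumption | simp only: sum.cartesian_product split_def)+
    show "Lp_norm lborel P (PV 0 ?h) \<le> ennreal (D * (1 / 2 ^ dist2 0 m) ^ r * 2 powr (e * real 0) * size_norm p m X c)"
      unfolding e
    proof (rule main[OF \<rho> X Y(1,2)])
      fix k :: "nat \<times> (real^'d)" assume "k \<in> {0} \<times> Y"
      then show "2 ^ (CARD('d) * 0) * L2_inner ?h (wav (\<theta> (fst k)) 0 (snd k)) = (\<Sum>i\<in>{0<..<2 ^ CARD('d)} \<times> X. wmat \<rho> 0 m k i * c i)"
        by (intro coef_layer[OF \<rho>]) auto
    qed simp
  qed
qed

text \<open>Multiplication by \<open>\<rho>\<close> spreads level \<open>m\<close> to the levels
  \<open>n\<close> with decay \<open>(1 / 2 ^ dist2 n m) ^ r\<close>. Weighted by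
  \<open>2 powr ((\<alpha> + e) * real n)\<close>, the contributions decay geometrically on both
  sides of \<open>m\<close> because \<open>\<bar>\<alpha> + e\<bar> < r\<close>, so the total has
  the order of the term \<open>n = m\<close>.\<close>

lemma besov_layer:
  assumes A: "0 \<le> A" and p: "1 \<le> p" and P: "(P = ennreal p \<and> e = 0) \<or> (P = \<infinity> \<and> e = real CARD('d) / p)"
    and \<alpha>: "\<bar>\<alpha> + e\<bar> < real r" and Q: "1 \<le> Q"
  obtains C where "0 \<le> C" "\<And>\<rho> m X c. cbnd r A 1 \<rho> \<Longrightarrow> finite X \<Longrightarrow> X \<subseteq> dyadic_lattice m \<Longrightarrow>
      besov_norm V \<alpha> P Q (\<lambda>z. \<rho> z * layer_sum m X c z) \<le> ennreal (C * 2 powr ((\<alpha> + e) * real m) * size_norm p m X c)"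
proof (rule layer_norm_bound[OF A p P])
  fix D assume D: "0 \<le> D"
    "\<And>\<rho> n m X c. cbnd r A 1 \<rho> \<Longrightarrow> finite X \<Longrightarrow> X \<subseteq> dyadic_lattice m \<Longrightarrow>
      Lp_norm lborel P (PW n (\<lambda>z. \<rho> z * layer_sum m X c z)) \<le>
        ennreal (D * (1 / 2 ^ dist2 n m) ^ r * 2 powr (e * real n) * size_norm p m X c)"
    "\<And>\<rho> m X c. cbnd r A 1 \<rho> \<Longrightarrow> finite X \<Longrightarrow> X \<subseteq> dyadic_lattice m \<Longrightarrow>
      Lp_norm lborel P (PV 0 (\<lambda>z. \<rho> z * layer_sum m X c z)) \<le>
        ennreal (D * (1 / 2 ^ dist2 0 m) ^ r * 2 powr (e * real 0) * size_norm p m X c)"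
  define a where "a = \<alpha> + e"
  \<comment> \<open>The first term is for levels above \<open>m\<close>, the second for those
    below.\<close>
  define g where "g k = 2 powr ((a - real r) * real k) + 2 powr ((- a - real r) * real k)" for k
  have gs: "summable g" unfolding g_def using \<alpha> by (intro summable_add summable_pow) (auto simp: a_def)
  have g0: "0 \<le> g k" for k by (simp add: g_def)
  have key: "2 powr (a * real n) * (1 / 2 ^ dist2 n m) ^ r \<le> 2 powr (a * real m) * g (dist2 n m)" for n m
  proof (cases "n \<le> m")
    case True
    define k where "k = m - n"
    have n: "real n = real m - real k" and d: "dist2 n m = k" using True by (auto simp: k_def dist2_def)
    have "2 powr (a * real n) * (1 / 2 ^ dist2 n m) ^ r = 2 powr (a * real m) * 2 powr ((- a - real r) * real k)"
      unfolding d pow_powr n by (simp add: algebra_simps flip: powr_add)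
    also have "\<dots> \<le> 2 powr (a * real m) * g k" by (intro mult_left_mono) (auto simp: g_def)
    finally show ?thesis by (simp add: d)
  next
    case False
    define k where "k = n - m"
    have n: "real n = real m + real k" and d: "dist2 n m = k" using False by (auto simp: k_def dist2_def)
    have "2 powr (a * real n) * (1 / 2 ^ dist2 n m) ^ r = 2 powr (a * real m) * 2 powr ((a - real r) * real k)"
      unfolding d pow_powr n by (simp add: algebra_simps flip: powr_add)
    also have "\<dots> \<le> 2 powr (a * real m) * g k" by (intro mult_left_mono) (auto simp: g_def)
    finally show ?thesis by (simp add: d)
  qed
  \<comment> \<open>Twice \<open>suminf g\<close> for the two-sided sum of the layers, once for the
    part in \<open>V 0\<close>.\<close>
  define C where "C = 3 * D * suminf g"
  have sg0: "0 \<le> suminf g" by (rule suminf_nonneg[OF gs g0])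
  show ?thesis
  proof (rule that[of C])
    show "0 \<le> C" unfolding C_def using D(1) sg0 by simp
    fix \<rho> :: "real^'d \<Rightarrow> real" and m and X :: "(real^'d) set" and c :: "nat \<times> (real^'d) \<Rightarrow> real"
    assume \<rho>: "cbnd r A 1 \<rho>" and X: "finite X" "X \<subseteq> dyadic_lattice m"
    let ?h = "\<lambda>z. \<rho> z * layer_sum m X c z"
    have h: "cs ?h" using cs_layer_sum C_on_continuous[OF cbnd_C_on[OF \<rho>]] by (rule cs_mult_left)
    define s where "s = size_norm p m X c"
    have s0: "0 \<le> s" by (simp add: s_def size_norm_def)
    define t where "t = D * s * 2 powr (a * real m)"
    have t0: "0 \<le> t" using D(1) s0 by (simp add: t_def)
    have W: "ennreal (2 powr (\<alpha> * real n)) * Lp_norm lborel P (PW n ?h) \<le> ennreal (t * g (dist2 n m))" for n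
    proof -
      have "ennreal (2 powr (\<alpha> * real n)) * Lp_norm lborel P (PW n ?h) \<le>
        ennreal (2 powr (\<alpha> * real n)) * ennreal (D * (1 / 2 ^ dist2 n m) ^ r * 2 powr (e * real n) * s)"
        unfolding s_def by (intro mult_left_mono D(2) \<rho> X) simp
      also have "\<dots> = ennreal (D * s * (2 powr (a * real n) * (1 / 2 ^ dist2 n m) ^ r))"
      proof -
        have pe: "2 powr (a * real n) = 2 powr (\<alpha> * real n) * 2 powr (e * real n)"
          by (simp add: a_def distrib_right powr_add)
        show ?thesis unfolding pe using D(1) s0 by (simp add: mult_ac flip: ennreal_mult)
      qed
      also have "\<dots> \<le> ennreal (D * s * (2 powr (a * real m) * g (dist2 n m)))"
        using D(1) s0 by (intro ennreal_leI mult_left_mono key) auto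
      finally show ?thesis by (simp add: t_def mult.assoc)
    qed
    have "eLp_norm (count_space UNIV) Q (\<lambda>n. ennreal (2 powr (\<alpha> * real n)) * Lp_norm lborel P (PW n ?h)) \<le> ennreal (t * (\<Sum>n. g (dist2 n m)))"
      by (rule lq_const_mult_le[OF Q W t0 g0 suminf_dist2(1)[OF gs g0]])
    also have "\<dots> \<le> ennreal (t * (2 * suminf g))"
      using t0 suminf_dist2(2)[OF gs g0] by (intro ennreal_leI mult_left_mono)
    finally have 1: "eLp_norm (count_space UNIV) Q (\<lambda>n. ennreal (2 powr (\<alpha> * real n)) * Lp_norm lborel P (PW n ?h)) \<le> ennreal (t * (2 * suminf g))" .
    have "Lp_norm lborel P (PV 0 ?h) \<le> ennreal (D * (1 / 2 ^ dist2 0 m) ^ r * 2 powr (e * real 0) * s)"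
      unfolding s_def by (intro D(3) \<rho> X)
    also have "\<dots> = ennreal (D * s * (2 powr (a * real 0) * (1 / 2 ^ dist2 0 m) ^ r))" by (simp add: mult_ac)
    also have "\<dots> \<le> ennreal (D * s * (2 powr (a * real m) * g (dist2 0 m)))"
      using D(1) s0 by (intro ennreal_leI mult_left_mono key) auto
    also have "\<dots> \<le> ennreal (t * suminf g)"
    proof -
      have "g (dist2 0 m) \<le> suminf g" using sum_le_suminf[OF gs, of "{dist2 0 m}"] g0 by simp
      then have "t * g (dist2 0 m) \<le> t * suminf g" using t0 by (rule mult_left_mono)
      then show ?thesis by (intro ennreal_leI) (simp add: t_def mult.assoc)
    qed
    finally have "besov_norm V \<alpha> P Q ?h \<le> ennreal (t * suminf g) + ennreal (t * (2 * suminf g))"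
      unfolding besov_eq[OF h] using 1 by (rule add_mono)
    also have "\<dots> = ennreal (t * suminf g + t * (2 * suminf g))"
      using t0 sg0 by (intro ennreal_plus[symmetric]) auto
    also have "t * suminf g + t * (2 * suminf g) = C * 2 powr ((\<alpha> + e) * real m) * size_norm p m X c"
      by (simp add: C_def t_def a_def s_def)
    finally show "besov_norm V \<alpha> P Q ?h \<le> ennreal (C * 2 powr ((\<alpha> + e) * real m) * size_norm p m X c)" .
  qed
qed

end

section \<open>Mollification\<close>

text \<open>The powers of \<open>1 / t\<close> are included because the derivative of a member of
  this family is a linear combination of members, so that smoothness across 0 follows by
  induction.\<close>

definition flat :: "nat \<Rightarrow> real \<Rightarrow> real" where
  "flat k t = (if 0 < t then (1 / t) ^ k * exp (- (1 / t)) else 0)"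

lemma flat_DERIV: "(flat k has_real_derivative (flat (k + 2) t - real k * flat (k + 1) t)) (at t)"
proof -
  consider "t > 0" | "t < 0" | "t = 0" by linarith
  then show ?thesis
  proof cases
    case 1
    have "((\<lambda>t. (1 / t) ^ k * exp (- (1 / t))) has_real_derivative
        (real k * ((1 / t) ^ (k - Suc 0) * - ((1 / t) * (1 / t)))) * exp (- (1 / t)) +
        (1 / t) ^ k * (exp (- (1 / t)) * ((1 / t) * (1 / t)))) (at t)"
      using 1 by (auto intro!: derivative_eq_intros simp: divide_inverse mult_ac)
    moreover have "(real k * ((1 / t) ^ (k - Suc 0) * - ((1 / t) * (1 / t)))) * exp (- (1 / t)) +
        (1 / t) ^ k * (exp (- (1 / t)) * ((1 / t) * (1 / t))) = flat (k + 2) t - real k * flat (k + 1) t"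
      using 1 by (cases k) (simp_all add: flat_def mult_ac del: of_nat_Suc)
    ultimately have "((\<lambda>t. (1 / t) ^ k * exp (- (1 / t))) has_real_derivative (flat (k + 2) t - real k * flat (k + 1) t)) (at t)"
      by (simp only:)
    then show ?thesis
      by (rule has_field_derivative_transform_within_open[where S="{0<..}"]) (use 1 in \<open>auto simp: flat_def\<close>)
  next
    case 2
    have "((\<lambda>t. 0) has_real_derivative (flat (k + 2) t - real k * flat (k + 1) t)) (at t)"
      using 2 by (auto simp: flat_def)
    then show ?thesis
      by (rule has_field_derivative_transform_within_open[where S="{..<0}"]) (use 2 in \<open>auto simp: flat_def\<close>)
  next
    case 3
    have "((\<lambda>h. flat k h / h) \<longlongrightarrow> 0) (at 0)"
    proof (rule filterlim_split_at)
      show "((\<lambda>h. flat k h / h) \<longlongrightarrow> 0) (at_left 0)"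
        by (rule tendsto_eventually) (auto simp: flat_def eventually_at_filter)
      have "((\<lambda>h::real. inverse h ^ (k + 1) / exp (inverse h)) \<longlongrightarrow> 0) (at_right 0)"
        by (rule filterlim_compose[OF tendsto_power_div_exp_0 filterlim_inverse_at_top_right])
      then show "((\<lambda>h. flat k h / h) \<longlongrightarrow> 0) (at_right 0)"
      proof (rule Lim_transform_eventually)
        show "\<forall>\<^sub>F h in at_right 0. inverse h ^ (k + 1) / exp (inverse h) = flat k h / h"
          using eventually_at_right_less[of "0::real"]
          by eventually_elim (simp add: flat_def exp_minus divide_inverse)
      qed
    qed
    then show ?thesis using 3 by (simp add: has_field_derivative_iff flat_def)
  qed
qed

lemma C_on_flat: "C_on r UNIV (\<lambda>x::real^'d::finite. flat k (a * x $ i + b))"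
proof (induction r arbitrary: k)
  case 0
  have "continuous_on UNIV (flat k)"
    using flat_DERIV by (intro DERIV_continuous_on) (auto intro: has_field_derivative_at_within)
  then show ?case by (auto intro!: continuous_on_compose2[of UNIV "flat k"] continuous_intros)
next
  case (Suc r)
  let ?D = "\<lambda>x::real^'d. a * (flat (k + 2) (a * x $ i + b) + (- real k) * flat (k + 1) (a * x $ i + b))"
  have d: "((\<lambda>x. flat k (a * x $ i + b)) has_derivative (\<lambda>h. ?D x * h $ i)) (at x)" for x
  proof -
    have "((\<lambda>x::real^'d. a * x $ i + b) has_derivative (\<lambda>h. a * h $ i)) (at x)"
      by (auto intro!: derivative_eq_intros bounded_linear.has_derivative[OF bounded_linear_vec_nth])
    from has_derivative_compose[OF this flat_DERIV[of k "a * x $ i + b", unfolded has_field_derivative_def]]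
    show ?thesis by (simp add: mult_ac)
  qed
  have "partial j (\<lambda>x. flat k (a * x $ i + b)) = (\<lambda>x. (if i = j then 1 else 0) * ?D x)" for j
    using partial_eq[OF d] by (auto simp: axis_def)
  moreover have "C_on r UNIV (\<lambda>x. (if i = j then 1 else 0) * ?D x)" for j
    by (intro C_on_cmult C_on_add Suc.IH)
  ultimately have "C_on r UNIV (partial j (\<lambda>x::real^'d. flat k (a * x $ i + b)))" for j by (simp only:)
  moreover have "(\<lambda>x::real^'d. flat k (a * x $ i + b)) differentiable (at x)" for x
    unfolding differentiable_def using d by blast
  ultimately show ?case unfolding C_on.simps by blast
qed

text \<open>Positive exactly on the open cube of points whose coordinates all have modulus less than
  1.\<close>

definition bump :: "real^'d::finite \<Rightarrow> real" where
  "bump x = (\<Prod>i\<in>UNIV. flat 0 (1 * x $ i + 1) * flat 0 ((-1) * x $ i + 1))"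

lemma C_on_bump: "C_on r UNIV bump"
  unfolding bump_def[abs_def] by (intro C_on_prod C_on_mult C_on_flat)

lemma bump_nonneg: "0 \<le> bump x"
  by (auto simp: bump_def flat_def intro!: prod_nonneg)

text \<open>The cube lies in the ball of radius d because the Euclidean norm is at most the sum of
  the moduli of the coordinates; the crude radius is harmless after the scaling in
  \<open>moll\<close>.\<close>

lemma bump_zero: "real CARD('d) < norm (x :: real^'d::finite) \<Longrightarrow> bump x = 0"
proof -
  assume n: "real CARD('d) < norm x"
  have "\<exists>i. 1 \<le> \<bar>x $ i\<bar>"
  proof (rule ccontr)
    assume "\<not> ?thesis"
    then have "(\<Sum>i\<in>UNIV. \<bar>x $ i\<bar>) \<le> (\<Sum>i\<in>(UNIV::'d set). 1)"
      by (intro sum_mono) (auto simp: not_le intro: less_imp_le)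
    then show False using n norm_le_l1_cart[of x] by simp
  qed
  then obtain i where "1 \<le> \<bar>x $ i\<bar>" by blast
  then have "flat 0 (1 * x $ i + 1) * flat 0 ((-1) * x $ i + 1) = 0" by (auto simp: flat_def)
  then show ?thesis unfolding bump_def by (intro prod_zero) auto
qed

lemma cs_bump: "cs bump"
  by (rule csI[OF C_on_continuous[OF C_on_bump[of 0]] bump_zero])

lemma bump_integral_pos: "0 < (\<integral>x. bump (x :: real^'d::finite) \<partial>lborel)"
proof -
  have "bump (0 :: real^'d) \<noteq> 0" by (auto simp: bump_def flat_def)
  then have "\<not> (AE x in lborel. bump (x :: real^'d) = 0)"
    using continuous_AE_zero[OF cs_continuous[OF cs_bump]] by blast
  then have "(\<integral>x. bump (x :: real^'d) \<partial>lborel) \<noteq> 0"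
    by (simp add: integral_nonneg_eq_0_iff_AE cs_integrable cs_bump bump_nonneg)
  moreover have "0 \<le> (\<integral>x. bump (x :: real^'d) \<partial>lborel)" by (intro integral_nonneg_AE AE_I2 bump_nonneg)
  ultimately show ?thesis by linarith
qed

section \<open>Convolution with mollifiers and smooth cut-offs\<close>

definition moll :: "nat \<Rightarrow> real^'d::finite \<Rightarrow> real" where
  "moll n x = (2 ^ (CARD('d) * n) / (\<integral>x. bump (x :: real^'d) \<partial>lborel)) * wav bump n 0 x"

lemma cs_moll: "cs (moll n)"
  unfolding moll_def[abs_def] by (intro cs_cmult cs_wav cs_bump)

lemma C_on_moll: "C_on r UNIV (moll n)"
  unfolding moll_def[abs_def] by (intro C_on_cmult C_on_wav C_on_bump)

lemma moll_nonneg: "0 \<le> moll n (x :: real^'d::finite)"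
  using less_imp_le[OF bump_integral_pos[where 'd='d]] bump_nonneg
  unfolding moll_def wav_def by (intro mult_nonneg_nonneg divide_nonneg_nonneg) auto

lemma moll_zero: "real CARD('d) / 2 ^ n < norm (x :: real^'d::finite) \<Longrightarrow> moll n x = 0"
  using bump_zero[of "2 ^ n *\<^sub>R x"] by (simp add: moll_def wav_def field_simps)

lemma moll_integral: "(\<integral>x. moll n (x :: real^'d::finite) \<partial>lborel) = 1"
proof -
  have "(bump :: real^'d \<Rightarrow> real) \<in> borel_measurable borel" using cs_measurable[OF cs_bump] by simp
  from integral_wav[OF this, of n 0] show ?thesis
    using bump_integral_pos[where 'd='d] by (simp add: moll_def wav_def)
qed

definition conv :: "(real^'d::finite \<Rightarrow> real) \<Rightarrow> (real^'d \<Rightarrow> real) \<Rightarrow> real^'d \<Rightarrow> real" where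
  "conv u g x = (\<integral>y. u (x - y) * g y \<partial>lborel)"

lemma conv_commute:
  fixes u g :: "real^'d::finite \<Rightarrow> real"
  assumes "cs u" "cs g" shows "conv u g x = conv g u x"
proof -
  have cm: "continuous_on UNIV (\<lambda>y. x - y)" by (intro continuous_intros)
  have "(\<lambda>y. u (x - y) * g y) \<in> borel_measurable borel"
    by (intro borel_measurable_continuous_onI continuous_on_mult continuous_on_compose2[OF cs_continuous[OF assms(1)] cm] cs_continuous assms) auto
  then have m: "(\<lambda>y. u (x - y) * g y) \<in> borel_measurable lborel" by simp
  have "conv u g x = (\<integral>y. u (x - y) * g y \<partial>density (distr lborel borel (\<lambda>y. x + (-1) *\<^sub>R y)) (\<lambda>_. ennreal (\<bar>-1\<bar> ^ DIM(real^'d))))"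
    unfolding conv_def using lborel_affine[of "-1" x] by simp
  also have "\<dots> = (\<integral>y. u (x - (x + (-1) *\<^sub>R y)) * g (x + (-1) *\<^sub>R y) \<partial>lborel)"
    using m by (subst integral_density) (auto simp: integral_distr)
  also have "\<dots> = conv g u x" by (simp add: conv_def mult.commute)
  finally show ?thesis .
qed

text \<open>The derivatives are put on \<open>u\<close>; through \<open>conv_commute\<close> they
  can be put on the mollifier instead, which gives smoothness.\<close>

lemma C_on_conv:
  fixes u g :: "real^'d::finite \<Rightarrow> real"
  assumes "cs u" "C_on r UNIV u" "cs g"
  shows "C_on r UNIV (conv u g)"
    and "0 < r \<Longrightarrow> partial i (conv u g) = conv (partial i u) g"
proof -
  obtain b where b: "\<And>y. b < norm y \<Longrightarrow> g y = 0" using assms(3) unfolding cs_def by blast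
  have cg: "continuous_on UNIV g" using assms(3) by (rule cs_continuous)
  have jc: "continuous_on UNIV (\<lambda>(x, y). v (x - y) * g y)" if "continuous_on UNIV v" for v
    unfolding case_prod_beta
    by (intro continuous_on_mult continuous_on_compose2[OF that] continuous_on_compose2[OF cg]) (auto intro!: continuous_intros)
  have cont: "continuous_on UNIV (conv v g)" if "continuous_on UNIV v" for v
    unfolding conv_def[abs_def] by (rule continuous_integral[OF jc[OF that]]) (use b in auto)
  have csv: "cs (\<lambda>y. v (x - y) * g y)" if "continuous_on UNIV v" for v x
    by (rule cs_mult_left[OF assms(3)]) (rule continuous_on_compose2[OF that], auto intro!: continuous_intros)
  obtain a :: "real^'d" where a: "cball 0 b \<subseteq> cbox (-a) a"
    using bounded_subset_cbox_symmetric[OF bounded_cball] by blast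
  then have out: "y \<notin> cbox (-a) a \<Longrightarrow> b < norm y" for y by (force simp: not_le[symmetric])
  have int: "conv v g x = integral (cbox (-a) a) (\<lambda>y. v (x - y) * g y)" if "continuous_on UNIV v" for v x
    unfolding conv_def using csv[OF that] b out by (intro cs_integral_box) auto
  have D: "(conv v g has_derivative (\<lambda>h. \<Sum>i\<in>UNIV. h $ i * conv (partial i v) g x)) (at x)"
    if v: "C_on (Suc 0) UNIV v" for v x
  proof -
    have cv: "continuous_on UNIV v" using v by (rule C_on_continuous)
    have cp: "continuous_on UNIV (partial i v)" for i using v by simp
    \<comment> \<open>The Leibniz rule takes derivatives as bounded linear maps; the coordinate form
      is encoded by inner products with the basis vectors.\<close>
    define fx where "fx x y = (\<Sum>i\<in>UNIV. (partial i v (x - y) * g y) *\<^sub>R blinfun_inner_right (axis i 1 :: real^'d))" for x y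
    have fxa: "blinfun_apply (fx x y) h = (\<Sum>i\<in>UNIV. h $ i * partial i v (x - y)) * g y" for x y h
      by (simp add: fx_def blinfun.sum_left blinfun.scaleR_left inner_axis' sum_distrib_left sum_distrib_right mult_ac)
    have cfx: "continuous_on UNIV (\<lambda>(x, y). fx x y)"
      unfolding fx_def case_prod_beta
      by (intro continuous_on_sum continuous_on_scaleR continuous_on_const jc[OF cp, unfolded case_prod_beta])
    have "((\<lambda>x. integral (cbox (-a) a) (\<lambda>y. v (x - y) * g y)) has_derivative integral (cbox (-a) a) (fx x)) (at x within UNIV)"
    proof (rule leibniz_rule)
      fix x y
      have vd: "(v has_derivative (\<lambda>h. \<Sum>i\<in>UNIV. h $ i * partial i v (x - y))) (at (x - y))"
        using v by (intro has_derivative_partial) auto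
      have "((\<lambda>x. x - y) has_derivative (\<lambda>h. h)) (at x)" by (auto intro!: derivative_eq_intros)
      from has_derivative_mult_left[OF has_derivative_compose[OF this vd], of "g y"]
      show "((\<lambda>x. v (x - y) * g y) has_derivative blinfun_apply (fx x y)) (at x within UNIV)"
        by (simp add: fxa[abs_def])
      show "(\<lambda>y. v (x - y) * g y) integrable_on cbox (- a) a"
        by (intro integrable_continuous continuous_on_subset[OF cs_continuous[OF csv[OF cv]]]) auto
      show "continuous_on (UNIV \<times> cbox (- a) a) (\<lambda>(x, t). fx x t)" using cfx by (rule continuous_on_subset) auto
    qed auto
    moreover have ap: "blinfun_apply (integral (cbox (-a) a) (fx x)) h = (\<Sum>i\<in>UNIV. h $ i * conv (partial i v) g x)" for h
    proof -
      have "continuous_on UNIV (fx x)"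
        using continuous_on_compose2[OF cfx continuous_on_Pair[OF continuous_on_const[of UNIV x] continuous_on_id]] by simp
      then have "fx x integrable_on cbox (-a) a" by (intro integrable_continuous) (auto intro: continuous_on_subset)
      then have "blinfun_apply (integral (cbox (-a) a) (fx x)) h = integral (cbox (-a) a) (\<lambda>y. \<Sum>i\<in>UNIV. h $ i * (partial i v (x - y) * g y))"
        by (subst blinfun_apply_integral) (auto simp: fxa sum_distrib_right mult.assoc)
      also have "\<dots> = (\<Sum>i\<in>UNIV. integral (cbox (-a) a) (\<lambda>y. h $ i * (partial i v (x - y) * g y)))"
        by (intro integral_sum integrable_continuous continuous_on_mult continuous_on_const
            continuous_on_subset[OF cs_continuous[OF csv[OF cp], unfolded continuous_on_def[symmetric]]]) auto
      also have "\<dots> = (\<Sum>i\<in>UNIV. h $ i * conv (partial i v) g x)" by (simp add: int[OF cp])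
      finally show ?thesis .
    qed
    moreover have "blinfun_apply (integral (cbox (-a) a) (fx x)) = (\<lambda>h. \<Sum>i\<in>UNIV. h $ i * conv (partial i v) g x)"
      using ap by auto
    moreover have "conv v g = (\<lambda>x. integral (cbox (-a) a) (\<lambda>y. v (x - y) * g y))" using int[OF cv] by auto
    ultimately show ?thesis by simp
  qed
  have P: "partial i (conv v g) = conv (partial i v) g" if v: "C_on (Suc 0) UNIV v" for v i
  proof
    fix x
    have "(\<Sum>j\<in>UNIV. axis i 1 $ j * conv (partial j v) g x) = conv (partial i v) g x"
      by (simp add: axis_def if_distrib[of "\<lambda>c. c * _"] sum.delta cong: if_cong)
    then show "partial i (conv v g) x = conv (partial i v) g x" using partial_eq[OF D[OF v]] by simp
  qed
  have "C_on r UNIV v \<Longrightarrow> C_on r UNIV (conv v g)" for v r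
  proof (induction r arbitrary: v)
    case 0 then show ?case using cont by simp
  next
    case (Suc r)
    have "C_on (Suc 0) UNIV v" using Suc.prems by (rule C_on_le) simp
    from D[OF this] P[OF this] Suc show ?case by (auto simp: differentiable_def)
  qed
  then show "C_on r UNIV (conv u g)" using assms(2) .
  show "partial i (conv u g) = conv (partial i u) g" if "0 < r"
    using P C_on_le[OF assms(2), of "Suc 0"] that by simp
qed

lemma cs_uniform:
  fixes u :: "real^'d::finite \<Rightarrow> real"
  assumes u: "cs u" and e: "0 < e"
  obtains \<delta> where "0 < \<delta>" "\<And>x y. norm y \<le> \<delta> \<Longrightarrow> \<bar>u (x - y) - u x\<bar> \<le> e"
proof -
  obtain b where b: "\<And>y. b < norm y \<Longrightarrow> u y = 0" using u unfolding cs_def by blast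
  \<comment> \<open>If \<open>norm x\<close> exceeds \<open>b + 1\<close>, both values are 0;
    otherwise \<open>x\<close> and \<open>x - y\<close> lie in this ball, as \<open>norm y\<close>
    will be at most 1.\<close>
  have "uniformly_continuous_on (cball 0 (b + 2)) u"
    using cs_continuous[OF u] by (intro compact_uniformly_continuous) (auto intro: continuous_on_subset)
  then obtain d where d: "0 < d" "\<And>x x'. x \<in> cball 0 (b + 2) \<Longrightarrow> x' \<in> cball 0 (b + 2) \<Longrightarrow> dist x' x < d \<Longrightarrow> dist (u x') (u x) < e"
    using e unfolding uniformly_continuous_on_def by metis
  show ?thesis
  proof (rule that[of "min 1 (d / 2)"])
    show "0 < min 1 (d / 2)" using d(1) by simp
    fix x y :: "real^'d" assume y: "norm y \<le> min 1 (d / 2)"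
    show "\<bar>u (x - y) - u x\<bar> \<le> e"
    proof (cases "b + 1 < norm x")
      case True
      then have "b < norm (x - y)" using y norm_triangle_ineq2[of x y] by simp
      then show ?thesis using True b[of x] b[of "x - y"] e by simp
    next
      case False
      then have "x \<in> cball 0 (b + 2)" "x - y \<in> cball 0 (b + 2)"
        using y norm_triangle_ineq4[of x y] by (auto simp: norm_minus_commute[of y x])
      moreover have "dist (x - y) x < d" using y d(1) by (simp add: dist_norm)
      ultimately show ?thesis using d(2)[of x "x - y"] by (simp add: dist_real_def)
    qed
  qed
qed

lemma moll_radius: "0 < \<delta> \<Longrightarrow> \<exists>n0. \<forall>n\<ge>n0. real m / 2 ^ n \<le> \<delta>"
proof -
  assume d: "0 < \<delta>"
  have "(\<lambda>n. real m * (1 / 2) ^ n) \<longlonglongrightarrow> 0" by (intro tendsto_mult_right_zero LIMSEQ_power_zero) auto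
  from order_tendstoD(2)[OF this d] show ?thesis
    by (auto simp: eventually_sequentially power_one_over intro: less_imp_le)
qed

lemma conv_moll_uniform:
  fixes u :: "real^'d::finite \<Rightarrow> real"
  assumes u: "cs u" and e: "0 < e"
  shows "\<exists>n0. \<forall>n\<ge>n0. \<forall>x. \<bar>conv u (moll n) x - u x\<bar> \<le> e"
proof -
  obtain \<delta> where \<delta>: "0 < \<delta>" "\<And>x y. norm y \<le> \<delta> \<Longrightarrow> \<bar>u (x - y) - u x\<bar> \<le> e" using cs_uniform[OF u e] by blast
  obtain n0 where n0: "\<And>n. n \<ge> n0 \<Longrightarrow> real CARD('d) / 2 ^ n \<le> \<delta>" using moll_radius[OF \<delta>(1)] by blast
  have "\<bar>conv u (moll n) x - u x\<bar> \<le> e" if n: "n \<ge> n0" for n x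
  proof -
    have c1: "cs (\<lambda>y. u (x - y) * moll n y)"
      by (rule cs_mult_left[OF cs_moll]) (rule continuous_on_compose2[OF cs_continuous[OF u]], auto intro!: continuous_intros)
    have c2: "cs (\<lambda>y. (u (x - y) - u x) * moll n y)"
      by (rule cs_mult_left[OF cs_moll], rule continuous_on_diff, rule continuous_on_compose2[OF cs_continuous[OF u]], auto intro!: continuous_intros)
    have "(\<integral>y. (u (x - y) - u x) * moll n y \<partial>lborel) = conv u (moll n) x - (\<integral>y. u x * moll n (y :: real^'d) \<partial>lborel)"
      unfolding conv_def left_diff_distrib
      by (intro Bochner_Integration.integral_diff cs_integrable c1 cs_cmult cs_moll)
    then have "conv u (moll n) x - u x = (\<integral>y. (u (x - y) - u x) * moll n y \<partial>lborel)"
      by (simp add: moll_integral)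
    also have "\<bar>\<dots>\<bar> \<le> (\<integral>y. \<bar>(u (x - y) - u x) * moll n y\<bar> \<partial>lborel)" by (rule integral_abs_bound)
    also have "\<dots> \<le> (\<integral>y. e * moll n (y :: real^'d) \<partial>lborel)"
    proof (rule integral_mono)
      show "integrable lborel (\<lambda>y. \<bar>(u (x - y) - u x) * moll n y\<bar>)" by (intro cs_integrable cs_abs c2)
      show "integrable lborel (\<lambda>y :: real^'d. e * moll n y)" by (intro cs_integrable cs_cmult cs_moll)
      show "\<bar>(u (x - y) - u x) * moll n y\<bar> \<le> e * moll n y" for y
      proof (cases "norm y \<le> \<delta>")
        case True
        then show ?thesis using mult_right_mono[OF \<delta>(2)[OF True, of x] moll_nonneg[of n y]] moll_nonneg[of n y] by (simp add: abs_mult)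
      next
        case False
        then have "moll n y = 0" using n0[OF n] by (intro moll_zero) linarith
        then show ?thesis by simp
      qed
    qed
    also have "\<dots> = e" by (simp add: moll_integral)
    finally show ?thesis .
  qed
  then show ?thesis by blast
qed

text \<open>Convolution commutes with partial derivatives, so the approximation of the derivatives
  is uniform approximation applied to each of them.\<close>

lemma conv_moll_approx:
  fixes u :: "real^'d::finite \<Rightarrow> real"
  assumes "cs u" "C_on r UNIV u" "0 < e"
  shows "\<exists>n0. \<forall>n\<ge>n0. cbnd r e 1 (\<lambda>x. conv u (moll n) x - u x)"
  using assms
proof (induction r arbitrary: u)
  case 0
  have c: "C_on 0 UNIV (\<lambda>x. conv u (moll n) x - u x)" for n
    using C_on_conv(1)[OF 0(1,2) cs_moll] 0(2) by (intro C_on_diff)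
  obtain n0 where "\<forall>n\<ge>n0. \<forall>x. \<bar>conv u (moll n) x - u x\<bar> \<le> e" using conv_moll_uniform[OF 0(1,3)] by blast
  then show ?case using c by (intro exI[of _ n0]) simp
next
  case (Suc r)
  have "\<exists>n0. \<forall>n\<ge>n0. cbnd r e 1 (\<lambda>x. conv (partial i u) (moll n) x - partial i u x)" for i
    using Suc.prems by (intro Suc.IH cs_partial) auto
  then obtain n1 where n1: "\<And>i n. n \<ge> n1 i \<Longrightarrow> cbnd r e 1 (\<lambda>x. conv (partial i u) (moll n) x - partial i u x)" by metis
  obtain n0 where n0: "\<And>n x. n \<ge> n0 \<Longrightarrow> \<bar>conv u (moll n) x - u x\<bar> \<le> e" using conv_moll_uniform[OF Suc.prems(1,3)] by blast
  have "cbnd (Suc r) e 1 (\<lambda>x. conv u (moll n) x - u x)" if n: "n \<ge> n0 + (\<Sum>i\<in>UNIV. n1 i)" for n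
  proof -
    have d1: "conv u (moll n) differentiable (at x)" for x
      using C_on_conv(1)[OF Suc.prems(1,2) cs_moll] by simp
    have d2: "u differentiable (at x)" for x using Suc.prems(2) by simp
    have p: "partial i (\<lambda>x. conv u (moll n) x - u x) = (\<lambda>x. conv (partial i u) (moll n) x - partial i u x)" for i
    proof
      fix x
      have "partial i (\<lambda>x. conv u (moll n) x + (-1) * u x) x = partial i (conv u (moll n)) x + (-1) * partial i u x"
        by (simp only: partial_add[OF d1 differentiable_mult[OF differentiable_const d2]] partial_cmult[OF d2])
      then show "partial i (\<lambda>x. conv u (moll n) x - u x) x = conv (partial i u) (moll n) x - partial i u x"
        using C_on_conv(2)[OF Suc.prems(1,2) cs_moll, of i] by simp
    qed
    have "n1 i \<le> n" for i
      using n member_le_sum[of i UNIV n1] by simp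
    then have "cbnd r (e * 1) 1 (partial i (\<lambda>x. conv u (moll n) x - u x))" for i
      unfolding p using n1 by simp
    moreover have "\<bar>conv u (moll n) x - u x\<bar> \<le> e" for x using n0 n by simp
    ultimately show ?thesis using d1 d2 by (auto intro!: differentiable_diff)
  qed
  then show ?case by blast
qed

lemma cs_conv_moll:
  fixes u :: "real^'d::finite \<Rightarrow> real"
  assumes u: "cs u" shows "cs (conv u (moll n))" "smooth_on UNIV (conv u (moll n))"
proof -
  obtain b where b: "\<And>y. b < norm y \<Longrightarrow> u y = 0" using u unfolding cs_def by blast
  have c: "conv u (moll n) = conv (moll n) u" using conv_commute[OF u cs_moll] by auto
  show s: "smooth_on UNIV (conv u (moll n))"
    unfolding smooth_on_def c using C_on_conv(1)[OF cs_moll C_on_moll u] by blast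
  show "cs (conv u (moll n))"
  proof (rule csI)
    show "continuous_on UNIV (conv u (moll n))" using s C_on_continuous unfolding smooth_on_def by blast
    fix x :: "real^'d" assume x: "b + real CARD('d) / 2 ^ n < norm x"
    have "u (x - y) * moll n y = 0" for y
    proof (cases "real CARD('d) / 2 ^ n < norm y")
      case False
      then have "b < norm (x - y)" using x norm_triangle_ineq2[of x y] by linarith
      then show ?thesis by (simp add: b)
    qed (simp add: moll_zero)
    then show "conv u (moll n) x = 0" by (simp only: conv_def integral_zero)
  qed
qed

lemma smooth_approx:
  fixes u :: "real^'d::finite \<Rightarrow> real"
  assumes "cs u" "C_on r UNIV u" "0 < e"
  obtains v where "smooth_on UNIV v" "cs v" "cbnd r e 1 (\<lambda>x. v x - u x)"
  using conv_moll_approx[OF assms] cs_conv_moll[OF assms(1)] by blast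

text \<open>Mollification of a function of the distance to \<open>L\<close> that is 1 up to
  \<open>\<delta>\<close> and 0 beyond \<open>2 * \<delta>\<close>. A mollifier of radius at most
  \<open>\<delta>\<close> preserves the value 1 on \<open>L\<close> and keeps the support within
  distance \<open>3 * \<delta>\<close>.\<close>

lemma cutoff:
  fixes L U :: "(real^'d::finite) set"
  assumes L: "compact L" "L \<subseteq> U" and U: "open U"
  obtains \<rho> where "\<rho> \<in> Cc_smooth U" "\<And>x. x \<in> L \<Longrightarrow> \<rho> x = 1"
proof (cases "L = {}")
  case True
  have "(\<lambda>x. 0 :: real) \<in> Cc_smooth U"
    using C_on_const[of _ 0] by (auto simp: Cc_smooth_def smooth_on_def supp_def)
  then show ?thesis using True that by blast
next
  case False
  obtain e where e: "0 < e" "{x. infdist x L \<le> e} \<subseteq> U" using compact_in_open_separated[OF False L(1) U L(2)] by blast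
  define \<delta> where "\<delta> = e / 3"
  have \<delta>: "0 < \<delta>" using e by (simp add: \<delta>_def)
  define f where "f y = max 0 (min 1 (2 - infdist y L / \<delta>))" for y
  have cpt: "compact {x. infdist x L \<le> e}" using compact_infdist_le[OF False L(1) e(1)] .
  have f0: "f y = 0" if "2 * \<delta> < infdist y L" for y
  proof -
    have "2 \<le> infdist y L / \<delta>" using that \<delta> by (simp add: field_simps)
    then show ?thesis by (simp add: f_def)
  qed
  have f1: "f y = 1" if "infdist y L \<le> \<delta>" for y
  proof -
    have "infdist y L / \<delta> \<le> 1" using that \<delta> by simp
    then show ?thesis by (simp add: f_def)
  qed
  have tri: "infdist x L \<le> infdist z L + norm (x - z)" "infdist z L \<le> infdist x L + norm (x - z)" for x z
    using infdist_triangle[of x L z] infdist_triangle[of z L x] by (auto simp: dist_norm norm_minus_commute)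
  have csf: "cs f"
  proof -
    obtain b where b: "\<And>x. infdist x L \<le> e \<Longrightarrow> norm x \<le> b"
      using compact_imp_bounded[OF cpt] unfolding bounded_iff by blast
    show ?thesis
    proof (rule csI[of _ b])
      show "continuous_on UNIV f" unfolding f_def[abs_def] using \<delta>
        by (intro continuous_intros) auto
      show "f y = 0" if "b < norm y" for y
        using b[of y] that \<delta> by (intro f0) (force simp: \<delta>_def not_le[symmetric])
    qed
  qed
  obtain n where n: "real CARD('d) / 2 ^ n \<le> \<delta>" using moll_radius[OF \<delta>, of "CARD('d)"] by blast
  define \<rho> where "\<rho> = conv f (moll n)"
  have \<rho>1: "\<rho> x = 1" if "x \<in> L" for x
  proof -
    have "f (x - y) * moll n y = moll n y" for y
    proof (cases "real CARD('d) / 2 ^ n < norm y")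
      case False
      then have "infdist (x - y) L \<le> \<delta>" using tri(1)[of "x - y" x] n that by simp
      then show ?thesis by (simp add: f1)
    qed (simp add: moll_zero)
    then show ?thesis by (simp only: \<rho>_def conv_def moll_integral)
  qed
  have \<rho>0: "\<rho> x = 0" if "x \<notin> {x. infdist x L \<le> e}" for x
  proof -
    have "f (x - y) * moll n y = 0" for y
    proof (cases "real CARD('d) / 2 ^ n < norm y")
      case False
      moreover have "3 * \<delta> < infdist x L" using that by (simp add: \<delta>_def)
      moreover have "infdist x L \<le> infdist (x - y) L + norm y" using tri(1)[of x "x - y"] by simp
      ultimately have "2 * \<delta> < infdist (x - y) L" using n by linarith
      then show ?thesis by (simp add: f0)
    qed (simp add: moll_zero)
    then show ?thesis by (simp only: \<rho>_def conv_def integral_zero)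
  qed
  have sm: "smooth_on UNIV \<rho>" unfolding \<rho>_def by (rule cs_conv_moll[OF csf])
  have "\<rho> \<in> Cc 0 U"
    by (rule CcI[of 0 \<rho> "{x. infdist x L \<le> e}"]) (use sm \<rho>0 cpt e in \<open>auto simp: smooth_on_def\<close>)
  then have "\<rho> \<in> Cc_smooth U" using sm by (simp add: Cc_def Cc_smooth_def)
  then show ?thesis using that \<rho>1 by blast
qed

section \<open>The local Besov spaces\<close>

text \<open>\<open>u\<close> is arbitrary outside \<open>U\<close>, so continuity of the product is
  glued from the open sets \<open>U\<close> and the complement of the support of
  \<open>\<rho>\<close>, where the product is 0.\<close>

lemma cs_cut:
  assumes U: "open U" and \<rho>: "\<rho> \<in> Cc_smooth U" and u: "continuous_on U u"
  shows "cs (\<lambda>x. \<rho> x * u x)"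
proof -
  have c: "continuous_on UNIV \<rho>" using \<rho> C_on_continuous unfolding Cc_smooth_def smooth_on_def by blast
  obtain b where b: "\<And>y. y \<in> supp \<rho> \<Longrightarrow> norm y \<le> b"
    using \<rho> compact_imp_bounded[of "supp \<rho>"] unfolding Cc_smooth_def bounded_iff by blast
  have z: "\<rho> x = 0" if "x \<in> - supp \<rho>" for x using supp_zero that by blast
  have "continuous_on (U \<union> - supp \<rho>) (\<lambda>x. \<rho> x * u x)"
  proof (rule continuous_on_open_Un[OF U])
    show "open (- supp \<rho>)" by (simp add: supp_def open_Compl)
    show "continuous_on U (\<lambda>x. \<rho> x * u x)" using c u by (intro continuous_on_mult) (auto intro: continuous_on_subset)
    show "continuous_on (- supp \<rho>) (\<lambda>x. \<rho> x * u x)"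
      by (rule continuous_on_eq[of _ "\<lambda>x. 0"]) (use z in auto)
  qed
  moreover have "U \<union> - supp \<rho> = UNIV" using \<rho> by (auto simp: Cc_smooth_def)
  ultimately show ?thesis
    by (intro csI[of _ b]) (use z b in \<open>force simp: not_le[symmetric]\<close>)+
qed

lemma smooth_on_continuous: "smooth_on U u \<Longrightarrow> continuous_on U u"
  unfolding smooth_on_def by (metis C_on.simps(1))

text \<open>A Cauchy criterion without differences of extended values: the hypothesis bounds the
  limit superior by the limit inferior plus \<open>e\<close>.\<close>

lemma ennreal_Cauchy_convergent:
  fixes u :: "nat \<Rightarrow> ennreal"
  assumes "\<And>e. 0 < e \<Longrightarrow> \<exists>N. \<forall>m\<ge>N. \<forall>n\<ge>N. u n \<le> u m + ennreal e"
  shows "convergent u"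
proof -
  have "limsup u \<le> liminf u"
  proof (rule ennreal_le_epsilon)
    fix e :: real assume "liminf u < \<top>" and e: "0 < e"
    then obtain N where N: "\<And>m n. m \<ge> N \<Longrightarrow> n \<ge> N \<Longrightarrow> u n \<le> u m + ennreal e" using assms by blast
    have "limsup u \<le> u m + ennreal e" if "m \<ge> N" for m
      using N[OF that] by (intro Limsup_bounded) (auto simp: eventually_sequentially)
    then have "limsup u - ennreal e \<le> u m" if "m \<ge> N" for m
      using that by (simp add: ennreal_minus_le_iff add.commute)
    then have "limsup u - ennreal e \<le> liminf u"
      by (intro Liminf_bounded) (auto simp: eventually_sequentially)
    then show "limsup u \<le> liminf u + ennreal e"
      by (simp add: ennreal_minus_le_iff add.commute)
  qed
  then have "liminf u = limsup u" using Liminf_le_Limsup[of sequentially u] by (intro antisym) auto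
  then have "u \<longlonglongrightarrow> limsup u" by (subst tendsto_iff_Liminf_eq_Limsup) auto
  then show ?thesis by (rule convergentI)
qed

context wavelets
begin

context
  fixes U :: "(real^'d) set" and \<alpha> :: real and P Q :: ennreal
  assumes U: "open U" and P: "1 \<le> P" and Q: "1 \<le> Q"
begin

abbreviation "BC \<equiv> besov_cauchy V U \<alpha> P Q"
abbreviation "BR \<equiv> besov_null_rel V U \<alpha> P Q"
abbreviation "BN \<equiv> besov_norm V \<alpha> P Q"

lemma BC_cs: "s \<in> BC \<Longrightarrow> \<rho> \<in> Cc_smooth U \<Longrightarrow> cs (\<lambda>x. \<rho> x * s n x)"
  unfolding besov_cauchy_def using cs_cut[OF U] smooth_on_continuous by blast

lemma BC_cs_diff: "s \<in> BC \<Longrightarrow> s' \<in> BC \<Longrightarrow> \<rho> \<in> Cc_smooth U \<Longrightarrow> cs (\<lambda>x. \<rho> x * (s n x - s' m x))"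
  using cs_diff[OF BC_cs BC_cs, of s \<rho> s' \<rho> n m] by (simp add: right_diff_distrib)

lemma BN_triangle:
  assumes "s1 \<in> BC" "s2 \<in> BC" "s3 \<in> BC" "\<rho> \<in> Cc_smooth U"
  shows "BN (\<lambda>x. \<rho> x * (s1 n x - s3 k x)) \<le> BN (\<lambda>x. \<rho> x * (s1 n x - s2 m x)) + BN (\<lambda>x. \<rho> x * (s2 m x - s3 k x))"
  using besov_add[OF P Q BC_cs_diff[OF assms(1,2,4)] BC_cs_diff[OF assms(2,3,4)], of \<alpha> n m m k]
  by (simp add: algebra_simps)

lemma BN_sym:
  assumes "s1 \<in> BC" "s2 \<in> BC" "\<rho> \<in> Cc_smooth U"
  shows "BN (\<lambda>x. \<rho> x * (s1 n x - s2 m x)) = BN (\<lambda>x. \<rho> x * (s2 m x - s1 n x))"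
  using besov_uminus[OF BC_cs_diff[OF assms], of \<alpha> P Q n m] by (simp add: algebra_simps)

lemma BC_zero: "(\<lambda>n x. 0) \<in> BC"
  using besov_zero[OF P Q, of \<alpha>] C_on_subset[OF C_on_const]
  by (auto simp: besov_cauchy_def smooth_on_def)

lemma BR_refl: "s \<in> BC \<Longrightarrow> s \<in> BR `` {s}"
  using besov_zero[OF P Q, of \<alpha>] by (simp add: besov_null_rel_def)

lemma BR_class: "s \<in> BC \<Longrightarrow> BR `` {s} \<in> besov_loc V U \<alpha> P Q"
  unfolding besov_loc_def by (rule quotientI)

text \<open>Distances and pairings are defined through representatives picked by
  \<open>SOME\<close>; these are unknown, but they differ from the given \<open>s\<close> by a null
  sequence.\<close>

lemma BR_some:
  assumes s: "s \<in> BC"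
  shows "(SOME g. g \<in> BR `` {s}) \<in> BC"
    "\<rho> \<in> Cc_smooth U \<Longrightarrow> (\<lambda>n. BN (\<lambda>x. \<rho> x * (s n x - (SOME g. g \<in> BR `` {s}) n x))) \<longlonglongrightarrow> 0"
proof -
  have "(SOME g. g \<in> BR `` {s}) \<in> BR `` {s}" using someI[of "\<lambda>g. g \<in> BR `` {s}" s] BR_refl[OF s] by blast
  then show "(SOME g. g \<in> BR `` {s}) \<in> BC"
    "\<rho> \<in> Cc_smooth U \<Longrightarrow> (\<lambda>n. BN (\<lambda>x. \<rho> x * (s n x - (SOME g. g \<in> BR `` {s}) n x))) \<longlonglongrightarrow> 0"
    unfolding besov_null_rel_def by auto
qed

text \<open>The seminorm of a difference of classes is a \<open>lim\<close>, which carries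
  information only once convergence is known; this follows from the triangle inequality for the
  chosen Cauchy sequences. The bound then passes from \<open>s\<close> and \<open>s'\<close> to the
  representatives with errors that tend to 0.\<close>

lemma besov_loc_dist_le:
  assumes s: "s \<in> BC" and s': "s' \<in> BC" and \<rho>: "\<rho> \<in> Cc_smooth U"
    and B: "\<And>n. n \<ge> l \<Longrightarrow> BN (\<lambda>x. \<rho> x * (s n x - s' n x)) \<le> B"
  shows "besov_loc_dist V \<alpha> P Q \<rho> (BR `` {s}) (BR `` {s'}) \<le> B"
proof -
  define g g' where "g = (SOME g. g \<in> BR `` {s})" and "g' = (SOME g. g \<in> BR `` {s'})"
  have g: "g \<in> BC" "(\<lambda>n. BN (\<lambda>x. \<rho> x * (s n x - g n x))) \<longlonglongrightarrow> 0"
    unfolding g_def using BR_some[OF s] \<rho> by auto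
  have g': "g' \<in> BC" "(\<lambda>n. BN (\<lambda>x. \<rho> x * (s' n x - g' n x))) \<longlonglongrightarrow> 0"
    unfolding g'_def using BR_some[OF s'] \<rho> by auto
  define u where "u n = BN (\<lambda>x. \<rho> x * (g n x - g' n x))" for n
  have "convergent u"
  proof (rule ennreal_Cauchy_convergent)
    fix e :: real assume e: "0 < e"
    then have e2: "0 < ennreal (e / 2)" by simp
    obtain N1 where N1: "\<And>m n. m \<ge> N1 \<Longrightarrow> n \<ge> N1 \<Longrightarrow> BN (\<lambda>x. \<rho> x * (g m x - g n x)) < ennreal (e / 2)"
      using g(1) \<rho> e2 unfolding besov_cauchy_def by blast
    obtain N2 where N2: "\<And>m n. m \<ge> N2 \<Longrightarrow> n \<ge> N2 \<Longrightarrow> BN (\<lambda>x. \<rho> x * (g' m x - g' n x)) < ennreal (e / 2)"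
      using g'(1) \<rho> e2 unfolding besov_cauchy_def by blast
    have "u n \<le> u m + ennreal e" if "m \<ge> max N1 N2" "n \<ge> max N1 N2" for m n
    proof -
      have "u n \<le> BN (\<lambda>x. \<rho> x * (g n x - g m x)) + BN (\<lambda>x. \<rho> x * (g m x - g' n x))"
        unfolding u_def by (rule BN_triangle[OF g(1) g(1) g'(1) \<rho>])
      also have "BN (\<lambda>x. \<rho> x * (g m x - g' n x)) \<le> u m + BN (\<lambda>x. \<rho> x * (g' m x - g' n x))"
        unfolding u_def by (rule BN_triangle[OF g(1) g'(1) g'(1) \<rho>])
      finally have "u n \<le> BN (\<lambda>x. \<rho> x * (g n x - g m x)) + (u m + BN (\<lambda>x. \<rho> x * (g' m x - g' n x)))"
        by (simp add: add_left_mono)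
      also have "\<dots> \<le> ennreal (e / 2) + (u m + ennreal (e / 2))"
        using N1[of n m] N2[of m n] that by (intro add_mono order_refl) (auto intro: less_imp_le)
      also have "\<dots> = u m + (ennreal (e / 2) + ennreal (e / 2))" by (simp add: ac_simps)
      also have "ennreal (e / 2) + ennreal (e / 2) = ennreal e" using e by (simp flip: ennreal_plus)
      finally show ?thesis .
    qed
    then show "\<exists>N. \<forall>m\<ge>N. \<forall>n\<ge>N. u n \<le> u m + ennreal e" by blast
  qed
  then have u: "u \<longlonglongrightarrow> lim u" by (simp add: convergent_LIMSEQ_iff)
  have "u n \<le> BN (\<lambda>x. \<rho> x * (s n x - g n x)) + (B + BN (\<lambda>x. \<rho> x * (s' n x - g' n x)))" if "n \<ge> l" for n
  proof -
    have "u n \<le> BN (\<lambda>x. \<rho> x * (g n x - s n x)) + BN (\<lambda>x. \<rho> x * (s n x - g' n x))"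
      unfolding u_def by (rule BN_triangle[OF g(1) s g'(1) \<rho>])
    also have "BN (\<lambda>x. \<rho> x * (g n x - s n x)) = BN (\<lambda>x. \<rho> x * (s n x - g n x))" by (rule BN_sym[OF g(1) s \<rho>])
    also have "BN (\<lambda>x. \<rho> x * (s n x - g' n x)) \<le> BN (\<lambda>x. \<rho> x * (s n x - s' n x)) + BN (\<lambda>x. \<rho> x * (s' n x - g' n x))"
      by (rule BN_triangle[OF s s' g'(1) \<rho>])
    also have "BN (\<lambda>x. \<rho> x * (s n x - s' n x)) \<le> B" by (rule B[OF that])
    finally show ?thesis by (simp add: add_left_mono add_right_mono)
  qed
  then have ev: "\<forall>\<^sub>F n in sequentially. u n \<le> BN (\<lambda>x. \<rho> x * (s n x - g n x)) + (B + BN (\<lambda>x. \<rho> x * (s' n x - g' n x)))"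
    unfolding eventually_sequentially by blast
  have "(\<lambda>n. BN (\<lambda>x. \<rho> x * (s n x - g n x)) + (B + BN (\<lambda>x. \<rho> x * (s' n x - g' n x)))) \<longlonglongrightarrow> 0 + (B + 0)"
    by (intro tendsto_add g(2) g'(2) tendsto_const)
  from tendsto_le[OF _ this u ev] have "lim u \<le> B" by simp
  then show ?thesis unfolding besov_loc_dist_def u_def g_def g'_def .
qed

text \<open>A cut-off equal to 1 on the support of \<open>\<eta>\<close> does not change the pairing
  and makes \<open>besov_dual\<close> applicable; neither the cut-off nor the constant depends on
  the sequences.\<close>

lemma BC_pairing_diff:
  assumes \<alpha>: "- real r < \<alpha>" and \<eta>: "\<eta> \<in> Cc r U"
  obtains \<rho> C where "\<rho> \<in> Cc_smooth U" "0 \<le> C"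
    "\<And>s s' n m. s \<in> BC \<Longrightarrow> s' \<in> BC \<Longrightarrow>
      ennreal \<bar>L2_inner (s n) \<eta> - L2_inner (s' m) \<eta>\<bar> \<le> ennreal C * BN (\<lambda>x. \<rho> x * (s n x - s' m x))"
proof -
  have \<eta>': "\<eta> \<in> Cc r UNIV" using \<eta> by (simp add: Cc_def)
  obtain \<rho> where \<rho>: "\<rho> \<in> Cc_smooth U" "\<And>x. x \<in> supp \<eta> \<Longrightarrow> \<rho> x = 1"
    using cutoff[of "supp \<eta>" U] \<eta> U by (auto simp: Cc_def)
  obtain C where C: "0 \<le> C" "\<And>h. cs h \<Longrightarrow> ennreal \<bar>L2_inner h \<eta>\<bar> \<le> ennreal C * BN h"
    using besov_dual[OF \<alpha> P Q \<eta>'] by blast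
  have eq: "L2_inner u \<eta> = L2_inner (\<lambda>x. \<rho> x * u x) \<eta>" for u
  proof -
    have "u x * \<eta> x = \<rho> x * u x * \<eta> x" for x
      using \<rho>(2)[of x] supp_zero[of x \<eta>] by (cases "x \<in> supp \<eta>") auto
    then show ?thesis unfolding L2_inner_def by presburger
  qed
  show ?thesis
  proof (rule that[OF \<rho>(1) C(1)])
    fix s s' n m assume s: "s \<in> BC" and s': "s' \<in> BC"
    have "L2_inner (\<lambda>x. \<rho> x * s n x - \<rho> x * s' m x) \<eta> = L2_inner (\<lambda>x. \<rho> x * s n x) \<eta> - L2_inner (\<lambda>x. \<rho> x * s' m x) \<eta>"
      using BC_cs[OF s \<rho>(1)] BC_cs[OF s' \<rho>(1)] Cc_cs[OF \<eta>] by (intro L2_inner_diff cs_L2)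
    then have "L2_inner (s n) \<eta> - L2_inner (s' m) \<eta> = L2_inner (\<lambda>x. \<rho> x * (s n x - s' m x)) \<eta>"
      using eq[of "s n"] eq[of "s' m"] by (simp add: right_diff_distrib)
    then show "ennreal \<bar>L2_inner (s n) \<eta> - L2_inner (s' m) \<eta>\<bar> \<le> ennreal C * BN (\<lambda>x. \<rho> x * (s n x - s' m x))"
      using C(2)[OF BC_cs_diff[OF s s' \<rho>(1)]] by simp
  qed
qed

text \<open>The pairings along \<open>s\<close> form a Cauchy sequence, and those along the
  representative picked by \<open>SOME\<close> differ from them by a null sequence, so
  \<open>besov_pairing\<close> can be evaluated on the known sequence.\<close>

lemma besov_pairing_lim:
  assumes \<alpha>: "- real r < \<alpha>" and \<eta>: "\<eta> \<in> Cc r U" and s: "s \<in> BC"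
  shows "(\<lambda>n. L2_inner (s n) \<eta>) \<longlonglongrightarrow> besov_pairing (BR `` {s}) \<eta>"
proof -
  obtain \<rho> C where \<rho>: "\<rho> \<in> Cc_smooth U" and C: "0 \<le> C"
    and b: "\<And>s s' n m. s \<in> BC \<Longrightarrow> s' \<in> BC \<Longrightarrow>
      ennreal \<bar>L2_inner (s n) \<eta> - L2_inner (s' m) \<eta>\<bar> \<le> ennreal C * BN (\<lambda>x. \<rho> x * (s n x - s' m x))"
    using BC_pairing_diff[OF \<alpha> \<eta>] by blast
  have "Cauchy (\<lambda>n. L2_inner (s n) \<eta>)"
  proof (rule metric_CauchyI)
    fix e :: real assume e: "0 < e"
    have "0 < ennreal (e / (C + 1))" using e C by simp
    then obtain N where N: "\<And>m n. m \<ge> N \<Longrightarrow> n \<ge> N \<Longrightarrow> BN (\<lambda>x. \<rho> x * (s m x - s n x)) < ennreal (e / (C + 1))"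
      using s \<rho> unfolding besov_cauchy_def by blast
    have "dist (L2_inner (s m) \<eta>) (L2_inner (s n) \<eta>) < e" if "m \<ge> N" "n \<ge> N" for m n
    proof -
      have "ennreal \<bar>L2_inner (s m) \<eta> - L2_inner (s n) \<eta>\<bar> \<le> ennreal C * ennreal (e / (C + 1))"
        using b[OF s s, of m n] N[OF that] by (meson less_imp_le mult_left_mono order_trans zero_le)
      then have "\<bar>L2_inner (s m) \<eta> - L2_inner (s n) \<eta>\<bar> \<le> C * (e / (C + 1))"
        using C e by (simp flip: ennreal_mult)
      also have "\<dots> < e" using C e by (simp add: field_simps)
      finally show ?thesis by (simp add: dist_real_def)
    qed
    then show "\<exists>M. \<forall>m\<ge>M. \<forall>n\<ge>M. dist (L2_inner (s m) \<eta>) (L2_inner (s n) \<eta>) < e" by blast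
  qed
  then obtain l where l: "(\<lambda>n. L2_inner (s n) \<eta>) \<longlonglongrightarrow> l" using Cauchy_convergent convergent_def by blast
  define g where "g = (SOME g. g \<in> BR `` {s})"
  have g: "g \<in> BC" "(\<lambda>n. BN (\<lambda>x. \<rho> x * (s n x - g n x))) \<longlonglongrightarrow> 0"
    unfolding g_def using BR_some[OF s] \<rho> by auto
  have lim0: "(\<lambda>n. ennreal C * BN (\<lambda>x. \<rho> x * (s n x - g n x))) \<longlonglongrightarrow> ennreal C * 0"
    by (intro ennreal_tendsto_cmult g(2)) simp
  have "(\<lambda>n. ennreal \<bar>L2_inner (s n) \<eta> - L2_inner (g n) \<eta>\<bar>) \<longlonglongrightarrow> 0"
    by (rule tendsto_sandwich[OF _ _ tendsto_const lim0[simplified]]) (use b[OF s g(1)] in auto)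
  then have "(\<lambda>n. ennreal \<bar>L2_inner (s n) \<eta> - L2_inner (g n) \<eta>\<bar>) \<longlonglongrightarrow> ennreal 0" by simp
  then have "(\<lambda>n. \<bar>L2_inner (s n) \<eta> - L2_inner (g n) \<eta>\<bar>) \<longlonglongrightarrow> 0"
    by (subst (asm) tendsto_ennreal_iff) auto
  then have "(\<lambda>n. L2_inner (s n) \<eta> - L2_inner (g n) \<eta>) \<longlonglongrightarrow> 0" by (rule tendsto_rabs_zero_cancel)
  from tendsto_diff[OF l this] have "(\<lambda>n. L2_inner (g n) \<eta>) \<longlonglongrightarrow> l" by simp
  then have "besov_pairing (BR `` {s}) \<eta> = l"
    unfolding besov_pairing_def g_def[symmetric] by (rule limI)
  then show ?thesis using l by simp
qed

end

end

section \<open>Random distributions\<close>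

text \<open>Quantiles instead of moments: \<open>b n\<close> is a level exceeded with probability at
  most \<open>(1 / 2) ^ n\<close>, Borel-Cantelli leaves finitely many exceptions for almost every
  outcome, and these are absorbed by \<open>\<kappa>\<close>.\<close>

lemma (in prob_space) AE_bounded_multiples:
  fixes Y :: "nat \<Rightarrow> 'a \<Rightarrow> real"
  assumes Y [measurable]: "\<And>n. Y n \<in> borel_measurable M"
  shows "\<exists>b. (\<forall>n. 0 < b n) \<and> (AE \<omega> in M. \<exists>\<kappa>. \<forall>n. \<bar>Y n \<omega>\<bar> \<le> \<kappa> * b n)"
proof -
  have "\<exists>k::nat. measure M {\<omega> \<in> space M. real k < \<bar>Y n \<omega>\<bar>} < (1 / 2) ^ n" for n
  proof -
    let ?A = "\<lambda>k::nat. {\<omega> \<in> space M. real k < \<bar>Y n \<omega>\<bar>}"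
    have "(\<lambda>k. measure M (?A k)) \<longlonglongrightarrow> measure M (\<Inter>k. ?A k)"
      by (rule finite_Lim_measure_decseq) (auto simp: decseq_def)
    moreover have "(\<Inter>k. ?A k) = {}"
    proof -
      have "\<exists>k::nat. \<not> real k < \<bar>Y n \<omega>\<bar>" for \<omega> using real_arch_simple[of "\<bar>Y n \<omega>\<bar>"] by (auto simp: not_less)
      then show ?thesis by blast
    qed
    ultimately have "(\<lambda>k. measure M (?A k)) \<longlonglongrightarrow> 0" by simp
    from order_tendstoD(2)[OF this, of "(1 / 2) ^ n"] show ?thesis by (auto simp: eventually_sequentially)
  qed
  then obtain k where k: "\<And>n. measure M {\<omega> \<in> space M. real (k n :: nat) < \<bar>Y n \<omega>\<bar>} < (1 / 2) ^ n" by metis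
  define b where "b n = real (k n) + 1" for n
  define A where "A n = {\<omega> \<in> space M. b n < \<bar>Y n \<omega>\<bar>}" for n
  have A: "A n \<in> sets M" for n unfolding A_def by measurable
  have "measure M (A n) \<le> (1 / 2) ^ n" for n
  proof -
    have "measure M (A n) \<le> measure M {\<omega> \<in> space M. real (k n) < \<bar>Y n \<omega>\<bar>}"
      by (intro finite_measure_mono) (auto simp: A_def b_def)
    then show ?thesis using k[of n] by simp
  qed
  then have "summable (\<lambda>n. measure M (A n))"
    by (intro summable_comparison_test[OF _ summable_geometric[of "1 / 2 :: real"]]) auto
  then have "AE \<omega> in M. eventually (\<lambda>n. \<omega> \<in> space M - A n) sequentially"
    using A by (intro borel_cantelli_AE1) (auto simp: less_top[symmetric])
  then have "AE \<omega> in M. \<exists>\<kappa>. \<forall>n. \<bar>Y n \<omega>\<bar> \<le> \<kappa> * b n"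
  proof eventually_elim
    case (elim \<omega>)
    then obtain N where N: "\<And>n. n \<ge> N \<Longrightarrow> \<bar>Y n \<omega>\<bar> \<le> b n"
      unfolding eventually_sequentially A_def by (auto simp: not_less)
    define \<kappa> where "\<kappa> = 1 + (\<Sum>n<N. \<bar>Y n \<omega>\<bar>)"
    have \<kappa>: "1 \<le> \<kappa>" by (simp add: \<kappa>_def sum_nonneg)
    have b: "1 \<le> b n" for n by (simp add: b_def)
    have "\<bar>Y n \<omega>\<bar> \<le> \<kappa> * b n" for n
    proof (cases "n < N")
      case True
      then have "\<bar>Y n \<omega>\<bar> \<le> (\<Sum>n<N. \<bar>Y n \<omega>\<bar>)" by (intro member_le_sum) auto
      then have "\<bar>Y n \<omega>\<bar> \<le> \<kappa>" by (simp add: \<kappa>_def)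
      also have "\<dots> \<le> \<kappa> * b n" using mult_left_mono[OF b[of n], of \<kappa>] \<kappa> by simp
      finally show ?thesis .
    next
      case False
      then have "\<bar>Y n \<omega>\<bar> \<le> 1 * b n" using N by simp
      also have "\<dots> \<le> \<kappa> * b n" using \<kappa> b[of n] by (intro mult_right_mono) auto
      finally show ?thesis .
    qed
    then show ?case by blast
  qed
  moreover have "0 < b n" for n by (simp add: b_def add_nonneg_pos)
  ultimately show ?thesis by blast
qed

text \<open>Along a subsequence with summable exceptional probabilities, Borel-Cantelli turns
  convergence in probability into almost sure convergence, and limits are unique.\<close>

lemma (in prob_space) AE_eq_limits:
  fixes X :: "nat \<Rightarrow> 'a \<Rightarrow> real"
  assumes X [measurable]: "\<And>n. X n \<in> borel_measurable M" and Z [measurable]: "Z \<in> borel_measurable M"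
    and a: "AE \<omega> in M. (\<lambda>n. X n \<omega>) \<longlonglongrightarrow> Y \<omega>"
    and p: "\<And>\<epsilon>. \<epsilon> > 0 \<Longrightarrow> (\<lambda>n. measure M {\<omega> \<in> space M. \<bar>X n \<omega> - Z \<omega>\<bar> > \<epsilon>}) \<longlonglongrightarrow> 0"
  shows "AE \<omega> in M. Y \<omega> = Z \<omega>"
proof -
  let ?A = "\<lambda>k n. {\<omega> \<in> space M. \<bar>X n \<omega> - Z \<omega>\<bar> > (1 / 2) ^ k}"
  have "\<exists>n\<ge>k. measure M (?A k n) < (1 / 2) ^ k" for k :: nat
  proof -
    have "\<forall>\<^sub>F n in sequentially. measure M (?A k n) < (1 / 2) ^ k"
      by (rule order_tendstoD(2)[OF p]) auto
    then obtain N where "\<And>n. n \<ge> N \<Longrightarrow> measure M (?A k n) < (1 / 2) ^ k" by (auto simp: eventually_sequentially)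
    then show ?thesis by (intro exI[of _ "max k N"]) auto
  qed
  then obtain n where n: "\<And>k. n k \<ge> k" "\<And>k. measure M (?A k (n k)) < (1 / 2) ^ k" by metis
  have "summable (\<lambda>k. measure M (?A k (n k)))"
    using n(2) by (intro summable_comparison_test[OF _ summable_geometric[of "1 / 2 :: real"]]) (auto intro: less_imp_le)
  then have "AE \<omega> in M. eventually (\<lambda>k. \<omega> \<in> space M - ?A k (n k)) sequentially"
    by (intro borel_cantelli_AE1) (auto simp: less_top[symmetric])
  then show ?thesis using a
  proof eventually_elim
    case (elim \<omega>)
    have ev: "\<forall>\<^sub>F k in sequentially. norm (X (n k) \<omega> - Z \<omega>) \<le> (1 / 2) ^ k"
      using elim(1) by eventually_elim (auto simp: not_less)
    have "(\<lambda>k. (1 / 2 :: real) ^ k) \<longlonglongrightarrow> 0" by (intro LIMSEQ_power_zero) auto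
    from Lim_null_comparison[OF ev this] have 1: "(\<lambda>k. X (n k) \<omega>) \<longlonglongrightarrow> Z \<omega>" by (rule LIM_zero_cancel)
    have "filterlim n at_top sequentially"
      using n(1) by (intro filterlim_at_top_mono[OF filterlim_ident]) auto
    from filterlim_compose[OF elim(2) this] have "(\<lambda>k. X (n k) \<omega>) \<longlonglongrightarrow> Y \<omega>" .
    then show ?case using 1 LIMSEQ_unique by blast
  qed
qed

text \<open>Turns the moment hypothesis, stated for the norm of exponent \<open>p\<close> with its
  weight, into a bound on the expected p-th power of the weighted coefficient.\<close>

lemma Lp_norm_cmult_le:
  assumes m: "g \<in> borel_measurable M" and c: "0 < c" and b: "0 \<le> b" and p: "1 \<le> p" and g: "ennreal c * Lp_norm M (ennreal p) g \<le> ennreal b"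
  shows "(\<integral>\<^sup>+x. ennreal (\<bar>c * g x\<bar> powr p) \<partial>M) \<le> ennreal (b powr p)"
proof -
  let ?I = "\<integral>\<^sup>+x. enn_powr (ennreal \<bar>g x\<bar>) p \<partial>M"
  have N: "Lp_norm M (ennreal p) g = enn_powr ?I (1 / p)"
    using p by (simp add: Lp_norm_def eLp_norm_def)
  have "ennreal (1 / c) * (ennreal c * Lp_norm M (ennreal p) g) \<le> ennreal (1 / c) * ennreal b"
    using g by (rule mult_left_mono) simp
  then have "Lp_norm M (ennreal p) g \<le> ennreal (b / c)"
    using c b by (simp add: mult.assoc[symmetric] flip: ennreal_mult)
  then have "enn_powr (enn_powr ?I (1 / p)) p \<le> enn_powr (ennreal (b / c)) p"
    unfolding N using p by (intro enn_powr_mono) auto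
  then have I: "?I \<le> ennreal ((b / c) powr p)"
    using p b c by (simp add: enn_powr_powr enn_powr_ennreal)
  have "(\<integral>\<^sup>+x. ennreal (\<bar>c * g x\<bar> powr p) \<partial>M) \<le> ennreal (c powr p) * ?I"
  proof -
    have "(\<integral>\<^sup>+x. ennreal (\<bar>c * g x\<bar> powr p) \<partial>M) = (\<integral>\<^sup>+x. ennreal (c powr p) * enn_powr (ennreal \<bar>g x\<bar>) p \<partial>M)"
      using c by (intro nn_integral_cong) (simp add: enn_powr_ennreal abs_mult powr_mult ennreal_mult)
    also have "\<dots> = ennreal (c powr p) * ?I" by (intro nn_integral_cmult) (use m in \<open>simp add: enn_powr_ennreal\<close>)
    finally show ?thesis by simp
  qed
  also have "\<dots> \<le> ennreal (c powr p) * ennreal ((b / c) powr p)" using I by (rule mult_left_mono) simp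
  also have "\<dots> = ennreal (b powr p)" using b c by (simp add: powr_divide flip: ennreal_mult)
  finally show ?thesis .
qed

lemma countable_dyadic: "countable (dyadic_lattice n :: (real^'d::finite) set)"
proof -
  have "dyadic_lattice n = (\<Union>b::nat. {x \<in> dyadic_lattice n. norm (x - (0::real^'d)) \<le> real b})"
    by (auto intro: real_arch_simple)
  moreover have "countable (\<Union>b::nat. {x \<in> dyadic_lattice n. norm (x - (0::real^'d)) \<le> real b})"
    by (intro countable_UN countableI_type countable_finite card_dyadic_lattice) auto
  ultimately show ?thesis by metis
qed

text \<open>The spanning sequence enters through the exhausting sets \<open>K j\<close> and their
  starting levels \<open>kk j\<close>. Of the target space only the exponent
  \<open>\<alpha>'\<close> below \<open>\<beta>\<close> is prepared here, so that one random
  sequence serves both the Besov and the Hoelder space.\<close>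

locale random_distribution = wavelets r R V \<phi> \<psi> + prob_space M
  for r R and V :: "int \<Rightarrow> (real^'d::finite \<Rightarrow> real) set" and \<phi> \<psi> and M :: "'w measure" +
  fixes U :: "(real^'d) set" and f :: "(real^'d \<Rightarrow> real) \<Rightarrow> 'w \<Rightarrow> real" and p \<beta> \<alpha>' :: real
    and K :: "nat \<Rightarrow> (real^'d) set" and kk :: "nat \<Rightarrow> nat"
  assumes U: "open U" and p: "1 \<le> p" and \<alpha>': "\<alpha>' < \<beta>"
    and rv: "\<And>\<eta>. \<eta> \<in> Cc r U \<Longrightarrow> f \<eta> \<in> borel_measurable M"
    and lin: "\<And>\<eta> \<eta>' \<mu>. \<eta> \<in> Cc r U \<Longrightarrow> \<eta>' \<in> Cc r U \<Longrightarrow> AE \<omega> in M. f (\<lambda>x. \<mu> * \<eta> x + \<eta>' x) \<omega> = \<mu> * f \<eta> \<omega> + f \<eta>' \<omega>"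
    and weak: "\<And>K' \<eta>s \<eta> \<epsilon>. compact K' \<Longrightarrow> K' \<subseteq> U \<Longrightarrow> (\<And>n. \<eta>s n \<in> Cc r U) \<Longrightarrow> \<eta> \<in> Cc r U \<Longrightarrow> (\<And>n. supp (\<eta>s n) \<subseteq> K') \<Longrightarrow>
        (\<lambda>n. C_norm (r - 1) (\<lambda>x. \<eta>s n x - \<eta> x)) \<longlonglongrightarrow> 0 \<Longrightarrow> 0 < \<epsilon> \<Longrightarrow>
        (\<lambda>n. measure M {\<omega> \<in> space M. \<bar>f (\<eta>s n) \<omega> - f \<eta> \<omega>\<bar> > \<epsilon>}) \<longlonglongrightarrow> 0"
    and K_mono: "incseq K" and K_compact: "\<And>j. compact (K j)" and K_exhaust: "\<And>L. compact L \<Longrightarrow> L \<subseteq> U \<Longrightarrow> \<exists>j. L \<subseteq> K j"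
    and moment: "\<And>j. \<exists>C>0. \<forall>n\<ge>kk j. \<forall>i\<in>{0<..<2 ^ CARD('d)}. \<forall>x\<in>dyadic_lattice n \<inter> K j.
        ennreal (2 ^ (CARD('d) * n)) * Lp_norm M (ennreal p) (f (wav (\<theta> i) n x)) \<le> ennreal (C * 2 powr (- real n * \<beta>))"
begin

lemma Cc_combine:
  assumes u: "u \<in> Cc r U" and v: "v \<in> Cc r U" shows "(\<lambda>x. a * u x + v x) \<in> Cc r U"
proof (rule CcI[where S="supp u \<union> supp v"])
  show "C_on r UNIV (\<lambda>x. a * u x + v x)" using u v by (intro C_on_add C_on_cmult Cc_C_on)
  show "a * u y + v y = 0" if "y \<notin> supp u \<union> supp v" for y using that supp_zero[of y u] supp_zero[of y v] by simp
qed (use u v in \<open>auto simp: Cc_def\<close>)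

lemma Cc_zero: "(\<lambda>x. 0) \<in> Cc r U"
  by (rule CcI[where S="{}"]) (auto intro: C_on_const)

lemma Cc_sum: "(\<And>i. i \<in> I \<Longrightarrow> g i \<in> Cc r U) \<Longrightarrow> (\<lambda>x. \<Sum>i\<in>I. c i * g i x) \<in> Cc r U"
  by (induction I rule: infinite_finite_induct) (auto intro: Cc_zero Cc_combine)

lemma f_zero: "AE \<omega> in M. f (\<lambda>x. 0) \<omega> = 0"
  using lin[OF Cc_zero Cc_zero, of 1] by eventually_elim simp

lemma f_sum:
  assumes "finite I" "\<And>i. i \<in> I \<Longrightarrow> g i \<in> Cc r U"
  shows "AE \<omega> in M. f (\<lambda>x. \<Sum>i\<in>I. c i * g i x) \<omega> = (\<Sum>i\<in>I. c i * f (g i) \<omega>)"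
  using assms
proof (induction I rule: finite_induct)
  case empty then show ?case using f_zero by simp
next
  case (insert a I)
  have s: "(\<lambda>x. \<Sum>i\<in>I. c i * g i x) \<in> Cc r U" using insert.prems by (intro Cc_sum) auto
  have "AE \<omega> in M. f (\<lambda>x. \<Sum>i\<in>I. c i * g i x) \<omega> = (\<Sum>i\<in>I. c i * f (g i) \<omega>)" using insert by auto
  then show ?case using lin[OF insert.prems[OF insertI1] s, of "c a"]
    by (eventually_elim) (use insert.hyps in auto)
qed

text \<open>The ball condition puts the wavelets into \<open>Cc r U\<close>, and the bound on the
  norm makes the set finite. For large \<open>n\<close> all points near a given compact subset of
  \<open>U\<close> satisfy both, see \<open>near_lat\<close>.\<close>

definition lat :: "nat \<Rightarrow> (real^'d) set" where
  "lat n = {x \<in> dyadic_lattice n. norm x \<le> real n \<and> cball x (R / 2 ^ n) \<subseteq> U}"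

lemma finite_lat: "finite (lat n)"
  by (rule finite_subset[OF _ card_dyadic_lattice(1)[of "real n" n 0]]) (auto simp: lat_def)

lemma lat_sub: "lat n \<subseteq> dyadic_lattice n"
  by (auto simp: lat_def)

lemma wav_zero_all: "j \<in> {0} \<union> {0<..<2 ^ CARD('d)} \<Longrightarrow> R / 2 ^ n \<le> norm (y - x) \<Longrightarrow> wav (\<theta> j) n x y = 0"
  using VL.wav_zero[of j n y x] WL.wav_zero[of j n y x] by blast

lemma lat_Cc:
  assumes "j \<in> {0} \<union> {0<..<2 ^ CARD('d)}" "x \<in> lat n" shows "wav (\<theta> j) n x \<in> Cc r U"
proof (rule CcI[where S="cball x (R / 2 ^ n)"])
  show "C_on r UNIV (wav (\<theta> j) n x)" by (intro C_on_wav cbnd_C_on[OF \<theta>_cbnd] assms)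
  show "wav (\<theta> j) n x y = 0" if "y \<notin> cball x (R / 2 ^ n)" for y
    by (rule wav_zero_all[OF assms(1)]) (use that in \<open>auto simp: dist_norm norm_minus_commute\<close>)
qed (use assms in \<open>auto simp: lat_def\<close>)

definition cf :: "nat \<Rightarrow> nat \<Rightarrow> real^'d \<Rightarrow> 'w \<Rightarrow> real" where
  "cf j n x \<omega> = 2 ^ (CARD('d) * n) * f (wav (\<theta> j) n x) \<omega>"

lemma cf_measurable: "j \<in> {0} \<union> {0<..<2 ^ CARD('d)} \<Longrightarrow> x \<in> lat n \<Longrightarrow> cf j n x \<in> borel_measurable M"
  unfolding cf_def[abs_def] using rv[OF lat_Cc] by measurable

definition F :: "nat \<Rightarrow> 'w \<Rightarrow> real^'d \<Rightarrow> real" where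
  "F n \<omega> z = (\<Sum>x\<in>lat n. cf 0 n x \<omega> * wav (\<theta> 0) n x z)"

definition cW :: "nat \<Rightarrow> 'w \<Rightarrow> nat \<times> (real^'d) \<Rightarrow> real" where
  "cW n \<omega> k = cf (fst k) n (snd k) \<omega>"

text \<open>For fixed \<open>z\<close> the kernel is a finite combination of members of
  \<open>Cc r U\<close>, so finitely many uses of almost sure linearity suffice. In the result the
  wavelets are evaluated at \<open>z\<close>, and their images under \<open>f\<close> become the
  coefficients.\<close>

lemma f_kern:
  assumes G: "G \<subseteq> {0} \<union> {0<..<2 ^ CARD('d)}" and z: "near R n z \<subseteq> lat n"
  shows "AE \<omega> in M. f (\<lambda>y. \<Sum>j\<in>G. \<Sum>x\<in>near R n z. (2 ^ (CARD('d) * n) * wav (\<theta> j) n x z) * wav (\<theta> j) n x y) \<omega> =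
    (\<Sum>k\<in>G \<times> lat n. cW n \<omega> k * wav (\<theta> (fst k)) n (snd k) z)"
proof -
  have fG: "finite G" using finite_subset[OF G] by simp
  have fn: "finite (near R n z)" using R_pos by (intro finite_near) simp
  have e: "(\<lambda>y. \<Sum>j\<in>G. \<Sum>x\<in>near R n z. (2 ^ (CARD('d) * n) * wav (\<theta> j) n x z) * wav (\<theta> j) n x y) =
    (\<lambda>y. \<Sum>k\<in>G \<times> near R n z. (2 ^ (CARD('d) * n) * wav (\<theta> (fst k)) n (snd k) z) * wav (\<theta> (fst k)) n (snd k) y)"
    by (simp add: sum.cartesian_product split_def)
  have "AE \<omega> in M. f (\<lambda>y. \<Sum>k\<in>G \<times> near R n z. (2 ^ (CARD('d) * n) * wav (\<theta> (fst k)) n (snd k) z) * wav (\<theta> (fst k)) n (snd k) y) \<omega> =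
    (\<Sum>k\<in>G \<times> near R n z. (2 ^ (CARD('d) * n) * wav (\<theta> (fst k)) n (snd k) z) * f (wav (\<theta> (fst k)) n (snd k)) \<omega>)"
  proof (rule f_sum)
    fix k assume k: "k \<in> G \<times> near R n z"
    show "wav (\<theta> (fst k)) n (snd k) \<in> Cc r U" by (rule lat_Cc) (use k G z in auto)
  qed (use fG fn in auto)
  moreover have "(\<Sum>k\<in>G \<times> near R n z. (2 ^ (CARD('d) * n) * wav (\<theta> (fst k)) n (snd k) z) * f (wav (\<theta> (fst k)) n (snd k)) \<omega>) =
      (\<Sum>k\<in>G \<times> lat n. cW n \<omega> k * wav (\<theta> (fst k)) n (snd k) z)" for \<omega>
  proof -
    have "(\<Sum>k\<in>G \<times> lat n. cW n \<omega> k * wav (\<theta> (fst k)) n (snd k) z) = (\<Sum>k\<in>G \<times> near R n z. cW n \<omega> k * wav (\<theta> (fst k)) n (snd k) z)"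
    proof (rule sum.mono_neutral_right)
      show "\<forall>k\<in>G \<times> lat n - G \<times> near R n z. cW n \<omega> k * wav (\<theta> (fst k)) n (snd k) z = 0"
      proof
        fix k assume k: "k \<in> G \<times> lat n - G \<times> near R n z"
        then have "fst k \<in> G" "snd k \<in> dyadic_lattice n" "snd k \<notin> near R n z" using lat_sub by (auto simp: mem_Times_iff)
        then have "R / 2 ^ n \<le> norm (z - snd k)" by (auto simp: near_def norm_minus_commute)
        then have "wav (\<theta> (fst k)) n (snd k) z = 0" using \<open>fst k \<in> G\<close> G by (intro wav_zero_all) auto
        then show "cW n \<omega> k * wav (\<theta> (fst k)) n (snd k) z = 0" by simp
      qed
    qed (use fG finite_lat z in auto)
    then show ?thesis by (simp add: cW_def cf_def mult_ac)
  qed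
  ultimately show ?thesis unfolding e by simp
qed

text \<open>\<open>f\<close> applied to both sides of \<open>kern_Suc\<close>, with one more use of
  almost sure linearity.\<close>

lemma F_Suc_AE:
  assumes z: "near R n z \<subseteq> lat n" "near R (Suc n) z \<subseteq> lat (Suc n)"
  shows "AE \<omega> in M. F (Suc n) \<omega> z = F n \<omega> z + layer_sum n (lat n) (cW n \<omega>) z"
proof -
  have Fk: "(\<Sum>k\<in>{0} \<times> lat n. cW n \<omega> k * wav (\<theta> (fst k)) n (snd k) z) = F n \<omega> z" for n \<omega>
  proof -
    have "{0} \<times> lat n = Pair (0::nat) ` lat n" by auto
    then show ?thesis by (simp add: sum.reindex inj_on_def F_def cW_def)
  qed
  have kC: "VL.kern n z \<in> Cc r U" "WL.kern n z \<in> Cc r U" 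
  proof -
    have *: "(\<lambda>y. \<Sum>j\<in>G. 1 * (\<Sum>x\<in>near R n z. (2 ^ (CARD('d) * n) * wav (\<theta> j) n x z) * wav (\<theta> j) n x y)) \<in> Cc r U"
      if "G \<subseteq> {0} \<union> {0<..<2 ^ CARD('d)}" for G
      using that z by (intro Cc_sum lat_Cc) auto
    show "VL.kern n z \<in> Cc r U" "WL.kern n z \<in> Cc r U"
      using *[of "{0}"] *[of "{0<..<2 ^ CARD('d)}"] by (auto simp: VL.kern_def WL.kern_def)
  qed
  have k: "VL.kern (Suc n) z = (\<lambda>y. 1 * VL.kern n z y + WL.kern n z y)" using kern_Suc by auto
  have a1: "AE \<omega> in M. f (VL.kern (Suc n) z) \<omega> = F (Suc n) \<omega> z"
    using f_kern[of "{0}" "Suc n" z, OF _ z(2)] unfolding Fk VL.kern_def by simp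
  have a2: "AE \<omega> in M. f (VL.kern n z) \<omega> = F n \<omega> z"
    using f_kern[of "{0}" n z, OF _ z(1)] unfolding Fk VL.kern_def by simp
  have a3: "AE \<omega> in M. f (WL.kern n z) \<omega> = layer_sum n (lat n) (cW n \<omega>) z"
    using f_kern[of "{0<..<2 ^ CARD('d)}" n z, OF Un_upper2 z(1)] unfolding WL.kern_def layer_sum_def by simp
  show ?thesis using a1 a2 a3 lin[OF kC, of 1]
    by eventually_elim (simp add: k)
qed

text \<open>Restricted to dyadic \<open>z\<close>, since each \<open>z\<close> has its own
  exceptional set and only countably many may be discarded; \<open>F_Suc_cut\<close> recovers all
  points by continuity.\<close>

definition consistent :: "'w \<Rightarrow> bool" where
  "consistent \<omega> \<longleftrightarrow> (\<forall>n. \<forall>z\<in>(\<Union>m. dyadic_lattice m). near R n z \<subseteq> lat n \<longrightarrow> near R (Suc n) z \<subseteq> lat (Suc n) \<longrightarrow>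
     F (Suc n) \<omega> z = F n \<omega> z + layer_sum n (lat n) (cW n \<omega>) z)"

lemma consistent_AE: "AE \<omega> in M. consistent \<omega>"
proof -
  have c: "countable (\<Union>m. dyadic_lattice m :: (real^'d) set)" using countable_dyadic by blast
  have "AE \<omega> in M. near R n z \<subseteq> lat n \<longrightarrow> near R (Suc n) z \<subseteq> lat (Suc n) \<longrightarrow>
     F (Suc n) \<omega> z = F n \<omega> z + layer_sum n (lat n) (cW n \<omega>) z" for n z
  proof (cases "near R n z \<subseteq> lat n \<and> near R (Suc n) z \<subseteq> lat (Suc n)")
    case True
    then show ?thesis using F_Suc_AE[of n z] by auto
  qed auto
  then show ?thesis unfolding consistent_def by (subst AE_all_countable, subst AE_ball_countable[OF c]) blast
qed

text \<open>Wavelets that reach \<open>L\<close> at level \<open>n\<close> are supported within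
  \<open>2 * R / 2 ^ n\<close> of \<open>L\<close>, hence eventually in a fixed closed neighbourhood
  \<open>L'\<close> inside \<open>U\<close>. As \<open>L'\<close> does not depend on
  \<open>n\<close>, one \<open>K j\<close> contains all these centres, and the projections of a test
  function have a common compact support.\<close>

lemma near_lat:
  assumes L: "compact L" "L \<subseteq> U"
  obtains L' n0 where "compact L'" "L' \<subseteq> U" "\<And>n z. n \<ge> n0 \<Longrightarrow> z \<in> L \<Longrightarrow> near R n z \<subseteq> lat n \<inter> L'"
    "\<And>n z x. n \<ge> n0 \<Longrightarrow> z \<in> L \<Longrightarrow> x \<in> near R n z \<Longrightarrow> cball x (R / 2 ^ n) \<subseteq> L'"
proof (cases "L = {}")
  case True
  then show ?thesis using that[of "{}" 0] by auto
next
  case False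
  obtain e where e: "0 < e" "{x. infdist x L \<le> e} \<subseteq> U" using compact_in_open_separated[OF False L(1) U L(2)] by blast
  obtain b where b: "\<And>x. x \<in> L \<Longrightarrow> norm x \<le> b" using compact_imp_bounded[OF L(1)] unfolding bounded_iff by blast
  obtain m where m: "2 * R \<le> real m" using real_arch_simple by blast
  obtain n1 where n1: "\<And>n. n \<ge> n1 \<Longrightarrow> real m / 2 ^ n \<le> e" using moll_radius[OF e(1)] by blast
  obtain n2 :: nat where n2: "b + R \<le> real n2" using real_arch_simple by blast
  have near2: "infdist y L \<le> e" if "n \<ge> n1" "z \<in> L" "x \<in> near R n z" "y \<in> cball x (R / 2 ^ n)" for n z x y
  proof -
    have "infdist y L \<le> dist y z" by (rule infdist_le[OF that(2)])
    also have "\<dots> \<le> dist y x + dist x z" by (rule dist_triangle)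
    also have "\<dots> \<le> R / 2 ^ n + R / 2 ^ n"
      using that(3,4) by (intro add_mono) (auto simp: near_def dist_norm norm_minus_commute)
    also have "\<dots> = 2 * R / 2 ^ n" by simp
    also have "\<dots> \<le> real m / 2 ^ n" using m by (intro divide_right_mono) auto
    finally show ?thesis using n1[OF that(1)] by simp
  qed
  have xin: "x \<in> cball x (R / 2 ^ n)" for x n using R_pos by simp
  show ?thesis
  proof (rule that[of "{x. infdist x L \<le> e}" "max n1 n2"])
    show "compact {x. infdist x L \<le> e}" using compact_infdist_le[OF False L(1) e(1)] .
    show "{x. infdist x L \<le> e} \<subseteq> U" by (rule e(2))
    fix n z assume n: "max n1 n2 \<le> n" and z: "z \<in> L"
    show "near R n z \<subseteq> lat n \<inter> {x. infdist x L \<le> e}"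
    proof
      fix x assume x: "x \<in> near R n z"
      have "cball x (R / 2 ^ n) \<subseteq> U" using near2[OF _ z x] n e(2) by auto
      moreover have "norm x \<le> real n"
      proof -
        have "R / 2 ^ n \<le> R" using R_pos by (simp add: divide_le_eq)
        then have "norm x \<le> norm z + R" using x norm_triangle_ineq2[of x z] by (auto simp: near_def)
        also have "\<dots> \<le> real n2" using b[OF z] n2 by simp
        finally show ?thesis using n by simp
      qed
      ultimately show "x \<in> lat n \<inter> {x. infdist x L \<le> e}"
        using x near2[OF _ z x xin] n by (auto simp: lat_def near_def)
    qed
    fix x assume x: "x \<in> near R n z"
    show "cball x (R / 2 ^ n) \<subseteq> {x. infdist x L \<le> e}" using near2[OF _ z x] n by auto
  qed
qed

text \<open>The identity is multiplied by \<open>\<rho>\<close> before it is extended from dyadic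
  points: the product is continuous on the whole space, and it is 0 at a dyadic point either by
  \<open>consistent\<close> or because \<open>\<rho>\<close> vanishes there. The layer may then be
  restricted to \<open>L\<close>, which contains all centres active where \<open>\<rho>\<close> is
  nonzero.\<close>

lemma F_Suc_cut:
  assumes \<omega>: "consistent \<omega>" and \<rho>: "continuous_on UNIV \<rho>"
    and z: "\<And>z. \<rho> z \<noteq> 0 \<Longrightarrow> near R n z \<subseteq> lat n \<inter> L \<and> near R (Suc n) z \<subseteq> lat (Suc n)"
  shows "\<rho> z * (F (Suc n) \<omega> z - F n \<omega> z) = \<rho> z * layer_sum n (lat n \<inter> L) (cW n \<omega>) z"
proof -
  let ?u = "\<lambda>z. \<rho> z * (F (Suc n) \<omega> z - F n \<omega> z - layer_sum n (lat n) (cW n \<omega>) z)"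
  have cF: "continuous_on UNIV (F n \<omega>)" for n
    unfolding F_def[abs_def] by (intro cs_continuous cs_sum cs_cmult cs_wav \<theta>_cs) auto
  have "continuous_on UNIV ?u"
    by (intro continuous_on_mult \<rho> continuous_on_diff cF cs_continuous[OF cs_layer_sum])
  moreover have "?u a = 0" if "a \<in> dyadic_lattice m" for m a
  proof (cases "\<rho> a = 0")
    case False
    then have "F (Suc n) \<omega> a = F n \<omega> a + layer_sum n (lat n) (cW n \<omega>) a"
      using \<omega> z[OF False] that unfolding consistent_def by blast
    then show ?thesis by simp
  qed simp
  ultimately have u: "?u z = 0" by (rule dyadic_dense)
  have "\<rho> z * layer_sum n (lat n) (cW n \<omega>) z = \<rho> z * layer_sum n (lat n \<inter> L) (cW n \<omega>) z"
  proof (cases "\<rho> z = 0")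
    case False
    have "layer_sum n (lat n) (cW n \<omega>) z = layer_sum n (lat n \<inter> L) (cW n \<omega>) z"
      unfolding layer_sum_def
    proof (rule sum.mono_neutral_right)
      show "\<forall>k\<in>{0<..<2 ^ CARD('d)} \<times> lat n - {0<..<2 ^ CARD('d)} \<times> (lat n \<inter> L). cW n \<omega> k * wav (\<theta> (fst k)) n (snd k) z = 0"
      proof
        fix k :: "nat \<times> (real^'d)" assume k: "k \<in> {0<..<2 ^ CARD('d)} \<times> lat n - {0<..<2 ^ CARD('d)} \<times> (lat n \<inter> L)"
        then have fk: "fst k \<in> {0<..<2 ^ CARD('d)}" "snd k \<in> dyadic_lattice n" "snd k \<notin> near R n z"
          using z[OF False] lat_sub by (auto simp: mem_Times_iff)
        then have "R / 2 ^ n \<le> norm (z - snd k)" by (auto simp: near_def norm_minus_commute)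
        then have "wav (\<theta> (fst k)) n (snd k) z = 0" using fk by (intro wav_zero_all) auto
        then show "cW n \<omega> k * wav (\<theta> (fst k)) n (snd k) z = 0" by simp
      qed
    qed (use finite_lat in auto)
    then show ?thesis by simp
  qed simp
  with u show ?thesis by (simp add: right_diff_distrib)
qed

section \<open>Moments and almost sure size of the coefficients\<close>

definition Z :: "nat \<Rightarrow> nat \<Rightarrow> 'w \<Rightarrow> real" where
  "Z j n \<omega> = (\<Sum>k\<in>{0<..<2 ^ CARD('d)} \<times> (lat n \<inter> K j). \<bar>cW n \<omega> k\<bar> powr p) / 2 ^ (CARD('d) * n)"

lemma Z_nonneg: "0 \<le> Z j n \<omega>"
  by (simp add: Z_def sum_nonneg)

lemma size_norm_Z: "size_norm p n (lat n \<inter> K j) (cW n \<omega>) = Z j n \<omega> powr (1 / p)"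
  by (simp add: size_norm_def Z_def)

lemma cW_measurable: "k \<in> ({0} \<union> {0<..<2 ^ CARD('d)}) \<times> lat n \<Longrightarrow> (\<lambda>\<omega>. cW n \<omega> k) \<in> borel_measurable M"
  unfolding cW_def using cf_measurable by auto

lemma Z_measurable: "Z j n \<in> borel_measurable M"
  unfolding Z_def[abs_def] using cW_measurable
  by (intro borel_measurable_divide borel_measurable_sum powr_real_measurable borel_measurable_abs borel_measurable_const) auto

text \<open>The number of lattice points in \<open>K j\<close> grows at most like
  \<open>2 ^ (CARD('d) * n)\<close>, which the cell volume in \<open>Z\<close> cancels; what remains
  is the moment bound of a single coefficient.\<close>

lemma Z_moment:
  obtains C where "0 \<le> C" "\<And>n. n \<ge> kk j \<Longrightarrow> (\<integral>\<^sup>+\<omega>. ennreal (Z j n \<omega>) \<partial>M) \<le> ennreal (C * 2 powr (- real n * \<beta> * p))"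
proof -
  obtain C where C: "0 < C" "\<And>n i x. n \<ge> kk j \<Longrightarrow> i \<in> {0<..<2 ^ CARD('d)} \<Longrightarrow> x \<in> dyadic_lattice n \<inter> K j \<Longrightarrow>
      ennreal (2 ^ (CARD('d) * n)) * Lp_norm M (ennreal p) (f (wav (\<theta> i) n x)) \<le> ennreal (C * 2 powr (- real n * \<beta>))"
    using moment[of j] by blast
  obtain b where b: "\<And>x. x \<in> K j \<Longrightarrow> norm x \<le> b" using compact_imp_bounded[OF K_compact[of j]] unfolding bounded_iff by blast
  define b' where "b' = \<bar>b\<bar>"
  define D where "D = 2 ^ CARD('d) * (2 * b' + 1) ^ CARD('d)"
  show ?thesis
  proof (rule that[of "D * C powr p"])
    show "0 \<le> D * C powr p" by (simp add: D_def b'_def)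
    fix n assume n: "n \<ge> kk j"
    let ?I = "{0::nat<..<2 ^ CARD('d)} \<times> (lat n \<inter> K j)"
    have fI: "finite ?I" using finite_lat by auto
    have m: "(\<lambda>\<omega>. cW n \<omega> k) \<in> borel_measurable M" if "k \<in> ?I" for k using that by (intro cW_measurable) auto
    have one: "(\<integral>\<^sup>+\<omega>. ennreal (\<bar>cW n \<omega> k\<bar> powr p) \<partial>M) \<le> ennreal ((C * 2 powr (- real n * \<beta>)) powr p)" if k: "k \<in> ?I" for k
      unfolding cW_def cf_def
      using k C(1) n subsetD[OF lat_sub] by (intro Lp_norm_cmult_le[OF rv[OF lat_Cc] _ _ p C(2)]) auto
    have card: "real (card ?I) \<le> D * 2 ^ (CARD('d) * n)"
    proof -
      have "lat n \<inter> K j \<subseteq> {x \<in> dyadic_lattice n. norm (x - 0) \<le> b'}" using b lat_sub by (force simp: b'_def)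
      then have "card (lat n \<inter> K j) \<le> card {x \<in> dyadic_lattice n. norm (x - (0::real^'d)) \<le> b'}"
        by (intro card_mono card_dyadic_lattice) (auto simp: b'_def)
      then have "real (card (lat n \<inter> K j)) \<le> (2 * (2 ^ n * b') + 1) ^ CARD('d)"
        using card_dyadic_lattice(2)[of b' n "0::real^'d"] by (simp add: b'_def)
      also have "\<dots> \<le> ((2 * b' + 1) * 2 ^ n) ^ CARD('d)"
        by (intro power_mono) (auto simp: b'_def algebra_simps)
      also have "\<dots> = (2 * b' + 1) ^ CARD('d) * 2 ^ (CARD('d) * n)"
        by (simp add: power_mult_distrib power_mult[symmetric] mult.commute)
      finally have c: "real (card (lat n \<inter> K j)) \<le> (2 * b' + 1) ^ CARD('d) * 2 ^ (CARD('d) * n)" .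
      have "real (card ?I) = real (2 ^ CARD('d) - 1) * real (card (lat n \<inter> K j))" by (simp add: card_cartesian_product)
      also have "\<dots> \<le> 2 ^ CARD('d) * ((2 * b' + 1) ^ CARD('d) * 2 ^ (CARD('d) * n))"
        using c by (intro mult_mono) (auto simp: of_nat_diff)
      finally show ?thesis by (simp add: D_def mult_ac)
    qed
    have "(\<integral>\<^sup>+\<omega>. ennreal (Z j n \<omega>) \<partial>M) = (\<integral>\<^sup>+\<omega>. ennreal (1 / 2 ^ (CARD('d) * n)) * (\<Sum>k\<in>?I. ennreal (\<bar>cW n \<omega> k\<bar> powr p)) \<partial>M)"
      by (intro nn_integral_cong) (simp add: Z_def sum_ennreal sum_nonneg flip: ennreal_mult)
    also have "\<dots> = ennreal (1 / 2 ^ (CARD('d) * n)) * (\<Sum>k\<in>?I. \<integral>\<^sup>+\<omega>. ennreal (\<bar>cW n \<omega> k\<bar> powr p) \<partial>M)"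
    proof -
      have mk: "(\<lambda>\<omega>. ennreal (\<bar>cW n \<omega> k\<bar> powr p)) \<in> borel_measurable M" if "k \<in> ?I" for k
        using m[OF that] by measurable
      then show ?thesis by (simp only: nn_integral_cmult borel_measurable_sum nn_integral_sum)
    qed
    also have "\<dots> \<le> ennreal (1 / 2 ^ (CARD('d) * n)) * (\<Sum>k\<in>?I. ennreal ((C * 2 powr (- real n * \<beta>)) powr p))"
      by (intro mult_left_mono sum_mono one) auto
    also have "(\<Sum>k\<in>?I. ennreal ((C * 2 powr (- real n * \<beta>)) powr p)) = ennreal (real (card ?I) * (C * 2 powr (- real n * \<beta>)) powr p)"
      by (subst sum_ennreal) simp_all
    also have "ennreal (1 / 2 ^ (CARD('d) * n)) * \<dots> = ennreal (1 / 2 ^ (CARD('d) * n) * (real (card ?I) * (C * 2 powr (- real n * \<beta>)) powr p))"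
      by (rule ennreal_mult[symmetric]) auto
    also have "\<dots> \<le> ennreal (1 / 2 ^ (CARD('d) * n) * ((D * 2 ^ (CARD('d) * n)) * (C * 2 powr (- real n * \<beta>)) powr p))"
      using card by (intro ennreal_leI mult_left_mono mult_right_mono) auto
    also have "1 / 2 ^ (CARD('d) * n) * ((D * 2 ^ (CARD('d) * n)) * (C * 2 powr (- real n * \<beta>)) powr p) = D * C powr p * 2 powr (- real n * \<beta> * p)"
      using C(1) by (simp add: powr_mult powr_powr)
    finally show "(\<integral>\<^sup>+\<omega>. ennreal (Z j n \<omega>) \<partial>M) \<le> ennreal (D * C powr p * 2 powr (- real n * \<beta> * p))" .
  qed
qed

text \<open>Since \<open>\<alpha>' < \<beta>\<close>, the series of \<open>Z j n \<omega>\<close>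
  with weights \<open>2 powr (\<alpha>' * p * real n)\<close> has finite expectation; its almost
  surely finite value is the constant \<open>\<kappa>\<close>.\<close>

lemma Z_AE: "AE \<omega> in M. \<forall>j. \<exists>\<kappa>. \<forall>n\<ge>kk j. Z j n \<omega> \<le> \<kappa> * 2 powr (- \<alpha>' * p * real n)"
proof (subst AE_all_countable, rule allI)
  fix j
  obtain C where C: "0 \<le> C" "\<And>n. n \<ge> kk j \<Longrightarrow> (\<integral>\<^sup>+\<omega>. ennreal (Z j n \<omega>) \<partial>M) \<le> ennreal (C * 2 powr (- real n * \<beta> * p))"
    using Z_moment[of j] by blast
  define y where "y n \<omega> = (if n \<ge> kk j then ennreal (2 powr (\<alpha>' * p * real n)) * ennreal (Z j n \<omega>) else 0)" for n \<omega>
  have ym: "y n \<in> borel_measurable M" for n unfolding y_def[abs_def] using Z_measurable[of j n] by measurable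
  have sb: "summable (\<lambda>n. C * 2 powr (((\<alpha>' - \<beta>) * p) * real n))"
    using \<alpha>' p by (intro summable_mult summable_pow) (simp add: mult_neg_pos)
  have "(\<integral>\<^sup>+\<omega>. (\<Sum>n. y n \<omega>) \<partial>M) = (\<Sum>n. \<integral>\<^sup>+\<omega>. y n \<omega> \<partial>M)" by (rule nn_integral_suminf[OF ym])
  also have "\<dots> \<le> (\<Sum>n. ennreal (C * 2 powr (((\<alpha>' - \<beta>) * p) * real n)))"
  proof (rule suminf_le)
    fix n
    show "(\<integral>\<^sup>+\<omega>. y n \<omega> \<partial>M) \<le> ennreal (C * 2 powr (((\<alpha>' - \<beta>) * p) * real n))"
    proof (cases "n \<ge> kk j")
      case True
      then have "(\<integral>\<^sup>+\<omega>. y n \<omega> \<partial>M) = ennreal (2 powr (\<alpha>' * p * real n)) * (\<integral>\<^sup>+\<omega>. ennreal (Z j n \<omega>) \<partial>M)"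
        using Z_measurable[of j n] by (simp add: y_def nn_integral_cmult)
      also have "\<dots> \<le> ennreal (2 powr (\<alpha>' * p * real n)) * ennreal (C * 2 powr (- real n * \<beta> * p))"
        by (intro mult_left_mono C(2) True) simp
      also have "\<dots> = ennreal (C * (2 powr (\<alpha>' * p * real n) * 2 powr (- real n * \<beta> * p)))"
        using C(1) by (simp add: mult_ac flip: ennreal_mult)
      also have "2 powr (\<alpha>' * p * real n) * 2 powr (- real n * \<beta> * p) = 2 powr (((\<alpha>' - \<beta>) * p) * real n)"
        by (simp add: algebra_simps flip: powr_add)
      finally show ?thesis .
    qed (simp add: y_def)
  qed auto
  also have "\<dots> = ennreal (\<Sum>n. C * 2 powr (((\<alpha>' - \<beta>) * p) * real n))"
    using C(1) sb by (intro suminf_ennreal2) auto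
  finally have "(\<integral>\<^sup>+\<omega>. (\<Sum>n. y n \<omega>) \<partial>M) < \<infinity>"
    by (rule le_less_trans) (simp only: infinity_ennreal_def ennreal_less_top)
  then have "(\<integral>\<^sup>+\<omega>. (\<Sum>n. y n \<omega>) \<partial>M) \<noteq> \<infinity>" by simp
  then have "AE \<omega> in M. (\<Sum>n. y n \<omega>) \<noteq> \<infinity>"
    using ym by (intro nn_integral_noteq_infinite) auto
  then show "AE \<omega> in M. \<exists>\<kappa>. \<forall>n\<ge>kk j. Z j n \<omega> \<le> \<kappa> * 2 powr (- \<alpha>' * p * real n)"
  proof eventually_elim
    case (elim \<omega>)
    then obtain \<kappa> where \<kappa>: "(\<Sum>n. y n \<omega>) = ennreal \<kappa>" "0 \<le> \<kappa>" by (cases "\<Sum>n. y n \<omega>" rule: ennreal_cases) auto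
    have "Z j n \<omega> \<le> \<kappa> * 2 powr (- \<alpha>' * p * real n)" if n: "n \<ge> kk j" for n
    proof -
      have "y n \<omega> \<le> ennreal \<kappa>" using sum_le_suminf[of "\<lambda>n. y n \<omega>" "{n}"] \<kappa> by simp
      then have "2 powr (\<alpha>' * p * real n) * Z j n \<omega> \<le> \<kappa>"
        using n \<kappa>(2) Z_nonneg[of j n \<omega>] by (simp add: y_def flip: ennreal_mult)
      then show ?thesis by (simp add: powr_minus field_simps)
    qed
    then show ?case by blast
  qed
qed

end

context random_distribution
begin

text \<open>The precision of the smooth approximations must not depend on \<open>\<omega>\<close>, because \<open>s n\<close> has to be a
  measurable function of finitely many coefficients.\<close>

definition bnd :: "nat \<Rightarrow> real" where
  "bnd = (SOME b. (\<forall>n. 0 < b n) \<and> (AE \<omega> in M. \<exists>\<kappa>. \<forall>n. \<bar>\<Sum>x\<in>lat n. \<bar>cf 0 n x \<omega>\<bar>\<bar> \<le> \<kappa> * b n))"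

lemma bnd: "0 < bnd n" "AE \<omega> in M. \<exists>\<kappa>. \<forall>n. (\<Sum>x\<in>lat n. \<bar>cf 0 n x \<omega>\<bar>) \<le> \<kappa> * bnd n"
proof -
  have m: "(\<lambda>\<omega>. \<Sum>x\<in>lat n. \<bar>cf 0 n x \<omega>\<bar>) \<in> borel_measurable M" for n
    by (intro borel_measurable_sum borel_measurable_abs cf_measurable) auto
  note someI_ex[OF AE_bounded_multiples[of "\<lambda>n \<omega>. \<Sum>x\<in>lat n. \<bar>cf 0 n x \<omega>\<bar>", OF m], folded bnd_def]
  then show "0 < bnd n" "AE \<omega> in M. \<exists>\<kappa>. \<forall>n. (\<Sum>x\<in>lat n. \<bar>cf 0 n x \<omega>\<bar>) \<le> \<kappa> * bnd n"
    by (auto simp: sum_nonneg)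
qed

text \<open>Chosen once for each level and lattice point, independently of \<open>\<omega>\<close>;
  division by \<open>bnd n\<close> offsets the growth of the coefficients, so that the total error
  is a random constant times \<open>(1 / 2) ^ n\<close>.\<close>

definition tl :: "nat \<Rightarrow> real^'d \<Rightarrow> real^'d \<Rightarrow> real" where
  "tl n x = (SOME v. smooth_on UNIV v \<and> cs v \<and> cbnd r ((1 / 2) ^ n / bnd n) 1 (\<lambda>y. v y - wav (\<theta> 0) n x y))"

lemma tl: "smooth_on UNIV (tl n x)" "cs (tl n x)" "cbnd r ((1 / 2) ^ n / bnd n) 1 (\<lambda>y. tl n x y - wav (\<theta> 0) n x y)"
proof -
  have w: "cs (wav (\<theta> 0) n x)" "C_on r UNIV (wav (\<theta> 0) n x)"
    by (intro cs_wav \<theta>_cs C_on_wav cbnd_C_on[OF \<theta>_cbnd]; simp)+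
  have "\<exists>v. smooth_on UNIV v \<and> cs v \<and> cbnd r ((1 / 2) ^ n / bnd n) 1 (\<lambda>y. v y - wav (\<theta> 0) n x y)"
    using smooth_approx[OF w, of "(1 / 2) ^ n / bnd n"] bnd(1)[of n] by (metis divide_pos_pos half_gt_zero zero_less_one zero_less_power)
  from someI_ex[OF this] show "smooth_on UNIV (tl n x)" "cs (tl n x)" "cbnd r ((1 / 2) ^ n / bnd n) 1 (\<lambda>y. tl n x y - wav (\<theta> 0) n x y)"
    unfolding tl_def by blast+
qed

definition s :: "nat \<Rightarrow> 'w \<Rightarrow> real^'d \<Rightarrow> real" where
  "s n \<omega> z = (\<Sum>x\<in>lat n. cf 0 n x \<omega> * tl n x z)"

lemma s_smooth: "smooth_on U (s n \<omega>)"
proof -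
  have "C_on k UNIV (s n \<omega>)" for k
    unfolding s_def[abs_def] using tl(1) by (intro C_on_sum C_on_cmult) (auto simp: smooth_on_def)
  then show ?thesis unfolding smooth_on_def using C_on_subset by blast
qed

lemma cs_s: "cs (s n \<omega>)"
  unfolding s_def[abs_def] by (intro cs_sum cs_cmult tl)

lemma cs_F: "cs (F n \<omega>)"
  unfolding F_def[abs_def] by (intro cs_sum cs_cmult cs_wav \<theta>_cs) auto

lemma s_F:
  assumes "(\<Sum>x\<in>lat n. \<bar>cf 0 n x \<omega>\<bar>) \<le> \<kappa> * bnd n"
  shows "cbnd r (\<kappa> * (1 / 2) ^ n) 1 (\<lambda>z. s n \<omega> z - F n \<omega> z)"
proof -
  have "cbnd r (\<Sum>x\<in>lat n. \<bar>cf 0 n x \<omega>\<bar> * ((1 / 2) ^ n / bnd n)) 1 (\<lambda>z. \<Sum>x\<in>lat n. cf 0 n x \<omega> * (tl n x z - wav (\<theta> 0) n x z))"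
    by (intro cbnd_sum cbnd_cmult tl) auto
  moreover have "(\<lambda>z. \<Sum>x\<in>lat n. cf 0 n x \<omega> * (tl n x z - wav (\<theta> 0) n x z)) = (\<lambda>z. s n \<omega> z - F n \<omega> z)"
    by (simp add: s_def F_def right_diff_distrib sum_subtractf)
  moreover have "(\<Sum>x\<in>lat n. \<bar>cf 0 n x \<omega>\<bar> * ((1 / 2) ^ n / bnd n)) \<le> \<kappa> * (1 / 2) ^ n"
  proof -
    have "(\<Sum>x\<in>lat n. \<bar>cf 0 n x \<omega>\<bar> * ((1 / 2) ^ n / bnd n)) = (\<Sum>x\<in>lat n. \<bar>cf 0 n x \<omega>\<bar>) * ((1 / 2) ^ n / bnd n)"
      by (rule sum_distrib_right[symmetric])
    also have "\<dots> \<le> (\<kappa> * bnd n) * ((1 / 2) ^ n / bnd n)"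
      using assms bnd(1)[of n] by (intro mult_right_mono) auto
    also have "\<dots> = \<kappa> * (1 / 2) ^ n" using bnd(1)[of n] by simp
    finally show ?thesis .
  qed
  ultimately show ?thesis using cbnd_mono[of r _ 1 _ "\<kappa> * (1 / 2) ^ n" 1] by simp
qed

text \<open>A quantitative event: one constant \<open>\<kappa>\<close> for all levels and for the
  sets of the exhaustion up to index \<open>j\<close>. Estimates are uniform on it, and for each
  \<open>j\<close> the events with natural \<open>\<kappa>\<close> cover
  \<open>good\<close>.\<close>

definition H :: "real \<Rightarrow> nat \<Rightarrow> 'w \<Rightarrow> bool" where
  "H \<kappa> j \<omega> \<longleftrightarrow> (\<forall>n. (\<Sum>x\<in>lat n. \<bar>cf 0 n x \<omega>\<bar>) \<le> \<kappa> * bnd n) \<and> (\<forall>i\<le>j. \<forall>n\<ge>kk i. Z i n \<omega> \<le> \<kappa> * 2 powr (- \<alpha>' * p * real n))"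

lemma H_mono: "H \<kappa> j \<omega> \<Longrightarrow> i \<le> j \<Longrightarrow> H \<kappa> i \<omega>"
  unfolding H_def by (meson order_trans)

lemma H_nonneg:
  assumes "H \<kappa> j \<omega>" shows "0 \<le> \<kappa>"
proof -
  have "0 \<le> (\<Sum>x\<in>lat 0. \<bar>cf 0 0 x \<omega>\<bar>)" by (simp add: sum_nonneg)
  then have "0 \<le> \<kappa> * bnd 0" using assms unfolding H_def by (meson order_trans)
  then show ?thesis using bnd(1)[of 0] by (simp add: zero_le_mult_iff)
qed

lemma good_AE: "AE \<omega> in M. consistent \<omega> \<and> (\<forall>j. \<exists>\<kappa>::nat. H (real \<kappa>) j \<omega>)"
  using consistent_AE bnd(2) Z_AE
proof eventually_elim
  case (elim \<omega>)
  obtain a where a: "\<And>n. (\<Sum>x\<in>lat n. \<bar>cf 0 n x \<omega>\<bar>) \<le> a * bnd n" using elim(2) by blast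
  obtain k where k: "\<And>j n. n \<ge> kk j \<Longrightarrow> Z j n \<omega> \<le> k j * 2 powr (- \<alpha>' * p * real n)" using elim(3) by metis
  have "\<exists>\<kappa>::nat. H (real \<kappa>) j \<omega>" for j
  proof -
    obtain \<kappa> :: nat where \<kappa>: "\<bar>a\<bar> + (\<Sum>i\<le>j. \<bar>k i\<bar>) \<le> real \<kappa>" using real_arch_simple by blast
    have S: "0 \<le> (\<Sum>i\<le>j. \<bar>k i\<bar>)" by (simp add: sum_nonneg)
    have "(\<Sum>x\<in>lat n. \<bar>cf 0 n x \<omega>\<bar>) \<le> real \<kappa> * bnd n" for n
      using \<kappa> S bnd(1)[of n] by (intro order_trans[OF a[of n]] mult_right_mono) linarith+
    moreover have "Z i n \<omega> \<le> real \<kappa> * 2 powr (- \<alpha>' * p * real n)" if "i \<le> j" "n \<ge> kk i" for i n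
    proof -
      have "\<bar>k i\<bar> \<le> (\<Sum>i\<le>j. \<bar>k i\<bar>)" using that by (intro member_le_sum) auto
      then show ?thesis using \<kappa> by (intro order_trans[OF k[OF that(2)]] mult_right_mono) auto
    qed
    ultimately show ?thesis unfolding H_def by blast
  qed
  then show ?case using elim(1) by blast
qed

text \<open>The set of failures of an almost sure statement is only contained in a null set; fixing
  such a null set makes \<open>good\<close> measurable.\<close>

definition bad :: "'w set" where
  "bad = (SOME N. N \<in> null_sets M \<and> {\<omega> \<in> space M. \<not> (consistent \<omega> \<and> (\<forall>j. \<exists>\<kappa>::nat. H (real \<kappa>) j \<omega>))} \<subseteq> N)"

definition good :: "'w set" where
  "good = space M - bad"

lemma good: "good \<in> sets M" "AE \<omega> in M. \<omega> \<in> good" "\<omega> \<in> good \<Longrightarrow> consistent \<omega>" "\<omega> \<in> good \<Longrightarrow> \<exists>\<kappa>::nat. H (real \<kappa>) j \<omega>"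
proof -
  have "\<exists>N. N \<in> null_sets M \<and> {\<omega> \<in> space M. \<not> (consistent \<omega> \<and> (\<forall>j. \<exists>\<kappa>::nat. H (real \<kappa>) j \<omega>))} \<subseteq> N"
    using good_AE unfolding eventually_ae_filter by blast
  from someI_ex[OF this, folded bad_def]
  have bad: "bad \<in> null_sets M" "{\<omega> \<in> space M. \<not> (consistent \<omega> \<and> (\<forall>j. \<exists>\<kappa>::nat. H (real \<kappa>) j \<omega>))} \<subseteq> bad" by blast+
  show "good \<in> sets M" using bad(1) unfolding good_def by blast
  show "AE \<omega> in M. \<omega> \<in> good" using AE_not_in[OF bad(1)] AE_space by eventually_elim (simp add: good_def)
  show "\<omega> \<in> good \<Longrightarrow> consistent \<omega>" "\<omega> \<in> good \<Longrightarrow> \<exists>\<kappa>::nat. H (real \<kappa>) j \<omega>"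
    using bad(2) unfolding good_def by blast+
qed

lemma Cc_smooth_data:
  assumes \<rho>: "\<rho> \<in> Cc_smooth U"
  obtains A b where "0 \<le> A" "cbnd r A 1 \<rho>" "continuous_on UNIV \<rho>" "\<And>y. b < norm y \<Longrightarrow> \<rho> y = 0"
proof -
  have C: "C_on k UNIV \<rho>" for k using \<rho> by (simp add: Cc_smooth_def smooth_on_def)
  have "bounded (supp \<rho>)" using \<rho> compact_imp_bounded by (auto simp: Cc_smooth_def)
  then obtain A b where A: "cbnd r A 1 \<rho>" and b: "\<And>y. y \<in> supp \<rho> \<Longrightarrow> norm y \<le> b"
    using C_on_cbnd[OF C[of r], of "supp \<rho>" 1] supp_zero[of _ \<rho>] unfolding bounded_iff by (metis zero_less_one)
  show ?thesis
  proof (rule that[OF _ A])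
    show "0 \<le> A" using cbnd_abs[OF A, of 0] by linarith
    show "continuous_on UNIV \<rho>" using C[of 0] by simp
    show "\<rho> y = 0" if "b < norm y" for y using that b supp_zero by (meson not_less)
  qed
qed

text \<open>Off \<open>good\<close> the zero sequence is used, so that \<open>X \<omega>\<close>
  defines a class in the completion for every \<open>\<omega>\<close>.\<close>

definition X :: "'w \<Rightarrow> nat \<Rightarrow> real^'d \<Rightarrow> real" where
  "X \<omega> = (if \<omega> \<in> good then \<lambda>n. s n \<omega> else (\<lambda>n x. 0))"

section \<open>The limit in one Besov space, for exponent \<open>p\<close> or for the supremum
  norm\<close>

context
  fixes P Q :: ennreal and e \<alpha> :: real
  assumes PE: "(P = ennreal p \<and> e = 0) \<or> (P = \<infinity> \<and> e = real CARD('d) / p)" and \<alpha>e: "\<bar>\<alpha> + e\<bar> < real r"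
    and \<alpha>r: "\<bar>\<alpha>\<bar> < real r" and lt: "\<alpha> + e < \<alpha>'" and Q: "1 \<le> Q"
begin

lemma P1: "1 \<le> P"
  using PE p by auto

text \<open>The constants depend on \<open>\<rho>\<close> but not on \<open>\<omega>\<close>, which
  enters only through \<open>\<kappa>\<close>: this uniformity on \<open>H \<kappa> j\<close> is
  what the measurability argument uses. The layers decay with exponent
  \<open>\<delta>0 = \<alpha>' - \<alpha> - e\<close>, the smoothing errors like
  \<open>(1 / 2) ^ m\<close>; hence \<open>\<delta> = min \<delta>0 1\<close>.\<close>

lemma tail:
  assumes \<rho>: "\<rho> \<in> Cc_smooth U"
  obtains j m0 C \<delta> where "0 \<le> C" "0 < \<delta>" "\<And>\<omega> \<kappa> n l. consistent \<omega> \<Longrightarrow> H \<kappa> j \<omega> \<Longrightarrow> m0 \<le> l \<Longrightarrow> l \<le> n \<Longrightarrow>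
      besov_norm V \<alpha> P Q (\<lambda>x. \<rho> x * (s n \<omega> x - s l \<omega> x)) \<le> ennreal (C * (\<kappa> + \<kappa> powr (1 / p)) * 2 powr (- \<delta> * real l))"
proof (rule Cc_smooth_data[OF \<rho>])
  fix A b assume A: "0 \<le> A" "cbnd r A 1 \<rho>" and cont: "continuous_on UNIV \<rho>" and b: "\<And>y. b < norm y \<Longrightarrow> \<rho> y = 0"
  have sup: "compact (supp \<rho>)" "supp \<rho> \<subseteq> U" using \<rho> by (auto simp: Cc_smooth_def)
  obtain L' n0 where L': "compact L'" "L' \<subseteq> U" "\<And>n z. n \<ge> n0 \<Longrightarrow> z \<in> supp \<rho> \<Longrightarrow> near R n z \<subseteq> lat n \<inter> L'"
    by (rule near_lat[OF sup]) blast
  obtain j where j: "L' \<subseteq> K j" using K_exhaust[OF L'(1,2)] by blast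
  obtain C1 where C1: "0 \<le> C1" "\<And>\<rho> m X c. cbnd r A 1 \<rho> \<Longrightarrow> finite X \<Longrightarrow> X \<subseteq> dyadic_lattice m \<Longrightarrow>
      besov_norm V \<alpha> P Q (\<lambda>z. \<rho> z * layer_sum m X c z) \<le> ennreal (C1 * 2 powr ((\<alpha> + e) * real m) * size_norm p m X c)"
    by (rule besov_layer[OF A(1) p PE \<alpha>e Q]) blast
  have \<alpha>r': "\<alpha> < real r" using \<alpha>r by simp
  obtain C2 where C2: "0 \<le> C2" "\<And>h A. cs h \<Longrightarrow> cbnd r A 1 h \<Longrightarrow> (\<And>y. b < norm y \<Longrightarrow> h y = 0) \<Longrightarrow>
      besov_norm V \<alpha> P Q h \<le> ennreal (C2 * A)"
    by (rule besov_Cr[OF \<alpha>r' P1 Q, where T=b]) blast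
  define \<delta>0 where "\<delta>0 = \<alpha>' - \<alpha> - e"
  have \<delta>0: "0 < \<delta>0" using lt by (simp add: \<delta>0_def)
  \<comment> \<open>The sum of the geometric series of the layer bounds:
    \<open>C1 = D * (1 - 2 powr (- \<delta>0))\<close> makes the telescoping in \<open>main\<close>
    exact.\<close>
  define D where "D = C1 / (1 - 2 powr (- \<delta>0))"
  have one: "0 < 1 - 2 powr (- \<delta>0)" using powr_less_mono[of "- \<delta>0" 0 2] \<delta>0 by simp
  then have D0: "0 \<le> D" using C1(1) by (simp add: D_def)
  define \<delta> where "\<delta> = min \<delta>0 1"
  have \<delta>l: "\<delta> * real m \<le> real m" "\<delta> * real m \<le> \<delta>0 * real m" for m
  proof -
    have "\<delta> \<le> 1" "\<delta> \<le> \<delta>0" by (simp_all add: \<delta>_def)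
    then show "\<delta> * real m \<le> real m" "\<delta> * real m \<le> \<delta>0 * real m"
      using mult_right_mono[of \<delta> 1 "real m"] mult_right_mono[of \<delta> \<delta>0 "real m"] by simp_all
  qed
  define B where "B = C2 * (2 ^ r * A)"
  have B: "0 \<le> B" using C2(1) A(1) by (simp add: B_def)
  show thesis
  proof (rule that[of "2 * B + D" \<delta> j "max n0 (kk j)"])
    show "0 \<le> 2 * B + D" using B D0 by simp
    show "0 < \<delta>" using \<delta>0 by (simp add: \<delta>_def)
    fix \<omega> \<kappa> n l
    assume \<omega>: "consistent \<omega>" and H: "H \<kappa> j \<omega>" and l: "max n0 (kk j) \<le> l" and n: "l \<le> n"
    have \<kappa>: "0 \<le> \<kappa>" by (rule H_nonneg[OF H])
    have csF: "cs (\<lambda>x. \<rho> x * (F m \<omega> x - F k \<omega> x))" for m k by (intro cs_mult_left cs_diff cs_F cont)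
    have csM: "cs (\<lambda>x. \<rho> x * (s m \<omega> x - F m \<omega> x))" "cs (\<lambda>x. \<rho> x * (F m \<omega> x - s m \<omega> x))" for m
      by (intro cs_mult_left cs_diff cs_F cs_s cont)+
    have step: "besov_norm V \<alpha> P Q (\<lambda>x. \<rho> x * (F (Suc m) \<omega> x - F m \<omega> x)) \<le> ennreal (C1 * \<kappa> powr (1 / p) * 2 powr (- \<delta>0 * real m))"
      if m: "l \<le> m" for m
    proof -
      have e1: "(\<lambda>x. \<rho> x * (F (Suc m) \<omega> x - F m \<omega> x)) = (\<lambda>x. \<rho> x * layer_sum m (lat m \<inter> K j) (cW m \<omega>) x)"
      proof (rule ext, rule F_Suc_cut[OF \<omega> cont])
        fix z assume "\<rho> z \<noteq> 0"
        then have "z \<in> supp \<rho>" using supp_zero by blast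
        then show "near R m z \<subseteq> lat m \<inter> K j \<and> near R (Suc m) z \<subseteq> lat (Suc m)"
          using L'(3)[of m z] L'(3)[of "Suc m" z] l m j by auto
      qed
      have "besov_norm V \<alpha> P Q (\<lambda>x. \<rho> x * (F (Suc m) \<omega> x - F m \<omega> x)) \<le>
          ennreal (C1 * 2 powr ((\<alpha> + e) * real m) * Z j m \<omega> powr (1 / p))"
        unfolding e1 size_norm_Z[symmetric] by (rule C1(2)[OF A(2)]) (use finite_lat lat_sub in auto)
      also have "\<dots> \<le> ennreal (C1 * 2 powr ((\<alpha> + e) * real m) * (\<kappa> * 2 powr (- \<alpha>' * p * real m)) powr (1 / p))"
        using H l m Z_nonneg[of j m \<omega>] C1(1) p unfolding H_def
        by (intro ennreal_leI mult_left_mono powr_mono2) auto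
      also have "(\<kappa> * 2 powr (- \<alpha>' * p * real m)) powr (1 / p) = \<kappa> powr (1 / p) * 2 powr (- \<alpha>' * real m)"
        using \<kappa> p by (simp add: powr_mult powr_powr)
      also have "C1 * 2 powr ((\<alpha> + e) * real m) * (\<kappa> powr (1 / p) * 2 powr (- \<alpha>' * real m)) =
          C1 * \<kappa> powr (1 / p) * (2 powr ((\<alpha> + e) * real m) * 2 powr (- \<alpha>' * real m))" by simp
      also have "2 powr ((\<alpha> + e) * real m) * 2 powr (- \<alpha>' * real m) = 2 powr (- \<delta>0 * real m)"
        by (simp add: \<delta>0_def algebra_simps flip: powr_add)
      finally show ?thesis .
    qed
    have main: "besov_norm V \<alpha> P Q (\<lambda>x. \<rho> x * (F n \<omega> x - F l \<omega> x)) \<le>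
        ennreal (D * \<kappa> powr (1 / p) * (2 powr (- \<delta>0 * real l) - 2 powr (- \<delta>0 * real n)))"
      using n
    proof (induction n rule: dec_induct)
      case base
      then show ?case using besov_zero[OF P1 Q, of \<alpha>] by simp
    next
      case (step m)
      have mono: "2 powr (- \<delta>0 * real m) \<le> 2 powr (- \<delta>0 * real l)" using step(1) \<delta>0 by simp
      have "besov_norm V \<alpha> P Q (\<lambda>x. \<rho> x * (F (Suc m) \<omega> x - F l \<omega> x)) =
          besov_norm V \<alpha> P Q (\<lambda>x. \<rho> x * (F m \<omega> x - F l \<omega> x) + \<rho> x * (F (Suc m) \<omega> x - F m \<omega> x))"
        by (simp add: algebra_simps)
      also have "\<dots> \<le> besov_norm V \<alpha> P Q (\<lambda>x. \<rho> x * (F m \<omega> x - F l \<omega> x)) + besov_norm V \<alpha> P Q (\<lambda>x. \<rho> x * (F (Suc m) \<omega> x - F m \<omega> x))"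
        by (rule besov_add[OF P1 Q csF csF])
      also have "\<dots> \<le> ennreal (D * \<kappa> powr (1 / p) * (2 powr (- \<delta>0 * real l) - 2 powr (- \<delta>0 * real m))) +
          ennreal (C1 * \<kappa> powr (1 / p) * 2 powr (- \<delta>0 * real m))"
        by (intro add_mono step.IH \<open>\<And>m. l \<le> m \<Longrightarrow> _\<close>) (use step in auto)
      also have "\<dots> = ennreal (D * \<kappa> powr (1 / p) * (2 powr (- \<delta>0 * real l) - 2 powr (- \<delta>0 * real m)) + C1 * \<kappa> powr (1 / p) * 2 powr (- \<delta>0 * real m))"
        using D0 C1(1) mono by (intro ennreal_plus[symmetric]) auto
      also have "D * \<kappa> powr (1 / p) * (2 powr (- \<delta>0 * real l) - 2 powr (- \<delta>0 * real m)) + C1 * \<kappa> powr (1 / p) * 2 powr (- \<delta>0 * real m) =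
          D * \<kappa> powr (1 / p) * (2 powr (- \<delta>0 * real l) - 2 powr (- \<delta>0 * real (Suc m)))"
      proof -
        have c: "C1 = D * (1 - 2 powr (- \<delta>0))" using one \<delta>0 by (simp add: D_def)
        have "2 powr (- \<delta>0 * real (Suc m)) = 2 powr (- \<delta>0) * 2 powr (- \<delta>0 * real m)"
          by (simp add: algebra_simps flip: powr_add)
        then show ?thesis unfolding c by (simp add: algebra_simps)
      qed
      finally show ?case .
    qed
    have moll: "besov_norm V \<alpha> P Q (\<lambda>x. \<rho> x * (s m \<omega> x - F m \<omega> x)) \<le> ennreal (B * (\<kappa> * (1 / 2) ^ m))"
      "besov_norm V \<alpha> P Q (\<lambda>x. \<rho> x * (F m \<omega> x - s m \<omega> x)) \<le> ennreal (B * (\<kappa> * (1 / 2) ^ m))" for m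
    proof -
      have c: "cbnd r (\<kappa> * (1 / 2) ^ m) 1 (\<lambda>z. s m \<omega> z - F m \<omega> z)" using H unfolding H_def by (intro s_F) blast
      then have c': "cbnd r (\<kappa> * (1 / 2) ^ m) 1 (\<lambda>z. F m \<omega> z - s m \<omega> z)" using cbnd_cmult[OF c, of "- 1"] by simp
      have "besov_norm V \<alpha> P Q (\<lambda>x. \<rho> x * (s m \<omega> x - F m \<omega> x)) \<le> ennreal (C2 * (2 ^ r * A * (\<kappa> * (1 / 2) ^ m)))"
        by (intro C2(2) csM cbnd_mult A c) (simp_all add: b)
      then show "besov_norm V \<alpha> P Q (\<lambda>x. \<rho> x * (s m \<omega> x - F m \<omega> x)) \<le> ennreal (B * (\<kappa> * (1 / 2) ^ m))"
        by (simp add: B_def mult_ac)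
      have "besov_norm V \<alpha> P Q (\<lambda>x. \<rho> x * (F m \<omega> x - s m \<omega> x)) \<le> ennreal (C2 * (2 ^ r * A * (\<kappa> * (1 / 2) ^ m)))"
        by (intro C2(2) csM cbnd_mult A c') (simp_all add: b)
      then show "besov_norm V \<alpha> P Q (\<lambda>x. \<rho> x * (F m \<omega> x - s m \<omega> x)) \<le> ennreal (B * (\<kappa> * (1 / 2) ^ m))"
        by (simp add: B_def mult_ac)
    qed
    have half: "B * (\<kappa> * (1 / 2) ^ m) \<le> B * (\<kappa> * 2 powr (- \<delta> * real l))" if "l \<le> m" for m
    proof -
      have "(1 / 2 :: real) ^ m \<le> (1 / 2) ^ l" using that by (intro power_decreasing) auto
      also have "\<dots> = 2 powr (- real l)" by (simp add: powr_minus powr_realpow power_one_over inverse_eq_divide)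
      also have "\<dots> \<le> 2 powr (- \<delta> * real l)" using \<delta>l(1)[of l] by (intro powr_mono) auto
      finally show ?thesis using B \<kappa> by (intro mult_left_mono) auto
    qed
    let ?a = "B * (\<kappa> * 2 powr (- \<delta> * real l))" and ?c = "D * (\<kappa> powr (1 / p) * 2 powr (- \<delta> * real l))"
    have "besov_norm V \<alpha> P Q (\<lambda>x. \<rho> x * (F n \<omega> x - F l \<omega> x)) \<le> ennreal ?c"
    proof (rule order_trans[OF main ennreal_leI])
      have "2 powr (- \<delta>0 * real l) - 2 powr (- \<delta>0 * real n) \<le> 2 powr (- \<delta>0 * real l)" by simp
      also have "\<dots> \<le> 2 powr (- \<delta> * real l)" using \<delta>l(2)[of l] by (intro powr_mono) auto
      finally have "D * \<kappa> powr (1 / p) * (2 powr (- \<delta>0 * real l) - 2 powr (- \<delta>0 * real n)) \<le> D * \<kappa> powr (1 / p) * 2 powr (- \<delta> * real l)"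
        using D0 by (intro mult_left_mono) auto
      then show "D * \<kappa> powr (1 / p) * (2 powr (- \<delta>0 * real l) - 2 powr (- \<delta>0 * real n)) \<le> ?c" by (simp add: mult.assoc)
    qed
    moreover have "besov_norm V \<alpha> P Q (\<lambda>x. \<rho> x * (s n \<omega> x - F n \<omega> x)) \<le> ennreal ?a"
      "besov_norm V \<alpha> P Q (\<lambda>x. \<rho> x * (F l \<omega> x - s l \<omega> x)) \<le> ennreal ?a"
      by (rule order_trans[OF moll(1) ennreal_leI[OF half[OF n]]], rule order_trans[OF moll(2) ennreal_leI[OF half[OF order_refl]]])
    ultimately have sum3: "besov_norm V \<alpha> P Q (\<lambda>x. \<rho> x * (s n \<omega> x - F n \<omega> x)) +
        (besov_norm V \<alpha> P Q (\<lambda>x. \<rho> x * (F n \<omega> x - F l \<omega> x)) + besov_norm V \<alpha> P Q (\<lambda>x. \<rho> x * (F l \<omega> x - s l \<omega> x))) \<le>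
        ennreal ?a + (ennreal ?c + ennreal ?a)" by (intro add_mono)
    have "besov_norm V \<alpha> P Q (\<lambda>x. \<rho> x * (s n \<omega> x - s l \<omega> x)) =
        besov_norm V \<alpha> P Q (\<lambda>x. \<rho> x * (s n \<omega> x - F n \<omega> x) + (\<rho> x * (F n \<omega> x - F l \<omega> x) + \<rho> x * (F l \<omega> x - s l \<omega> x)))"
      by (simp add: algebra_simps)
    also have "\<dots> \<le> besov_norm V \<alpha> P Q (\<lambda>x. \<rho> x * (s n \<omega> x - F n \<omega> x)) +
        besov_norm V \<alpha> P Q (\<lambda>x. \<rho> x * (F n \<omega> x - F l \<omega> x) + \<rho> x * (F l \<omega> x - s l \<omega> x))"
      by (rule besov_add[OF P1 Q csM(1) cs_add[OF csF csM(2)]])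
    also have "\<dots> \<le> besov_norm V \<alpha> P Q (\<lambda>x. \<rho> x * (s n \<omega> x - F n \<omega> x)) +
        (besov_norm V \<alpha> P Q (\<lambda>x. \<rho> x * (F n \<omega> x - F l \<omega> x)) + besov_norm V \<alpha> P Q (\<lambda>x. \<rho> x * (F l \<omega> x - s l \<omega> x)))"
      by (rule add_left_mono[OF besov_add[OF P1 Q csF csM(2)]])
    also note sum3
    also have "ennreal ?a + (ennreal ?c + ennreal ?a) = ennreal (?a + (?c + ?a))"
      using B D0 \<kappa> by (simp flip: ennreal_plus)
    also have "\<dots> \<le> ennreal ((2 * B + D) * (\<kappa> + \<kappa> powr (1 / p)) * 2 powr (- \<delta> * real l))"
    proof (rule ennreal_leI)
      have "?a + (?c + ?a) = (2 * B * \<kappa> + D * \<kappa> powr (1 / p)) * 2 powr (- \<delta> * real l)" by (simp add: algebra_simps)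
      also have "\<dots> \<le> ((2 * B + D) * (\<kappa> + \<kappa> powr (1 / p))) * 2 powr (- \<delta> * real l)"
        using B D0 \<kappa> by (intro mult_right_mono) (auto simp: algebra_simps)
      finally show "?a + (?c + ?a) \<le> (2 * B + D) * (\<kappa> + \<kappa> powr (1 / p)) * 2 powr (- \<delta> * real l)" .
    qed
    finally show "besov_norm V \<alpha> P Q (\<lambda>x. \<rho> x * (s n \<omega> x - s l \<omega> x)) \<le>
      ennreal ((2 * B + D) * (\<kappa> + \<kappa> powr (1 / p)) * 2 powr (- \<delta> * real l))" .
  qed
qed

text \<open>At a fixed level only finitely many coefficients enter and the smooth functions
  \<open>tl l x\<close> are deterministic, so the seminorm is Lipschitz in the coefficients.\<close>

lemma s_diff_bound:
  assumes \<rho>: "\<rho> \<in> Cc_smooth U"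
  obtains C where "0 \<le> C" "\<And>\<omega> \<omega>'. besov_norm V \<alpha> P Q (\<lambda>x. \<rho> x * (s l \<omega> x - s l \<omega>' x)) \<le> ennreal (C * (\<Sum>x\<in>lat l. \<bar>cf 0 l x \<omega> - cf 0 l x \<omega>'\<bar>))"
proof (rule Cc_smooth_data[OF \<rho>])
  fix A b assume A: "0 \<le> A" "cbnd r A 1 \<rho>" and cont: "continuous_on UNIV \<rho>" and b: "\<And>y. b < norm y \<Longrightarrow> \<rho> y = 0"
  have \<alpha>r': "\<alpha> < real r" using \<alpha>r by simp
  obtain C2 where C2: "0 \<le> C2" "\<And>h A. cs h \<Longrightarrow> cbnd r A 1 h \<Longrightarrow> (\<And>y. b < norm y \<Longrightarrow> h y = 0) \<Longrightarrow>
      besov_norm V \<alpha> P Q h \<le> ennreal (C2 * A)"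
    by (rule besov_Cr[OF \<alpha>r' P1 Q, where T=b]) blast
  have "\<exists>a. cbnd r a 1 (tl l x)" for x
  proof -
    obtain a where a: "\<And>y. a < norm y \<Longrightarrow> tl l x y = 0" using tl(2)[of l x] unfolding cs_def by blast
    have "C_on r UNIV (tl l x)" using tl(1) by (simp add: smooth_on_def)
    then show ?thesis by (rule C_on_cbnd[where S="cball 0 a" and s=1]) (use a in auto)
  qed
  then obtain a where a: "\<And>x. cbnd r (a x) 1 (tl l x)" by metis
  have a0: "0 \<le> a x" for x using cbnd_abs[OF a, of x 0] by linarith
  define S where "S = (\<Sum>x\<in>lat l. a x)"
  have S: "0 \<le> S" using a0 by (simp add: S_def sum_nonneg)
  show thesis
  proof (rule that[of "C2 * (2 ^ r * A * S)"])
    show "0 \<le> C2 * (2 ^ r * A * S)" using C2(1) A(1) S by simp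
    fix \<omega> \<omega>'
    let ?T = "\<Sum>x\<in>lat l. \<bar>cf 0 l x \<omega> - cf 0 l x \<omega>'\<bar>"
    have "cbnd r (\<Sum>x\<in>lat l. \<bar>cf 0 l x \<omega> - cf 0 l x \<omega>'\<bar> * a x) 1 (\<lambda>z. \<Sum>x\<in>lat l. (cf 0 l x \<omega> - cf 0 l x \<omega>') * tl l x z)"
      by (intro cbnd_sum cbnd_cmult a) simp
    moreover have "(\<Sum>x\<in>lat l. \<bar>cf 0 l x \<omega> - cf 0 l x \<omega>'\<bar> * a x) \<le> S * ?T"
    proof -
      have "a x \<le> S" if "x \<in> lat l" for x unfolding S_def using that a0 finite_lat by (intro member_le_sum) auto
      then have "(\<Sum>x\<in>lat l. \<bar>cf 0 l x \<omega> - cf 0 l x \<omega>'\<bar> * a x) \<le> (\<Sum>x\<in>lat l. \<bar>cf 0 l x \<omega> - cf 0 l x \<omega>'\<bar> * S)"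
        by (intro sum_mono mult_left_mono) auto
      then show ?thesis by (simp add: sum_distrib_left mult.commute)
    qed
    moreover have "(\<lambda>z. \<Sum>x\<in>lat l. (cf 0 l x \<omega> - cf 0 l x \<omega>') * tl l x z) = (\<lambda>z. s l \<omega> z - s l \<omega>' z)"
      by (simp add: s_def left_diff_distrib sum_subtractf)
    ultimately have c: "cbnd r (S * ?T) 1 (\<lambda>z. s l \<omega> z - s l \<omega>' z)"
      using cbnd_mono[of r _ 1 _ "S * ?T" 1] by simp
    have "besov_norm V \<alpha> P Q (\<lambda>x. \<rho> x * (s l \<omega> x - s l \<omega>' x)) \<le> ennreal (C2 * (2 ^ r * A * (S * ?T)))"
      by (intro C2(2) cs_mult_left cs_diff cs_s cont cbnd_mult A c) (simp_all add: b)
    then show "besov_norm V \<alpha> P Q (\<lambda>x. \<rho> x * (s l \<omega> x - s l \<omega>' x)) \<le> ennreal (C2 * (2 ^ r * A * S) * ?T)"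
      by (simp add: mult.assoc)
  qed
qed

lemma decay: "0 < \<delta> \<Longrightarrow> (\<lambda>l. c * 2 powr (- \<delta> * real l)) \<longlonglongrightarrow> 0"
  using summable_LIMSEQ_zero[OF summable_mult[OF summable_pow[of "- \<delta>"], of c]] by simp

lemma s_cauchy:
  assumes \<omega>: "\<omega> \<in> good"
  shows "(\<lambda>n. s n \<omega>) \<in> besov_cauchy V U \<alpha> P Q"
  unfolding besov_cauchy_def
proof (intro CollectI conjI allI ballI impI)
  show "smooth_on U (s n \<omega>)" for n by (rule s_smooth)
  fix \<rho> and \<epsilon> :: ennreal assume \<rho>: "\<rho> \<in> Cc_smooth U" and \<epsilon>: "0 < \<epsilon>"
  show "\<exists>N. \<forall>m\<ge>N. \<forall>n\<ge>N. besov_norm V \<alpha> P Q (\<lambda>x. \<rho> x * (s m \<omega> x - s n \<omega> x)) < \<epsilon>"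
  proof (rule tail[OF \<rho>])
    fix j m0 C \<delta> assume C: "0 \<le> C" and \<delta>: "(0::real) < \<delta>"
      and t: "\<And>\<omega> \<kappa> n l. consistent \<omega> \<Longrightarrow> H \<kappa> j \<omega> \<Longrightarrow> m0 \<le> l \<Longrightarrow> l \<le> n \<Longrightarrow>
      besov_norm V \<alpha> P Q (\<lambda>x. \<rho> x * (s n \<omega> x - s l \<omega> x)) \<le> ennreal (C * (\<kappa> + \<kappa> powr (1 / p)) * 2 powr (- \<delta> * real l))"
    obtain \<kappa> :: nat where \<kappa>: "H (real \<kappa>) j \<omega>" using good(4)[OF \<omega>] by blast
    let ?g = "\<lambda>l. C * (real \<kappa> + real \<kappa> powr (1 / p)) * 2 powr (- \<delta> * real l)"
    have "(\<lambda>l. ennreal (?g l)) \<longlonglongrightarrow> ennreal 0" by (rule tendsto_ennrealI[OF decay[OF \<delta>]])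
    then have "\<forall>\<^sub>F l in sequentially. ennreal (?g l) < \<epsilon>" using \<epsilon> by (intro order_tendstoD(2)) auto
    then obtain N where N: "\<And>l. l \<ge> N \<Longrightarrow> ennreal (?g l) < \<epsilon>" unfolding eventually_sequentially by blast
    have le: "besov_norm V \<alpha> P Q (\<lambda>x. \<rho> x * (s m \<omega> x - s n \<omega> x)) < \<epsilon>" if "max N m0 \<le> n" "n \<le> m" for m n
      using that by (intro le_less_trans[OF t[OF good(3)[OF \<omega>] \<kappa>, of n m] N]) auto
    have cont: "continuous_on UNIV \<rho>" by (rule Cc_smooth_data[OF \<rho>])
    have "cs (\<lambda>x. \<rho> x * (s m \<omega> x - s n \<omega> x))" for m n by (intro cs_mult_left cs_diff cs_s cont)
    then have sym: "besov_norm V \<alpha> P Q (\<lambda>x. \<rho> x * (s m \<omega> x - s n \<omega> x)) = besov_norm V \<alpha> P Q (\<lambda>x. \<rho> x * (s n \<omega> x - s m \<omega> x))" for m n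
      using besov_uminus[of "\<lambda>x. \<rho> x * (s m \<omega> x - s n \<omega> x)" \<alpha> P Q] by (simp add: algebra_simps)
    have "besov_norm V \<alpha> P Q (\<lambda>x. \<rho> x * (s m \<omega> x - s n \<omega> x)) < \<epsilon>" if "max N m0 \<le> n" "max N m0 \<le> m" for m n
      using le[of n m] le[of m n] sym[of m n] that by (cases "n \<le> m") auto
    then show ?thesis by blast
  qed
qed

lemma X_cauchy: "X \<omega> \<in> besov_cauchy V U \<alpha> P Q"
  using s_cauchy BC_zero[OF U P1 Q] by (simp add: X_def)

definition FX :: "'w \<Rightarrow> (nat \<Rightarrow> real^'d \<Rightarrow> real) set" where
  "FX \<omega> = besov_null_rel V U \<alpha> P Q `` {X \<omega>}"

lemma FX_class: "FX \<omega> \<in> besov_loc V U \<alpha> P Q"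
  unfolding FX_def by (rule BR_class[OF U P1 Q X_cauchy])

text \<open>The distance of two limits is compared with that of their approximations at level
  \<open>l\<close>: two tails, uniform on \<open>H \<kappa> j\<close>, and one difference governed
  by finitely many coefficients.\<close>

lemma dist_bound:
  assumes \<rho>: "\<rho> \<in> Cc_smooth U"
  obtains j m0 C \<delta> where "0 < \<delta>" "\<And>\<omega> \<omega>' \<kappa> l. \<omega> \<in> good \<Longrightarrow> \<omega>' \<in> good \<Longrightarrow> H \<kappa> j \<omega> \<Longrightarrow> H \<kappa> j \<omega>' \<Longrightarrow> m0 \<le> l \<Longrightarrow>
     besov_loc_dist V \<alpha> P Q \<rho> (FX \<omega>) (FX \<omega>') \<le> ennreal (2 * C * (\<kappa> + \<kappa> powr (1 / p)) * 2 powr (- \<delta> * real l)) +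
       besov_norm V \<alpha> P Q (\<lambda>x. \<rho> x * (s l \<omega> x - s l \<omega>' x))"
proof (rule tail[OF \<rho>])
  fix j m0 C \<delta> assume C: "0 \<le> C" and \<delta>: "(0::real) < \<delta>"
    and t: "\<And>\<omega> \<kappa> n l. consistent \<omega> \<Longrightarrow> H \<kappa> j \<omega> \<Longrightarrow> m0 \<le> l \<Longrightarrow> l \<le> n \<Longrightarrow>
      besov_norm V \<alpha> P Q (\<lambda>x. \<rho> x * (s n \<omega> x - s l \<omega> x)) \<le> ennreal (C * (\<kappa> + \<kappa> powr (1 / p)) * 2 powr (- \<delta> * real l))"
  show thesis
  proof (rule that[of \<delta> j m0 C, OF \<delta>])
    fix \<omega> \<omega>' \<kappa> l assume \<omega>: "\<omega> \<in> good" "\<omega>' \<in> good" and H: "H \<kappa> j \<omega>" "H \<kappa> j \<omega>'" and l: "m0 \<le> l"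
    let ?g = "C * (\<kappa> + \<kappa> powr (1 / p)) * 2 powr (- \<delta> * real l)"
    let ?m = "besov_norm V \<alpha> P Q (\<lambda>x. \<rho> x * (s l \<omega> x - s l \<omega>' x))"
    have g: "0 \<le> ?g" using C H_nonneg[OF H(1)] by simp
    note BC = s_cauchy[OF \<omega>(1)] s_cauchy[OF \<omega>(2)]
    note tri = BN_triangle[OF U P1 Q, where \<rho>=\<rho>]
    have "besov_norm V \<alpha> P Q (\<lambda>x. \<rho> x * (X \<omega> n x - X \<omega>' n x)) \<le> ennreal ?g + (?m + ennreal ?g)" if n: "l \<le> n" for n
    proof -
      have "besov_norm V \<alpha> P Q (\<lambda>x. \<rho> x * (s n \<omega> x - s n \<omega>' x)) \<le>
          besov_norm V \<alpha> P Q (\<lambda>x. \<rho> x * (s n \<omega> x - s l \<omega> x)) + besov_norm V \<alpha> P Q (\<lambda>x. \<rho> x * (s l \<omega> x - s n \<omega>' x))"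
        by (rule tri[OF BC(1) BC(1) BC(2) \<rho>])
      also have "\<dots> \<le> besov_norm V \<alpha> P Q (\<lambda>x. \<rho> x * (s n \<omega> x - s l \<omega> x)) + (?m + besov_norm V \<alpha> P Q (\<lambda>x. \<rho> x * (s l \<omega>' x - s n \<omega>' x)))"
        by (rule add_left_mono[OF tri[OF BC(1) BC(2) BC(2) \<rho>]])
      also have "besov_norm V \<alpha> P Q (\<lambda>x. \<rho> x * (s l \<omega>' x - s n \<omega>' x)) = besov_norm V \<alpha> P Q (\<lambda>x. \<rho> x * (s n \<omega>' x - s l \<omega>' x))"
        by (rule BN_sym[OF U P1 Q BC(2) BC(2) \<rho>])
      also have "besov_norm V \<alpha> P Q (\<lambda>x. \<rho> x * (s n \<omega> x - s l \<omega> x)) + (?m + \<dots>) \<le> ennreal ?g + (?m + ennreal ?g)"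
        by (intro add_mono order_refl t good(3) \<omega> H l n)
      finally show ?thesis using \<omega> by (simp add: X_def)
    qed
    then have "besov_loc_dist V \<alpha> P Q \<rho> (FX \<omega>) (FX \<omega>') \<le> ennreal ?g + (?m + ennreal ?g)"
      unfolding FX_def by (rule besov_loc_dist_le[OF U P1 Q X_cauchy X_cauchy \<rho>])
    also have "\<dots> = ennreal ?g + ennreal ?g + ?m" by (simp add: ac_simps)
    also have "ennreal ?g + ennreal ?g = ennreal (2 * C * (\<kappa> + \<kappa> powr (1 / p)) * 2 powr (- \<delta> * real l))"
      using g by (simp add: algebra_simps flip: ennreal_plus)
    finally show "besov_loc_dist V \<alpha> P Q \<rho> (FX \<omega>) (FX \<omega>') \<le> ennreal (2 * C * (\<kappa> + \<kappa> powr (1 / p)) * 2 powr (- \<delta> * real l)) + ?m" .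
  qed
qed

text \<open>The coefficients of level \<open>l\<close> as a sequence along an enumeration of
  \<open>lat l\<close>, so that measurability and openness refer to the product topology on
  sequences.\<close>

definition coord :: "nat \<Rightarrow> 'w \<Rightarrow> nat \<Rightarrow> real" where
  "coord l \<omega> i = (if lat l = {} then 0 else cf 0 l (from_nat_into (lat l) i) \<omega>)"

lemma coord_measurable: "coord l \<in> borel_measurable M"
proof (rule measurable_coordinatewise_then_product)
  show "(\<lambda>\<omega>. coord l \<omega> i) \<in> borel_measurable M" for i
    using cf_measurable[of 0 "from_nat_into (lat l) i" l] from_nat_into[of "lat l" i]
    by (cases "lat l = {}") (simp_all add: coord_def)
qed

lemma coord_eq: "x \<in> lat l \<Longrightarrow> coord l \<omega> (to_nat_on (lat l) x) = cf 0 l x \<omega>"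
  using finite_lat[of l] by (auto simp: coord_def countable_finite)

lemma H_measurable: "{\<omega> \<in> good. H \<kappa> j \<omega>} \<in> sets M"
proof -
  have [measurable]: "(\<lambda>\<omega>. \<Sum>x\<in>lat n. \<bar>cf 0 n x \<omega>\<bar>) \<in> borel_measurable M" for n
    by (intro borel_measurable_sum borel_measurable_abs cf_measurable) auto
  note [measurable] = Z_measurable
  have "{\<omega> \<in> space M. H \<kappa> j \<omega>} \<in> sets M" unfolding H_def by measurable
  moreover have "{\<omega> \<in> good. H \<kappa> j \<omega>} = good \<inter> {\<omega> \<in> space M. H \<kappa> j \<omega>}" by (auto simp: good_def)
  ultimately show ?thesis using good(1) by simp
qed

text \<open>The local Besov space need not be separable (for \<open>q = \<infinity>\<close>), so measurability does not follow from
  pointwise limits: on the event \<open>H \<kappa> j\<close> the convergence of \<open>s n\<close> is uniform, and there the preimage of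
  an open set is relatively open in the finitely many coefficients of some level.\<close>

lemma open_neighbourhood:
  assumes G: "besov_loc_open V U \<alpha> P Q G" and \<omega>: "\<omega> \<in> good" "FX \<omega> \<in> G"
  shows "\<exists>\<kappa>::nat. \<exists>j l T. open T \<and> H (real \<kappa>) j \<omega> \<and> coord l \<omega> \<in> T \<and>
    (\<forall>\<omega>'\<in>good. H (real \<kappa>) j \<omega>' \<longrightarrow> coord l \<omega>' \<in> T \<longrightarrow> FX \<omega>' \<in> G)"
proof -
  obtain S \<epsilon> where S: "finite S" "S \<subseteq> Cc_smooth U" "0 < \<epsilon>"
    and near: "\<And>Y. Y \<in> besov_loc V U \<alpha> P Q \<Longrightarrow> (\<And>\<rho>. \<rho> \<in> S \<Longrightarrow> besov_loc_dist V \<alpha> P Q \<rho> (FX \<omega>) Y < \<epsilon>) \<Longrightarrow> Y \<in> G"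
    using G \<omega>(2) unfolding besov_loc_open_def by meson
  \<comment> \<open>The radius \<open>\<epsilon>\<close> of the neighbourhood is an extended real,
    possibly infinite; a finite positive one below it is used.\<close>
  obtain x where x: "0 < x" "x < \<epsilon>" using dense[OF S(3)] by blast
  then have "x \<noteq> \<top>" by auto
  then obtain e' where "x = ennreal e'" by (cases x) auto
  with x have e': "0 < e'" "ennreal e' < \<epsilon>" by simp_all
  define D where "D \<rho> j m0 C \<delta> \<longleftrightarrow> 0 < \<delta> \<and> (\<forall>\<omega> \<omega>' \<kappa> l. \<omega> \<in> good \<longrightarrow> \<omega>' \<in> good \<longrightarrow> H \<kappa> j \<omega> \<longrightarrow> H \<kappa> j \<omega>' \<longrightarrow> m0 \<le> l \<longrightarrow>
     besov_loc_dist V \<alpha> P Q \<rho> (FX \<omega>) (FX \<omega>') \<le> ennreal (2 * C * (\<kappa> + \<kappa> powr (1 / p)) * 2 powr (- \<delta> * real l)) +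
       besov_norm V \<alpha> P Q (\<lambda>x. \<rho> x * (s l \<omega> x - s l \<omega>' x)))" for \<rho> j m0 C \<delta>
  have "\<exists>j m0 C \<delta>. D \<rho> j m0 C \<delta>" if "\<rho> \<in> S" for \<rho>
  proof (rule dist_bound[of \<rho>])
    show "\<rho> \<in> Cc_smooth U" using that S(2) by blast
    fix j m0 C and \<delta> :: real
    assume a: "0 < \<delta>" and b: "\<And>\<omega> \<omega>' \<kappa> l. \<omega> \<in> good \<Longrightarrow> \<omega>' \<in> good \<Longrightarrow> H \<kappa> j \<omega> \<Longrightarrow> H \<kappa> j \<omega>' \<Longrightarrow> m0 \<le> l \<Longrightarrow>
     besov_loc_dist V \<alpha> P Q \<rho> (FX \<omega>) (FX \<omega>') \<le> ennreal (2 * C * (\<kappa> + \<kappa> powr (1 / p)) * 2 powr (- \<delta> * real l)) +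
       besov_norm V \<alpha> P Q (\<lambda>x. \<rho> x * (s l \<omega> x - s l \<omega>' x))"
    have "D \<rho> j m0 C \<delta>" unfolding D_def by (intro conjI a allI impI b)
    then show ?thesis by blast
  qed
  then obtain j m0 C \<delta> where D: "\<And>\<rho>. \<rho> \<in> S \<Longrightarrow> D \<rho> (j \<rho>) (m0 \<rho>) (C \<rho>) (\<delta> \<rho>)" by metis
  have \<delta>: "\<And>\<rho>. \<rho> \<in> S \<Longrightarrow> 0 < \<delta> \<rho>"
    and d: "\<And>\<rho> \<omega> \<omega>' \<kappa> l. \<rho> \<in> S \<Longrightarrow> \<omega> \<in> good \<Longrightarrow> \<omega>' \<in> good \<Longrightarrow> H \<kappa> (j \<rho>) \<omega> \<Longrightarrow> H \<kappa> (j \<rho>) \<omega>' \<Longrightarrow> m0 \<rho> \<le> l \<Longrightarrow>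
     besov_loc_dist V \<alpha> P Q \<rho> (FX \<omega>) (FX \<omega>') \<le> ennreal (2 * C \<rho> * (\<kappa> + \<kappa> powr (1 / p)) * 2 powr (- \<delta> \<rho> * real l)) +
       besov_norm V \<alpha> P Q (\<lambda>x. \<rho> x * (s l \<omega> x - s l \<omega>' x))"
    using D unfolding D_def by simp_all
  \<comment> \<open>\<open>H\<close> with a larger index is stronger, so one index above all
    \<open>j \<rho>\<close> handles the finitely many seminorms together.\<close>
  define jj where "jj = (\<Sum>\<rho>\<in>S. j \<rho>)"
  have jj: "j \<rho> \<le> jj" if "\<rho> \<in> S" for \<rho> unfolding jj_def using that S(1) by (intro member_le_sum) auto
  obtain \<kappa> :: nat where \<kappa>: "H (real \<kappa>) jj \<omega>" using good(4)[OF \<omega>(1)] by blast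
  have "\<forall>\<^sub>F l in sequentially. m0 \<rho> \<le> l \<and> 2 * C \<rho> * (real \<kappa> + real \<kappa> powr (1 / p)) * 2 powr (- \<delta> \<rho> * real l) < e' / 2" if "\<rho> \<in> S" for \<rho>
    using eventually_ge_at_top[of "m0 \<rho>"] order_tendstoD(2)[OF decay[OF \<delta>[OF that], of "2 * C \<rho> * (real \<kappa> + real \<kappa> powr (1 / p))"], of "e' / 2"] e'(1)
    by (intro eventually_conj) auto
  then have "\<forall>\<^sub>F l in sequentially. \<forall>\<rho>\<in>S. m0 \<rho> \<le> l \<and> 2 * C \<rho> * (real \<kappa> + real \<kappa> powr (1 / p)) * 2 powr (- \<delta> \<rho> * real l) < e' / 2"
    using S(1) by (intro eventually_ball_finite) auto
  then obtain l where l: "\<And>\<rho>. \<rho> \<in> S \<Longrightarrow> m0 \<rho> \<le> l" "\<And>\<rho>. \<rho> \<in> S \<Longrightarrow> 2 * C \<rho> * (real \<kappa> + real \<kappa> powr (1 / p)) * 2 powr (- \<delta> \<rho> * real l) < e' / 2"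
    by (auto simp: eventually_sequentially)
  define E where "E \<rho> c \<longleftrightarrow> (\<forall>\<omega> \<omega>'. besov_norm V \<alpha> P Q (\<lambda>x. \<rho> x * (s l \<omega> x - s l \<omega>' x)) \<le>
      ennreal (c * (\<Sum>x\<in>lat l. \<bar>cf 0 l x \<omega> - cf 0 l x \<omega>'\<bar>)))" for \<rho> c
  have "\<exists>c. E \<rho> c" if "\<rho> \<in> S" for \<rho>
  proof (rule s_diff_bound[of \<rho> l])
    show "\<rho> \<in> Cc_smooth U" using that S(2) by blast
  qed (unfold E_def, blast)
  then obtain c where E: "\<And>\<rho>. \<rho> \<in> S \<Longrightarrow> E \<rho> (c \<rho>)" by metis
  then have c: "\<And>\<rho> \<omega> \<omega>'. \<rho> \<in> S \<Longrightarrow> besov_norm V \<alpha> P Q (\<lambda>x. \<rho> x * (s l \<omega> x - s l \<omega>' x)) \<le> ennreal (c \<rho> * (\<Sum>x\<in>lat l. \<bar>cf 0 l x \<omega> - cf 0 l x \<omega>'\<bar>))"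
    unfolding E_def by blast
  define T where "T = (\<Inter>\<rho>\<in>S. {v :: nat \<Rightarrow> real. c \<rho> * (\<Sum>x\<in>lat l. \<bar>cf 0 l x \<omega> - v (to_nat_on (lat l) x)\<bar>) < e' / 2})"
  have "open T" unfolding T_def
    by (intro open_INT S(1) ballI open_Collect_less continuous_on_mult continuous_on_sum continuous_on_rabs continuous_on_diff
        continuous_on_const continuous_on_product_coordinates)
  moreover have "coord l \<omega> \<in> T" using e'(1) by (simp add: T_def coord_eq)
  moreover have "FX \<omega>' \<in> G" if w: "\<omega>' \<in> good" "H (real \<kappa>) jj \<omega>'" "coord l \<omega>' \<in> T" for \<omega>'
  proof (rule near[OF FX_class])
    fix \<rho> assume \<rho>: "\<rho> \<in> S"
    have "c \<rho> * (\<Sum>x\<in>lat l. \<bar>cf 0 l x \<omega> - cf 0 l x \<omega>'\<bar>) \<le> e' / 2" using w(3) \<rho> by (auto simp: T_def coord_eq)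
    then have "besov_norm V \<alpha> P Q (\<lambda>x. \<rho> x * (s l \<omega> x - s l \<omega>' x)) \<le> ennreal (e' / 2)"
      using c[OF \<rho>, of \<omega> \<omega>'] by (meson ennreal_leI order_trans)
    moreover have "ennreal (2 * C \<rho> * (real \<kappa> + real \<kappa> powr (1 / p)) * 2 powr (- \<delta> \<rho> * real l)) \<le> ennreal (e' / 2)"
      using l(2)[OF \<rho>] by (intro ennreal_leI) simp
    ultimately have "besov_loc_dist V \<alpha> P Q \<rho> (FX \<omega>) (FX \<omega>') \<le> ennreal (e' / 2) + ennreal (e' / 2)"
      using d[OF \<rho> \<omega>(1) w(1) H_mono[OF \<kappa> jj[OF \<rho>]] H_mono[OF w(2) jj[OF \<rho>]] l(1)[OF \<rho>]] by (meson add_mono order_trans)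
    also have "\<dots> = ennreal e'" using e'(1) by (simp flip: ennreal_plus)
    finally show "besov_loc_dist V \<alpha> P Q \<rho> (FX \<omega>) (FX \<omega>') < \<epsilon>" using e'(2) by (rule le_less_trans)
  qed
  ultimately show ?thesis using \<kappa> by blast
qed

text \<open>It suffices to treat open \<open>G\<close>. For fixed \<open>\<kappa>\<close>,
  \<open>j\<close> and \<open>l\<close> the union \<open>W\<close> of all admissible open sets is
  again open and admissible, so the possibly uncountably many neighbourhoods from
  \<open>open_neighbourhood\<close> are reduced to countably many measurable pieces.\<close>

lemma FX_measurable: "FX \<in> measurable M (besov_loc_borel V U \<alpha> P Q)"
  unfolding besov_loc_borel_def
proof (rule measurable_measure_of)
  show "{G. besov_loc_open V U \<alpha> P Q G} \<subseteq> Pow (besov_loc V U \<alpha> P Q)" by (auto simp: besov_loc_open_def)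
  show "FX \<in> space M \<rightarrow> besov_loc V U \<alpha> P Q" using FX_class by blast
  fix G assume "G \<in> {G. besov_loc_open V U \<alpha> P Q G}"
  then have G: "besov_loc_open V U \<alpha> P Q G" by simp
  define W where "W \<kappa> j l = \<Union>{T. open T \<and> (\<forall>\<omega>\<in>good. H (real \<kappa>) j \<omega> \<longrightarrow> coord l \<omega> \<in> T \<longrightarrow> FX \<omega> \<in> G)}" for \<kappa> j l :: nat
  have "open (W \<kappa> j l)" for \<kappa> j l unfolding W_def by (intro open_Union) auto
  then have pre: "coord l -` W \<kappa> j l \<inter> space M \<in> sets M" for \<kappa> j l
    by (intro measurable_sets[OF coord_measurable]) auto
  have sp: "good \<subseteq> space M" by (auto simp: good_def)
  have "{\<omega> \<in> good. FX \<omega> \<in> G} = (\<Union>\<kappa>. \<Union>j. \<Union>l. {\<omega> \<in> good. H (real \<kappa>) j \<omega>} \<inter> (coord l -` W \<kappa> j l \<inter> space M))" (is "_ = ?W")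
  proof
    show "{\<omega> \<in> good. FX \<omega> \<in> G} \<subseteq> ?W"
    proof
      fix \<omega> assume "\<omega> \<in> {\<omega> \<in> good. FX \<omega> \<in> G}"
      then have \<omega>: "\<omega> \<in> good" "FX \<omega> \<in> G" by auto
      then obtain \<kappa> j l T where "open T" "H (real \<kappa>) j \<omega>" "coord l \<omega> \<in> T"
        "\<forall>\<omega>'\<in>good. H (real \<kappa>) j \<omega>' \<longrightarrow> coord l \<omega>' \<in> T \<longrightarrow> FX \<omega>' \<in> G" using open_neighbourhood[OF G] by blast
      then have "coord l \<omega> \<in> W \<kappa> j l" unfolding W_def by blast
      then show "\<omega> \<in> ?W" using \<omega> \<open>H (real \<kappa>) j \<omega>\<close> sp by blast
    qed
    show "?W \<subseteq> {\<omega> \<in> good. FX \<omega> \<in> G}" unfolding W_def by blast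
  qed
  moreover have "?W \<in> sets M" by (intro sets.countable_UN'' sets.Int H_measurable pre countableI_type)
  ultimately have 1: "{\<omega> \<in> good. FX \<omega> \<in> G} \<in> sets M" by simp
  define z where "z = besov_null_rel V U \<alpha> P Q `` {\<lambda>n x. 0}"
  have "FX -` G \<inter> space M = {\<omega> \<in> good. FX \<omega> \<in> G} \<union> (if z \<in> G then space M - good else {})"
    using sp by (auto simp: FX_def X_def z_def split: if_splits)
  then show "FX -` G \<inter> space M \<in> sets M" using 1 good(1) by auto
qed

lemma FX_pairing:
  assumes \<omega>: "\<omega> \<in> good" and \<eta>: "\<eta> \<in> Cc r U"
  shows "(\<lambda>n. L2_inner (s n \<omega>) \<eta>) \<longlonglongrightarrow> besov_pairing (FX \<omega>) \<eta>"
  using besov_pairing_lim[OF U P1 Q _ \<eta> X_cauchy, of \<omega>] \<alpha>r \<omega> unfolding FX_def X_def by simp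

text \<open>The pairing is a limit along \<open>s n\<close>, whereas \<open>f\<close> of a
  projection is expressed by \<open>F n\<close>; on \<open>good\<close> the difference of their
  pairings tends to 0. From \<open>n0\<close> on, the projections of \<open>\<eta>\<close> are
  combinations over \<open>lat n\<close> with common support \<open>L'\<close>, as the weak
  continuity demands.\<close>

lemma FX_AE:
  assumes \<eta>: "\<eta> \<in> Cc r U"
  shows "AE \<omega> in M. besov_pairing (FX \<omega>) \<eta> = f \<eta> \<omega>"
proof -
  have sup: "compact (supp \<eta>)" "supp \<eta> \<subseteq> U" and \<eta>': "\<eta> \<in> Cc r UNIV" using \<eta> by (auto simp: Cc_def)
  have cs\<eta>: "cs \<eta>" by (rule Cc_cs[OF \<eta>])
  show ?thesis
  proof (rule near_lat[OF sup])
    fix L' n0 assume L': "compact L'" "L' \<subseteq> U" and near: "\<And>n z. n0 \<le> n \<Longrightarrow> z \<in> supp \<eta> \<Longrightarrow> near R n z \<subseteq> lat n \<inter> L'"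
      and near': "\<And>n z x. n0 \<le> n \<Longrightarrow> z \<in> supp \<eta> \<Longrightarrow> x \<in> near R n z \<Longrightarrow> cball x (R / 2 ^ n) \<subseteq> L'"
    have touch: "\<exists>z\<in>supp \<eta>. x \<in> near R n z" if x: "x \<in> dyadic_lattice n" and nz: "L2_inner \<eta> (wav (\<theta> 0) n x) \<noteq> 0" for n x
    proof (rule ccontr)
      assume no: "\<not> ?thesis"
      have "\<eta> z * wav (\<theta> 0) n x z = 0" for z
      proof (cases "z \<in> supp \<eta>")
        case True
        then have "R / 2 ^ n \<le> norm (z - x)" using no x by (force simp: near_def norm_minus_commute)
        then show ?thesis using wav_zero_all[of 0 n z x] by simp
      qed (simp add: supp_zero)
      then have "L2_inner \<eta> (wav (\<theta> 0) n x) = 0" by (simp only: L2_inner_def Bochner_Integration.integral_zero)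
      then show False using nz by simp
    qed
    have PVs: "PV n \<eta> = (\<lambda>y. \<Sum>x\<in>lat n. 2 ^ (CARD('d) * n) * L2_inner \<eta> (wav (\<theta> 0) n x) * wav (\<theta> 0) n x y)" if n: "n0 \<le> n" for n
    proof -
      have "PV n \<eta> = (\<lambda>y. \<Sum>j\<in>{0}. \<Sum>x\<in>lat n. 2 ^ (CARD('d) * n) * L2_inner \<eta> (wav (\<theta> j) n x) * wav (\<theta> j) n x y)"
        by (rule VL.P_eq_sum[OF finite_lat lat_sub]) (use touch near[OF n] in blast)
      then show ?thesis by simp
    qed
    have PVz: "PV n \<eta> y = 0" if n: "n0 \<le> n" and y: "y \<notin> L'" for n y
    proof -
      have "2 ^ (CARD('d) * n) * L2_inner \<eta> (wav (\<theta> 0) n x) * wav (\<theta> 0) n x y = 0" if x: "x \<in> lat n" for x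
      proof (cases "L2_inner \<eta> (wav (\<theta> 0) n x) = 0")
        case False
        then obtain z where "z \<in> supp \<eta>" "x \<in> near R n z" using touch x lat_sub by blast
        then have "y \<notin> cball x (R / 2 ^ n)" using near'[OF n] y by blast
        then have "R / 2 ^ n \<le> norm (y - x)" by (simp add: dist_norm norm_minus_commute)
        then show ?thesis using wav_zero_all[of 0 n y x] by simp
      qed simp
      then show ?thesis unfolding PVs[OF n] by (rule sum.neutral[OF ballI])
    qed
    have PVC: "PV n \<eta> \<in> Cc r U" if n: "n0 \<le> n" for n
      by (rule CcI[OF C_on_P(1)[OF cs\<eta>] PVz[OF n] L'])
    have PVsup: "supp (PV n \<eta>) \<subseteq> L'" if n: "n0 \<le> n" for n
      unfolding supp_def using PVz[OF n] compact_imp_closed[OF L'(1)] by (intro closure_minimal) auto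
    have fF: "AE \<omega> in M. f (PV n \<eta>) \<omega> = L2_inner (F n \<omega>) \<eta>" if n: "n0 \<le> n" for n
    proof -
      have "AE \<omega> in M. f (PV n \<eta>) \<omega> = (\<Sum>x\<in>lat n. 2 ^ (CARD('d) * n) * L2_inner \<eta> (wav (\<theta> 0) n x) * f (wav (\<theta> 0) n x) \<omega>)"
        unfolding PVs[OF n] by (rule f_sum[OF finite_lat lat_Cc]) auto
      moreover have "L2_inner (F n \<omega>) \<eta> = (\<Sum>x\<in>lat n. 2 ^ (CARD('d) * n) * L2_inner \<eta> (wav (\<theta> 0) n x) * f (wav (\<theta> 0) n x) \<omega>)" for \<omega>
      proof -
        have "L2_inner (F n \<omega>) \<eta> = (\<Sum>x\<in>lat n. cf 0 n x \<omega> * L2_inner (wav (\<theta> 0) n x) \<eta>)"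
          unfolding F_def[abs_def] by (intro L2_inner_sum cs_L2 cs_wav \<theta>_cs cs\<eta>) auto
        then show ?thesis by (simp add: cf_def L2_inner_commute[of \<eta>] mult_ac)
      qed
      ultimately show ?thesis by simp
    qed
    have sF: "(\<lambda>n. L2_inner (F n \<omega>) \<eta>) \<longlonglongrightarrow> besov_pairing (FX \<omega>) \<eta>" if \<omega>: "\<omega> \<in> good" for \<omega>
    proof -
      obtain \<kappa> :: nat where \<kappa>: "H (real \<kappa>) 0 \<omega>" using good(4)[OF \<omega>] by blast
      let ?I = "\<integral>x. \<bar>\<eta> x\<bar> \<partial>lborel"
      have "\<bar>L2_inner (s n \<omega>) \<eta> - L2_inner (F n \<omega>) \<eta>\<bar> \<le> real \<kappa> * ?I * (1 / 2) ^ n" for n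
      proof -
        have c: "cbnd r (real \<kappa> * (1 / 2) ^ n) 1 (\<lambda>z. s n \<omega> z - F n \<omega> z)" using \<kappa> unfolding H_def by (intro s_F) blast
        have "L2_inner (s n \<omega>) \<eta> - L2_inner (F n \<omega>) \<eta> = L2_inner (\<lambda>x. s n \<omega> x - F n \<omega> x) \<eta>"
          by (intro L2_inner_diff[symmetric] cs_L2 cs_s cs_F cs\<eta>)
        also have "\<bar>\<dots>\<bar> \<le> (\<integral>x. real \<kappa> * (1 / 2) ^ n * \<bar>\<eta> x\<bar> \<partial>lborel)"
          unfolding L2_inner_def
        proof (rule integral_abs_bound_integral)
          show "integrable lborel (\<lambda>x. (s n \<omega> x - F n \<omega> x) * \<eta> x)"
            by (intro cs_integrable cs_mult_left cs_continuous[OF cs_diff] cs_s cs_F cs\<eta>)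
          show "integrable lborel (\<lambda>x. real \<kappa> * (1 / 2) ^ n * \<bar>\<eta> x\<bar>)"
            by (intro cs_integrable cs_cmult cs_abs cs\<eta>)
          show "\<bar>(s n \<omega> x - F n \<omega> x) * \<eta> x\<bar> \<le> real \<kappa> * (1 / 2) ^ n * \<bar>\<eta> x\<bar>" for x
            unfolding abs_mult using cbnd_abs[OF c] by (intro mult_right_mono) auto
        qed
        finally show ?thesis by (simp add: mult_ac)
      qed
      then have ev: "\<forall>\<^sub>F n in sequentially. norm (L2_inner (s n \<omega>) \<eta> - L2_inner (F n \<omega>) \<eta>) \<le> real \<kappa> * ?I * (1 / 2) ^ n" by simp
      have "(\<lambda>n. real \<kappa> * ?I * (1 / 2) ^ n) \<longlonglongrightarrow> 0" by (intro tendsto_mult_right_zero LIMSEQ_power_zero) simp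
      from Lim_null_comparison[OF ev this] have "(\<lambda>n. L2_inner (s n \<omega>) \<eta> - L2_inner (F n \<omega>) \<eta>) \<longlonglongrightarrow> 0" .
      from tendsto_diff[OF FX_pairing[OF \<omega> \<eta>] this] show ?thesis by simp
    qed
    \<comment> \<open>The shift by \<open>n0\<close> makes every projection in the sequence a test
      function in \<open>Cc r U\<close>.\<close>
    show ?thesis
    proof (rule AE_eq_limits[where X="\<lambda>n. f (PV (n + n0) \<eta>)"])
      show "f (PV (n + n0) \<eta>) \<in> borel_measurable M" for n by (intro rv PVC) simp
      show "f \<eta> \<in> borel_measurable M" by (rule rv[OF \<eta>])
      have "AE \<omega> in M. \<forall>n. f (PV (n + n0) \<eta>) \<omega> = L2_inner (F (n + n0) \<omega>) \<eta>"
        unfolding AE_all_countable using fF by simp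
      then show "AE \<omega> in M. (\<lambda>n. f (PV (n + n0) \<eta>) \<omega>) \<longlonglongrightarrow> besov_pairing (FX \<omega>) \<eta>"
        using good(2) by eventually_elim (simp add: LIMSEQ_ignore_initial_segment[OF sF])
      show "(\<lambda>n. prob {\<omega> \<in> space M. \<epsilon> < \<bar>f (PV (n + n0) \<eta>) \<omega> - f \<eta> \<omega>\<bar>}) \<longlonglongrightarrow> 0" if "0 < \<epsilon>" for \<epsilon>
        by (rule weak[OF L' PVC \<eta> PVsup LIMSEQ_ignore_initial_segment[OF PV_C_norm_tendsto[OF \<eta>']] that]) auto
    qed
  qed
qed

end

end

text \<open>Both classes are built from the same \<open>X \<omega>\<close>, so their pairings with a
  test function are limits of one sequence and coincide on \<open>good\<close>. In the Hoelder case
  \<open>\<bar>\<alpha> + d / p\<bar> < r\<close> holds because \<open>\<alpha> + d / p\<close> lies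
  between \<open>\<alpha>\<close> and \<open>\<alpha>'\<close>.\<close>

lemma (in random_distribution) modification_exists:
  assumes \<alpha>: "\<bar>\<alpha>\<bar> < real r" "\<alpha> < \<alpha>'" and q: "1 \<le> q" and \<alpha>'r: "\<alpha>' < real r"
    and h: "\<alpha> < \<beta> - real CARD('d) / p \<Longrightarrow> \<alpha> + real CARD('d) / p < \<alpha>'"
  shows "\<exists>F \<in> measurable M (besov_loc_borel V U \<alpha> (ennreal p) q).
           (\<forall>\<eta>\<in>Cc r U. AE \<omega> in M. besov_pairing (F \<omega>) \<eta> = f \<eta> \<omega>) \<and>
           (\<alpha> < \<beta> - real CARD('d) / p \<longrightarrow> (AE \<omega> in M. in_holder_loc r V U \<alpha> (F \<omega>)))"
proof (intro bexI conjI ballI impI)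
  have PE: "(ennreal p = ennreal p \<and> (0::real) = 0) \<or> (ennreal p = \<infinity> \<and> 0 = real CARD('d) / p)" by simp
  have a: "\<bar>\<alpha> + 0\<bar> < real r" "\<alpha> + 0 < \<alpha>'" using \<alpha> by simp_all
  show "FX (ennreal p) q \<alpha> \<in> measurable M (besov_loc_borel V U \<alpha> (ennreal p) q)"
    by (rule FX_measurable[OF PE a(1) \<alpha>(1) a(2) q])
  show "AE \<omega> in M. besov_pairing (FX (ennreal p) q \<alpha> \<omega>) \<eta> = f \<eta> \<omega>" if "\<eta> \<in> Cc r U" for \<eta>
    by (rule FX_AE[OF PE a(1) \<alpha>(1) a(2) q that])
  assume "\<alpha> < \<beta> - real CARD('d) / p"
  from h[OF this] have b2: "\<alpha> + real CARD('d) / p < \<alpha>'" .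
  have "0 \<le> real CARD('d) / p" using p by simp
  then have b1: "\<bar>\<alpha> + real CARD('d) / p\<bar> < real r" using \<alpha>(1) b2 \<alpha>'r by linarith
  have PE': "((\<infinity>::ennreal) = ennreal p \<and> real CARD('d) / p = 0) \<or> ((\<infinity>::ennreal) = \<infinity> \<and> real CARD('d) / p = real CARD('d) / p)" by simp
  have q': "(1::ennreal) \<le> \<infinity>" by simp
  show "AE \<omega> in M. in_holder_loc r V U \<alpha> (FX (ennreal p) q \<alpha> \<omega>)"
    using good(2)
  proof eventually_elim
    case (elim \<omega>)
    show ?case unfolding in_holder_loc_def
    proof (intro bexI ballI)
      show "FX \<infinity> \<infinity> \<alpha> \<omega> \<in> besov_loc V U \<alpha> \<infinity> \<infinity>" by (rule FX_class[OF PE' b1 \<alpha>(1) b2 q'])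
      show "besov_pairing (FX \<infinity> \<infinity> \<alpha> \<omega>) \<eta> = besov_pairing (FX (ennreal p) q \<alpha> \<omega>) \<eta>" if "\<eta> \<in> Cc r U" for \<eta>
        by (rule LIMSEQ_unique[OF FX_pairing[OF PE' b1 \<alpha>(1) b2 q' elim that] FX_pairing[OF PE a(1) \<alpha>(1) a(2) q elim that]])
    qed
  qed
qed

theorem proposition2p32:
  fixes M :: "'w measure"
    and U :: "(real^'d::finite) set"
    and r :: nat and R p \<alpha> \<beta> :: real and q :: ennreal
    and V :: "int \<Rightarrow> (real^'d \<Rightarrow> real) set"
    and \<phi> :: "real^'d \<Rightarrow> real"
    and \<psi> :: "nat \<Rightarrow> real^'d \<Rightarrow> real"
    and f :: "(real^'d \<Rightarrow> real) \<Rightarrow> 'w \<Rightarrow> real"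
    and \<K> :: "((real^'d) set \<times> nat) set"
  assumes "prob_space M"
    and "open U" and "r \<ge> 1" and "R > 0"
    and "wavelet_family r R V \<phi> \<psi>"
    and random_variables: "\<And>\<eta>. \<eta> \<in> Cc r U \<Longrightarrow> f \<eta> \<in> borel_measurable M"
    and linear: "\<And>\<eta> \<eta>' \<mu>. \<eta> \<in> Cc r U \<Longrightarrow> \<eta>' \<in> Cc r U \<Longrightarrow>
        \<exists>A\<in>sets M. measure M A = 1 \<and>
          (\<forall>\<omega>\<in>A. f (\<lambda>x. \<mu> * \<eta> x + \<eta>' x) \<omega> = \<mu> * f \<eta> \<omega> + f \<eta>' \<omega>)"
    and weak_continuity: "\<And>K' \<eta>s \<eta>. compact K' \<Longrightarrow> K' \<subseteq> U \<Longrightarrow>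
        (\<And>n. \<eta>s n \<in> Cc r U) \<Longrightarrow> \<eta> \<in> Cc r U \<Longrightarrow> (\<And>n. supp (\<eta>s n) \<subseteq> K') \<Longrightarrow>
        (\<lambda>n. C_norm (r - 1) (\<lambda>x. \<eta>s n x - \<eta> x)) \<longlonglongrightarrow> 0 \<Longrightarrow>
        (\<forall>\<epsilon>>0. (\<lambda>n. measure M {\<omega> \<in> space M. \<bar>f (\<eta>s n) \<omega> - f \<eta> \<omega>\<bar> > \<epsilon>}) \<longlonglongrightarrow> 0)"
    and "1 \<le> p" and "1 \<le> q"
    and "\<bar>\<alpha>\<bar> < real r" and "\<bar>\<beta>\<bar> < real r" and "\<alpha> < \<beta>"
    and "spanning_sequence U R \<K>"
    and moment_bounds: "\<And>K k. (K, k) \<in> \<K> \<Longrightarrow>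
        \<exists>C>0. \<forall>n\<ge>k. \<forall>i\<in>{1..<2 ^ CARD('d)}.
          (SUP x \<in> dyadic_lattice k \<inter> K.
             Lp_norm M (ennreal p) (f (\<lambda>y. \<phi> (2 ^ k *\<^sub>R (y - x))))) \<le> ennreal C \<and>
          (SUP x \<in> dyadic_lattice n \<inter> K.
             2 ^ (CARD('d) * n) *
             Lp_norm M (ennreal p) (f (\<lambda>y. \<psi> i (2 ^ n *\<^sub>R (y - x)))))
            \<le> ennreal (C * 2 powr (- real n * \<beta>))"
  shows "\<exists>F \<in> measurable M (besov_loc_borel V U \<alpha> (ennreal p) q).
           (\<forall>\<eta>\<in>Cc r U. AE \<omega> in M. besov_pairing (F \<omega>) \<eta> = f \<eta> \<omega>) \<and>
           (\<alpha> < \<beta> - real CARD('d) / p \<longrightarrow> (AE \<omega> in M. in_holder_loc r V U \<alpha> (F \<omega>)))"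
proof -
  interpret W: wavelets r R V \<phi> \<psi> using assms(3-5) by unfold_locales
  interpret prob_space M by fact
  obtain K k where K: "incseq K" "\<And>L. compact L \<Longrightarrow> L \<subseteq> U \<Longrightarrow> \<exists>n. L \<subseteq> K n" "\<And>n. adapted U R (K n) (k n)"
      "\<K> = range (\<lambda>n. (K n, k n))"
    using \<open>spanning_sequence U R \<K>\<close> unfolding spanning_sequence_def by blast
  \<comment> \<open>\<open>\<alpha>'\<close> has to exceed \<open>\<alpha>\<close>, and in the
    Hoelder case also \<open>\<alpha> + d / p\<close>; the hypotheses place these values below
    \<open>\<beta>\<close>.\<close>
  define \<gamma> where "\<gamma> = (if \<alpha> < \<beta> - real CARD('d) / p then max \<alpha> (\<alpha> + real CARD('d) / p) else \<alpha>)"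
  have "\<gamma> < \<beta>" using \<open>\<alpha> < \<beta>\<close> by (auto simp: \<gamma>_def)
  then obtain \<alpha>' where gap: "\<gamma> < \<alpha>'" "\<alpha>' < \<beta>" using dense by blast
  interpret random_distribution r R V \<phi> \<psi> M U f p \<beta> \<alpha>' K k
  proof unfold_locales
    show "open U" "1 \<le> p" "\<alpha>' < \<beta>" "incseq K" by fact+
    show "compact (K j)" for j using K(3) by (simp add: adapted_def)
    show "\<exists>j. L \<subseteq> K j" if "compact L" "L \<subseteq> U" for L by (rule K(2)[OF that])
    show "f \<eta> \<in> borel_measurable M" if "\<eta> \<in> Cc r U" for \<eta> by (rule random_variables[OF that])
    show "AE \<omega> in M. f (\<lambda>x. \<mu> * \<eta> x + \<eta>' x) \<omega> = \<mu> * f \<eta> \<omega> + f \<eta>' \<omega>" if \<eta>: "\<eta> \<in> Cc r U" "\<eta>' \<in> Cc r U" for \<eta> \<eta>' \<mu>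
    proof -
      obtain A where A: "A \<in> sets M" "prob A = 1" "\<forall>\<omega>\<in>A. f (\<lambda>x. \<mu> * \<eta> x + \<eta>' x) \<omega> = \<mu> * f \<eta> \<omega> + f \<eta>' \<omega>"
        using linear[OF \<eta>] by blast
      have "AE \<omega> in M. \<omega> \<in> A" using prob_eq_1[OF A(1)] A(2) by simp
      then show ?thesis by eventually_elim (use A(3) in blast)
    qed
    show "(\<lambda>n. prob {\<omega> \<in> space M. \<epsilon> < \<bar>f (\<eta>s n) \<omega> - f \<eta> \<omega>\<bar>}) \<longlonglongrightarrow> 0"
      if "compact K'" "K' \<subseteq> U" "\<And>n. \<eta>s n \<in> Cc r U" "\<eta> \<in> Cc r U" "\<And>n. supp (\<eta>s n) \<subseteq> K'"
        "(\<lambda>n. C_norm (r - 1) (\<lambda>x. \<eta>s n x - \<eta> x)) \<longlonglongrightarrow> 0" "0 < \<epsilon>" for K' \<eta>s \<eta> \<epsilon>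
      using weak_continuity[OF that(1-6)] that(7) by blast
    show "\<exists>C>0. \<forall>n\<ge>k j. \<forall>i\<in>{0<..<2 ^ CARD('d)}. \<forall>x\<in>dyadic_lattice n \<inter> K j.
        ennreal (2 ^ (CARD('d) * n)) * Lp_norm M (ennreal p) (f (wav (W.\<theta> i) n x)) \<le> ennreal (C * 2 powr (- real n * \<beta>))" for j
    proof -
      have "(K j, k j) \<in> \<K>" using K(4) by blast
      from moment_bounds[OF this] obtain C where C: "C > 0"
        "\<And>n i. n \<ge> k j \<Longrightarrow> i \<in> {1..<2 ^ CARD('d)} \<Longrightarrow> (SUP x \<in> dyadic_lattice n \<inter> K j.
             2 ^ (CARD('d) * n) * Lp_norm M (ennreal p) (f (\<lambda>y. \<psi> i (2 ^ n *\<^sub>R (y - x))))) \<le> ennreal (C * 2 powr (- real n * \<beta>))"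
        by blast
      have "ennreal (2 ^ (CARD('d) * n)) * Lp_norm M (ennreal p) (f (wav (W.\<theta> i) n x)) \<le> ennreal (C * 2 powr (- real n * \<beta>))"
        if n: "n \<ge> k j" and i: "i \<in> {0<..<2 ^ CARD('d)}" and x: "x \<in> dyadic_lattice n \<inter> K j" for n i x
      proof -
        have i': "i \<in> {1..<2 ^ CARD('d)}" using i by auto
        have w: "wav (W.\<theta> i) n x = (\<lambda>y. \<psi> i (2 ^ n *\<^sub>R (y - x)))" using i by (simp add: wav_def W.\<theta>_def)
        have two: "ennreal (2 ^ (CARD('d) * n)) = 2 ^ (CARD('d) * n)" by (simp flip: ennreal_power)
        show ?thesis unfolding w two by (rule order_trans[OF SUP_upper[OF x] C(2)[OF n i']])
      qed
      then show ?thesis using C(1) by blast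
    qed
  qed
  show ?thesis
  proof (rule modification_exists)
    show "\<bar>\<alpha>\<bar> < real r" "1 \<le> q" by fact+
    show "\<alpha> < \<alpha>'" using gap(1) by (auto simp: \<gamma>_def split: if_splits)
    show "\<alpha>' < real r" using gap(2) \<open>\<bar>\<beta>\<bar> < real r\<close> by linarith
    show "\<alpha> + real CARD('d) / p < \<alpha>'" if "\<alpha> < \<beta> - real CARD('d) / p" using gap(1) that by (auto simp: \<gamma>_def)
  qed
qed

end
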